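(* Let $s_0$ be a central configuration for $U$, let $y$ be an $s_0$-asymptotic solution and let $\mathcal Q$ be its $s_0$-asymptotic quadratic form. Then $\mathcal Q$ is Fredholm on $W^{1,2}_0([0,+\infty);\mathcal X)$ if and only if the [BS]-condition holds.
   Context: Setting. Let $n,d\ge 2$ be integers, $m_1,\dots,m_n>0$, $\alpha\in(0,2)$, $M=\mathrm{diag}(m_1I_d,\dots,m_nI_d)$, $\langle u,v\rangle_M=\langle Mu,v\rangle$, $|u|_M=\langle u,u\rangle_M^{1/2}$ on $\mathbb R^{nd}$. Let $\mathcal X=\{q\in\mathbb R^{nd}:\sum_i m_iq_i=0\}$, $N=\dim\mathcal X=d(n-1)$, $\widehat{\mathcal X}=\{q\in\mathcal X: q_i\ne q_j \text{ for } i\neq j\}$, $U(q)=\sum_{i<j}m_im_j\|q_i-q_j\|^{-\alpha}$ on $\widehat{\mathcal X}$, $\mathcal E=\{q\in\widehat{\mathcal X}:|q|_M=1\}$. A central configuration is a critical point $s_0\in\mathcal E$ of $U|_{\mathcal E}$. Asymptotic solutions. For $T\in(0,+\infty]$, an asymptotic solution is $\gamma\in C^2((0,T),\widehat{\mathcal X})$, continuous up to $t=0$ with $\gamma(0)\in\widehat{\mathcal X}$, solving $M\ddot\gamma=\nabla U(\gamma)$ on $(0,T)$ ($\nabla$ is the Euclidean gradient), and such that: if $T<+\infty$, $\gamma\in C^0([0,T],\mathcal X)$ and $\gamma(t)\to0$ as $t\to T^-$ (total collision); if $T=+\infty$, $\frac12|\dot\gamma(t)|_M^2\to 0$ as $t\to+\infty$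 (parabolic). It is an $s_0$-asymptotic solution if $\gamma(t)/|\gamma(t)|_M\to s_0$ as $t\to T^-$. Its energy is $h=\frac12|\dot\gamma|_M^2-U(\gamma)$ (which is $0$ if $T=+\infty$). Regularised variables. Put $r=|\gamma|_M$, $s=\gamma/r$, $\tau(t)=\int_0^t r^{-(2+\alpha)/2}$ (which maps $[0,T)$ onto $[0,+\infty)$), $\rho=r^{(2-\alpha)/4}$ and $y=\rho s$, all regarded as functions of $\tau\in[0,+\infty)$; $'=d/d\tau$. The curve $y$ is also called an $s_0$-asymptotic solution. Put $\beta=\frac{2(2+\alpha)}{2-\alpha}$, $c_\alpha=\left(\frac4{2-\alpha}\right)^2-1$, and $\bar\delta_\alpha=-\frac{2-\alpha}4\sqrt{2U(s_0)}$ if $T<+\infty$, $\bar\delta_\alpha=\frac{2-\alpha}4\sqrt{2U(s_0)}$ if $T=+\infty$. Coefficients. $(u\otimes_M v)\eta=\langle v,\eta\rangle_M u$; ${}^{\mathsf T}$ is the adjoint with respect to $\langle\cdot,\cdot\rangle_M$. $W(x)=|x|_M^{2+\alpha}U(x)-|x|_M^2U(s_0)$, $\widetilde U(x)=|x|_M^\alpha U(x)$; $D^2W(x)$ and $D^2\widetilde U(x)$ denote the endomorphisms of $\mathcal X$ representing the second differentials with respect to $\langle\cdot,\cdot\rangle_M$. Endomorphisms of $\mathcal X$: $P(\tau)=c_\alpha s\otimes_M s+I$; $Q(\tau)=c_\alpha\frac{\rho'}\rho(I-s\otimes_M s)+c_\alpha s\otimes_M s'$; $R(\tau)=\big[c_\alpha(\frac{\rho'}\rho)^2+\beta(\beta-2)h\rho^{\beta-2}\big]s\otimes_Ms+\big[2U(s_0)-c_\alpha(\frac{\rho'}\rho)^2+\beta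 h\rho^{\beta-2}\big]I+c_\alpha s'\otimes_Ms'-c_\alpha\frac{\rho'}\rho(s\otimes_Ms'+s'\otimes_Ms)$; $\widetilde R(\tau)=R(\tau)+D^2W(y(\tau))$. The $s_0$-asymptotic quadratic form. On $W^{1,2}_0([0,+\infty),\mathcal X)$ ($W^{1,2}$ functions vanishing at $0$), $\mathcal Q(\eta)=\int_0^{+\infty}\big[\langle P\eta',\eta'\rangle_M+\langle Q\eta,\eta'\rangle_M+\langle Q^{\mathsf T}\eta',\eta\rangle_M+\langle\widetilde R\eta,\eta\rangle_M\big]d\tau$. A bounded quadratic form on a Hilbert space is called Fredholm if the bounded selfadjoint operator representing it (via Riesz) is Fredholm. [BS]-condition: the endomorphism $\widetilde R_0=c_\alpha\bar\delta_\alpha^2\,s_0\otimes_Ms_0+\frac{(2-\alpha)^2}8U(s_0)I+D^2\widetilde U(s_0)$ of $\mathcal X$ is positive definite; equivalently, the smallest eigenvalue $\mu_1$ of $D^2\widetilde U(s_0)$ satisfies $\mu_1>-\frac{(2-\alpha)^2}8U(s_0)$. *)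

theory Defs
  imports "HOL-Analysis.Analysis" "HOL-Library.Function_Algebras"
begin

section \<open>The n-body problem with a homogeneous potential\<close>

text \<open>A configuration of \<open>CARD('n)\<close> bodies in \<open>CARD('d)\<close>-space is an element \<open>q\<close> of
  \<^typ>\<open>real^'d^'n\<close>; the position of the body \<open>i\<close> is \<open>q $ i\<close>.\<close>

definition mass_op :: "('n \<Rightarrow> real) \<Rightarrow> real^'d^'n \<Rightarrow> real^'d^'n" where
  "mass_op m q = (\<chi> i. m i *\<^sub>R q $ i)"

definition inner_M :: "('n::finite \<Rightarrow> real) \<Rightarrow> real^'d^'n \<Rightarrow> real^'d^'n \<Rightarrow> real" where
  "inner_M m u v = mass_op m u \<bullet> v"

definition norm_M :: "('n::finite \<Rightarrow> real) \<Rightarrow> real^'d^'n \<Rightarrow> real" where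
  "norm_M m u = sqrt (inner_M m u u)"

definition cm_space :: "('n::finite \<Rightarrow> real) \<Rightarrow> (real^'d^'n) set" where
  "cm_space m = {q. (\<Sum>i\<in>UNIV. m i *\<^sub>R q $ i) = 0}"

definition collision_free :: "('n::finite \<Rightarrow> real) \<Rightarrow> (real^'d^'n) set" where
  "collision_free m = {q \<in> cm_space m. \<forall>i j. i \<noteq> j \<longrightarrow> q $ i \<noteq> q $ j}"

text \<open>The sum over \<open>i < j\<close> is written as half of the sum over ordered pairs, so that no order on
  the index type is needed. The same formula defines the potential on the open set of all
  collision-free configurations, also those with centre of mass different from 0; this is where
  its Euclidean gradient is taken.\<close>

definition potential :: "('n::finite \<Rightarrow> real) \<Rightarrow> real \<Rightarrow> real^'d^'n \<Rightarrow> real" where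
  "potential m \<alpha> q =
     (\<Sum>i\<in>UNIV. \<Sum>j\<in>UNIV - {i}. m i * m j * norm (q $ i - q $ j) powr (- \<alpha>)) / 2"

definition ellipsoid :: "('n::finite \<Rightarrow> real) \<Rightarrow> (real^'d^'n) set" where
  "ellipsoid m = {q \<in> collision_free m. norm_M m q = 1}"

text \<open>Critical point of the restriction to the submanifold \<^term>\<open>ellipsoid m\<close>: the derivative
  vanishes along every curve in the submanifold.\<close>

definition central_configuration :: "('n::finite \<Rightarrow> real) \<Rightarrow> real \<Rightarrow> real^'d^'n \<Rightarrow> bool" where
  "central_configuration m \<alpha> s0 \<longleftrightarrow> s0 \<in> ellipsoid m \<and>
     (\<forall>c :: real \<Rightarrow> real^'d^'n.
        c 0 = s0 \<and> c differentiable (at 0) \<and> (\<forall>\<^sub>F t in nhds 0. c t \<in> ellipsoid m) \<longrightarrow>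
        ((\<lambda>t. potential m \<alpha> (c t)) has_real_derivative 0) (at 0))"


section \<open>Asymptotic solutions\<close>

abbreviation velocity :: "(real \<Rightarrow> 'a::real_normed_vector) \<Rightarrow> real \<Rightarrow> 'a" where
  "velocity \<gamma> t \<equiv> vector_derivative \<gamma> (at t)"

definition C2_on :: "real set \<Rightarrow> (real \<Rightarrow> 'a::real_normed_vector) \<Rightarrow> bool" where
  "C2_on S \<gamma> \<longleftrightarrow> (\<forall>t\<in>S. \<gamma> differentiable (at t)) \<and> velocity \<gamma> C1_differentiable_on S"

definition asymptotic_solution ::
  "('n::finite \<Rightarrow> real) \<Rightarrow> real \<Rightarrow> ereal \<Rightarrow> (real \<Rightarrow> real^'d^'n) \<Rightarrow> bool" where
  "asymptotic_solution m \<alpha> T \<gamma> \<longleftrightarrow>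
     0 < T \<and>
     C2_on (einterval 0 T) \<gamma> \<and>
     continuous_on {t. 0 \<le> t \<and> ereal t < T} \<gamma> \<and>
     (\<forall>t. 0 \<le> t \<and> ereal t < T \<longrightarrow> \<gamma> t \<in> collision_free m) \<and>
     (\<forall>t\<in>einterval 0 T.
        GDERIV (potential m \<alpha>) (\<gamma> t) :> mass_op m (velocity (velocity \<gamma>) t)) \<and>
     (if T < \<infinity>
      then continuous_on {0..real_of_ereal T} \<gamma> \<and> \<gamma> ` {0..real_of_ereal T} \<subseteq> cm_space m \<and>
           (\<gamma> \<longlongrightarrow> 0) (at_left (real_of_ereal T))
      else ((\<lambda>t. (norm_M m (velocity \<gamma> t))\<^sup>2 / 2) \<longlongrightarrow> 0) at_top)"

definition end_filter :: "ereal \<Rightarrow> real filter" where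
  "end_filter T = (if T < \<infinity> then at_left (real_of_ereal T) else at_top)"

definition s0_asymptotic_solution ::
  "('n::finite \<Rightarrow> real) \<Rightarrow> real \<Rightarrow> real^'d^'n \<Rightarrow> ereal \<Rightarrow> (real \<Rightarrow> real^'d^'n) \<Rightarrow> bool" where
  "s0_asymptotic_solution m \<alpha> s0 T \<gamma> \<longleftrightarrow> asymptotic_solution m \<alpha> T \<gamma> \<and>
     ((\<lambda>t. \<gamma> t /\<^sub>R norm_M m (\<gamma> t)) \<longlongrightarrow> s0) (end_filter T)"

text \<open>Well defined by conservation of energy.\<close>

definition energy ::
  "('n::finite \<Rightarrow> real) \<Rightarrow> real \<Rightarrow> ereal \<Rightarrow> (real \<Rightarrow> real^'d^'n) \<Rightarrow> real" where
  "energy m \<alpha> T \<gamma> = (THE h. \<forall>t\<in>einterval 0 T.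
     h = (norm_M m (velocity \<gamma> t))\<^sup>2 / 2 - potential m \<alpha> (\<gamma> t))"


section \<open>Regularised variables\<close>

definition new_time :: "('n::finite \<Rightarrow> real) \<Rightarrow> real \<Rightarrow> (real \<Rightarrow> real^'d^'n) \<Rightarrow> real \<Rightarrow> real" where
  "new_time m \<alpha> \<gamma> t = integral {0..t} (\<lambda>u. norm_M m (\<gamma> u) powr (- (2 + \<alpha>) / 2))"

definition old_time ::
  "('n::finite \<Rightarrow> real) \<Rightarrow> real \<Rightarrow> ereal \<Rightarrow> (real \<Rightarrow> real^'d^'n) \<Rightarrow> real \<Rightarrow> real" where
  "old_time m \<alpha> T \<gamma> = inv_into {t. 0 \<le> t \<and> ereal t < T} (new_time m \<alpha> \<gamma>)"

definition reg_rho ::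
  "('n::finite \<Rightarrow> real) \<Rightarrow> real \<Rightarrow> ereal \<Rightarrow> (real \<Rightarrow> real^'d^'n) \<Rightarrow> real \<Rightarrow> real" where
  "reg_rho m \<alpha> T \<gamma> \<tau> = norm_M m (\<gamma> (old_time m \<alpha> T \<gamma> \<tau>)) powr ((2 - \<alpha>) / 4)"

definition reg_s ::
  "('n::finite \<Rightarrow> real) \<Rightarrow> real \<Rightarrow> ereal \<Rightarrow> (real \<Rightarrow> real^'d^'n) \<Rightarrow> real \<Rightarrow> real^'d^'n" where
  "reg_s m \<alpha> T \<gamma> \<tau> =
     \<gamma> (old_time m \<alpha> T \<gamma> \<tau>) /\<^sub>R norm_M m (\<gamma> (old_time m \<alpha> T \<gamma> \<tau>))"

definition reg_y ::
  "('n::finite \<Rightarrow> real) \<Rightarrow> real \<Rightarrow> ereal \<Rightarrow> (real \<Rightarrow> real^'d^'n) \<Rightarrow> real \<Rightarrow> real^'d^'n" where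
  "reg_y m \<alpha> T \<gamma> \<tau> = reg_rho m \<alpha> T \<gamma> \<tau> *\<^sub>R reg_s m \<alpha> T \<gamma> \<tau>"

abbreviation tau_deriv :: "(real \<Rightarrow> 'a::real_normed_vector) \<Rightarrow> real \<Rightarrow> 'a" where
  "tau_deriv f \<tau> \<equiv> vector_derivative f (at \<tau> within {0..})"

definition beta :: "real \<Rightarrow> real" where
  "beta \<alpha> = 2 * (2 + \<alpha>) / (2 - \<alpha>)"

definition c_const :: "real \<Rightarrow> real" where
  "c_const \<alpha> = (4 / (2 - \<alpha>))\<^sup>2 - 1"

definition delta_bar :: "('n::finite \<Rightarrow> real) \<Rightarrow> real \<Rightarrow> real^'d^'n \<Rightarrow> ereal \<Rightarrow> real" where
  "delta_bar m \<alpha> s0 T =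
     (if T < \<infinity> then - ((2 - \<alpha>) / 4 * sqrt (2 * potential m \<alpha> s0))
      else (2 - \<alpha>) / 4 * sqrt (2 * potential m \<alpha> s0))"


section \<open>Coefficients\<close>

text \<open>Endomorphisms of \<^term>\<open>cm_space m\<close> are functions on the whole configuration type of which
  only the values on \<^term>\<open>cm_space m\<close> matter.\<close>

definition tensor_M ::
  "('n::finite \<Rightarrow> real) \<Rightarrow> real^'d^'n \<Rightarrow> real^'d^'n \<Rightarrow> real^'d^'n \<Rightarrow> real^'d^'n" where
  "tensor_M m u v \<eta> = inner_M m v \<eta> *\<^sub>R u"

definition adjoint_M ::
  "('n::finite \<Rightarrow> real) \<Rightarrow> (real^'d^'n \<Rightarrow> real^'d^'n) \<Rightarrow> real^'d^'n \<Rightarrow> real^'d^'n" where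
  "adjoint_M m A v =
     (THE u. u \<in> cm_space m \<and> (\<forall>w\<in>cm_space m. inner_M m u w = inner_M m v (A w)))"

definition second_differential ::
  "('a::real_normed_vector \<Rightarrow> real) \<Rightarrow> 'a \<Rightarrow> 'a \<Rightarrow> 'a \<Rightarrow> real" where
  "second_differential f x v w =
     frechet_derivative (\<lambda>z. frechet_derivative f (at z) w) (at x) v"

text \<open>The functions whose second differential is needed are given by formulas on an open subset of
  the whole configuration type; the second differential of their restriction to
  \<^term>\<open>cm_space m\<close> is the restriction of their second differential.\<close>

definition hessian_M ::
  "('n::finite \<Rightarrow> real) \<Rightarrow> (real^'d^'n \<Rightarrow> real) \<Rightarrow> real^'d^'n \<Rightarrow> real^'d^'n \<Rightarrow> real^'d^'n" where
  "hessian_M m f x v =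
     (THE u. u \<in> cm_space m \<and> (\<forall>w\<in>cm_space m. inner_M m u w = second_differential f x v w))"

definition W_fun :: "('n::finite \<Rightarrow> real) \<Rightarrow> real \<Rightarrow> real^'d^'n \<Rightarrow> real^'d^'n \<Rightarrow> real" where
  "W_fun m \<alpha> s0 x =
     norm_M m x powr (2 + \<alpha>) * potential m \<alpha> x - (norm_M m x)\<^sup>2 * potential m \<alpha> s0"

definition U_tilde :: "('n::finite \<Rightarrow> real) \<Rightarrow> real \<Rightarrow> real^'d^'n \<Rightarrow> real" where
  "U_tilde m \<alpha> x = norm_M m x powr \<alpha> * potential m \<alpha> x"

definition coeff_P ::
  "('n::finite \<Rightarrow> real) \<Rightarrow> real \<Rightarrow> ereal \<Rightarrow> (real \<Rightarrow> real^'d^'n) \<Rightarrow> real \<Rightarrow>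
   real^'d^'n \<Rightarrow> real^'d^'n" where
  "coeff_P m \<alpha> T \<gamma> \<tau> v =
     (let s = reg_s m \<alpha> T \<gamma> \<tau> in c_const \<alpha> *\<^sub>R tensor_M m s s v + v)"

definition coeff_Q ::
  "('n::finite \<Rightarrow> real) \<Rightarrow> real \<Rightarrow> ereal \<Rightarrow> (real \<Rightarrow> real^'d^'n) \<Rightarrow> real \<Rightarrow>
   real^'d^'n \<Rightarrow> real^'d^'n" where
  "coeff_Q m \<alpha> T \<gamma> \<tau> v =
     (let c = c_const \<alpha>;
          s = reg_s m \<alpha> T \<gamma> \<tau>; s' = tau_deriv (reg_s m \<alpha> T \<gamma>) \<tau>;
          \<rho> = reg_rho m \<alpha> T \<gamma> \<tau>; \<rho>' = tau_deriv (reg_rho m \<alpha> T \<gamma>) \<tau>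
      in (c * (\<rho>' / \<rho>)) *\<^sub>R (v - tensor_M m s s v) + c *\<^sub>R tensor_M m s s' v)"

definition coeff_R ::
  "('n::finite \<Rightarrow> real) \<Rightarrow> real \<Rightarrow> real^'d^'n \<Rightarrow> ereal \<Rightarrow> (real \<Rightarrow> real^'d^'n) \<Rightarrow> real \<Rightarrow>
   real^'d^'n \<Rightarrow> real^'d^'n" where
  "coeff_R m \<alpha> s0 T \<gamma> \<tau> v =
     (let c = c_const \<alpha>; b = beta \<alpha>; h = energy m \<alpha> T \<gamma>;
          s = reg_s m \<alpha> T \<gamma> \<tau>; s' = tau_deriv (reg_s m \<alpha> T \<gamma>) \<tau>;
          \<rho> = reg_rho m \<alpha> T \<gamma> \<tau>; \<rho>' = tau_deriv (reg_rho m \<alpha> T \<gamma>) \<tau>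
      in (c * (\<rho>' / \<rho>)\<^sup>2 + b * (b - 2) * h * \<rho> powr (b - 2)) *\<^sub>R tensor_M m s s v
         + (2 * potential m \<alpha> s0 - c * (\<rho>' / \<rho>)\<^sup>2 + b * h * \<rho> powr (b - 2)) *\<^sub>R v
         + c *\<^sub>R tensor_M m s' s' v
         - (c * (\<rho>' / \<rho>)) *\<^sub>R (tensor_M m s s' v + tensor_M m s' s v))"

definition coeff_R_tilde ::
  "('n::finite \<Rightarrow> real) \<Rightarrow> real \<Rightarrow> real^'d^'n \<Rightarrow> ereal \<Rightarrow> (real \<Rightarrow> real^'d^'n) \<Rightarrow> real \<Rightarrow>
   real^'d^'n \<Rightarrow> real^'d^'n" where
  "coeff_R_tilde m \<alpha> s0 T \<gamma> \<tau> v =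
     coeff_R m \<alpha> s0 T \<gamma> \<tau> v + hessian_M m (W_fun m \<alpha> s0) (reg_y m \<alpha> T \<gamma> \<tau>) v"

definition R_tilde_0 ::
  "('n::finite \<Rightarrow> real) \<Rightarrow> real \<Rightarrow> real^'d^'n \<Rightarrow> ereal \<Rightarrow> real^'d^'n \<Rightarrow> real^'d^'n" where
  "R_tilde_0 m \<alpha> s0 T v =
     (c_const \<alpha> * (delta_bar m \<alpha> s0 T)\<^sup>2) *\<^sub>R tensor_M m s0 s0 v
     + ((2 - \<alpha>)\<^sup>2 / 8 * potential m \<alpha> s0) *\<^sub>R v
     + hessian_M m (U_tilde m \<alpha>) s0 v"

definition BS_condition ::
  "('n::finite \<Rightarrow> real) \<Rightarrow> real \<Rightarrow> real^'d^'n \<Rightarrow> ereal \<Rightarrow> bool" where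
  "BS_condition m \<alpha> s0 T \<longleftrightarrow>
     (\<forall>v\<in>cm_space m. v \<noteq> 0 \<longrightarrow> inner_M m (R_tilde_0 m \<alpha> s0 T v) v > 0)"


section \<open>The Sobolev space\<close>

definition L2_halfline :: "'a::euclidean_space set \<Rightarrow> (real \<Rightarrow> 'a) set" where
  "L2_halfline V = {f. (\<forall>t\<ge>0. f t \<in> V) \<and> f \<in> borel_measurable (lebesgue_on {0..}) \<and>
     integrable (lebesgue_on {0..}) (\<lambda>t. (norm (f t))\<^sup>2)}"

text \<open>Continuously differentiable test functions with compact support in \<open>(0,\<infinity>)\<close>; by mollification
  they define the same weak derivatives as smooth ones.\<close>

definition test_functions :: "(real \<Rightarrow> real) set" where
  "test_functions = {\<phi>. \<phi> C1_differentiable_on UNIV \<and>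
     (\<exists>a b. 0 < a \<and> (\<forall>t. t \<notin> {a..b} \<longrightarrow> \<phi> t = 0))}"

definition has_weak_derivative :: "(real \<Rightarrow> 'a::euclidean_space) \<Rightarrow> (real \<Rightarrow> 'a) \<Rightarrow> bool" where
  "has_weak_derivative f g \<longleftrightarrow> (\<forall>\<phi>\<in>test_functions.
     (LINT t|lebesgue_on {0..}. deriv \<phi> t *\<^sub>R f t) = - (LINT t|lebesgue_on {0..}. \<phi> t *\<^sub>R g t))"

text \<open>Every class in \<open>W\<^sup>1\<^sup>,\<^sup>2([0,\<infinity>),V)\<close> has exactly one continuous representative on \<open>[0,\<infinity>)\<close>,
  to which the condition at 0 refers; it is extended by 0 to the negative half-line, so that
  equality of elements is equality of functions.\<close>

definition W12_0 :: "'a::euclidean_space set \<Rightarrow> (real \<Rightarrow> 'a) set" where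
  "W12_0 V = {f \<in> L2_halfline V. continuous_on {0..} f \<and> f 0 = 0 \<and> (\<forall>t<0. f t = 0) \<and>
     (\<exists>g\<in>L2_halfline V. has_weak_derivative f g)}"

text \<open>The weak derivative is determined up to a null set.\<close>

definition weak_deriv :: "'a::euclidean_space set \<Rightarrow> (real \<Rightarrow> 'a) \<Rightarrow> real \<Rightarrow> 'a" where
  "weak_deriv V f = (SOME g. g \<in> L2_halfline V \<and> has_weak_derivative f g)"

definition W12_inner ::
  "('n::finite \<Rightarrow> real) \<Rightarrow> (real \<Rightarrow> real^'d^'n) \<Rightarrow> (real \<Rightarrow> real^'d^'n) \<Rightarrow> real" where
  "W12_inner m \<eta> \<xi> = (LINT t|lebesgue_on {0..}.
     inner_M m (weak_deriv (cm_space m) \<eta> t) (weak_deriv (cm_space m) \<xi> t)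
     + inner_M m (\<eta> t) (\<xi> t))"


section \<open>Fredholm quadratic forms\<close>

instantiation "fun" :: (type, real_vector) real_vector
begin

definition scaleR_fun :: "real \<Rightarrow> ('a \<Rightarrow> 'b) \<Rightarrow> 'a \<Rightarrow> 'b" where
  "scaleR_fun c f = (\<lambda>x. c *\<^sub>R f x)"

instance
  by standard (auto simp: scaleR_fun_def plus_fun_def scaleR_add_right scaleR_add_left)

end

text \<open>In this section a Hilbert space is a linear subspace \<open>H\<close> of a real vector space together with
  an inner product \<open>ip\<close> on \<open>H\<close>.\<close>

definition bounded_operator_on :: "'a::real_vector set \<Rightarrow> ('a \<Rightarrow> 'a \<Rightarrow> real) \<Rightarrow> ('a \<Rightarrow> 'a) \<Rightarrow> bool" where
  "bounded_operator_on H ip A \<longleftrightarrow>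
     (\<forall>x\<in>H. A x \<in> H) \<and>
     (\<forall>x\<in>H. \<forall>y\<in>H. A (x + y) = A x + A y) \<and>
     (\<forall>c. \<forall>x\<in>H. A (c *\<^sub>R x) = c *\<^sub>R A x) \<and>
     (\<exists>C. \<forall>x\<in>H. sqrt (ip (A x) (A x)) \<le> C * sqrt (ip x x))"

definition selfadjoint_on :: "'a::real_vector set \<Rightarrow> ('a \<Rightarrow> 'a \<Rightarrow> real) \<Rightarrow> ('a \<Rightarrow> 'a) \<Rightarrow> bool" where
  "selfadjoint_on H ip A \<longleftrightarrow> (\<forall>x\<in>H. \<forall>y\<in>H. ip (A x) y = ip x (A y))"

text \<open>Finite-dimensional kernel, closed range, finite-dimensional cokernel.\<close>

definition fredholm_operator_on ::
  "'a::real_vector set \<Rightarrow> ('a \<Rightarrow> 'a \<Rightarrow> real) \<Rightarrow> ('a \<Rightarrow> 'a) \<Rightarrow> bool" where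
  "fredholm_operator_on H ip A \<longleftrightarrow>
     bounded_operator_on H ip A \<and>
     (\<exists>B. finite B \<and> {x \<in> H. A x = 0} \<subseteq> span B) \<and>
     (\<forall>y\<in>H. (\<forall>e>0. \<exists>z\<in>A ` H. sqrt (ip (y - z) (y - z)) < e) \<longrightarrow> y \<in> A ` H) \<and>
     (\<exists>B. finite B \<and> B \<subseteq> H \<and> H \<subseteq> span (A ` H \<union> B))"

definition fredholm_form_on ::
  "'a::real_vector set \<Rightarrow> ('a \<Rightarrow> 'a \<Rightarrow> real) \<Rightarrow> ('a \<Rightarrow> real) \<Rightarrow> bool" where
  "fredholm_form_on H ip q \<longleftrightarrow>
     (\<exists>A. bounded_operator_on H ip A \<and> selfadjoint_on H ip A \<and>
          (\<forall>x\<in>H. q x = ip (A x) x) \<and> fredholm_operator_on H ip A)"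

definition asymptotic_form ::
  "('n::finite \<Rightarrow> real) \<Rightarrow> real \<Rightarrow> real^'d^'n \<Rightarrow> ereal \<Rightarrow> (real \<Rightarrow> real^'d^'n) \<Rightarrow>
   (real \<Rightarrow> real^'d^'n) \<Rightarrow> real" where
  "asymptotic_form m \<alpha> s0 T \<gamma> \<eta> = (let \<eta>' = weak_deriv (cm_space m) \<eta> in
     LINT \<tau>|lebesgue_on {0..}.
       inner_M m (coeff_P m \<alpha> T \<gamma> \<tau> (\<eta>' \<tau>)) (\<eta>' \<tau>)
       + inner_M m (coeff_Q m \<alpha> T \<gamma> \<tau> (\<eta> \<tau>)) (\<eta>' \<tau>)
       + inner_M m (adjoint_M m (coeff_Q m \<alpha> T \<gamma> \<tau>) (\<eta>' \<tau>)) (\<eta> \<tau>)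
       + inner_M m (coeff_R_tilde m \<alpha> s0 T \<gamma> \<tau> (\<eta> \<tau>)) (\<eta> \<tau>))"

end

theory Submission
  imports Defs
begin

text \<open>In the form \<open>\<Q>\<close> the coefficients converge at infinity: \<open>s \<rightarrow> s\<^sub>0\<close>, \<open>s' \<rightarrow> 0\<close>, \<open>\<rho>'/\<rho>\<close> tends to
  the constant \<open>\<delta>\<close> and \<open>h \<rho>\<^sup>\<beta>\<^sup>-\<^sup>2 \<rightarrow> 0\<close>. These limits come from the Lagrange--Jacobi identity for
  \<open>|\<gamma>|\<^sup>2\<close>, energy conservation and l'Hospital's rule. The limit of \<open>Q\<close> is symmetric, so its contribution to
  the form is a boundary term up to a perturbation that is small at infinity, and the limit form is
  \<open>\<integral> \<langle>P\<^sub>0 \<eta>', \<eta>'\<rangle> + \<langle>R\<^sub>0 \<eta>, \<eta>\<rangle>\<close> with \<open>R\<^sub>0\<close> the endomorphism of the [BS]-condition.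

  If \<open>R\<^sub>0\<close> is positive definite, the form is coercive up to finitely many continuous functionals, hence
  Fredholm. Otherwise \<open>R\<^sub>0\<close> has an eigenvector \<open>v\<close> with eigenvalue \<open>\<mu> \<le> 0\<close>. Since \<open>s\<^sub>0\<close> is an eigenvector with
  eigenvalue \<open>2 U(s\<^sub>0) > 0\<close>, \<open>v\<close> is orthogonal to it, so that \<open>P\<^sub>0 v = v\<close>, and long oscillations
  \<open>cos (\<surd>(-\<mu>) \<tau>) v\<close> cut off far out form an orthonormal sequence on which the operator tends to 0;
  such an operator is not Fredholm.\<close>

section \<open>Fredholm forms on Hilbert spaces\<close>

text \<open>The obstacle to coercivity is a bounded interval \<open>[0, L]\<close>, where the lower
  order coefficients are only known to be bounded. The functionals of the overview are the
  coordinates of \<open>x\<close> at the points of a fine grid of \<open>[0, L]\<close>: where they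
  vanish, the estimate |x t - x s|^2 <= |t - s| \<open>E1 x\<close> makes \<open>x\<close> small
  against its energy, which plays the role of a compact embedding. The last grid point is
  \<open>L\<close> itself, so the limit cross term, an exact derivative, integrates to 0 over the
  remaining half-line. In the converse direction the singular vectors get disjoint supports, which
  makes them orthogonal, and lie so far out that the operator shrinks the n-th one to 4^-n; this
  forces an infinite-dimensional cokernel. That s' tends to 0 is read off from energy conservation,
  v^2 + |S1|^2 = 2 U(\<sigma>) + 2 h r^\<alpha>: once the radial part v^2 has the limit 2 U(s0),
  nothing is left for the tangential part. The Hessian of W is homogeneous of degree 0, so y may be
  replaced by s in it although |y| tends to 0 at a collision and to infinity on a parabolic
  motion.\<close>

lemma linear_part_zero:
  fixes a b :: real
  assumes "b \<ge> 0" "\<And>t. 2 * t * a + t\<^sup>2 * b \<ge> 0"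
  shows "a = 0"
proof -
  \<comment> \<open>The minimiser would be -a/b; the denominator b + 1 also covers b = 0 and still
    gives a negative value unless a = 0.\<close>
  have "2 * (- a / (b+1)) * a + (- a / (b+1))\<^sup>2 * b = - (a\<^sup>2 * (b + 2) / (b+1)\<^sup>2)"
    using assms(1) by (simp add: divide_simps power2_eq_square) (simp add: algebra_simps)
  with assms(2)[of "- a / (b+1)"] have "a\<^sup>2 * (b + 2) / (b+1)\<^sup>2 \<le> 0" by simp
  moreover have "(b+1)\<^sup>2 > 0" using assms(1) by simp
  ultimately have "a\<^sup>2 * (b + 2) \<le> 0" by (simp add: divide_le_0_iff)
  then show ?thesis using assms(1)
    by (smt (verit, best) mult_pos_pos zero_less_power2)
qed

text \<open>\<open>fredholm_form_on\<close> speaks of a carrier set with a function as inner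
  product, so Hilbert space theory is set up in the same form. The locale is used for the Sobolev
  space, for a subspace of finite codimension under the inner product \<open>ip (A x) y\<close>, and
  for the mass inner product.\<close>

locale ip_on =
  fixes H :: "'a::real_vector set" and ip :: "'a \<Rightarrow> 'a \<Rightarrow> real"
  assumes sub: "subspace H"
    and ip_add: "x \<in> H \<Longrightarrow> y \<in> H \<Longrightarrow> z \<in> H \<Longrightarrow> ip (x + y) z = ip x z + ip y z"
    and ip_scale: "x \<in> H \<Longrightarrow> y \<in> H \<Longrightarrow> ip (c *\<^sub>R x) y = c * ip x y"
    and ip_sym: "x \<in> H \<Longrightarrow> y \<in> H \<Longrightarrow> ip x y = ip y x"
    and ip_pos: "x \<in> H \<Longrightarrow> x \<noteq> 0 \<Longrightarrow> ip x x > 0"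
begin

lemma memH [simp, intro]: "0 \<in> H" "x \<in> H \<Longrightarrow> y \<in> H \<Longrightarrow> x + y \<in> H" "x \<in> H \<Longrightarrow> y \<in> H \<Longrightarrow> x - y \<in> H"
  "x \<in> H \<Longrightarrow> c *\<^sub>R x \<in> H"
  using sub by (auto simp: subspace_0 subspace_add subspace_diff subspace_scale)

lemma sum_mem: "(\<And>i. i \<in> I \<Longrightarrow> f i \<in> H) \<Longrightarrow> sum f I \<in> H"
  using sub by (rule subspace_sum)

lemma ip_0 [simp]: "x \<in> H \<Longrightarrow> ip 0 x = 0" "x \<in> H \<Longrightarrow> ip x 0 = 0"
  using ip_scale[of x x 0] ip_scale[of 0 x 0] ip_sym[of x 0] by auto

lemma ip_add_r: "x \<in> H \<Longrightarrow> y \<in> H \<Longrightarrow> z \<in> H \<Longrightarrow> ip z (x + y) = ip z x + ip z y"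
  by (metis ip_add ip_sym memH(2))

lemma ip_scale_r: "x \<in> H \<Longrightarrow> y \<in> H \<Longrightarrow> ip x (c *\<^sub>R y) = c * ip x y"
  by (metis ip_scale ip_sym memH(4))

lemma ip_diff: "x \<in> H \<Longrightarrow> y \<in> H \<Longrightarrow> z \<in> H \<Longrightarrow> ip (x - y) z = ip x z - ip y z"
  using ip_add[of "x - y" y z] by simp

lemma ip_diff_r: "x \<in> H \<Longrightarrow> y \<in> H \<Longrightarrow> z \<in> H \<Longrightarrow> ip z (x - y) = ip z x - ip z y"
  using ip_add_r[of "x - y" y z] by simp

lemma ip_sum: "(\<And>i. i \<in> I \<Longrightarrow> f i \<in> H) \<Longrightarrow> y \<in> H \<Longrightarrow> ip (sum f I) y = (\<Sum>i\<in>I. ip (f i) y)"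
  by (induction I rule: infinite_finite_induct) (auto simp: ip_add sum_mem)

lemmas ip_simps = ip_add ip_add_r ip_scale ip_scale_r ip_diff ip_diff_r

lemma ip_ge_0 [simp]: "x \<in> H \<Longrightarrow> ip x x \<ge> 0"
  by (cases "x = 0") (auto dest: ip_pos less_imp_le)

definition nrm :: "'a \<Rightarrow> real" where "nrm x = sqrt (ip x x)"

lemma nrm_ge_0 [simp]: "x \<in> H \<Longrightarrow> nrm x \<ge> 0" by (simp add: nrm_def)

lemma nrm_sq: "x \<in> H \<Longrightarrow> (nrm x)\<^sup>2 = ip x x" by (simp add: nrm_def)

lemma nrm_0 [simp]: "nrm 0 = 0" by (simp add: nrm_def)

lemma nrm_eq_0: "x \<in> H \<Longrightarrow> nrm x = 0 \<longleftrightarrow> x = 0"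
  using ip_pos[of x] unfolding nrm_def by force

lemma nrm_scale: "x \<in> H \<Longrightarrow> nrm (c *\<^sub>R x) = \<bar>c\<bar> * nrm x"
  by (simp add: nrm_def ip_simps real_sqrt_mult flip: mult.assoc power2_eq_square)

lemma nrm_minus_commute: "x \<in> H \<Longrightarrow> y \<in> H \<Longrightarrow> nrm (x - y) = nrm (y - x)"
  by (simp add: nrm_def ip_simps)

lemma CS: assumes "x \<in> H" "y \<in> H" shows "\<bar>ip x y\<bar> \<le> nrm x * nrm y"
proof (cases "nrm x = 0 \<or> nrm y = 0")
  case True
  then show ?thesis using assms by (auto simp: nrm_eq_0)
next
  case False
  define a b where "a = nrm x" and "b = nrm y"
  have pos: "a > 0" "b > 0" using False assms nrm_ge_0[of x] nrm_ge_0[of y]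
    unfolding a_def b_def by linarith+
  have sq: "ip x x = a\<^sup>2" "ip y y = b\<^sup>2" by (simp_all add: a_def b_def nrm_sq assms)
  \<comment> \<open>With a and b the two norms, expanding the squares of these vectors gives 2ab(ab
    - <x,y>) and 2ab(ab + <x,y>).\<close>
  have m: "b *\<^sub>R x - a *\<^sub>R y \<in> H" "b *\<^sub>R x + a *\<^sub>R y \<in> H" using assms by auto
  have "0 \<le> 2 * (a * b) * (a * b - ip x y)"
    using ip_ge_0[OF m(1)] assms by (simp add: ip_simps sq ip_sym[of y x] algebra_simps power2_eq_square)
  moreover have "0 \<le> 2 * (a * b) * (a * b + ip x y)"
    using ip_ge_0[OF m(2)] assms by (simp add: ip_simps sq ip_sym[of y x] algebra_simps power2_eq_square)
  moreover have "a * b > 0" using pos by simp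
  ultimately have "a * b - ip x y \<ge> 0" "a * b + ip x y \<ge> 0"
    by (smt (verit) mult_pos_neg)+
  then show ?thesis unfolding a_def b_def by linarith
qed

lemma nrm_triangle: assumes "x \<in> H" "y \<in> H" shows "nrm (x + y) \<le> nrm x + nrm y"
proof -
  have "(nrm (x + y))\<^sup>2 = (nrm x)\<^sup>2 + 2 * ip x y + (nrm y)\<^sup>2"
    using assms by (simp add: nrm_sq ip_simps ip_sym[of y x])
  also have "\<dots> \<le> (nrm x + nrm y)\<^sup>2" using CS[OF assms] by (simp add: power2_sum)
  finally show ?thesis using assms by (meson add_nonneg_nonneg nrm_ge_0 power2_le_imp_le)
qed

lemma nrm_triangle_diff: assumes "x \<in> H" "y \<in> H" "z \<in> H"
  shows "nrm (x - z) \<le> nrm (x - y) + nrm (y - z)"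
  using nrm_triangle[of "x - y" "y - z"] assms by simp

lemma nrm_sum: "(\<And>i. i \<in> I \<Longrightarrow> f i \<in> H) \<Longrightarrow> nrm (sum f I) \<le> (\<Sum>i\<in>I. nrm (f i))"
proof (induction I rule: infinite_finite_induct)
  case (insert i I)
  then show ?case using nrm_triangle[of "f i" "sum f I"] by (force intro: sum_mem)
qed auto

definition conv :: "(nat \<Rightarrow> 'a) \<Rightarrow> 'a \<Rightarrow> bool" where
  "conv X x \<longleftrightarrow> (\<lambda>n. nrm (X n - x)) \<longlonglongrightarrow> 0"

lemma conv_ip: assumes "\<And>n. X n \<in> H" "x \<in> H" "y \<in> H" "conv X x"
  shows "(\<lambda>n. ip (X n) y) \<longlonglongrightarrow> ip x y"
proof -
  have "(\<lambda>n. ip (X n) y - ip x y) \<longlonglongrightarrow> 0"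
  proof (rule Lim_null_comparison)
    show "\<forall>\<^sub>F n in sequentially. norm (ip (X n) y - ip x y) \<le> nrm (X n - x) * nrm y"
      using CS[of "X _ - x" y] assms by (simp add: ip_simps)
    show "(\<lambda>n. nrm (X n - x) * nrm y) \<longlonglongrightarrow> 0"
      using tendsto_mult_right[of "\<lambda>n. nrm (X n - x)" 0 sequentially "nrm y"] assms(4)
      by (simp add: conv_def)
  qed
  then show ?thesis by (simp add: LIM_zero_iff)
qed

lemma conv_unique: assumes "\<And>n. X n \<in> H" "x \<in> H" "y \<in> H" "conv X x" "conv X y" shows "x = y"
proof -
  have "ip x (x - y) = ip y (x - y)"
    using LIMSEQ_unique conv_ip[of X x "x - y"] conv_ip[of X y "x - y"] assms by blast
  then have "ip (x - y) (x - y) = 0" using assms by (simp add: ip_diff)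
  then show ?thesis using ip_pos[of "x - y"] assms by fastforce
qed

lemma conv_nrm: assumes "\<And>n. X n \<in> H" "x \<in> H" "conv X x"
  shows "(\<lambda>n. nrm (X n)) \<longlonglongrightarrow> nrm x"
proof -
  have "(\<lambda>n. nrm (X n) - nrm x) \<longlonglongrightarrow> 0"
  proof (rule Lim_null_comparison)
    have "\<bar>nrm (X n) - nrm x\<bar> \<le> nrm (X n - x)" for n
      using nrm_triangle[of "X n - x" x] nrm_triangle[of "x - X n" "X n"] nrm_minus_commute[of x "X n"] assms
      by simp
    then show "\<forall>\<^sub>F n in sequentially. norm (nrm (X n) - nrm x) \<le> nrm (X n - x)" by simp
    show "(\<lambda>n. nrm (X n - x)) \<longlonglongrightarrow> 0" using assms(3) by (simp add: conv_def)
  qed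
  then show ?thesis by (simp add: LIM_zero_iff)
qed

definition cauchy :: "(nat \<Rightarrow> 'a) \<Rightarrow> bool" where
  "cauchy X \<longleftrightarrow> (\<forall>e>0. \<exists>N. \<forall>m\<ge>N. \<forall>n\<ge>N. nrm (X m - X n) < e)"

lemma conv_cauchy: assumes "\<And>n. X n \<in> H" "x \<in> H" "conv X x" shows "cauchy X"
  unfolding cauchy_def
proof (intro allI impI)
  fix e :: real assume "e > 0"
  then obtain N where N: "nrm (X n - x) < e / 2" if "n \<ge> N" for n
    using assms(3) unfolding conv_def lim_sequentially dist_real_def
    by (metis abs_less_iff diff_zero half_gt_zero)
  have "nrm (X m - X n) < e" if "m \<ge> N" "n \<ge> N" for m n
    using nrm_triangle_diff[of "X m" x "X n"] nrm_minus_commute[of x "X n"] N[of m] N[of n] that assms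
    by force
  then show "\<exists>N. \<forall>m\<ge>N. \<forall>n\<ge>N. nrm (X m - X n) < e" by blast
qed

end

section \<open>Riesz representation, finite codimension, and two criteria for Fredholm
  operators\<close>

locale hilbert_on = ip_on +
  assumes complete: "(\<And>n. X n \<in> H) \<Longrightarrow> cauchy X \<Longrightarrow> \<exists>x\<in>H. conv X x"
begin

text \<open>The representing vector is the minimiser of J x = |x|^2 - 2 \<phi>(x): J is bounded
  below by -K^2, the parallelogram identity makes minimising sequences Cauchy, and the first
  variation at the minimum is the representation formula.\<close>

lemma riesz:
  assumes add: "\<And>x y. x \<in> H \<Longrightarrow> y \<in> H \<Longrightarrow> \<phi> (x + y) = \<phi> x + \<phi> y"
    and scale: "\<And>c x. x \<in> H \<Longrightarrow> \<phi> (c *\<^sub>R x) = c * \<phi> x"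
    and bound: "\<And>x. x \<in> H \<Longrightarrow> \<bar>\<phi> x\<bar> \<le> K * nrm x"
  shows "\<exists>u\<in>H. \<forall>x\<in>H. ip u x = \<phi> x"
proof -
  define J where "J x = ip x x - 2 * \<phi> x" for x
  have diff: "\<phi> (x - y) = \<phi> x - \<phi> y" if "x \<in> H" "y \<in> H" for x y
    using add[of "x - y" y] that by simp
  have lb: "J x \<ge> - K\<^sup>2" if "x \<in> H" for x
  proof -
    have "0 \<le> (nrm x - K)\<^sup>2" by simp
    then show ?thesis using bound[OF that] nrm_sq[OF that]
      unfolding J_def power2_diff by (simp add: mult.commute)
  qed
  define d where "d = Inf (J ` H)"
  have bdd: "bdd_below (J ` H)" using lb by (auto intro!: bdd_belowI[of _ "- K\<^sup>2"])
  have dle: "d \<le> J x" if "x \<in> H" for x unfolding d_def using bdd that by (auto intro: cInf_lower)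
  have "\<exists>x\<in>H. J x < d + inverse (real (Suc n))" for n
    using cInf_lessD[of "J ` H" "d + inverse (real (Suc n))"] unfolding d_def[symmetric]
    using memH(1) by (auto simp del: memH)
  then obtain X where X: "\<And>n. X n \<in> H" "\<And>n. J (X n) < d + inverse (real (Suc n))" by metis
  \<comment> \<open>Parallelogram identity: the linear part of J cancels in 2 J(x) + 2 J(y) - 4 J((x
    + y)/2), which leaves |x - y|^2, and the midpoint has value at least d.\<close>
  have est: "(nrm (X m - X n))\<^sup>2 \<le> 2 * inverse (real (Suc m)) + 2 * inverse (real (Suc n))" for m n
  proof -
    let ?z = "(1/2) *\<^sub>R (X m + X n)"
    have "(nrm (X m - X n))\<^sup>2 = 2 * J (X m) + 2 * J (X n) - 4 * J ?z"
      using X(1) by (simp add: J_def nrm_sq ip_simps add scale ip_sym[of "X n" "X m"] field_simps)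
    moreover have "d \<le> J ?z" using X(1) by (intro dle) auto
    ultimately show ?thesis using X(2)[of m] X(2)[of n] by (smt (verit))
  qed
  have "cauchy X" unfolding cauchy_def
  proof (intro allI impI)
    fix e :: real assume e: "e > 0"
    then obtain N where N: "inverse (real (Suc N)) < e\<^sup>2 / 4"
      using reals_Archimedean[of "e\<^sup>2 / 4"] by auto
    have "nrm (X m - X n) < e" if "m \<ge> N" "n \<ge> N" for m n
    proof -
      have "inverse (real (Suc m)) \<le> inverse (real (Suc N))" "inverse (real (Suc n)) \<le> inverse (real (Suc N))"
        using that by (auto intro!: le_imp_inverse_le)
      then have "(nrm (X m - X n))\<^sup>2 < e\<^sup>2" using est[of m n] N by linarith
      then show ?thesis using e by (intro power2_less_imp_less[of _ e]) auto
    qed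
    then show "\<exists>N. \<forall>m\<ge>N. \<forall>n\<ge>N. nrm (X m - X n) < e" by blast
  qed
  then obtain u where u: "u \<in> H" "conv X u" using complete X(1) by blast
  have "(\<lambda>n. \<phi> (X n) - \<phi> u) \<longlonglongrightarrow> 0"
  proof (rule Lim_null_comparison)
    show "\<forall>\<^sub>F n in sequentially. norm (\<phi> (X n) - \<phi> u) \<le> K * nrm (X n - u)"
      using bound[of "X _ - u"] u X(1) by (simp add: diff)
    show "(\<lambda>n. K * nrm (X n - u)) \<longlonglongrightarrow> 0"
      using u(2) tendsto_mult_left[of "\<lambda>n. nrm (X n - u)" 0 sequentially K] by (simp add: conv_def)
  qed
  then have 1: "(\<lambda>n. \<phi> (X n)) \<longlonglongrightarrow> \<phi> u" by (simp add: LIM_zero_iff)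
  have "(\<lambda>n. (nrm (X n))\<^sup>2) \<longlonglongrightarrow> (nrm u)\<^sup>2"
    using u X(1) by (intro tendsto_power conv_nrm)
  with 1 have "(\<lambda>n. J (X n)) \<longlonglongrightarrow> J u"
    unfolding J_def by (intro tendsto_intros) (simp_all add: nrm_sq u X(1))
  moreover have "(\<lambda>n. d + inverse (real (Suc n))) \<longlonglongrightarrow> d + 0"
    by (intro tendsto_intros LIMSEQ_inverse_real_of_nat)
  ultimately have Ju: "J u \<le> d"
    using X(2) by (intro LIMSEQ_le[of "\<lambda>n. J (X n)" "J u" "\<lambda>n. d + inverse (real (Suc n))"])
      (auto intro: less_imp_le)
  show ?thesis
  proof (rule bexI[OF _ u(1)], rule ballI)
    fix x assume x: "x \<in> H"
    have "2 * t * (ip u x - \<phi> x) + t\<^sup>2 * ip x x \<ge> 0" for t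
      using Ju dle[of "u + t *\<^sub>R x"] x u
      by (simp add: J_def ip_simps add scale ip_sym[of x u] algebra_simps power2_eq_square)
    then have "ip u x - \<phi> x = 0" using x by (intro linear_part_zero[of "ip x x"]) auto
    then show "ip u x = \<phi> x" by simp
  qed
qed

text \<open>\<open>riesz\<close> is applied in the second argument for each fixed x. A vector is
  determined by its inner products, so linearity and selfadjointness pass from the form to the
  operator; testing with y = A x gives the norm bound.\<close>

lemma sym_form_operator:
  assumes add: "\<And>x y z. x \<in> H \<Longrightarrow> y \<in> H \<Longrightarrow> z \<in> H \<Longrightarrow> b (x + y) z = b x z + b y z"
    and scale: "\<And>c x y. x \<in> H \<Longrightarrow> y \<in> H \<Longrightarrow> b (c *\<^sub>R x) y = c * b x y"
    and sym: "\<And>x y. x \<in> H \<Longrightarrow> y \<in> H \<Longrightarrow> b x y = b y x"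
    and bound: "\<And>x y. x \<in> H \<Longrightarrow> y \<in> H \<Longrightarrow> \<bar>b x y\<bar> \<le> K * nrm x * nrm y"
  shows "\<exists>A. bounded_operator_on H ip A \<and> selfadjoint_on H ip A \<and> (\<forall>x\<in>H. \<forall>y\<in>H. ip (A x) y = b x y)"
proof -
  have "\<forall>x\<in>H. \<exists>u. u \<in> H \<and> (\<forall>y\<in>H. ip u y = b x y)"
  proof
    fix x assume x: "x \<in> H"
    have "\<exists>u\<in>H. \<forall>y\<in>H. ip u y = b x y"
      using x sym add scale bound[OF x] by (intro riesz[of _ "K * nrm x"]) (simp_all add: sym[of x])
    then show "\<exists>u. u \<in> H \<and> (\<forall>y\<in>H. ip u y = b x y)" by blast
  qed
  then obtain A where A: "\<And>x. x \<in> H \<Longrightarrow> A x \<in> H" "\<And>x y. x \<in> H \<Longrightarrow> y \<in> H \<Longrightarrow> ip (A x) y = b x y"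
    by (auto simp: bchoice_iff)
  have eqI: "u = v" if "u \<in> H" "v \<in> H" "\<And>y. y \<in> H \<Longrightarrow> ip u y = ip v y" for u v
    using that ip_pos[of "u - v"] by (force simp: ip_simps)
  have "bounded_operator_on H ip A" unfolding bounded_operator_on_def
  proof (intro conjI ballI allI)
    fix x y assume "x \<in> H" "y \<in> H"
    then show "A (x + y) = A x + A y" by (intro eqI) (auto simp: A ip_simps add)
  next
    fix c x assume "x \<in> H"
    then show "A (c *\<^sub>R x) = c *\<^sub>R A x" by (intro eqI) (auto simp: A ip_simps scale)
  next
    have "nrm (A x) \<le> K * nrm x" if x: "x \<in> H" for x
    proof (cases "nrm (A x) = 0")
      case True
      \<comment> \<open>The sign of K is not among the assumptions; it is recovered from the bound
        at the pair (x, x).\<close>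
      have "x \<in> H \<Longrightarrow> 0 \<le> K * nrm x"
      proof (cases "nrm x = 0")
        case False
        then have "0 \<le> K * nrm x * nrm x" using bound[OF x x] by linarith
        then show ?thesis using nrm_ge_0[OF x] False by (simp add: zero_le_mult_iff)
      qed simp
      then show ?thesis using True x by simp
    next
      case False
      have "(nrm (A x))\<^sup>2 = b x (A x)" using x A by (simp add: nrm_sq)
      also have "\<dots> \<le> K * nrm x * nrm (A x)" using bound[of x "A x"] x A(1) by force
      finally show ?thesis using False nrm_ge_0[OF A(1)[OF x]]
        by (simp add: power2_eq_square)
    qed
    then show "\<exists>C. \<forall>x\<in>H. sqrt (ip (A x) (A x)) \<le> C * sqrt (ip x x)" unfolding nrm_def by blast
  qed (rule A)
  moreover have "selfadjoint_on H ip A" unfolding selfadjoint_on_def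
    using A sym ip_sym by metis
  ultimately show ?thesis using A by blast
qed

text \<open>Each further functional either vanishes on the common kernel so far or lowers its
  dimension by one, and then a single vector g with l g nonzero spans the loss. Linearity is asked
  on S only, since inner products are linear only on their carrier.\<close>

lemma (in -) subspace_kernel_span:
  assumes "finite L" "subspace S"
    and "\<And>l x y. l \<in> L \<Longrightarrow> x \<in> S \<Longrightarrow> y \<in> S \<Longrightarrow> l (x + y) = (l x + l y :: real)"
    and "\<And>l c x. l \<in> L \<Longrightarrow> x \<in> S \<Longrightarrow> l (c *\<^sub>R x) = c * l x"
  shows "\<exists>G. finite G \<and> G \<subseteq> S \<and> S \<subseteq> span ({x \<in> S. \<forall>l\<in>L. l x = 0} \<union> G)"
  using assms(1,3,4)
proof (induction L)
  case empty
  then show ?case by (intro exI[of _ "{}"]) (auto intro: span_base)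
next
  case (insert l L)
  let ?N = "{x \<in> S. \<forall>l\<in>L. l x = 0}"
  let ?M = "{x \<in> S. \<forall>l\<in>insert l L. l x = 0}"
  obtain G where G: "finite G" "G \<subseteq> S" "S \<subseteq> span (?N \<union> G)" using insert by auto
  show ?case
  proof (cases "\<exists>g\<in>?N. l g \<noteq> 0")
    case False
    then have "?M = ?N" by auto
    then show ?thesis using G by auto
  next
    case True
    then obtain g where g: "g \<in> ?N" "l g \<noteq> 0" by auto
    have diff: "l' (x + (-c) *\<^sub>R g) = l' x - c * l' g" if "x \<in> S" "l' \<in> insert l L" for x c l'
    proof -
      have gS: "g \<in> S" using g by simp
      then have "(-c) *\<^sub>R g \<in> S" using assms(2) by (rule subspace_scale[rotated])
      then have "l' (x + (-c) *\<^sub>R g) = l' x + l' ((-c) *\<^sub>R g)"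
        using that by (intro insert.prems(1))
      also have "l' ((-c) *\<^sub>R g) = - c * l' g" using that gS by (intro insert.prems(2))
      finally show ?thesis by simp
    qed
    have "?N \<subseteq> span (?M \<union> insert g G)"
    proof
      fix x assume x: "x \<in> ?N"
      have "x + (- (l x / l g)) *\<^sub>R g \<in> ?M"
      proof -
        have xS: "x \<in> S" and gS: "g \<in> S" using x g by auto
        have "l' (x + (- (l x / l g)) *\<^sub>R g) = 0" if "l' \<in> insert l L" for l'
          using diff[OF xS that, of "l x / l g"] that x g by (cases "l' = l") auto
        moreover have "x + (- (l x / l g)) *\<^sub>R g \<in> S"
          by (intro subspace_add[OF assms(2)] subspace_scale[OF assms(2)] xS gS)
        ultimately show ?thesis by simp
      qed
      then have "x + (- (l x / l g)) *\<^sub>R g \<in> span (?M \<union> insert g G)" by (blast intro: span_base)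
      moreover have "(l x / l g) *\<^sub>R g \<in> span (?M \<union> insert g G)" by (blast intro: span_base span_scale)
      ultimately have "(x + (- (l x / l g)) *\<^sub>R g) + (l x / l g) *\<^sub>R g \<in> span (?M \<union> insert g G)"
        by (rule span_add)
      then show "x \<in> span (?M \<union> insert g G)" by simp
    qed
    moreover have "G \<subseteq> span (?M \<union> insert g G)" by (blast intro: span_base)
    ultimately have "span (?N \<union> G) \<subseteq> span (?M \<union> insert g G)" by (intro span_minimal) auto
    then show ?thesis using G g by (intro exI[of _ "insert g G"]) auto
  qed
qed

lemma (in -) tendsto_zero_squeeze_le:
  fixes f g :: "nat \<Rightarrow> real"
  assumes "g \<longlonglongrightarrow> 0" "\<And>n. 0 \<le> f n" "\<And>n. f n \<le> C * g n"
  shows "f \<longlonglongrightarrow> 0"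
proof (rule Lim_null_comparison)
  show "\<forall>\<^sub>F n in sequentially. norm (f n) \<le> C * g n" using assms by simp
  show "(\<lambda>n. C * g n) \<longlonglongrightarrow> 0" using tendsto_mult_left[OF assms(1), of C] by simp
qed

text \<open>A vector b outside the closed subspace C has a positive distance d from it, so the
  b-coefficient of an element of the sum is controlled by its norm. Along a convergent sequence the
  coefficients therefore converge, and so do the components in C.\<close>

lemma add_line_closed:
  assumes C: "subspace C" "C \<subseteq> H" "\<And>X x. (\<And>n. X n \<in> C) \<Longrightarrow> x \<in> H \<Longrightarrow> conv X x \<Longrightarrow> x \<in> C"
    and b: "b \<in> H" and X: "\<And>n. X n \<in> span (insert b C)" and x: "x \<in> H" and cv: "conv X x"
  shows "x \<in> span (insert b C)"
proof (cases "b \<in> C")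
  case True
  then have "span (insert b C) = C" using C(1) by (simp add: insert_absorb span_eq_iff)
  then show ?thesis using C(3) X x cv by blast
next
  case False
  have "\<exists>d>0. \<forall>c\<in>C. d \<le> nrm (b - c)"
  proof (rule ccontr)
    assume "\<not> ?thesis"
    then have "\<forall>n. \<exists>c\<in>C. nrm (b - c) < inverse (real (Suc n))"
      by (meson inverse_positive_iff_positive not_le of_nat_0_less_iff zero_less_Suc)
    then obtain c where c: "\<And>n. c n \<in> C" "\<And>n. nrm (b - c n) < inverse (real (Suc n))" by metis
    have "conv c b" unfolding conv_def
    proof (rule tendsto_zero_squeeze_le[OF LIMSEQ_inverse_real_of_nat, where C=1])
      show "0 \<le> nrm (c n - b)" for n using c C b by (auto simp: subset_iff)
      show "nrm (c n - b) \<le> 1 * inverse (real (Suc n))" for n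
        using c(2)[of n] nrm_minus_commute[of b "c n"] c(1)[of n] C(2) b by auto
    qed
    then show False using False C(3) c(1) b by blast
  qed
  then obtain d where d: "d > 0" "\<And>c. c \<in> C \<Longrightarrow> d \<le> nrm (b - c)" by blast
  have "\<exists>t. X n - t *\<^sub>R b \<in> C" for n
    using X[of n] C(1) by (auto simp: span_insert span_eq_iff[THEN iffD2])
  then obtain t where t: "\<And>n. X n - t n *\<^sub>R b \<in> C" by metis
  have XH: "X n \<in> H" for n
  proof -
    have "(X n - t n *\<^sub>R b) + t n *\<^sub>R b \<in> H" using t[of n] C(2) b by blast
    then show ?thesis by simp
  qed
  \<comment> \<open>After division by the difference of the coefficients, X m - X n becomes b - c
    with c in C, which has norm at least d.\<close>
  have key: "\<bar>t m - t n\<bar> * d \<le> nrm (X m - X n)" for m n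
  proof (cases "t m = t n")
    case False
    let ?s = "t m - t n"
    define c where "c = (- (1 / ?s)) *\<^sub>R ((X m - t m *\<^sub>R b) - (X n - t n *\<^sub>R b))"
    have c: "c \<in> C" unfolding c_def
      by (intro subspace_scale[OF C(1)] subspace_diff[OF C(1)] t)
    have "?s *\<^sub>R c = - ((X m - t m *\<^sub>R b) - (X n - t n *\<^sub>R b))"
      using False by (simp add: c_def)
    then have "?s *\<^sub>R (b - c) = X m - X n" by (simp add: scaleR_diff_right scaleR_diff_left)
    then have "nrm (X m - X n) = \<bar>?s\<bar> * nrm (b - c)" using nrm_scale[of "b - c" ?s] b c C(2) by auto
    then show ?thesis using d(2)[OF c] by (simp add: mult_left_mono)
  qed (use XH in auto)
  have "Cauchy t" unfolding Cauchy_def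
  proof (intro allI impI)
    fix e :: real assume "e > 0"
    then have "e * d > 0" using d by simp
    then obtain N where N: "\<And>m n. m \<ge> N \<Longrightarrow> n \<ge> N \<Longrightarrow> nrm (X m - X n) < e * d"
      using conv_cauchy[OF XH x cv] unfolding cauchy_def by blast
    have "dist (t m) (t n) < e" if "m \<ge> N" "n \<ge> N" for m n
    proof -
      have "\<bar>t m - t n\<bar> * d < e * d" using key[of m n] N[OF that] by linarith
      then show ?thesis using d(1) by (simp add: dist_real_def)
    qed
    then show "\<exists>M. \<forall>m\<ge>M. \<forall>n\<ge>M. dist (t m) (t n) < e" by blast
  qed
  then obtain l where l: "t \<longlonglongrightarrow> l" using Cauchy_convergent convergent_def by blast
  have "conv (\<lambda>n. X n - t n *\<^sub>R b) (x - l *\<^sub>R b)" unfolding conv_def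
  proof (rule tendsto_zero_squeeze_le[where C=1])
    have "(\<lambda>n. \<bar>t n - l\<bar> * nrm b) \<longlonglongrightarrow> 0 * nrm b"
      using l by (intro tendsto_mult tendsto_const) (simp add: LIM_zero tendsto_rabs_zero)
    then show "(\<lambda>n. nrm (X n - x) + \<bar>t n - l\<bar> * nrm b) \<longlonglongrightarrow> 0"
      using cv tendsto_add[of "\<lambda>n. nrm (X n - x)" 0] by (fastforce simp: conv_def)
    show "0 \<le> nrm (X n - t n *\<^sub>R b - (x - l *\<^sub>R b))" for n using XH b x by auto
    have "X n - t n *\<^sub>R b - (x - l *\<^sub>R b) = (X n - x) + (- (t n - l)) *\<^sub>R b" for n
      by (simp add: algebra_simps)
    then have "nrm (X n - t n *\<^sub>R b - (x - l *\<^sub>R b)) \<le> nrm (X n - x) + nrm ((- (t n - l)) *\<^sub>R b)" for n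
      using nrm_triangle[of "X n - x" "(- (t n - l)) *\<^sub>R b"] XH x b by (metis memH(3,4))
    then show "nrm (X n - t n *\<^sub>R b - (x - l *\<^sub>R b)) \<le> 1 * (nrm (X n - x) + \<bar>t n - l\<bar> * nrm b)" for n
      using nrm_scale[OF b, of "- (t n - l)"] by (metis abs_minus_cancel mult_1)
  qed
  then have "x - l *\<^sub>R b \<in> C" using C(3)[of "\<lambda>n. X n - t n *\<^sub>R b"] t x b by blast
  then show ?thesis using C(1) by (auto simp: span_insert span_eq_iff[THEN iffD2])
qed

text \<open>Needed for closed range: the operator is bounded below only on a subspace F of finite
  codimension, and its range is the closed image of F plus finitely many vectors.\<close>

lemma add_finite_closed:
  assumes "finite B" "B \<subseteq> H"
    and C: "subspace C" "C \<subseteq> H" "\<And>X x. (\<And>n. X n \<in> C) \<Longrightarrow> x \<in> H \<Longrightarrow> conv X x \<Longrightarrow> x \<in> C"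
    and "\<And>n. X n \<in> span (C \<union> B)" "x \<in> H" "conv X x"
  shows "x \<in> span (C \<union> B)"
  using assms(1,2,6-)
proof (induction B arbitrary: X x)
  case empty
  have "span C = C" using C(1) by (simp add: span_eq_iff)
  moreover have "x \<in> C" using empty.prems calculation by (intro C(3)[of X x]) auto
  then show ?case by (intro span_base) simp
next
  case (insert b B)
  have eq: "span (C \<union> insert b B) = span (insert b (span (C \<union> B)))"
  proof (rule antisym)
    show "span (C \<union> insert b B) \<subseteq> span (insert b (span (C \<union> B)))"
      using span_superset[of "C \<union> B"] by (intro span_mono) auto
    show "span (insert b (span (C \<union> B))) \<subseteq> span (C \<union> insert b B)"
      using span_mono[of "C \<union> B" "C \<union> insert b B"] span_superset[of "C \<union> insert b B"]
      by (intro span_minimal) auto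
  qed
  have "span (C \<union> B) \<subseteq> H" using insert C sub by (intro span_minimal) auto
  then have "x \<in> span (insert b (span (C \<union> B)))"
    using insert.prems insert.IH unfolding eq
    by (intro add_line_closed[of "span (C \<union> B)" b X x]) auto
  then show ?case using eq by simp
qed

text \<open>On the common kernel F of the functionals, \<open>ip (A x) y\<close> is an inner product
  equivalent to the given one, so the equation A u = y is solvable in F up to a vector orthogonal to
  F. As F is closed and has finite codimension, the kernel, which meets F only in 0, and the
  cokernel are finite-dimensional, and the range is closed.\<close>

theorem fredholm_of_coercive:
  assumes A: "bounded_operator_on H ip A" "selfadjoint_on H ip A"
    and L: "finite L"
    and L_add: "\<And>l x y. l \<in> L \<Longrightarrow> x \<in> H \<Longrightarrow> y \<in> H \<Longrightarrow> l (x + y) = (l x + l y :: real)"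
    and L_scale: "\<And>l c x. l \<in> L \<Longrightarrow> x \<in> H \<Longrightarrow> l (c *\<^sub>R x) = c * l x"
    and L_bound: "\<And>l x. l \<in> L \<Longrightarrow> x \<in> H \<Longrightarrow> \<bar>l x\<bar> \<le> K * nrm x"
    and c: "c > 0" and coercive: "\<And>x. x \<in> H \<Longrightarrow> (\<forall>l\<in>L. l x = 0) \<Longrightarrow> c * ip x x \<le> ip (A x) x"
  shows "fredholm_operator_on H ip A"
proof -
  have AH: "A x \<in> H" and Aadd: "y \<in> H \<Longrightarrow> A (x + y) = A x + A y"
    and Ascale: "A (a *\<^sub>R x) = a *\<^sub>R A x" if "x \<in> H" for x y a
    using A(1) that by (auto simp: bounded_operator_on_def)
  have Adiff: "A (x - y) = A x - A y" if "x \<in> H" "y \<in> H" for x y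
    using Aadd[of x "(-1) *\<^sub>R y"] Ascale[of y "-1"] that memH(4)[of y "-1"] by simp
  obtain C where C: "\<And>x. x \<in> H \<Longrightarrow> nrm (A x) \<le> C * nrm x"
    using A(1) unfolding bounded_operator_on_def nrm_def by metis
  have Asym: "ip (A x) y = ip x (A y)" if "x \<in> H" "y \<in> H" for x y
    using A(2) that by (auto simp: selfadjoint_on_def)
  have A0: "A 0 = 0" using Ascale[of 0 0] by simp
  have subA: "subspace (A ` S)" if "subspace S" "S \<subseteq> H" for S
  proof (rule subspaceI)
    show "0 \<in> A ` S" using A0 that by (metis imageI subspace_0)
    show "x + y \<in> A ` S" if xy: "x \<in> A ` S" "y \<in> A ` S" for x y
    proof -
      obtain u v where "u \<in> S" "v \<in> S" "x = A u" "y = A v" using xy by auto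
      then show ?thesis using \<open>subspace S\<close> \<open>S \<subseteq> H\<close> Aadd[of u v] by (metis image_eqI subsetD subspace_add)
    qed
    show "a *\<^sub>R x \<in> A ` S" if x: "x \<in> A ` S" for a x
    proof -
      obtain u where "u \<in> S" "x = A u" using x by auto
      then show ?thesis using \<open>subspace S\<close> \<open>S \<subseteq> H\<close> Ascale[of u a] by (metis image_eqI subsetD subspace_scale)
    qed
  qed
  define F where "F = {x \<in> H. \<forall>l\<in>L. l x = 0}"
  have FH: "F \<subseteq> H" by (auto simp: F_def)
  have F: "subspace F" using sub L_scale[of _ 0 0]
    by (auto simp: F_def L_add L_scale intro!: subspaceI)
  have F_closed: "x \<in> F" if X: "\<And>n. X n \<in> F" "x \<in> H" "conv X x" for X x
  proof -
    have "l x = 0" if l: "l \<in> L" for l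
    proof -
      have "(\<lambda>n. \<bar>l x\<bar>) \<longlonglongrightarrow> 0"
      proof (rule tendsto_zero_squeeze_le[where C=K])
        show "(\<lambda>n. nrm (X n - x)) \<longlonglongrightarrow> 0" using X by (simp add: conv_def)
        have "l (X n - x) = - l x" for n
          using L_add[OF l, of "X n - x" x] X(1)[of n] X(2) l by (auto simp: F_def)
        then show "\<bar>l x\<bar> \<le> K * nrm (X n - x)" for n
          using L_bound[OF l, of "X n - x"] X FH by (metis abs_minus_cancel memH(3) subsetD)
      qed simp
      then show ?thesis by (simp add: LIMSEQ_const_iff)
    qed
    then show ?thesis using X(2) by (simp add: F_def)
  qed
  have coerF: "c * ip x x \<le> ip (A x) x" if "x \<in> F" for x using coercive[of x] that by (auto simp: F_def)
  have lower: "c * nrm x \<le> nrm (A x)" if x: "x \<in> F" for x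
  proof (cases "nrm x = 0")
    case False
    have xH: "x \<in> H" using x FH by blast
    have "c * nrm x * nrm x = c * ip x x" using nrm_sq[OF xH] by (simp add: power2_eq_square mult.assoc)
    also have "\<dots> \<le> ip (A x) x" by (rule coerF[OF x])
    also have "\<dots> \<le> nrm (A x) * nrm x" using CS[OF AH[OF xH] xH] by linarith
    finally have "c * nrm x * nrm x \<le> nrm (A x) * nrm x" .
    moreover have "nrm x > 0" using False nrm_ge_0[OF xH] by linarith
    ultimately show ?thesis by simp
  qed (use x FH AH in auto)
  obtain G where G: "finite G" "G \<subseteq> H" "H \<subseteq> span (F \<union> G)"
    using subspace_kernel_span[OF L sub L_add L_scale] unfolding F_def by auto
  \<comment> \<open>The form of A serves as a second inner product on F. The estimates
    \<open>Fn1\<close> and \<open>Fn2\<close> say that its norm is equivalent to the original one,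
    and so completeness carries over.\<close>
  interpret Fb: ip_on F "\<lambda>x y. ip (A x) y"
  proof
    show "subspace F" by (rule F)
    fix x y z a assume x: "x \<in> F" 
    show "x \<noteq> 0 \<Longrightarrow> 0 < ip (A x) x" using coerF[OF x] ip_pos[of x] x FH c
      by (smt (verit) mult_pos_pos subsetD)
    assume y: "y \<in> F"
    show "ip (A x) y = ip (A y) x" using Asym[of x y] ip_sym[of x "A y"] x y FH AH by auto
    show "ip (A (a *\<^sub>R x)) y = a * ip (A x) y" using x y FH AH Ascale by (auto simp: ip_scale subset_iff)
    assume z: "z \<in> F"
    show "ip (A (x + y)) z = ip (A x) z + ip (A y) z" using x y z FH AH Aadd by (auto simp: ip_add subset_iff)
  qed
  have Fn1: "sqrt c * nrm x \<le> Fb.nrm x" if "x \<in> F" for x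
    using coerF[OF that] by (simp add: nrm_def Fb.nrm_def flip: real_sqrt_mult)
  have Fn2: "Fb.nrm x \<le> sqrt \<bar>C\<bar> * nrm x" if x: "x \<in> F" for x
  proof -
    have xH: "x \<in> H" using x FH by auto
    have "ip (A x) x \<le> nrm (A x) * nrm x" using CS[of "A x" x] AH xH by (smt (verit))
    also have "\<dots> \<le> (\<bar>C\<bar> * nrm x) * nrm x"
      using C[OF xH] nrm_ge_0[OF xH] by (intro mult_right_mono) (smt (verit) mult_right_mono)+
    also have "\<dots> = \<bar>C\<bar> * ip x x" using nrm_sq[OF xH] by (simp add: power2_eq_square)
    finally show ?thesis by (simp add: Fb.nrm_def nrm_def flip: real_sqrt_mult)
  qed
  interpret Fb: hilbert_on F "\<lambda>x y. ip (A x) y"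
  proof
    fix X assume X: "\<And>n. X n \<in> F" "Fb.cauchy X"
    have "cauchy X" unfolding cauchy_def
    proof (intro allI impI)
      fix e :: real assume "e > 0"
      then have "sqrt c * e > 0" using c by simp
      then obtain N where N: "\<And>m n. m \<ge> N \<Longrightarrow> n \<ge> N \<Longrightarrow> Fb.nrm (X m - X n) < sqrt c * e"
        using X(2) unfolding Fb.cauchy_def by blast
      have "nrm (X m - X n) < e" if "m \<ge> N" "n \<ge> N" for m n
      proof -
        have "sqrt c * nrm (X m - X n) < sqrt c * e"
          using Fn1[of "X m - X n"] N[OF that] X(1) by (smt (verit) Fb.memH(3))
        then show ?thesis using c by simp
      qed
      then show "\<exists>N. \<forall>m\<ge>N. \<forall>n\<ge>N. nrm (X m - X n) < e" by blast
    qed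
    then obtain x where x: "x \<in> H" "conv X x" using complete X FH by blast
    have xF: "x \<in> F" using F_closed X(1) x by blast
    have XF: "X n - x \<in> F" for n using X(1) xF by (rule Fb.memH(3))
    have "Fb.conv X x" unfolding Fb.conv_def
    proof (rule tendsto_zero_squeeze_le)
      show "(\<lambda>n. nrm (X n - x)) \<longlonglongrightarrow> 0" using x(2) by (simp only: conv_def)
      show "0 \<le> Fb.nrm (X n - x)" for n using XF by (rule Fb.nrm_ge_0)
      show "Fb.nrm (X n - x) \<le> sqrt \<bar>C\<bar> * nrm (X n - x)" for n using XF by (rule Fn2)
    qed
    then show "\<exists>x\<in>F. Fb.conv X x" using xF by blast
  qed
  define Fp where "Fp = {z \<in> H. \<forall>f\<in>F. ip z f = 0}"
  have Fp: "subspace Fp" unfolding Fp_def using sub FH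
    by (auto simp: ip_simps subset_iff intro!: subspaceI)
  \<comment> \<open>Riesz for the form of A on F: the functional x -> <y, x> is represented by some
    u, and y - A u is then orthogonal to F.\<close>
  have dec: "\<exists>x\<in>F. y - A x \<in> Fp" if y: "y \<in> H" for y
  proof -
    have "\<exists>u\<in>F. \<forall>x\<in>F. ip (A u) x = ip y x"
    proof (rule Fb.riesz[where K="nrm y / sqrt c"])
      fix x assume x: "x \<in> F"
      then show "ip y (a *\<^sub>R x) = a * ip y x" for a using y FH by (auto simp: ip_simps subset_iff)
      have "\<bar>ip y x\<bar> \<le> nrm y * nrm x" using CS[of y x] x y FH by auto
      also have "\<dots> \<le> nrm y * (Fb.nrm x / sqrt c)"
        using Fn1[OF x] c y by (intro mult_left_mono) (auto simp: field_simps)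
      finally show "\<bar>ip y x\<bar> \<le> nrm y / sqrt c * Fb.nrm x" by simp
    qed (use y FH in \<open>auto simp: ip_simps subset_iff\<close>)
    then obtain u where u: "u \<in> F" "\<forall>x\<in>F. ip (A u) x = ip y x" by blast
    then have "y - A u \<in> Fp" using y FH AH by (auto simp: Fp_def ip_simps subset_iff)
    then show ?thesis using u by blast
  qed
  have "\<exists>B. finite B \<and> {x \<in> H. A x = 0} \<subseteq> span B"
  proof -
    let ?K = "{x \<in> H. A x = 0}"
    have K: "subspace ?K" using sub A0 by (auto simp: Aadd Ascale intro!: subspaceI)
    obtain B where B: "finite B" "?K \<subseteq> span ({x \<in> ?K. \<forall>l\<in>L. l x = 0} \<union> B)"
      using subspace_kernel_span[OF L K] L_add L_scale by auto
    have "{x \<in> ?K. \<forall>l\<in>L. l x = 0} \<subseteq> {0}"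
      using Fb.ip_pos by (fastforce simp: F_def)
    then have "span ({x \<in> ?K. \<forall>l\<in>L. l x = 0} \<union> B) \<subseteq> span (insert 0 B)" by (intro span_mono) auto
    then show ?thesis using B by (intro exI[of _ "insert 0 B"] conjI) (simp, blast)
  qed
  moreover have "\<exists>B. finite B \<and> B \<subseteq> H \<and> H \<subseteq> span (A ` H \<union> B)"
  proof -
    \<comment> \<open>The orthogonal complement of F is finite-dimensional: a vector in it that is
      also orthogonal to the finite complement G is orthogonal to everything, hence 0.\<close>
    let ?L = "(\<lambda>g z. ip z g) ` G"
    obtain B where B: "finite B" "B \<subseteq> Fp" "Fp \<subseteq> span ({z \<in> Fp. \<forall>l\<in>?L. l z = 0} \<union> B)"
    proof -
      have "\<exists>B. finite B \<and> B \<subseteq> Fp \<and> Fp \<subseteq> span ({z \<in> Fp. \<forall>l\<in>?L. l z = 0} \<union> B)"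
      proof (rule subspace_kernel_span)
        show "finite ?L" "subspace Fp" using G Fp by auto
        show "l (x + y) = l x + l y" if "l \<in> ?L" "x \<in> Fp" "y \<in> Fp" for l x y
          using that G by (auto simp: ip_add Fp_def subset_iff)
        show "l (a *\<^sub>R x) = a * l x" if "l \<in> ?L" "x \<in> Fp" for l a x
          using that G by (auto simp: ip_scale Fp_def subset_iff)
      qed
      then show ?thesis using that by blast
    qed
    have "{z \<in> Fp. \<forall>l\<in>?L. l z = 0} \<subseteq> {0}"
    proof
      fix z assume z: "z \<in> {z \<in> Fp. \<forall>l\<in>?L. l z = 0}"
      then have zH: "z \<in> H" by (auto simp: Fp_def)
      have "subspace {w \<in> H. ip z w = 0}" using sub zH by (auto simp: ip_simps intro!: subspaceI)
      then have "span (F \<union> G) \<subseteq> {w \<in> H. ip z w = 0}"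
        using z FH G(2) by (intro span_minimal) (auto simp: Fp_def)
      then have "ip z z = 0" using G(3) zH by auto
      then show "z \<in> {0}" using ip_pos[OF zH] by force
    qed
    then have "span ({z \<in> Fp. \<forall>l\<in>?L. l z = 0} \<union> B) \<subseteq> span (insert 0 B)" by (intro span_mono) auto
    then have FpB: "Fp \<subseteq> span B" using B(3) unfolding span_insert_0 by blast
    have "H \<subseteq> span (A ` H \<union> B)"
    proof
      fix y assume "y \<in> H"
      then obtain x where x: "x \<in> F" "y - A x \<in> Fp" using dec by blast
      have "y - A x \<in> span (A ` H \<union> B)" using x FpB span_mono[of B "A ` H \<union> B"] by blast
      moreover have "A x \<in> span (A ` H \<union> B)" using x FH by (auto intro!: span_base)
      ultimately show "y \<in> span (A ` H \<union> B)" using span_add by fastforce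
    qed
    then show ?thesis using B by (intro exI[of _ B]) (auto simp: Fp_def)
  qed
  moreover have "y \<in> A ` H"
    if y: "y \<in> H" "\<forall>e>0. \<exists>z\<in>A ` H. sqrt (ip (y - z) (y - z)) < e" for y
  proof -
    have "\<forall>n. \<exists>z\<in>A ` H. nrm (y - z) < inverse (real (Suc n))"
      using y(2) unfolding nrm_def by simp
    then obtain Z where Z: "\<And>n. Z n \<in> A ` H" "\<And>n. nrm (y - Z n) < inverse (real (Suc n))" by metis
    have ZH: "Z n \<in> H" for n using Z(1)[of n] AH by auto
    have cv: "conv Z y" unfolding conv_def
    proof (rule tendsto_zero_squeeze_le[OF LIMSEQ_inverse_real_of_nat, where C=1])
      show "0 \<le> nrm (Z n - y)" for n using ZH y by auto
      show "nrm (Z n - y) \<le> 1 * inverse (real (Suc n))" for n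
        using Z(2)[of n] nrm_minus_commute[of y "Z n"] ZH y by auto
    qed
    \<comment> \<open>By the lower bound c |x| <= |A x| on F, convergence of A (f n) forces f to be
      Cauchy.\<close>
    have AF_closed: "x \<in> A ` F" if X: "\<And>n. X n \<in> A ` F" "x \<in> H" "conv X x" for X x
    proof -
      have "\<forall>n. \<exists>f\<in>F. X n = A f" using X(1) by blast
      then obtain f where f: "\<And>n. f n \<in> F" "\<And>n. X n = A (f n)" by metis
      have fH: "f n \<in> H" for n using f FH by auto
      have XH: "X n \<in> H" for n using f fH AH by auto
      have "cauchy f" unfolding cauchy_def
      proof (intro allI impI)
        fix e :: real assume "e > 0"
        then have "c * e > 0" using c by simp
        then obtain N where N: "\<And>m n. m \<ge> N \<Longrightarrow> n \<ge> N \<Longrightarrow> nrm (X m - X n) < c * e"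
          using conv_cauchy[OF XH X(2,3)] unfolding cauchy_def by blast
        have "nrm (f m - f n) < e" if "m \<ge> N" "n \<ge> N" for m n
        proof -
          have "c * nrm (f m - f n) < c * e"
            using lower[of "f m - f n"] N[OF that] f fH Adiff[of "f m" "f n"]
            by (smt (verit) Fb.memH(3))
          then show ?thesis using c by simp
        qed
        then show "\<exists>N. \<forall>m\<ge>N. \<forall>n\<ge>N. nrm (f m - f n) < e" by blast
      qed
      then obtain g where g: "g \<in> H" "conv f g" using complete fH by blast
      have gF: "g \<in> F" using F_closed f(1) g by blast
      have "conv X (A g)" unfolding conv_def
      proof (rule tendsto_zero_squeeze_le[where C=C])
        show "(\<lambda>n. nrm (f n - g)) \<longlonglongrightarrow> 0" using g by (simp add: conv_def)
        show "0 \<le> nrm (X n - A g)" for n using XH AH g by auto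
        show "nrm (X n - A g) \<le> C * nrm (f n - g)" for n
          using C[of "f n - g"] Adiff[of "f n" g] fH g f(2) by auto
      qed
      then have "x = A g" by (rule conv_unique[OF XH X(2) AH[OF g(1)] X(3)])
      then show ?thesis using gF by blast
    qed
    have rng: "A ` H = span (A ` F \<union> A ` G)"
    proof
      have "subspace {x \<in> H. A x \<in> span (A ` F \<union> A ` G)}" using sub A0
        by (auto simp: Aadd Ascale span_add span_scale span_0 intro!: subspaceI)
      then have "span (F \<union> G) \<subseteq> {x \<in> H. A x \<in> span (A ` F \<union> A ` G)}"
        using FH G(2) by (intro span_minimal) (auto intro: span_base)
      then show "A ` H \<subseteq> span (A ` F \<union> A ` G)" using G(3) by auto
      show "span (A ` F \<union> A ` G) \<subseteq> A ` H" using FH G(2) subA[OF sub] by (intro span_minimal) auto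
    qed
    have "y \<in> span (A ` F \<union> A ` G)"
    proof (rule add_finite_closed[OF _ _ subA[OF F FH] _ AF_closed _ y(1) cv])
      show "finite (A ` G)" using G by simp
      show "A ` G \<subseteq> H" "A ` F \<subseteq> H" using G(2) FH AH by blast+
      show "Z n \<in> span (A ` F \<union> A ` G)" for n using Z(1) rng by blast
    qed
    then show ?thesis using rng by simp
  qed
  ultimately show ?thesis using A(1) unfolding fredholm_operator_on_def by blast
qed

text \<open>Linear dependence modulo R: the quotient of the span by R has dimension at most
  \<open>card B\<close>. The proof is Gaussian elimination, one element of B at a time; the vectors
  are indexed, so repetitions are allowed.\<close>

lemma (in -) nontrivial_combination_in_subspace:
  assumes "finite B" "subspace R" "finite I" "card B < card I" "\<And>i. i \<in> I \<Longrightarrow> y i \<in> span (R \<union> B)"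
  shows "\<exists>a. (\<exists>i\<in>I. a i \<noteq> (0::real)) \<and> (\<Sum>i\<in>I. a i *\<^sub>R y i) \<in> R"
  using assms(1,3-)
proof (induction B arbitrary: I y)
  case empty
  then obtain i where i: "i \<in> I" by fastforce
  have "y j \<in> R" if "j \<in> I" for j
    using empty.prems(3)[OF that] assms(2) by (simp add: span_eq_iff[THEN iffD2])
  then show ?case using i assms(2)
    by (intro exI[of _ "\<lambda>_. 1"]) (auto intro: subspace_sum)
next
  case (insert b B)
  have "\<exists>k. y i - k *\<^sub>R b \<in> span (R \<union> B)" if "i \<in> I" for i
    using insert.prems(3)[OF that] by (simp add: span_insert)
  then obtain k where k: "\<And>i. i \<in> I \<Longrightarrow> y i - k i *\<^sub>R b \<in> span (R \<union> B)" by metis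
  show ?case
  proof (cases "\<forall>i\<in>I. k i = 0")
    case True
    then have "y i \<in> span (R \<union> B)" if "i \<in> I" for i using k[OF that] that by simp
    then show ?thesis using insert by (intro insert.IH) auto
  next
    case False
    then obtain j where j: "j \<in> I" "k j \<noteq> 0" by blast
    \<comment> \<open>Pivot step: y j carries a nonzero b-coefficient and clears that of all others.
      The coefficient of y j in the final combination, set in \<open>a'\<close> below, collects what
      was subtracted.\<close>
    let ?z = "\<lambda>i. y i - (k i / k j) *\<^sub>R y j"
    have z: "?z i \<in> span (R \<union> B)" if "i \<in> I - {j}" for i
    proof -
      have eq: "?z i = (y i - k i *\<^sub>R b) - (k i / k j) *\<^sub>R (y j - k j *\<^sub>R b)"
        using j by (simp add: algebra_simps)
      show ?thesis unfolding eq
      proof (intro span_diff[of "y i - k i *\<^sub>R b" "R \<union> B" "(k i / k j) *\<^sub>R (y j - k j *\<^sub>R b)"] span_scale)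
        show "y i - k i *\<^sub>R b \<in> span (R \<union> B)" using k that by blast
        show "y j - k j *\<^sub>R b \<in> span (R \<union> B)" using k j by blast
      qed
    qed
    have "card B < card (I - {j})" using insert j by simp
    then obtain a where a: "\<exists>i\<in>I - {j}. a i \<noteq> 0" "(\<Sum>i\<in>I - {j}. a i *\<^sub>R ?z i) \<in> R"
      using insert.IH[of "I - {j}" ?z] insert.prems z by auto
    define a' where "a' i = (if i = j then - (\<Sum>i\<in>I - {j}. a i * (k i / k j)) else a i)" for i
    have "(\<Sum>i\<in>I. a' i *\<^sub>R y i) = a' j *\<^sub>R y j + (\<Sum>i\<in>I - {j}. a' i *\<^sub>R y i)"
      using insert.prems j by (intro sum.remove) auto
    also have "(\<Sum>i\<in>I - {j}. a' i *\<^sub>R y i) = (\<Sum>i\<in>I - {j}. a i *\<^sub>R y i)"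
      by (intro sum.cong) (auto simp: a'_def)
    also have "a' j *\<^sub>R y j + \<dots> = (\<Sum>i\<in>I - {j}. a i *\<^sub>R ?z i)"
      by (simp add: a'_def scaleR_diff_right sum_subtractf scaleR_sum_left)
    finally have "(\<Sum>i\<in>I. a' i *\<^sub>R y i) \<in> R" using a by simp
    moreover have "\<exists>i\<in>I. a' i \<noteq> 0" using a(1) by (auto simp: a'_def)
    ultimately show ?thesis by blast
  qed
qed

text \<open>The geometric bound makes the series converge absolutely, so the partial sums are Cauchy
  by the triangle inequality, and the coefficients of the limit are limits of eventually constant
  sequences.\<close>

lemma orthonormal_series:
  assumes x: "\<And>n. x n \<in> H" "\<And>n. ip (x n) (x n) = 1" "\<And>m n. m \<noteq> n \<Longrightarrow> ip (x m) (x n) = 0"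
    and c: "\<And>n. \<bar>c n\<bar> \<le> (1/2) ^ n"
  shows "\<exists>y\<in>H. \<forall>n. ip y (x n) = c n"
proof -
  define S where "S N = (\<Sum>n<N. c n *\<^sub>R x n)" for N
  have SH: "S N \<in> H" for N unfolding S_def by (intro sum_mem) (simp add: x)
  have nx: "nrm (x n) = 1" for n by (simp add: nrm_def x)
  have est: "nrm (S n - S m) \<le> 2 * (1/2) ^ m" if "m \<le> n" for m n
  proof -
    have "S n - S m = (\<Sum>i=m..<n. c i *\<^sub>R x i)"
      using sum_diff_nat_ivl[of 0 m n "\<lambda>i. c i *\<^sub>R x i"] that by (simp add: S_def atLeast0LessThan)
    then have "nrm (S n - S m) \<le> (\<Sum>i=m..<n. nrm (c i *\<^sub>R x i))"
      using nrm_sum[of "{m..<n}" "\<lambda>i. c i *\<^sub>R x i"] x(1) by simp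
    also have "\<dots> \<le> (\<Sum>i=m..<n. (1/2) ^ i)"
      using c by (intro sum_mono) (simp add: nrm_scale x nx)
    also have "\<dots> \<le> 2 * (1/2) ^ m - 2 * (1/2) ^ n"
      using that by (induction n rule: dec_induct) auto
    also have "\<dots> \<le> 2 * (1/2) ^ m" by simp
    finally show ?thesis .
  qed
  have "cauchy S" unfolding cauchy_def
  proof (intro allI impI)
    fix e :: real assume "e > 0"
    then obtain N where N: "(1/2::real) ^ N < e / 2" using real_arch_pow_inv[of "e/2" "1/2"] by auto
    have *: "nrm (S m - S n) < e" if "m \<ge> N" "n \<ge> m" for m n
    proof -
      have "(1/2::real) ^ m \<le> (1/2) ^ N" using that by (intro power_decreasing) auto
      then show ?thesis using est[OF that(2)] N nrm_minus_commute[OF SH SH, of n m] by linarith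
    qed
    have "nrm (S m - S n) < e" if "m \<ge> N" "n \<ge> N" for m n
      using *[of m n] *[of n m] that nrm_minus_commute[OF SH SH, of n m] by (cases "m \<le> n") auto
    then show "\<exists>N. \<forall>m\<ge>N. \<forall>n\<ge>N. nrm (S m - S n) < e" by blast
  qed
  then obtain y where y: "y \<in> H" "conv S y" using complete SH by blast
  have "ip y (x n) = c n" for n
  proof -
    have eq: "ip (S N) (x n) = c n" if "N > n" for N
    proof -
      have "ip (S N) (x n) = (\<Sum>i<N. ip (c i *\<^sub>R x i) (x n))" unfolding S_def by (rule ip_sum) (simp_all add: x)
      also have "\<dots> = (\<Sum>i<N. if i = n then c i else 0)" by (intro sum.cong) (auto simp: ip_scale x)
      finally show ?thesis using that by simp
    qed
    have "(\<lambda>N. ip (S N) (x n)) \<longlonglongrightarrow> c n"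
      by (rule tendsto_eventually) (use eq in \<open>auto intro: eventually_sequentiallyI[of "Suc n"]\<close>)
    then show ?thesis using conv_ip[OF SH y(1) x(1)[of n] y(2)] LIMSEQ_unique by blast
  qed
  then show ?thesis using y by blast
qed

text \<open>If \<open>\<parallel>A x\<^sub>n\<parallel> \<le> 4\<^sup>-\<^sup>n\<close> then every \<open>y\<close> in the range has coefficients \<open>\<langle>y, x\<^sub>n\<rangle>\<close> of order \<open>4\<^sup>-\<^sup>n\<close>, so the
  vectors whose coefficients are \<open>2\<^sup>-\<^sup>n\<close> on disjoint infinite index sets are independent modulo the
  range.\<close>

theorem not_fredholm_of_orthonormal:
  assumes A: "selfadjoint_on H ip A"
    and x: "\<And>n. x n \<in> H" "\<And>n. ip (x n) (x n) = 1" "\<And>m n. m \<noteq> n \<Longrightarrow> ip (x m) (x n) = 0"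
    and Ax: "\<And>n. nrm (A (x n)) \<le> (1/4) ^ n"
  shows "\<not> fredholm_operator_on H ip A"
proof
  assume F: "fredholm_operator_on H ip A"
  then obtain B where B: "finite B" "B \<subseteq> H" "H \<subseteq> span (A ` H \<union> B)"
    and bA: "bounded_operator_on H ip A" by (auto simp: fredholm_operator_on_def)
  have AH: "A z \<in> H" and Aadd: "y \<in> H \<Longrightarrow> A (z + y) = A z + A y"
    and Ascale: "A (a *\<^sub>R z) = a *\<^sub>R A z" if "z \<in> H" for z y a
    using bA that by (auto simp: bounded_operator_on_def)
  have sA: "subspace (A ` H)"
  proof (rule subspaceI)
    show "0 \<in> A ` H" using Ascale[of 0 0] memH(1) by (metis imageI scale_zero_left)
    show "u + v \<in> A ` H" if uv: "u \<in> A ` H" "v \<in> A ` H" for u v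
    proof -
      obtain p q where "p \<in> H" "q \<in> H" "u = A p" "v = A q" using uv by blast
      then have "u + v = A (p + q)" "p + q \<in> H" using Aadd by auto
      then show ?thesis by blast
    qed
    show "a *\<^sub>R u \<in> A ` H" if u: "u \<in> A ` H" for a u
    proof -
      obtain p where "p \<in> H" "u = A p" using u by blast
      then have "a *\<^sub>R u = A (a *\<^sub>R p)" "a *\<^sub>R p \<in> H" using Ascale by auto
      then show ?thesis by blast
    qed
  qed
  \<comment> \<open>One residue class modulo k per vector: k vectors exceed the dimension of the
    cokernel by one, so some nontrivial combination of them lies in the range.\<close>
  define k where "k = Suc (card B)"
  have "\<exists>y\<in>H. \<forall>n. ip y (x n) = (if n mod k = i then (1/2) ^ n else 0)" for i
    using x by (intro orthonormal_series) auto
  then obtain y where y: "\<And>i. y i \<in> H" "\<And>i n. ip (y i) (x n) = (if n mod k = i then (1/2) ^ n else 0)"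
    by metis
  have "y i \<in> span (A ` H \<union> B)" for i using B(3) y(1) by blast
  then have "\<exists>a. (\<exists>i\<in>{..<k}. a i \<noteq> 0) \<and> (\<Sum>i<k. a i *\<^sub>R y i) \<in> A ` H"
    by (intro nontrivial_combination_in_subspace[OF B(1) sA]) (auto simp: k_def)
  then obtain a j where a: "j < k" "a j \<noteq> 0" "(\<Sum>i<k. a i *\<^sub>R y i) \<in> A ` H"
    by blast
  obtain z where z: "z \<in> H" "(\<Sum>i<k. a i *\<^sub>R y i) = A z" using a(3) by auto
  \<comment> \<open>On the class of j only the summand a j contributes, with coefficient of order
    2^-n, whereas selfadjointness bounds every coefficient of A z by |z| 4^-n.\<close>
  have bd: "\<bar>a j\<bar> * 2 ^ n \<le> nrm z" if n: "n mod k = j" for n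
  proof -
    have "ip (\<Sum>i<k. a i *\<^sub>R y i) (x n) = (\<Sum>i<k. ip (a i *\<^sub>R y i) (x n))"
      by (rule ip_sum) (simp_all add: x y)
    also have "\<dots> = (\<Sum>i<k. if i = j then a i * (1/2) ^ n else 0)"
      by (intro sum.cong) (auto simp: ip_scale x y n)
    also have "\<dots> = a j * (1/2) ^ n" using a(1) by simp
    finally have "a j * (1/2) ^ n = ip z (A (x n))"
      using z x A by (simp add: selfadjoint_on_def)
    then have "\<bar>a j\<bar> * (1/2) ^ n \<le> nrm z * nrm (A (x n))"
      using CS[of z "A (x n)"] z(1) AH[OF x(1)[of n]] by (simp add: abs_mult)
    also have "\<dots> \<le> nrm z * (1/4) ^ n" using Ax[of n] z by (intro mult_left_mono) auto
    finally have "\<bar>a j\<bar> * (1/2) ^ n * 4 ^ n \<le> nrm z * (1/4) ^ n * 4 ^ n" by (intro mult_right_mono) auto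
    also have "nrm z * (1/4) ^ n * 4 ^ n = nrm z" by (simp add: mult.assoc flip: power_mult_distrib)
    finally show ?thesis by (simp add: mult.assoc flip: power_mult_distrib)
  qed
  obtain n where n: "nrm z / \<bar>a j\<bar> < 2 ^ n" using real_arch_pow[of 2 "nrm z / \<bar>a j\<bar>"] by auto
  have "n * k + j \<ge> n" using a(1) by (cases k) auto
  then have "(2::real) ^ n \<le> 2 ^ (n * k + j)" by (intro power_increasing) auto
  then have "nrm z / \<bar>a j\<bar> < 2 ^ (n * k + j)" using n by linarith
  then show False using bd[of "n * k + j"] a by (simp add: field_simps)
qed

end

section \<open>Weak derivatives on the half-line\<close>

abbreviation hl :: "real measure" where "hl \<equiv> lebesgue_on {0..}"

lemma measurable_hl: "f \<in> borel_measurable borel \<Longrightarrow> f \<in> borel_measurable hl"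
  by (rule measurable_restrict_space1, rule measurable_completion) simp

lemma integrable_hl_iff:
  fixes f :: "real \<Rightarrow> 'a::{banach, second_countable_topology}"
  shows "integrable hl f \<longleftrightarrow> integrable lebesgue (\<lambda>t. indicator {0..} t *\<^sub>R f t)"
  by (subst integrable_restrict_space) auto

lemma integral_hl_eq:
  fixes f :: "real \<Rightarrow> 'a::{banach, second_countable_topology}"
  shows "(LINT t|hl. f t) = (LINT t|lebesgue. indicator {0..} t *\<^sub>R f t)"
  by (subst integral_restrict_space) auto

lemma integrable_hl_Icc: "integrable hl (\<lambda>t. indicator {a..b} t :: real)"
proof -
  have "integrable lborel (\<lambda>t. indicator {max 0 a..b} t :: real)"
    by (intro integrable_real_indicator) (auto simp: emeasure_lborel_Icc_eq)
  then have "integrable lebesgue (\<lambda>t. indicator {max 0 a..b} t :: real)"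
    using integrable_completion[of "\<lambda>t. indicator {max 0 a..b} t :: real" lborel] by simp
  moreover have "(\<lambda>t. indicator {max 0 a..b} t :: real) = (\<lambda>t. indicator {0..} t *\<^sub>R indicator {a..b} t)"
    by (auto simp: fun_eq_iff indicator_def)
  ultimately show ?thesis by (simp only: integrable_hl_iff)
qed

lemma integral_hl_Icc: "0 \<le> a \<Longrightarrow> a \<le> b \<Longrightarrow> (LINT t|hl. indicator {a..b} t) = b - a"
proof -
  assume *: "0 \<le> a" "a \<le> b"
  have "(\<lambda>t. indicator {0..} t *\<^sub>R indicator {a..b} t) = (\<lambda>t. indicator {a..b} t :: real)"
    using * by (auto simp: fun_eq_iff indicator_def)
  then have "(LINT t|hl. indicator {a..b} t) = (LINT t|lebesgue. indicator {a..b} t :: real)"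
    by (simp only: integral_hl_eq)
  also have "\<dots> = (LINT t|lborel. indicator {a..b} t :: real)" by (rule integral_completion) simp
  also have "\<dots> = b - a" using * by simp
  finally show ?thesis .
qed

lemma AE_hl_pos: "AE t in hl. 0 < t"
proof -
  have "AE t in lborel. t \<noteq> (0::real)" by (rule AE_lborel_singleton)
  then have "AE t in lebesgue. t \<noteq> (0::real)" by (rule AE_completion)
  then have "AE t in lebesgue. 0 \<le> t \<longrightarrow> 0 < (t::real)" by eventually_elim auto
  then show ?thesis by (subst AE_restrict_space_iff) auto
qed

section \<open>Square-integrable functions and estimates for their integrals\<close>

definition sq_int :: "(real \<Rightarrow> 'a::euclidean_space) \<Rightarrow> bool" where
  "sq_int f \<longleftrightarrow> f \<in> borel_measurable hl \<and> integrable hl (\<lambda>t. (norm (f t))\<^sup>2)"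

lemma sq_int_measurable [measurable_dest]: "sq_int f \<Longrightarrow> f \<in> borel_measurable hl"
  by (simp add: sq_int_def)

lemma sq_int_integrable: "sq_int f \<Longrightarrow> integrable hl (\<lambda>t. (norm (f t))\<^sup>2)"
  by (simp add: sq_int_def)

lemma mult_le_sum_squares: "2 * (x * y) \<le> x\<^sup>2 + (y::real)\<^sup>2"
  using zero_le_power2[of "x - y"] by (simp add: power2_diff)

lemma norm_add_sq_le: "(norm (x + y))\<^sup>2 \<le> 2 * (norm x)\<^sup>2 + 2 * (norm (y::'a::real_normed_vector))\<^sup>2"
proof -
  have "(norm (x + y))\<^sup>2 \<le> (norm x + norm y)\<^sup>2" by (simp add: norm_triangle_ineq power_mono)
  then show ?thesis using mult_le_sum_squares[of "norm x" "norm y"] by (simp add: power2_sum mult.assoc)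
qed

lemma sq_int_add: assumes "sq_int f" "sq_int g" shows "sq_int (\<lambda>t. f t + g t)"
  unfolding sq_int_def
proof
  note [measurable] = assms[THEN sq_int_measurable]
  show "(\<lambda>t. f t + g t) \<in> borel_measurable hl" by measurable
  have "integrable hl (\<lambda>t. 2 * (norm (f t))\<^sup>2 + 2 * (norm (g t))\<^sup>2)"
    using assms by (auto simp: sq_int_def)
  then show "integrable hl (\<lambda>t. (norm (f t + g t))\<^sup>2)"
    by (rule Bochner_Integration.integrable_bound) (auto simp: norm_add_sq_le)
qed

lemma sq_int_scale: assumes "sq_int f" shows "sq_int (\<lambda>t. c *\<^sub>R f t)"
  using assms by (auto simp: sq_int_def power_mult_distrib)

lemma sq_int_diff: assumes "sq_int f" "sq_int g" shows "sq_int (\<lambda>t. f t - g t)"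
  using sq_int_add[OF assms(1) sq_int_scale[OF assms(2), of "-1"]] by simp

lemma sq_int_L2: "f \<in> L2_halfline V \<longleftrightarrow> (\<forall>t\<ge>0. f t \<in> V) \<and> sq_int f"
  by (auto simp: L2_halfline_def sq_int_def)

text \<open>Expansion in an orthonormal basis reduces the claim to the matrix entries of p and the
  coordinates of f and g.\<close>

lemma bilinear_form_measurable:
  fixes p :: "'x \<Rightarrow> 'a::euclidean_space \<Rightarrow> 'b::euclidean_space \<Rightarrow> real"
  assumes "\<And>t. bilinear (p t)" "\<And>u w. (\<lambda>t. p t u w) \<in> borel_measurable M"
    and [measurable]: "f \<in> borel_measurable M" "g \<in> borel_measurable M"
  shows "(\<lambda>t. p t (f t) (g t)) \<in> borel_measurable M"
proof -
  have "p t (f t) (g t) = (\<Sum>i\<in>Basis. \<Sum>j\<in>Basis. (f t \<bullet> i) * ((g t \<bullet> j) * p t i j))" for t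
  proof -
    have "p t (f t) (g t) = p t (\<Sum>i\<in>Basis. (f t \<bullet> i) *\<^sub>R i) (\<Sum>j\<in>Basis. (g t \<bullet> j) *\<^sub>R j)"
      by (simp add: euclidean_representation)
    also have "\<dots> = (\<Sum>(i,j)\<in>Basis \<times> Basis. p t ((f t \<bullet> i) *\<^sub>R i) ((g t \<bullet> j) *\<^sub>R j))"
      by (rule bilinear_sum[OF assms(1)])
    finally show ?thesis
      by (simp add: bilinear_lmul[OF assms(1)] bilinear_rmul[OF assms(1)] sum.cartesian_product mult_ac)
  qed
  moreover have [measurable]: "(\<lambda>t. p t u w) \<in> borel_measurable M" for u w by (rule assms(2))
  have "(\<lambda>t. \<Sum>i\<in>Basis. \<Sum>j\<in>Basis. (f t \<bullet> i) * ((g t \<bullet> j) * p t i j)) \<in> borel_measurable M"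
    by measurable
  ultimately show ?thesis by simp
qed

text \<open>The product of norms is estimated by the sum of squares. A bound by a sum of energies
  suffices at this stage; \<open>bf_operator\<close> turns it into a product bound by
  rescaling.\<close>

lemma L2_form:
  fixes p :: "real \<Rightarrow> 'a::euclidean_space \<Rightarrow> 'b::euclidean_space \<Rightarrow> real"
  assumes "\<And>t. bilinear (p t)" "\<And>u w. (\<lambda>t. p t u w) \<in> borel_measurable hl"
    and bd: "\<And>t u w. \<bar>p t u w\<bar> \<le> C * norm u * norm w"
    and f: "sq_int f" and g: "sq_int g"
  shows "integrable hl (\<lambda>t. p t (f t) (g t))"
    and "\<bar>LINT t|hl. p t (f t) (g t)\<bar> \<le> \<bar>C\<bar> * ((LINT t|hl. (norm (f t))\<^sup>2) + (LINT t|hl. (norm (g t))\<^sup>2))"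
proof -
  let ?d = "\<lambda>t. \<bar>C\<bar> * ((norm (f t))\<^sup>2 + (norm (g t))\<^sup>2)"
  have d: "integrable hl ?d" using f g by (auto simp: sq_int_def)
  have le: "\<bar>p t (f t) (g t)\<bar> \<le> ?d t" for t
  proof -
    have "\<bar>p t (f t) (g t)\<bar> \<le> C * (norm (f t) * norm (g t))" using bd[of t "f t" "g t"] by (simp add: mult.assoc)
    also have "\<dots> \<le> \<bar>C\<bar> * (norm (f t) * norm (g t))" by (intro mult_right_mono) auto
    also have "norm (f t) * norm (g t) \<le> (norm (f t))\<^sup>2 + (norm (g t))\<^sup>2"
      using mult_le_sum_squares[of "norm (f t)" "norm (g t)"]
        zero_le_power2[of "norm (f t)"] zero_le_power2[of "norm (g t)"] by linarith
    finally show ?thesis by (simp add: mult_left_mono)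
  qed
  show i: "integrable hl (\<lambda>t. p t (f t) (g t))"
  proof (rule Bochner_Integration.integrable_bound[OF d])
    show "(\<lambda>t. p t (f t) (g t)) \<in> borel_measurable hl"
      by (rule bilinear_form_measurable[OF assms(1,2) sq_int_measurable[OF f] sq_int_measurable[OF g]])
    have "norm (p t (f t) (g t)) \<le> norm (?d t)" for t using le[of t] by simp
    then show "AE t in hl. norm (p t (f t) (g t)) \<le> norm (?d t)" by (intro AE_I2)
  qed
  have "\<bar>LINT t|hl. p t (f t) (g t)\<bar> \<le> (LINT t|hl. \<bar>p t (f t) (g t)\<bar>)"
    using integral_norm_bound[of hl "\<lambda>t. p t (f t) (g t)"] by simp
  also have "\<dots> \<le> (LINT t|hl. ?d t)" using i d le by (intro integral_mono) auto
  also have "\<dots> = \<bar>C\<bar> * ((LINT t|hl. (norm (f t))\<^sup>2) + (LINT t|hl. (norm (g t))\<^sup>2))"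
    using f g by (simp add: sq_int_def)
  finally show "\<bar>LINT t|hl. p t (f t) (g t)\<bar> \<le> \<bar>C\<bar> * ((LINT t|hl. (norm (f t))\<^sup>2) + (LINT t|hl. (norm (g t))\<^sup>2))" .
qed

lemma sq_int_bounded_mult_integrable:
  fixes g :: "real \<Rightarrow> 'a::euclidean_space"
  assumes g: "sq_int g" and [measurable]: "u \<in> borel_measurable hl"
    and u: "\<And>t. \<bar>u t\<bar> \<le> K * indicator {a..b} t"
  shows "integrable hl (\<lambda>t. u t *\<^sub>R g t)"
proof -
  note [measurable] = sq_int_measurable[OF g]
  have "integrable hl (\<lambda>t. \<bar>K\<bar> * indicator {a..b} t + \<bar>K\<bar> * (norm (g t))\<^sup>2)"
    using integrable_hl_Icc g by (auto simp: sq_int_def)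
  moreover have "(\<lambda>t. u t *\<^sub>R g t) \<in> borel_measurable hl" by measurable
  moreover have "norm (u t *\<^sub>R g t) \<le> norm (\<bar>K\<bar> * indicator {a..b} t + \<bar>K\<bar> * (norm (g t))\<^sup>2)" for t
  proof (cases "t \<in> {a..b}")
    case True
    have "norm (g t) \<le> 1 + (norm (g t))\<^sup>2"
      using mult_le_sum_squares[of 1 "norm (g t)"] zero_le_power2[of "norm (g t)"]
      unfolding one_power2 mult_1 by linarith
    then have "\<bar>u t\<bar> * norm (g t) \<le> \<bar>K\<bar> * (1 + (norm (g t))\<^sup>2)"
      using u[of t] True by (intro mult_mono) auto
    then show ?thesis using True by (simp add: distrib_left)
  next
    case False
    then show ?thesis using u[of t] by auto
  qed
  ultimately show ?thesis by (rule Bochner_Integration.integrable_bound[OF _ _ AE_I2])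
qed

lemma sq_int_Icc_integrable:
  assumes "sq_int g"
  shows "integrable hl (\<lambda>t. indicator {a..b} t *\<^sub>R g t)" "integrable hl (\<lambda>t. indicator {a<..b} t *\<^sub>R g t)"
    "integrable hl (\<lambda>t. indicator {a..b} t * norm (g t))"
    "integrable hl (\<lambda>t. indicator {a..b} t * (norm (g t))\<^sup>2)"
proof -
  show 1: "integrable hl (\<lambda>t. indicator {a..b} t *\<^sub>R g t)"
    using assms by (intro sq_int_bounded_mult_integrable[where K=1]) (auto intro!: measurable_hl simp: indicator_def)
  show "integrable hl (\<lambda>t. indicator {a<..b} t *\<^sub>R g t)"
    using assms by (intro sq_int_bounded_mult_integrable[where K=1 and a=a and b=b]) (auto intro!: measurable_hl simp: indicator_def)
  show "integrable hl (\<lambda>t. indicator {a..b} t * norm (g t))"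
    using integrable_norm[OF 1] by simp
  have [measurable]: "g \<in> borel_measurable hl" using assms by (rule sq_int_measurable)
  have [measurable]: "(\<lambda>t. indicator {a..b} t :: real) \<in> borel_measurable hl" by (rule measurable_hl) simp
  show "integrable hl (\<lambda>t. indicator {a..b} t * (norm (g t))\<^sup>2)"
  proof (rule Bochner_Integration.integrable_bound[OF sq_int_integrable[OF assms]])
    show "(\<lambda>t. indicator {a..b} t * (norm (g t))\<^sup>2) \<in> borel_measurable hl" by measurable
  qed (auto simp: indicator_def)
qed

text \<open>Cauchy-Schwarz against the constant 1, obtained as nonnegativity of the variance of |g|
  on the interval. The degenerate interval is separate because the mean divides by its
  length.\<close>

lemma integral_Icc_sq_le:
  assumes g: "sq_int g" and ab: "0 \<le> a" "a \<le> b"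
  shows "(LINT t|hl. indicator {a..b} t * norm (g t))\<^sup>2 \<le> (b - a) * (LINT t|hl. indicator {a..b} t * (norm (g t))\<^sup>2)"
proof (cases "a = b")
  case True
  have "(LINT t|hl. indicator {a..b} t * norm (g t)) = (LINT t|hl. 0)"
  proof (rule integral_cong_AE)
    have "AE t in lborel. t \<noteq> a" by (rule AE_lborel_singleton)
    then have "AE t in lebesgue. t \<noteq> a" by (rule AE_completion)
    then have "AE t in hl. t \<noteq> a" by (subst AE_restrict_space_iff) auto
    then show "AE t in hl. indicator {a..b} t * norm (g t) = 0" by eventually_elim (auto simp: True)
    show "(\<lambda>t. indicator {a..b} t * norm (g t)) \<in> borel_measurable hl"
      using sq_int_Icc_integrable(3)[OF g] by (rule borel_measurable_integrable)
  qed auto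
  then show ?thesis by (simp add: True)
next
  case False
  then have l: "b - a > 0" using ab by simp
  define X where "X = (LINT t|hl. indicator {a..b} t * norm (g t))"
  define B where "B = (LINT t|hl. indicator {a..b} t * (norm (g t))\<^sup>2)"
  \<comment> \<open>The mean of |g| over the interval, which minimises the integral of (|g| -
    c)^2.\<close>
  define c where "c = X / (b - a)"
  have "0 \<le> (LINT t|hl. indicator {a..b} t * (norm (g t) - c)\<^sup>2)" by (intro integral_nonneg_AE) auto
  also have "\<dots> = (LINT t|hl. indicator {a..b} t * (norm (g t))\<^sup>2 - (2 * c) * (indicator {a..b} t * norm (g t)) + c\<^sup>2 * indicator {a..b} t)"
    by (intro Bochner_Integration.integral_cong) (auto simp: power2_diff algebra_simps)
  also have "\<dots> = B - 2 * c * X + c\<^sup>2 * (b - a)"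
    using sq_int_Icc_integrable[OF g] integrable_hl_Icc integral_hl_Icc[OF ab] by (simp add: B_def X_def)
  also have "\<dots> = B - X\<^sup>2 / (b - a)"
  proof -
    have "c * (b - a) = X" "c * X = X\<^sup>2 / (b - a)" using l by (simp_all add: c_def power2_eq_square)
    then show ?thesis by (simp add: power2_eq_square mult.assoc)
  qed
  finally show ?thesis using l unfolding X_def[symmetric] B_def[symmetric] by (simp add: field_simps)
qed

section \<open>Cut-off functions and the fundamental theorem for weak derivatives\<close>

lemma DERIV_max_power:
  "((\<lambda>x::real. (max 0 x) ^ Suc (Suc n)) has_real_derivative real (Suc (Suc n)) * (max 0 x) ^ Suc n) (at x)"
proof -
  consider "x < 0" | "x > 0" | "x = 0" by linarith
  then show ?thesis
  proof cases
    case 1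
    have "((\<lambda>x::real. (0::real)) has_real_derivative real (Suc (Suc n)) * (max 0 x) ^ Suc n) (at x)" using 1 by simp
    moreover have "\<forall>\<^sub>F y in nhds x. 0 = (max 0 y) ^ Suc (Suc n)"
      using eventually_nhds_in_open[of "{..<0}" x] 1 by (auto elim!: eventually_mono)
    ultimately show ?thesis by (subst (asm) DERIV_cong_ev[OF refl _ refl]) auto
  next
    case 2
    have "((\<lambda>x::real. x ^ Suc (Suc n)) has_real_derivative real (Suc (Suc n)) * (max 0 x) ^ Suc n) (at x)"
      using 2 DERIV_pow[of "Suc (Suc n)" x] by simp
    moreover have "\<forall>\<^sub>F y in nhds x. y ^ Suc (Suc n) = (max 0 y) ^ Suc (Suc n)"
      using eventually_nhds_in_open[of "{0<..}" x] 2 by (auto elim!: eventually_mono)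
    ultimately show ?thesis by (subst (asm) DERIV_cong_ev[OF refl _ refl]) auto
  next
    case 3
    have "(\<lambda>h::real. (max 0 h) ^ Suc n) \<midarrow>0\<rightarrow> (max 0 0) ^ Suc n"
      by (intro tendsto_intros)
    then have "(\<lambda>h::real. (max 0 h) ^ Suc n) \<midarrow>0\<rightarrow> 0" by simp
    then have "(\<lambda>h::real. (max 0 h) ^ Suc (Suc n) / h) \<midarrow>0\<rightarrow> 0"
      by (rule Lim_null_comparison[rotated]) (auto simp: eventually_at_filter max_def abs_mult)
    then show ?thesis using 3 by (simp add: DERIV_def)
  qed
qed

lemma C1_real_iff:
  "f C1_differentiable_on S \<longleftrightarrow> (\<exists>D. (\<forall>x\<in>S. (f has_real_derivative D x) (at x)) \<and> continuous_on S D)"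
  unfolding C1_differentiable_on_def has_real_derivative_iff_has_vector_derivative ..

text \<open>A quadratic spline of class C^1, equal to 0 before 0 and to 1 after 1. Its derivative
  \<open>hat\<close> is the tent of height 2 over [0, 1], hence of total mass 1. Test functions are
  only required to be C^1, so these explicit profiles are admissible.\<close>

definition step :: "real \<Rightarrow> real" where
  "step u = 2 * (max 0 u)\<^sup>2 - 4 * (max 0 (u - 1/2))\<^sup>2 + 2 * (max 0 (u - 1))\<^sup>2"

definition hat :: "real \<Rightarrow> real" where
  "hat u = 4 * max 0 u - 8 * max 0 (u - 1/2) + 4 * max 0 (u - 1)"

lemma DERIV_step: "(step has_real_derivative hat u) (at u)"
proof -
  have *: "((\<lambda>x::real. (max 0 x)\<^sup>2) has_real_derivative 2 * max 0 x) (at x)" for x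
    using DERIV_max_power[of 0 x] by (simp add: numeral_2_eq_2)
  have s: "((\<lambda>x::real. (max 0 (x - c))\<^sup>2) has_real_derivative 2 * max 0 (x - c)) (at x)" for x c
    using DERIV_shift[of "\<lambda>x. (max 0 x)\<^sup>2" "2 * max 0 (x - c)" x "-c"] *[of "x - c"] by simp
  show ?thesis unfolding step_def hat_def
    by (rule derivative_eq_intros *[of u] s[of _ u] refl)+ simp
qed

lemma step_simps: "u \<le> 0 \<Longrightarrow> step u = 0" "1 \<le> u \<Longrightarrow> step u = 1"
  by (auto simp: step_def max_def power2_eq_square algebra_simps)

lemma hat_nonneg: "0 \<le> hat u" and hat_zero: "u \<notin> {0..1} \<Longrightarrow> hat u = 0"
  by (auto simp: hat_def max_def)

lemma hat_cont: "continuous_on S hat" unfolding hat_def[abs_def] by (intro continuous_intros)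

lemma step_bounds: "0 \<le> step u" "step u \<le> 1"
proof -
  have mono: "step x \<le> step y" if "x \<le> y" for x y
    using that DERIV_step hat_nonneg by (intro DERIV_nonneg_imp_nondecreasing[of x y step]) blast+
  show "0 \<le> step u" using mono[of "min 0 u" u] by (simp add: step_simps)
  show "step u \<le> 1" using mono[of u "max 1 u"] by (simp add: step_simps)
qed

text \<open>du Bois-Reymond: the test functions \<open>step (n (t - a)) - step (n (t - b))\<close> increase to the
  indicator of \<open>(a, b]\<close>, and their derivatives are approximate identities at \<open>a\<close> and \<open>b\<close>.\<close>

lemma hat_approximate_identity:
  fixes f :: "real \<Rightarrow> 'a::euclidean_space"
  assumes f: "continuous_on {0..} f" and c: "0 < c"
  shows "(\<lambda>n. LINT t|hl. (real (Suc n) * hat (real (Suc n) * (t - c))) *\<^sub>R f t) \<longlonglongrightarrow> f c"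
    and "integrable hl (\<lambda>t. (real (Suc n) * hat (real (Suc n) * (t - c))) *\<^sub>R f t)"
proof -
  define k where "k n t = real (Suc n) * hat (real (Suc n) * (t - c))" for n t
  have k0: "0 \<le> k n t" for n t by (simp add: k_def hat_nonneg)
  have kz: "k n t = 0" if "t \<notin> {c..c + 1 / Suc n}" for n t
  proof -
    have "real (Suc n) * (t - c) \<notin> {0..1}"
      using that by (auto simp: zero_le_mult_iff field_simps simp del: of_nat_Suc)
    then show ?thesis by (simp add: k_def hat_zero)
  qed
  have kc: "continuous_on S (k n)" for S n
    unfolding k_def[abs_def] by (intro continuous_intros continuous_on_compose2[OF hat_cont[of UNIV]]) auto
  have int: "integrable hl (\<lambda>t. k n t *\<^sub>R h t)"
    and eq: "(LINT t|hl. k n t *\<^sub>R h t) = integral {c..c + 1 / Suc n} (\<lambda>t. k n t *\<^sub>R h t)"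
    if h: "continuous_on {0..} h" for n and h :: "real \<Rightarrow> 'b::euclidean_space"
  proof -
    let ?I = "{c..c + 1 / Suc n}"
    have "continuous_on ?I (\<lambda>t. k n t *\<^sub>R h t)"
      using c by (intro continuous_intros kc continuous_on_subset[OF h]) auto
    then have "(\<lambda>t. k n t *\<^sub>R h t) absolutely_integrable_on ?I" by (rule absolutely_integrable_continuous_real)
    then have i: "integrable lebesgue (\<lambda>t. indicator ?I t *\<^sub>R (k n t *\<^sub>R h t))" by (simp add: set_integrable_def)
    have e: "(\<lambda>t. indicator {0..} t *\<^sub>R (k n t *\<^sub>R h t)) = (\<lambda>t. indicator ?I t *\<^sub>R (k n t *\<^sub>R h t))"
      using kz[of _ n] c by (fastforce simp: fun_eq_iff indicator_def)
    show "integrable hl (\<lambda>t. k n t *\<^sub>R h t)" unfolding integrable_hl_iff e by (rule i)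
    have "(LINT t|hl. k n t *\<^sub>R h t) = (LINT t:?I|lebesgue. k n t *\<^sub>R h t)"
      unfolding integral_hl_eq e set_lebesgue_integral_def ..
    also have "\<dots> = integral ?I (\<lambda>t. k n t *\<^sub>R h t)"
      using i by (intro set_lebesgue_integral_eq_integral(2)) (simp add: set_integrable_def)
    finally show "(LINT t|hl. k n t *\<^sub>R h t) = integral ?I (\<lambda>t. k n t *\<^sub>R h t)" .
  qed
  \<comment> \<open>\<open>step\<close> rescaled is a primitive of the kernel, so its mass is step 1
    - step 0.\<close>
  have one: "(LINT t|hl. k n t) = 1" for n
  proof -
    have "((\<lambda>t. step (real (Suc n) * (t - c))) has_vector_derivative k n t) (at t within {c..c + 1 / Suc n})" for t
    proof -
      have "((\<lambda>t. step (real (Suc n) * (t - c))) has_real_derivative hat (real (Suc n) * (t - c)) * real (Suc n)) (at t)"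
        by (rule DERIV_chain2[where f=step, OF DERIV_step]) (auto intro!: derivative_eq_intros)
      then show ?thesis
        by (auto simp: k_def mult.commute has_real_derivative_iff_has_vector_derivative intro: has_vector_derivative_at_within)
    qed
    then have "(k n has_integral step (real (Suc n) * (c + 1 / Suc n - c)) - step (real (Suc n) * (c - c))) {c..c + 1 / Suc n}"
      by (intro fundamental_theorem_of_calculus[where f="\<lambda>t. step (real (Suc n) * (t - c))"]) auto
    then have "integral {c..c + 1 / Suc n} (k n) = 1"
      by (simp add: step_simps integral_unique del: of_nat_Suc)
    then show ?thesis using eq[of "\<lambda>_. 1::real" n] by simp
  qed
  have ik: "integrable hl (k n)" for n using int[of "\<lambda>_. 1::real" n] by simp
  show "integrable hl (\<lambda>t. (real (Suc n) * hat (real (Suc n) * (t - c))) *\<^sub>R f t)" for n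
    using int[OF f, of n] by (simp add: k_def)
  have "(\<lambda>n. LINT t|hl. k n t *\<^sub>R f t) \<longlonglongrightarrow> f c"
  proof (rule metric_LIMSEQ_I)
    fix e :: real assume e: "e > 0"
    obtain d where d: "d > 0" "\<And>t. 0 \<le> t \<Longrightarrow> dist t c < d \<Longrightarrow> dist (f t) (f c) < e / 2"
      using f c e unfolding continuous_on_iff by (metis atLeast_iff half_gt_zero less_imp_le)
    obtain N where N: "inverse (real (Suc N)) < d" using reals_Archimedean d(1) by blast
    have "dist (LINT t|hl. k n t *\<^sub>R f t) (f c) < e" if n: "n \<ge> N" for n
    proof -
      have "1 / real (Suc n) \<le> inverse (real (Suc N))" using n by (simp add: inverse_eq_divide frac_le)
      then have nd: "1 / real (Suc n) < d" using N by linarith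
      have "(LINT t|hl. k n t *\<^sub>R f t) - f c = (LINT t|hl. k n t *\<^sub>R f t) - (LINT t|hl. k n t *\<^sub>R f c)"
        using one[of n] ik by simp
      also have "\<dots> = (LINT t|hl. k n t *\<^sub>R (f t - f c))"
        using int[OF f, of n] int[of "\<lambda>_. f c" n] by (simp add: scaleR_diff_right)
      also have "norm \<dots> \<le> (LINT t|hl. norm (k n t *\<^sub>R (f t - f c)))" by (rule integral_norm_bound)
      also have "\<dots> \<le> (LINT t|hl. k n t * (e / 2))"
      proof (rule integral_mono)
        show "integrable hl (\<lambda>t. norm (k n t *\<^sub>R (f t - f c)))"
          using f by (intro integrable_norm int continuous_intros)
        show "integrable hl (\<lambda>t. k n t * (e / 2))" using ik by simp
        fix t
        show "norm (k n t *\<^sub>R (f t - f c)) \<le> k n t * (e / 2)"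
        proof (cases "t \<in> {c..c + 1 / Suc n}")
          case True
          then have "norm (f t - f c) \<le> e / 2"
            using d(2)[of t] nd c by (simp add: dist_norm dist_real_def less_imp_le)
          then have "k n t * norm (f t - f c) \<le> k n t * (e / 2)" using k0[of n t] by (intro mult_left_mono)
          then show ?thesis using k0[of n t] by simp
        qed (simp add: kz)
      qed
      also have "\<dots> = e / 2" using one[of n] by simp
      finally show ?thesis using e by (simp add: dist_norm)
    qed
    then show "\<exists>no. \<forall>n\<ge>no. dist (LINT t|hl. k n t *\<^sub>R f t) (f c) < e" by blast
  qed
  then show "(\<lambda>n. LINT t|hl. (real (Suc n) * hat (real (Suc n) * (t - c))) *\<^sub>R f t) \<longlonglongrightarrow> f c"
    by (simp only: k_def)
qed

text \<open>The lower end is positive because test functions are supported away from 0; continuity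
  of f carries the formula to 0 afterwards.\<close>

lemma weak_derivative_FTC_pos:
  fixes f g :: "real \<Rightarrow> 'a::euclidean_space"
  assumes f: "continuous_on {0..} f" and g: "sq_int g" and w: "has_weak_derivative f g"
    and ab: "0 < a" "a \<le> b"
  shows "f b - f a = (LINT t|hl. indicator {a<..b} t *\<^sub>R g t)"
proof -
  define \<phi> where "\<phi> n t = step (real (Suc n) * (t - a)) - step (real (Suc n) * (t - b))" for n t
  define D where "D n t = real (Suc n) * hat (real (Suc n) * (t - a)) - real (Suc n) * hat (real (Suc n) * (t - b))" for n t
  have der: "(\<phi> n has_real_derivative D n t) (at t)" for n t
  proof -
    have "((\<lambda>t. step (real (Suc n) * (t - c))) has_real_derivative hat (real (Suc n) * (t - c)) * real (Suc n)) (at t)" for c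
      by (rule DERIV_chain2[where f=step, OF DERIV_step]) (auto intro!: derivative_eq_intros)
    from DERIV_diff[OF this[of a] this[of b]] show ?thesis
      by (simp add: \<phi>_def[abs_def] D_def mult.commute del: of_nat_Suc)
  qed
  have phi1: "\<phi> n t = 0" if "t \<le> a" for n t
  proof -
    have "real (Suc n) * (t - a) \<le> 0" "real (Suc n) * (t - b) \<le> 0"
      using that ab by (intro mult_nonneg_nonpos; simp)+
    then show ?thesis by (simp add: \<phi>_def step_simps)
  qed
  \<comment> \<open>The descent that starts at b takes time 1/(n+1), which is at most 1; so all
    these functions are supported in [a, b + 1].\<close>
  have phi2: "\<phi> n t = 0" if "b + 1 \<le> t" for n t
  proof -
    have "1 * 1 \<le> real (Suc n) * (t - a)" "1 * 1 \<le> real (Suc n) * (t - b)"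
      using that ab by (intro mult_mono; simp)+
    then show ?thesis by (simp add: \<phi>_def step_simps)
  qed
  have test: "\<phi> n \<in> test_functions" for n
  proof -
    have "continuous_on UNIV (D n)" unfolding D_def[abs_def]
      by (intro continuous_intros continuous_on_compose2[OF hat_cont[of UNIV]]) auto
    then have "\<phi> n C1_differentiable_on UNIV" unfolding C1_real_iff using der by blast
    moreover have "\<phi> n t = 0" if "t \<notin> {a..b + 1}" for t
      using phi1[of t n] phi2[of t n] that by fastforce
    ultimately show ?thesis unfolding test_functions_def using ab by blast
  qed
  have "deriv (\<phi> n) = D n" for n using der by (auto intro!: DERIV_imp_deriv)
  then have *: "(LINT t|hl. D n t *\<^sub>R f t) = - (LINT t|hl. \<phi> n t *\<^sub>R g t)" for n
    using bspec[OF w[unfolded has_weak_derivative_def] test[of n]] by simp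
  have "(\<lambda>n. LINT t|hl. D n t *\<^sub>R f t) \<longlonglongrightarrow> f a - f b"
  proof -
    have "(LINT t|hl. D n t *\<^sub>R f t) = (LINT t|hl. (real (Suc n) * hat (real (Suc n) * (t - a))) *\<^sub>R f t)
       - (LINT t|hl. (real (Suc n) * hat (real (Suc n) * (t - b))) *\<^sub>R f t)" for n
      using hat_approximate_identity(2)[OF f, of a n] hat_approximate_identity(2)[OF f, of b n] ab
      by (simp add: D_def scaleR_diff_left del: of_nat_Suc)
    then show ?thesis using ab by (simp only:) (intro tendsto_diff hat_approximate_identity(1) f; simp)
  qed
  moreover have "(\<lambda>n. LINT t|hl. \<phi> n t *\<^sub>R g t) \<longlonglongrightarrow> (LINT t|hl. indicator {a<..b} t *\<^sub>R g t)"
  proof (rule integral_dominated_convergence)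
    have [measurable]: "g \<in> borel_measurable hl" using g by (rule sq_int_measurable)
    have "continuous_on UNIV (\<phi> n)" for n using der by (meson DERIV_isCont continuous_at_imp_continuous_on)
    then have [measurable]: "\<phi> n \<in> borel_measurable hl" for n
      by (intro measurable_hl borel_measurable_continuous_onI)
    have [measurable]: "(\<lambda>t. indicator {a<..b} t :: real) \<in> borel_measurable hl" by (rule measurable_hl) simp
    show "(\<lambda>t. indicator {a<..b} t *\<^sub>R g t) \<in> borel_measurable hl" by measurable
    show "(\<lambda>t. \<phi> n t *\<^sub>R g t) \<in> borel_measurable hl" for n by measurable
    show "integrable hl (\<lambda>t. indicator {a..b + 1} t * norm (g t))" by (rule sq_int_Icc_integrable[OF g])
    show "AE t in hl. (\<lambda>n. \<phi> n t *\<^sub>R g t) \<longlonglongrightarrow> indicator {a<..b} t *\<^sub>R g t"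
    proof (rule AE_I2, intro tendsto_scaleR tendsto_const)
      fix t
      have lim: "(\<lambda>n. step (real (Suc n) * (t - c))) \<longlonglongrightarrow> (if t \<le> c then 0 else 1)" for c
      proof (cases "t \<le> c")
        case True
        then have "real (Suc n) * (t - c) \<le> 0" for n by (intro mult_nonneg_nonpos) auto
        then show ?thesis using True by (simp add: step_simps)
      next
        case False
        then obtain N where N: "1 < real N * (t - c)"
          using reals_Archimedean3[of "t - c"] by auto
        have "step (real (Suc n) * (t - c)) = 1" if "n \<ge> N" for n
        proof -
          have "real N * (t - c) \<le> real (Suc n) * (t - c)" using that False by (intro mult_right_mono) auto
          then show ?thesis using N by (intro step_simps) linarith
        qed
        then show ?thesis using False by (auto intro!: tendsto_eventually eventually_sequentiallyI[of N])
      qed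
      have "(\<lambda>n. \<phi> n t) \<longlonglongrightarrow> (if t \<le> a then 0 else 1) - (if t \<le> b then 0 else 1)"
        unfolding \<phi>_def by (intro tendsto_diff lim)
      then show "(\<lambda>n. \<phi> n t) \<longlonglongrightarrow> indicator {a<..b} t"
        using ab by (auto simp: indicator_def split: if_splits)
    qed
    have "\<bar>\<phi> n t\<bar> \<le> indicator {a..b + 1} t" for n t
    proof (cases "t \<in> {a..b + 1}")
      case True
      have "0 \<le> step (real (Suc n) * (t - a))" "step (real (Suc n) * (t - a)) \<le> 1"
        "0 \<le> step (real (Suc n) * (t - b))" "step (real (Suc n) * (t - b)) \<le> 1" by (rule step_bounds)+
      then show ?thesis using True unfolding \<phi>_def by simp
    next
      case False
      then show ?thesis using phi1[of t n] phi2[of t n] by fastforce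
    qed
    then show "AE t in hl. norm (\<phi> n t *\<^sub>R g t) \<le> indicator {a..b + 1} t * norm (g t)" for n
      by (intro AE_I2) (simp add: mult_right_mono)
  qed
  ultimately have "f a - f b = - (LINT t|hl. indicator {a<..b} t *\<^sub>R g t)"
    unfolding * by (intro LIMSEQ_unique[OF _ tendsto_minus])
  then have "- (f a - f b) = (LINT t|hl. indicator {a<..b} t *\<^sub>R g t)" by (simp only: minus_minus)
  then show ?thesis by (simp only: minus_diff_eq)
qed

lemma weak_derivative_FTC:
  fixes f g :: "real \<Rightarrow> 'a::euclidean_space"
  assumes f: "continuous_on {0..} f" and g: "sq_int g" and w: "has_weak_derivative f g"
    and ab: "0 \<le> a" "a \<le> b"
  shows "f b - f a = (LINT t|hl. indicator {a<..b} t *\<^sub>R g t)"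
proof (cases "a = b")
  case False
  then have lt: "a < b" using ab by simp
  \<comment> \<open>Positive times that decrease to a, the first of them being b; the formula on
    [s n, b] passes to the limit by continuity on the left and domination on the right.\<close>
  define s where "s n = a + (b - a) / real (Suc n)" for n
  have s: "0 < s n" "s n \<le> b" "a < s n" for n
  proof -
    define d where "d = (b - a) / real (Suc n)"
    have "d \<le> (b - a) / 1" unfolding d_def using lt by (intro divide_left_mono) auto
    then have "d \<le> b - a" by simp
    moreover have "d > 0" unfolding d_def using lt by simp
    ultimately show "0 < s n" "s n \<le> b" "a < s n" using ab unfolding s_def d_def[symmetric] by linarith+
  qed
  have slim: "s \<longlonglongrightarrow> a"
  proof -
    have "s \<longlonglongrightarrow> a + (b - a) * 0" unfolding s_def divide_inverse
      by (intro tendsto_intros LIMSEQ_inverse_real_of_nat)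
    then show ?thesis by simp
  qed
  have "(\<lambda>n. f (s n)) \<longlonglongrightarrow> f a"
    using s ab by (intro continuous_on_tendsto_compose[OF f slim]) (auto intro!: always_eventually less_imp_le)
  then have "(\<lambda>n. f b - f (s n)) \<longlonglongrightarrow> f b - f a" by (intro tendsto_intros)
  moreover have "(\<lambda>n. LINT t|hl. indicator {s n<..b} t *\<^sub>R g t) \<longlonglongrightarrow> (LINT t|hl. indicator {a<..b} t *\<^sub>R g t)"
  proof (rule integral_dominated_convergence)
    show "integrable hl (\<lambda>t. indicator {a..b} t * norm (g t))" by (rule sq_int_Icc_integrable[OF g])
    show "AE t in hl. norm (indicator {s n<..b} t *\<^sub>R g t) \<le> indicator {a..b} t * norm (g t)" for n
      using s(3)[of n] by (auto simp: indicator_def)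
    show "AE t in hl. (\<lambda>n. indicator {s n<..b} t *\<^sub>R g t) \<longlonglongrightarrow> indicator {a<..b} t *\<^sub>R g t"
    proof (rule AE_I2, intro tendsto_scaleR tendsto_const)
      fix t
      show "(\<lambda>n. indicator {s n<..b} t :: real) \<longlonglongrightarrow> indicator {a<..b} t"
      proof (cases "t \<le> a")
        case True
        then have "indicator {s n<..b} t = (indicator {a<..b} t :: real)" for n
          using s(3)[of n] by (auto simp: indicator_def)
        then show ?thesis by simp
      next
        case False
        then have "\<forall>\<^sub>F n in sequentially. s n < t" using slim by (intro order_tendstoD) auto
        then have "\<forall>\<^sub>F n in sequentially. indicator {s n<..b} t = (indicator {a<..b} t :: real)"
          by eventually_elim (use False in \<open>auto simp: indicator_def\<close>)
        then show ?thesis by (rule tendsto_eventually)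
      qed
    qed
  qed (use sq_int_Icc_integrable(2)[OF g] in \<open>auto intro: borel_measurable_integrable\<close>)
  moreover have "(\<lambda>n. f b - f (s n)) = (\<lambda>n. LINT t|hl. indicator {s n<..b} t *\<^sub>R g t)"
    using weak_derivative_FTC_pos[OF f g w s(1,2)] by (rule ext)
  ultimately show ?thesis using LIMSEQ_unique by simp
qed simp

text \<open>The 1/2-Hoelder estimate behind all pointwise control of Sobolev functions: continuity
  of evaluations, definiteness of the inner product, and smallness between grid zeros.\<close>

lemma weak_derivative_increment:
  fixes f g :: "real \<Rightarrow> 'a::euclidean_space"
  assumes f: "continuous_on {0..} f" and g: "sq_int g" and w: "has_weak_derivative f g"
    and ab: "0 \<le> a" "a \<le> b"
  shows "(norm (f b - f a))\<^sup>2 \<le> (b - a) * (LINT t|hl. indicator {a..b} t * (norm (g t))\<^sup>2)"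
proof -
  have "norm (f b - f a) \<le> (LINT t|hl. norm (indicator {a<..b} t *\<^sub>R g t))"
    unfolding weak_derivative_FTC[OF assms] by (rule integral_norm_bound)
  also have "\<dots> \<le> (LINT t|hl. indicator {a..b} t * norm (g t))"
    using sq_int_Icc_integrable[OF g] by (intro integral_mono integrable_norm) (auto simp: indicator_def)
  finally have "(norm (f b - f a))\<^sup>2 \<le> (LINT t|hl. indicator {a..b} t * norm (g t))\<^sup>2"
    by (rule power_mono) simp
  also have "\<dots> \<le> (b - a) * (LINT t|hl. indicator {a..b} t * (norm (g t))\<^sup>2)"
    by (rule integral_Icc_sq_le[OF g ab])
  finally show ?thesis .
qed

section \<open>The Sobolev space\<close>

lemma AE_lebesgue_hl: "AE t in lebesgue. P t \<Longrightarrow> AE t in hl. P t"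
  by (subst AE_restrict_space_iff) (auto elim: eventually_mono)

text \<open>Half-open intervals form an intersection-stable generator of the Borel sets, so all
  Borel integrals vanish and with them the density. The function is first replaced by a Borel
  version, since Lebesgue measure is the completion of \<open>lborel\<close> and the induction runs
  over Borel sets.\<close>

lemma zero_integrals_AE:
  fixes u :: "real \<Rightarrow> real"
  assumes u: "integrable lebesgue u" and z: "\<And>a b. (LINT t|lebesgue. indicator {a<..b} t *\<^sub>R u t) = 0"
    and z': "(LINT t|lebesgue. u t) = 0"
  shows "AE t in lebesgue. u t = 0"
proof -
  obtain v where v[measurable]: "v \<in> borel_measurable lborel" and uv: "AE t in lborel. u t = v t"
    using completion_ex_borel_measurable_real[of u lborel] u by auto
  have uv': "AE t in lebesgue. u t = v t" using uv by (rule AE_completion)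
  have vl: "integrable lebesgue v"
    using integrable_cong_AE[OF borel_measurable_integrable[OF u] measurable_completion[OF v] uv'] u by simp
  then have vi: "integrable lborel v" using integrable_completion[of v lborel] by simp
  have tr: "(LINT t:A|lborel. v t) = (LINT t|lebesgue. indicator A t *\<^sub>R u t)" if A: "A \<in> sets borel" for A
  proof -
    have [measurable]: "A \<in> sets lborel" using A by simp
    have "(LINT t:A|lborel. v t) = (LINT t|lebesgue. indicator A t *\<^sub>R v t)"
      unfolding set_lebesgue_integral_def by (rule integral_completion[symmetric]) measurable
    also have "\<dots> = (LINT t|lebesgue. indicator A t *\<^sub>R u t)"
    proof (rule integral_cong_AE)
      show "AE t in lebesgue. indicator A t *\<^sub>R v t = indicator A t *\<^sub>R u t" using uv' by eventually_elim simp
      show "(\<lambda>t. indicator A t *\<^sub>R v t) \<in> borel_measurable lebesgue" by (rule measurable_completion) measurable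
      show "(\<lambda>t. indicator A t *\<^sub>R u t) \<in> borel_measurable lebesgue"
        using u A by (intro borel_measurable_scaleR borel_measurable_integrable borel_measurable_indicator) auto
    qed
    finally show ?thesis .
  qed
  have "(LINT t:A|lborel. v t) = 0" if "A \<in> sets lborel" for A
  proof -
    have mem: "A \<in> sigma_sets UNIV (range (\<lambda>(a, b). {a<..b::real}))"
      using that unfolding sets_lborel borel_sigma_sets_Ioc by simp
    have st: "Int_stable (range (\<lambda>(a, b). {a<..b::real}))"
      by (auto intro!: Int_stableI simp: image_iff) blast
    have rng: "range (\<lambda>(a, b). {a<..b::real}) \<subseteq> Pow UNIV" by simp
    show ?thesis using st rng mem
    proof (induction rule: sigma_sets_induct_disjoint)
      case (basic A)
      then show ?case using z by (auto simp: tr)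
    next
      \<comment> \<open>Complements are the reason for the hypothesis on the integral over the whole
        line, which is not itself a half-open interval.\<close>
      case (compl A)
      then have A: "A \<in> sets lborel" unfolding sets_lborel borel_sigma_sets_Ioc by simp
      have "(LINT t:(A \<union> (UNIV - A))|lborel. v t) = (LINT t:A|lborel. v t) + (LINT t:(UNIV - A)|lborel. v t)"
        using A vi by (intro set_integral_Un) (auto simp: set_integrable_def intro!: integrable_mult_indicator[where 'b=real, simplified])
      moreover have "(LINT t:(A \<union> (UNIV - A))|lborel. v t) = 0" using tr[of UNIV] z' by simp
      ultimately show ?case using compl by simp
    next
      case (union A)
      have A: "A i \<in> sets lborel" for i using union(2) unfolding sets_lborel borel_sigma_sets_Ioc by auto
      have "(LINT t:(\<Union>i. A i)|lborel. v t) = (\<Sum>i. (LINT t:(A i)|lborel. v t))"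
        using A vi union(1) by (intro lebesgue_integral_countable_add)
          (auto simp: set_integrable_def disjoint_family_on_def intro!: integrable_mult_indicator[where 'b=real, simplified])
      then show ?case using union(3) by simp
    qed (auto simp: set_lebesgue_integral_def)
  qed
  then have "AE t in lborel. v t = 0" by (rule sigma_finite_measure.density_zero[OF sigma_finite_lborel vi])
  with uv have "AE t in lborel. u t = 0" by eventually_elim simp
  then show ?thesis by (rule AE_completion)
qed

text \<open>By the fundamental theorem g and h have the same integral over every bounded interval. A
  square-integrable function need not be integrable on the half-line, so each coordinate of the
  difference is truncated to (0, N] before \<open>zero_integrals_AE\<close> applies.\<close>

lemma weak_derivative_unique:
  fixes f g h :: "real \<Rightarrow> 'a::euclidean_space"
  assumes f: "continuous_on {0..} f" and g: "sq_int g" "has_weak_derivative f g"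
    and h: "sq_int h" "has_weak_derivative f h"
  shows "AE t in hl. g t = h t"
proof -
  have d: "sq_int (\<lambda>t. g t - h t)" using g h by (intro sq_int_diff)
  have z: "(LINT t|hl. indicator {a<..b} t *\<^sub>R (g t - h t)) = 0" if "0 \<le> a" for a b
  proof (cases "a \<le> b")
    case True
    then show ?thesis
      using weak_derivative_FTC[OF f g that True] weak_derivative_FTC[OF f h that True]
        sq_int_Icc_integrable(2)[OF g(1), of a b] sq_int_Icc_integrable(2)[OF h(1), of a b]
      by (simp add: scaleR_diff_right)
  qed simp
  have comp: "AE t in hl. (g t - h t) \<bullet> e = 0" for e
  proof -
    have "AE t in hl. indicator {0<..real N} t * ((g t - h t) \<bullet> e) = 0" for N
    proof (rule AE_lebesgue_hl)
      let ?u = "\<lambda>t. indicator {0<..real N} t * ((g t - h t) \<bullet> e)"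
      have e: "(\<lambda>t. indicator {a<..b} t *\<^sub>R ?u t) = (\<lambda>t. indicator {0..} t *\<^sub>R ((indicator {max 0 a<..min b (real N)} t *\<^sub>R (g t - h t)) \<bullet> e))" for a b
        by (auto simp: fun_eq_iff indicator_def)
      have e': "?u = (\<lambda>t. indicator {0..} t *\<^sub>R ((indicator {0<..real N} t *\<^sub>R (g t - h t)) \<bullet> e))"
        by (auto simp: fun_eq_iff indicator_def)
      have i: "integrable hl (\<lambda>t. indicator {a<..b} t *\<^sub>R (g t - h t))" for a b by (rule sq_int_Icc_integrable[OF d])
      have "(LINT t|hl. (indicator {a<..b} t *\<^sub>R (g t - h t)) \<bullet> e) = 0" if "0 \<le> a" for a b
        using integral_inner_left[OF i[of a b], of e] z[OF that, of b] by simp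
      then have 0: "(LINT t|lebesgue. indicator {0..} t *\<^sub>R ((indicator {a<..b} t *\<^sub>R (g t - h t)) \<bullet> e)) = 0" if "0 \<le> a" for a b
        using that unfolding integral_hl_eq by blast
      have "integrable hl (\<lambda>t. (indicator {0<..real N} t *\<^sub>R (g t - h t)) \<bullet> e)"
        using i by (intro integrable_inner_left) auto
      then have "integrable lebesgue ?u" unfolding e' integrable_hl_iff .
      then show "AE t in lebesgue. ?u t = 0"
      proof (rule zero_integrals_AE)
        show "(LINT t|lebesgue. indicator {a<..b} t *\<^sub>R ?u t) = 0" for a b unfolding e by (rule 0) simp
        show "(LINT t|lebesgue. ?u t) = 0" unfolding e' by (rule 0) simp
      qed
    qed
    then have "AE t in hl. \<forall>N. indicator {0<..real N} t * ((g t - h t) \<bullet> e) = 0" by (subst AE_all_countable) blast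
    with AE_hl_pos show ?thesis
    proof eventually_elim
      case (elim t)
      obtain N where "t < real N" using reals_Archimedean2 by blast
      then show ?case using elim(1) elim(2)[rule_format, of N] by (simp add: indicator_def)
    qed
  qed
  then have "AE t in hl. \<forall>e\<in>Basis. (g t - h t) \<bullet> e = 0" by (subst AE_ball_countable) (auto intro: countable_finite)
  then show ?thesis
    by eventually_elim (metis euclidean_all_zero_iff eq_iff_diff_eq_0)
qed

section \<open>Completeness of the square-integrable functions\<close>

lemma integrable_exp_hl: "integrable hl (\<lambda>t. exp (- 2 * t))"
proof -
  have "(\<lambda>x. exp (- 2 * x) :: real) absolutely_integrable_on {0..}"
    by (intro nonnegative_absolutely_integrable_1 integrable_on_exp_minus_to_infinity) auto
  then show ?thesis by (simp add: integrable_hl_iff set_integrable_def)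
qed

text \<open>Multiplication by exp(-t) turns an L^2-Cauchy sequence on the half-line into an
  L^1-Cauchy one, for which a subsequence is almost everywhere Cauchy. Undoing the factor gives a
  pointwise limit, and Fatou's lemma bounds the L^2 distance to it.\<close>

lemma L2_complete:
  fixes g :: "nat \<Rightarrow> real \<Rightarrow> 'a::euclidean_space"
  assumes V: "closed V" "0 \<in> V" and g: "\<And>n. g n \<in> L2_halfline V"
    and C: "\<And>e. e > 0 \<Longrightarrow> \<exists>N. \<forall>m\<ge>N. \<forall>n\<ge>N. (LINT t|hl. (norm (g m t - g n t))\<^sup>2) < e"
  shows "\<exists>h\<in>L2_halfline V. (\<lambda>n. LINT t|hl. (norm (g n t - h t))\<^sup>2) \<longlonglongrightarrow> 0"
proof -
  have sq: "sq_int (g n)" for n using g[of n] by (simp add: sq_int_L2)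
  note [measurable] = sq_int_measurable[OF sq]
  have [measurable]: "(\<lambda>t. exp (- t) :: real) \<in> borel_measurable hl"
    by (intro measurable_hl borel_measurable_continuous_onI continuous_intros)
  define s where "s n t = exp (- t) *\<^sub>R g n t" for n t
  have ee: "exp (- t) ^ 2 = exp (- 2 * t)" for t :: real
    by (simp add: power2_eq_square flip: exp_add)
  \<comment> \<open>Weighted arithmetic-geometric inequality. The weight l is free: a small l makes
    the fixed exponential part small, and then the L^2 distance is made small relative to l.\<close>
  have le: "exp (- t) * norm x \<le> l * exp (- 2 * t) + (norm x)\<^sup>2 / l" if "l > 0" for l t and x :: 'a
  proof -
    have "2 * ((sqrt l * exp (- t)) * (norm x / sqrt l)) \<le> (sqrt l * exp (- t))\<^sup>2 + (norm x / sqrt l)\<^sup>2"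
      by (rule mult_le_sum_squares)
    moreover have "(sqrt l * exp (- t)) * (norm x / sqrt l) = exp (- t) * norm x" using that by simp
    moreover have "(sqrt l * exp (- t))\<^sup>2 = l * exp (- 2 * t)" "(norm x / sqrt l)\<^sup>2 = (norm x)\<^sup>2 / l"
      using that ee by (simp_all add: power_mult_distrib power_divide)
    moreover have "0 \<le> exp (- t) * norm x" by simp
    ultimately show ?thesis by linarith
  qed
  have int: "integrable hl (\<lambda>t. exp (- t) *\<^sub>R f t)" if f: "sq_int f" for f :: "real \<Rightarrow> 'a"
  proof (rule Bochner_Integration.integrable_bound)
    note [measurable] = sq_int_measurable[OF f]
    show "integrable hl (\<lambda>t. exp (- 2 * t) + (norm (f t))\<^sup>2)"
      using integrable_exp_hl f by (auto simp: sq_int_def)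
    show "(\<lambda>t. exp (- t) *\<^sub>R f t) \<in> borel_measurable hl" by measurable
    show "AE t in hl. norm (exp (- t) *\<^sub>R f t) \<le> norm (exp (- 2 * t) + (norm (f t))\<^sup>2)"
      using le[of 1] by (intro AE_I2) simp
  qed
  have si: "integrable hl (s n)" for n unfolding s_def[abs_def] by (rule int[OF sq])
  have sC: "\<exists>N. \<forall>i\<ge>N. \<forall>j\<ge>N. (LINT t|hl. norm (s i t - s j t)) < e" if e: "e > 0" for e
  proof -
    define E where "E = (LINT t|hl. exp (- 2 * t))"
    have E: "E \<ge> 0" unfolding E_def by simp
    \<comment> \<open>Makes the exponential contribution l E at most e/2; the summand 1 guards
      against division by 0.\<close>
    define l where "l = e / (2 * (E + 1))"
    have l: "l > 0" using e E by (simp add: l_def)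
    have lE: "2 * (l * E) \<le> e" using e E by (simp add: l_def field_simps)
    obtain N where N: "\<And>m n. m \<ge> N \<Longrightarrow> n \<ge> N \<Longrightarrow> (LINT t|hl. (norm (g m t - g n t))\<^sup>2) < l * e / 2"
      using C[of "l * e / 2"] l e by auto
    have "(LINT t|hl. norm (s i t - s j t)) < e" if "i \<ge> N" "j \<ge> N" for i j
    proof -
      have i: "integrable hl (\<lambda>t. (norm (g i t - g j t))\<^sup>2)"
        using sq_int_diff[OF sq sq, of i j] by (rule sq_int_integrable)
      have "(LINT t|hl. norm (s i t - s j t)) \<le> (LINT t|hl. l * exp (- 2 * t) + (norm (g i t - g j t))\<^sup>2 / l)"
      proof (rule integral_mono)
        show "integrable hl (\<lambda>t. norm (s i t - s j t))" using si by auto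
        show "integrable hl (\<lambda>t. l * exp (- 2 * t) + (norm (g i t - g j t))\<^sup>2 / l)"
          using i integrable_exp_hl by (intro Bochner_Integration.integrable_add integrable_mult_right integrable_divide) auto
        show "norm (s i t - s j t) \<le> l * exp (- 2 * t) + (norm (g i t - g j t))\<^sup>2 / l" for t
          using le[OF l, of t "g i t - g j t"] by (simp add: s_def flip: scaleR_diff_right)
      qed
      also have "\<dots> = l * E + (LINT t|hl. (norm (g i t - g j t))\<^sup>2) / l"
        using i integrable_exp_hl by (simp add: E_def)
      also have "\<dots> < e"
      proof -
        have "2 * ((LINT t|hl. (norm (g i t - g j t))\<^sup>2) / l) < e"
          using N[OF that] l by (simp add: field_simps)
        then show ?thesis using lE by linarith
      qed
      finally show ?thesis .
    qed
    then show ?thesis by blast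
  qed
  obtain r where r: "strict_mono r" "AE t in hl. Cauchy (\<lambda>i. s (r i) t)"
    using cauchy_L1_AE_cauchy_subseq[of hl s] si sC by blast
  \<comment> \<open>\<open>L2_halfline\<close> demands values in V at every time t >= 0, also on the
    null set where the sequence diverges; there the value 0 is taken.\<close>
  define h where "h t = (if 0 \<le> t \<and> Cauchy (\<lambda>i. g (r i) t) then lim (\<lambda>i. g (r i) t) else 0)" for t
  have hV: "h t \<in> V" if "t \<ge> 0" for t
  proof (cases "Cauchy (\<lambda>i. g (r i) t)")
    case True
    then have "(\<lambda>i. g (r i) t) \<longlonglongrightarrow> h t"
      using that by (simp add: h_def Cauchy_convergent_iff convergent_LIMSEQ_iff)
    moreover have "g (r i) t \<in> V" for i using g[of "r i"] that by (simp add: L2_halfline_def)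
    ultimately show ?thesis using V(1) by (meson closed_sequentially)
  qed (simp add: h_def V)
  have hm [measurable]: "h \<in> borel_measurable hl" 
  proof -
    have "{t \<in> space hl. Cauchy (\<lambda>i. g (r i) t)} \<in> sets hl" by measurable
    moreover have "{t \<in> space hl. 0 \<le> t} = space hl" by auto
    then have "{t \<in> space hl. 0 \<le> t} \<in> sets hl" by (simp only: sets.top)
    ultimately show ?thesis unfolding h_def[abs_def] by measurable
  qed
  have lim: "AE t in hl. (\<lambda>i. g (r i) t) \<longlonglongrightarrow> h t"
    using r(2) AE_hl_pos
  proof eventually_elim
    case (elim t)
    then have "convergent (\<lambda>i. s (r i) t)" by (simp add: Cauchy_convergent_iff)
    then obtain l where "(\<lambda>i. s (r i) t) \<longlonglongrightarrow> l" by (auto simp: convergent_def)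
    then have "(\<lambda>i. exp t *\<^sub>R s (r i) t) \<longlonglongrightarrow> exp t *\<^sub>R l" by (intro tendsto_intros)
    then have "(\<lambda>i. g (r i) t) \<longlonglongrightarrow> exp t *\<^sub>R l" by (simp add: s_def flip: exp_add)
    then have "Cauchy (\<lambda>i. g (r i) t)" by (rule LIMSEQ_imp_Cauchy)
    then show ?case using elim by (simp add: h_def Cauchy_convergent_iff convergent_LIMSEQ_iff)
  qed
  \<comment> \<open>Fatou along the subsequence: its indices r i are at least i, so the Cauchy bound
    from N on is available for them.\<close>
  have key: "sq_int (\<lambda>t. g n t - h t) \<and> (LINT t|hl. (norm (g n t - h t))\<^sup>2) \<le> e"
    if e: "e > 0" and N: "\<And>m. m \<ge> N \<Longrightarrow> (LINT t|hl. (norm (g m t - g n t))\<^sup>2) < e" for e N n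
  proof -
    let ?F = "\<lambda>i t. ennreal ((norm (g (r i) t - g n t))\<^sup>2)"
    have "(\<integral>\<^sup>+t. ennreal ((norm (g n t - h t))\<^sup>2) \<partial>hl) = (\<integral>\<^sup>+t. liminf (\<lambda>i. ?F i t) \<partial>hl)"
    proof (rule nn_integral_cong_AE)
      show "AE t in hl. ennreal ((norm (g n t - h t))\<^sup>2) = liminf (\<lambda>i. ?F i t)"
        using lim
      proof eventually_elim
        case (elim t)
        then have "(\<lambda>i. ?F i t) \<longlonglongrightarrow> ennreal ((norm (h t - g n t))\<^sup>2)"
          by (intro tendsto_ennrealI tendsto_intros)
        then have "liminf (\<lambda>i. ?F i t) = ennreal ((norm (h t - g n t))\<^sup>2)"
          by (intro lim_imp_Liminf) auto
        then show ?case by (simp only: norm_minus_commute[of "h t"])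
      qed
    qed
    also have "\<dots> \<le> liminf (\<lambda>i. \<integral>\<^sup>+t. ?F i t \<partial>hl)" by (rule nn_integral_liminf) measurable
    also have "\<dots> \<le> ennreal e"
    proof (rule Liminf_le)
      have "(\<integral>\<^sup>+t. ?F i t \<partial>hl) \<le> ennreal e" if "i \<ge> N" for i
      proof -
        have "r i \<ge> N" using that seq_suble[OF r(1), of i] by linarith
        moreover have "integrable hl (\<lambda>t. (norm (g (r i) t - g n t))\<^sup>2)"
          using sq_int_diff[OF sq sq] by (rule sq_int_integrable)
        ultimately show ?thesis using N[of "r i"] by (simp add: nn_integral_eq_integral ennreal_leI)
      qed
      then show "\<forall>\<^sub>F i in sequentially. (\<integral>\<^sup>+t. ?F i t \<partial>hl) \<le> ennreal e"
        by (auto intro: eventually_sequentiallyI)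
    qed simp
    finally have fin: "(\<integral>\<^sup>+t. ennreal ((norm (g n t - h t))\<^sup>2) \<partial>hl) \<le> ennreal e" .
    have "integrable hl (\<lambda>t. (norm (g n t - h t))\<^sup>2)"
    proof (rule integrableI_bounded)
      show "(\<integral>\<^sup>+t. ennreal (norm ((norm (g n t - h t))\<^sup>2)) \<partial>hl) < \<infinity>"
        using fin by (simp add: order_le_less_trans[OF fin])
    qed measurable
    moreover from this have "(LINT t|hl. (norm (g n t - h t))\<^sup>2) \<le> e"
      using fin e by (simp add: nn_integral_eq_integral)
    ultimately show ?thesis by (simp add: sq_int_def)
  qed
  have key': "\<exists>N. \<forall>n\<ge>N. sq_int (\<lambda>t. g n t - h t) \<and> (LINT t|hl. (norm (g n t - h t))\<^sup>2) \<le> e" if "e > 0" for e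
    using C[OF that] key[OF that] by meson
  obtain n where "sq_int (\<lambda>t. g n t - h t)" using key'[of 1] by auto
  from sq_int_diff[OF sq[of n] this] have "sq_int h" by simp
  then have "h \<in> L2_halfline V" using hV by (simp add: sq_int_L2)
  moreover have "(\<lambda>n. LINT t|hl. (norm (g n t - h t))\<^sup>2) \<longlonglongrightarrow> 0"
  proof (rule LIMSEQ_I)
    fix e :: real assume "e > 0"
    then obtain N where "\<forall>n\<ge>N. (LINT t|hl. (norm (g n t - h t))\<^sup>2) \<le> e / 2" using key'[of "e/2"] by auto
    then show "\<exists>no. \<forall>n\<ge>no. norm ((LINT t|hl. (norm (g n t - h t))\<^sup>2) - 0) < e"
      using \<open>e > 0\<close> by (intro exI[of _ N]) fastforce
  qed
  ultimately show ?thesis by blast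
qed

section \<open>The Sobolev space as a real vector space with inner product\<close>

locale sobolev =
  fixes V :: "'a::euclidean_space set" and G :: "'a \<Rightarrow> 'a \<Rightarrow> real" and c0 :: real
  assumes V: "subspace V" and G: "bilinear G" and G_sym: "G u v = G v u"
    and c0: "0 < c0" and G_coercive: "c0 * (norm u)\<^sup>2 \<le> G u u"
begin

abbreviation "H \<equiv> W12_0 V"
abbreviation "wd \<equiv> weak_deriv V"

definition ip :: "(real \<Rightarrow> 'a) \<Rightarrow> (real \<Rightarrow> 'a) \<Rightarrow> real" where
  "ip \<eta> \<xi> = (LINT t|hl. G (wd \<eta> t) (wd \<xi> t) + G (\<eta> t) (\<xi> t))"

lemma H_D: assumes "\<eta> \<in> H"
  shows "continuous_on {0..} \<eta>" "\<eta> 0 = 0" "t < 0 \<Longrightarrow> \<eta> t = 0" "0 \<le> t \<Longrightarrow> \<eta> t \<in> V" "sq_int \<eta>"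
  using assms by (auto simp: W12_0_def sq_int_L2)

lemma wd: assumes "\<eta> \<in> H"
  shows "wd \<eta> \<in> L2_halfline V" "has_weak_derivative \<eta> (wd \<eta>)" "sq_int (wd \<eta>)" "0 \<le> t \<Longrightarrow> wd \<eta> t \<in> V"
proof -
  have "\<exists>g. g \<in> L2_halfline V \<and> has_weak_derivative \<eta> g" using assms by (auto simp: W12_0_def)
  then have "wd \<eta> \<in> L2_halfline V \<and> has_weak_derivative \<eta> (wd \<eta>)"
    unfolding weak_deriv_def by (rule someI_ex)
  then show "wd \<eta> \<in> L2_halfline V" "has_weak_derivative \<eta> (wd \<eta>)" "sq_int (wd \<eta>)" "0 \<le> t \<Longrightarrow> wd \<eta> t \<in> V"
    by (auto simp: sq_int_L2)
qed

lemma wd_unique: assumes "\<eta> \<in> H" "sq_int g" "has_weak_derivative \<eta> g"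
  shows "AE t in hl. wd \<eta> t = g t"
  by (rule weak_derivative_unique[OF H_D(1)[OF assms(1)] wd(3,2)[OF assms(1)] assms(2,3)])

lemma H_I: assumes "\<eta> \<in> L2_halfline V" "continuous_on {0..} \<eta>" "\<eta> 0 = 0" "\<And>t. t < 0 \<Longrightarrow> \<eta> t = 0"
   "g \<in> L2_halfline V" "has_weak_derivative \<eta> g" shows "\<eta> \<in> H"
  using assms by (auto simp: W12_0_def)

lemma (in -) test_function_mult_integrable:
  assumes "\<phi> \<in> test_functions" "sq_int f"
  shows "integrable hl (\<lambda>t. \<phi> t *\<^sub>R f t)" "integrable hl (\<lambda>t. deriv \<phi> t *\<^sub>R f t)"
proof -
  obtain D a b where D: "\<And>x. (\<phi> has_real_derivative D x) (at x)" "continuous_on UNIV D"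
    and ab: "0 < a" "\<And>t. t \<notin> {a..b} \<Longrightarrow> \<phi> t = 0"
    using assms(1) by (auto simp: test_functions_def C1_real_iff)
  have dD: "deriv \<phi> = D" using D by (auto intro!: DERIV_imp_deriv)
  have Dz: "D t = 0" if "t \<notin> {a..b}" for t
  proof -
    have "\<forall>\<^sub>F y in nhds t. 0 = \<phi> y"
      using eventually_nhds_in_open[of "- {a..b}" t] that ab(2) by (auto simp: open_Compl elim!: eventually_mono)
    then have "(\<phi> has_real_derivative 0) (at t)" 
      using DERIV_cong_ev[OF refl _ refl, where f="\<lambda>_. 0" and g=\<phi> and x=t and u=0] by simp
    then show ?thesis using DERIV_unique[OF D(1)[of t]] by simp
  qed
  have bd: "\<exists>K. \<forall>t. \<bar>u t\<bar> \<le> K * indicator {a..b} t" if "continuous_on UNIV u" "\<And>t. t \<notin> {a..b} \<Longrightarrow> u t = 0" for u :: "real \<Rightarrow> real"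
  proof -
    have "compact (u ` {a..b})" using that(1) by (intro compact_continuous_image) (auto intro: continuous_on_subset)
    then obtain K where "\<forall>x\<in>u ` {a..b}. norm x \<le> K" using compact_imp_bounded bounded_iff by metis
    then show ?thesis using that(2) by (intro exI[of _ K]) (auto simp: indicator_def)
  qed
  have phic: "continuous_on UNIV \<phi>" using D(1) by (meson DERIV_isCont continuous_at_imp_continuous_on)
  obtain K where "\<And>t. \<bar>\<phi> t\<bar> \<le> K * indicator {a..b} t" using bd[OF phic ab(2)] by blast
  then show "integrable hl (\<lambda>t. \<phi> t *\<^sub>R f t)"
    using phic assms(2) by (intro sq_int_bounded_mult_integrable measurable_hl borel_measurable_continuous_onI)
  obtain K where "\<And>t. \<bar>D t\<bar> \<le> K * indicator {a..b} t" using bd[OF D(2) Dz] by blast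
  then show "integrable hl (\<lambda>t. deriv \<phi> t *\<^sub>R f t)" unfolding dD
    using D assms(2) by (intro sq_int_bounded_mult_integrable measurable_hl borel_measurable_continuous_onI)
qed

lemma (in -) has_weak_derivative_add:
  assumes "sq_int f" "sq_int f'" "sq_int g" "sq_int g'" "has_weak_derivative f f'" "has_weak_derivative g g'"
  shows "has_weak_derivative (\<lambda>t. f t + g t) (\<lambda>t. f' t + g' t)"
  unfolding has_weak_derivative_def
proof
  fix \<phi> assume \<phi>: "\<phi> \<in> test_functions"
  have "(LINT t|hl. deriv \<phi> t *\<^sub>R (f t + g t)) = (LINT t|hl. deriv \<phi> t *\<^sub>R f t) + (LINT t|hl. deriv \<phi> t *\<^sub>R g t)"
    unfolding scaleR_add_right by (intro Bochner_Integration.integral_add test_function_mult_integrable \<phi> assms)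
  also have "\<dots> = - ((LINT t|hl. \<phi> t *\<^sub>R f' t) + (LINT t|hl. \<phi> t *\<^sub>R g' t))"
    using assms(5,6) \<phi> by (simp add: has_weak_derivative_def)
  also have "(LINT t|hl. \<phi> t *\<^sub>R f' t) + (LINT t|hl. \<phi> t *\<^sub>R g' t) = (LINT t|hl. \<phi> t *\<^sub>R (f' t + g' t))"
    unfolding scaleR_add_right
    by (intro Bochner_Integration.integral_add[symmetric] test_function_mult_integrable \<phi> assms)
  finally show "(LINT t|hl. deriv \<phi> t *\<^sub>R (f t + g t)) = - (LINT t|hl. \<phi> t *\<^sub>R (f' t + g' t))" .
qed

lemma (in -) has_weak_derivative_scale:
  assumes "has_weak_derivative f f'"
  shows "has_weak_derivative (\<lambda>t. c *\<^sub>R f t) (\<lambda>t. c *\<^sub>R f' t)"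
  unfolding has_weak_derivative_def
proof
  fix \<phi> assume "\<phi> \<in> test_functions"
  then have "(LINT t|hl. deriv \<phi> t *\<^sub>R f t) = - (LINT t|hl. \<phi> t *\<^sub>R f' t)"
    using assms by (simp add: has_weak_derivative_def)
  then have "(LINT t|hl. c *\<^sub>R (deriv \<phi> t *\<^sub>R f t)) = - (LINT t|hl. c *\<^sub>R (\<phi> t *\<^sub>R f' t))"
    by (simp only: integral_scaleR_right scaleR_minus_right)
  then show "(LINT t|hl. deriv \<phi> t *\<^sub>R c *\<^sub>R f t) = - (LINT t|hl. \<phi> t *\<^sub>R c *\<^sub>R f' t)"
    by (simp only: scaleR_left_commute[of c])
qed

lemma L2_add: "f \<in> L2_halfline V \<Longrightarrow> g \<in> L2_halfline V \<Longrightarrow> (\<lambda>t. f t + g t) \<in> L2_halfline V"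
  using V by (auto simp: sq_int_L2 sq_int_add subspace_add)

lemma L2_scale: "f \<in> L2_halfline V \<Longrightarrow> (\<lambda>t. c *\<^sub>R f t) \<in> L2_halfline V"
  using V by (auto simp: sq_int_L2 sq_int_scale subspace_scale)

text \<open>\<open>weak_deriv\<close> picks a representative by \<open>SOME\<close>, so it is
  additive only almost everywhere; the same holds for the other linear operations.\<close>

lemma H_add: assumes "f \<in> H" "g \<in> H"
  shows "f + g \<in> H" "AE t in hl. wd (f + g) t = wd f t + wd g t"
proof -
  have w: "has_weak_derivative (f + g) (\<lambda>t. wd f t + wd g t)" unfolding plus_fun_def
    using assms by (intro has_weak_derivative_add wd H_D)
  have fg: "f \<in> L2_halfline V" "g \<in> L2_halfline V" using assms by (auto simp: W12_0_def)
  show 1: "f + g \<in> H"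
  proof (rule H_I[OF _ _ _ _ _ w])
    show "f + g \<in> L2_halfline V" unfolding plus_fun_def using fg by (rule L2_add)
    show "continuous_on {0..} (f + g)" unfolding plus_fun_def using assms by (intro continuous_intros H_D)
    show "(\<lambda>t. wd f t + wd g t) \<in> L2_halfline V" using assms by (intro L2_add wd)
  qed (simp_all add: H_D(2,3)[OF assms(1)] H_D(2,3)[OF assms(2)])
  show "AE t in hl. wd (f + g) t = wd f t + wd g t"
    using assms by (intro wd_unique[OF 1 _ w] sq_int_add wd)
qed

lemma H_scale: assumes "f \<in> H"
  shows "c *\<^sub>R f \<in> H" "AE t in hl. wd (c *\<^sub>R f) t = c *\<^sub>R wd f t"
proof -
  have w: "has_weak_derivative (c *\<^sub>R f) (\<lambda>t. c *\<^sub>R wd f t)" unfolding scaleR_fun_def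
    using assms by (intro has_weak_derivative_scale wd)
  have f: "f \<in> L2_halfline V" using assms by (auto simp: W12_0_def)
  show 1: "c *\<^sub>R f \<in> H"
  proof (rule H_I[OF _ _ _ _ _ w])
    show "c *\<^sub>R f \<in> L2_halfline V" unfolding scaleR_fun_def using f by (rule L2_scale)
    show "continuous_on {0..} (c *\<^sub>R f)" unfolding scaleR_fun_def using assms by (intro continuous_intros H_D)
    show "(\<lambda>t. c *\<^sub>R wd f t) \<in> L2_halfline V" using assms by (intro L2_scale wd)
  qed (simp_all add: scaleR_fun_def H_D(2,3)[OF assms])
  show "AE t in hl. wd (c *\<^sub>R f) t = c *\<^sub>R wd f t"
    using assms by (intro wd_unique[OF 1 _ w] sq_int_scale wd)
qed

lemma H_subspace: "subspace H"
proof (rule subspaceI)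
  have "(\<lambda>t::real. 0::'a) \<in> H"
    using V by (intro H_I[of _ "\<lambda>t. 0"]) (auto simp: L2_halfline_def subspace_0 has_weak_derivative_def)
  then show "0 \<in> H" by (simp add: zero_fun_def)
qed (auto intro: H_add H_scale)

section \<open>Symmetric forms with bounded measurable coefficients\<close>

definition E0 :: "(real \<Rightarrow> 'a) \<Rightarrow> real" where "E0 \<eta> = (LINT t|hl. (norm (\<eta> t))\<^sup>2)"
definition E1 :: "(real \<Rightarrow> 'a) \<Rightarrow> real" where "E1 \<eta> = (LINT t|hl. (norm (wd \<eta> t))\<^sup>2)"

lemma E_nonneg [simp]: "0 \<le> E0 \<eta>" "0 \<le> E1 \<eta>" by (simp_all add: E0_def E1_def)

definition adm :: "(real \<Rightarrow> 'a \<Rightarrow> 'a \<Rightarrow> real) \<Rightarrow> bool" where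
  "adm p \<longleftrightarrow> (\<forall>t. bilinear (p t)) \<and> (\<forall>u w. (\<lambda>t. p t u w) \<in> borel_measurable hl) \<and>
     (\<exists>C. \<forall>t u w. \<bar>p t u w\<bar> \<le> C * norm u * norm w)"

lemma adm_const: "bilinear B \<Longrightarrow> adm (\<lambda>t. B)"
proof -
  assume B: "bilinear B"
  obtain C where "\<forall>x y. norm (B x y) \<le> C * norm x * norm y" using bilinear_bounded[OF B] by blast
  then have "\<exists>C. \<forall>(t::real) u w. \<bar>B u w\<bar> \<le> C * norm u * norm w" by auto
  then show ?thesis using B unfolding adm_def by simp
qed

lemma adm_integrable: assumes "adm p" "sq_int f" "sq_int g" shows "integrable hl (\<lambda>t. p t (f t) (g t))"
proof -
  obtain C where "\<And>t u w. \<bar>p t u w\<bar> \<le> C * norm u * norm w" using assms(1) unfolding adm_def by blast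
  moreover have "\<And>t. bilinear (p t)" "\<And>u w. (\<lambda>t. p t u w) \<in> borel_measurable hl"
    using assms(1) unfolding adm_def by blast+
  ultimately show ?thesis using L2_form(1)[OF _ _ _ assms(2,3), of p C] by blast
qed

lemma adm_bound: assumes "adm p"
  shows "\<exists>C\<ge>0. \<forall>f g. sq_int f \<longrightarrow> sq_int g \<longrightarrow>
    \<bar>LINT t|hl. p t (f t) (g t)\<bar> \<le> C * ((LINT t|hl. (norm (f t))\<^sup>2) + (LINT t|hl. (norm (g t))\<^sup>2))"
proof -
  obtain C where "\<And>t u w. \<bar>p t u w\<bar> \<le> C * norm u * norm w" using assms by (auto simp: adm_def)
  then show ?thesis using L2_form(2)[of p C] assms by (intro exI[of _ "\<bar>C\<bar>"]) (auto simp: adm_def)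
qed

text \<open>The polarised quadratic form: the two k-terms stand for Q and its transpose, so symmetry
  in \<eta> and \<xi> requires symmetry of p and l only. The inner product is the case p = l = G, k
  = 0.\<close>

definition bf :: "(real \<Rightarrow> 'a \<Rightarrow> 'a \<Rightarrow> real) \<Rightarrow> (real \<Rightarrow> 'a \<Rightarrow> 'a \<Rightarrow> real) \<Rightarrow> (real \<Rightarrow> 'a \<Rightarrow> 'a \<Rightarrow> real) \<Rightarrow>
    (real \<Rightarrow> 'a) \<Rightarrow> (real \<Rightarrow> 'a) \<Rightarrow> real" where
  "bf p k l \<eta> \<xi> = (LINT t|hl. p t (wd \<eta> t) (wd \<xi> t) + (k t (\<eta> t) (wd \<xi> t) + k t (\<xi> t) (wd \<eta> t)) + l t (\<eta> t) (\<xi> t))"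

lemma ip_bf: "ip = bf (\<lambda>t. G) (\<lambda>t u w. 0) (\<lambda>t. G)"
  by (simp add: fun_eq_iff ip_def bf_def)

lemma adm_0: "adm (\<lambda>t u w. 0)"
  by (intro adm_const) (simp add: bilinear_def linear_iff)

lemma bf_integrable:
  assumes "adm p" "adm k" "adm l" "\<eta> \<in> H" "\<xi> \<in> H"
  shows "integrable hl (\<lambda>t. p t (wd \<eta> t) (wd \<xi> t) + (k t (\<eta> t) (wd \<xi> t) + k t (\<xi> t) (wd \<eta> t)) + l t (\<eta> t) (\<xi> t))"
proof -
  note sq = wd(3)[OF assms(4)] wd(3)[OF assms(5)] H_D(5)[OF assms(4)] H_D(5)[OF assms(5)]
  show ?thesis
    by (rule Bochner_Integration.integrable_add[OF Bochner_Integration.integrable_add[OF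
          adm_integrable[OF assms(1) sq(1,2)] Bochner_Integration.integrable_add[OF
            adm_integrable[OF assms(2) sq(3,2)] adm_integrable[OF assms(2) sq(4,1)]]]
          adm_integrable[OF assms(3) sq(3,4)]])
qed

lemma bf_props:
  assumes a: "adm p" "adm k" "adm l"
  shows bf_add: "\<And>x y z. x \<in> H \<Longrightarrow> y \<in> H \<Longrightarrow> z \<in> H \<Longrightarrow> bf p k l (x + y) z = bf p k l x z + bf p k l y z"
    and bf_scale: "\<And>c x z. x \<in> H \<Longrightarrow> z \<in> H \<Longrightarrow> bf p k l (c *\<^sub>R x) z = c * bf p k l x z"
proof -
  have b: "bilinear (p t)" "bilinear (k t)" "bilinear (l t)" for t using a by (auto simp: adm_def)
  note bl = bilinear_ladd[OF b(1)] bilinear_ladd[OF b(2)] bilinear_ladd[OF b(3)]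
    bilinear_radd[OF b(1)] bilinear_radd[OF b(2)] bilinear_radd[OF b(3)]
    bilinear_lmul[OF b(1)] bilinear_lmul[OF b(2)] bilinear_lmul[OF b(3)]
    bilinear_rmul[OF b(1)] bilinear_rmul[OF b(2)] bilinear_rmul[OF b(3)]
  show "bf p k l (x + y) z = bf p k l x z + bf p k l y z" if H: "x \<in> H" "y \<in> H" "z \<in> H" for x y z
  proof -
    have "bf p k l (x + y) z = (LINT t|hl. (p t (wd x t) (wd z t) + (k t (x t) (wd z t) + k t (z t) (wd x t)) + l t (x t) (z t))
       + (p t (wd y t) (wd z t) + (k t (y t) (wd z t) + k t (z t) (wd y t)) + l t (y t) (z t)))"
      unfolding bf_def
    proof (rule integral_cong_AE)
      show "AE t in hl. p t (wd (x + y) t) (wd z t) + (k t ((x + y) t) (wd z t) + k t (z t) (wd (x + y) t)) + l t ((x + y) t) (z t)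
        = (p t (wd x t) (wd z t) + (k t (x t) (wd z t) + k t (z t) (wd x t)) + l t (x t) (z t))
       + (p t (wd y t) (wd z t) + (k t (y t) (wd z t) + k t (z t) (wd y t)) + l t (y t) (z t))"
        using H_add(2)[OF H(1,2)] by eventually_elim (simp add: bl)
    qed (intro borel_measurable_integrable borel_measurable_add bf_integrable a H H_add)+
    also have "\<dots> = bf p k l x z + bf p k l y z"
      unfolding bf_def by (intro Bochner_Integration.integral_add bf_integrable a H)
    finally show ?thesis .
  qed
  show "bf p k l (c *\<^sub>R x) z = c * bf p k l x z" if H: "x \<in> H" "z \<in> H" for c x z
  proof -
    have "bf p k l (c *\<^sub>R x) z = (LINT t|hl. c * (p t (wd x t) (wd z t) + (k t (x t) (wd z t) + k t (z t) (wd x t)) + l t (x t) (z t)))"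
      unfolding bf_def
    proof (rule integral_cong_AE)
      show "AE t in hl. p t (wd (c *\<^sub>R x) t) (wd z t) + (k t ((c *\<^sub>R x) t) (wd z t) + k t (z t) (wd (c *\<^sub>R x) t)) + l t ((c *\<^sub>R x) t) (z t)
        = c * (p t (wd x t) (wd z t) + (k t (x t) (wd z t) + k t (z t) (wd x t)) + l t (x t) (z t))"
        using H_scale(2)[OF H(1), of c] by eventually_elim (simp add: bl scaleR_fun_def algebra_simps)
    qed (intro borel_measurable_integrable borel_measurable_times borel_measurable_const bf_integrable a H H_scale)+
    also have "\<dots> = c * bf p k l x z" unfolding bf_def by simp
    finally show ?thesis .
  qed
qed

lemma bf_sym:
  assumes "\<And>t u w. p t u w = p t w u" "\<And>t u w. l t u w = l t w u"
  shows "bf p k l x z = bf p k l z x"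
  unfolding bf_def
proof (rule Bochner_Integration.integral_cong[OF refl])
  show "p t (wd x t) (wd z t) + (k t (x t) (wd z t) + k t (z t) (wd x t)) + l t (x t) (z t)
    = p t (wd z t) (wd x t) + (k t (z t) (wd x t) + k t (x t) (wd z t)) + l t (z t) (x t)" for t
    using assms(1)[of t "wd x t" "wd z t"] assms(2)[of t "x t" "z t"] by linarith
qed

lemma ip_lower: assumes "x \<in> H" shows "c0 * (E1 x + E0 x) \<le> ip x x"
proof -
  have "c0 * (E1 x + E0 x) = (LINT t|hl. c0 * (norm (wd x t))\<^sup>2 + c0 * (norm (x t))\<^sup>2)"
    using sq_int_integrable[OF wd(3)[OF assms]] sq_int_integrable[OF H_D(5)[OF assms]]
    by (simp add: E0_def E1_def distrib_left)
  also have "\<dots> \<le> ip x x" unfolding ip_def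
  proof (rule integral_mono)
    show "integrable hl (\<lambda>t. c0 * (norm (wd x t))\<^sup>2 + c0 * (norm (x t))\<^sup>2)"
      using sq_int_integrable[OF wd(3)[OF assms]] sq_int_integrable[OF H_D(5)[OF assms]] by simp
    show "integrable hl (\<lambda>t. G (wd x t) (wd x t) + G (x t) (x t))"
      by (intro Bochner_Integration.integrable_add adm_integrable[OF adm_const[OF G]] wd H_D assms)
  qed (intro add_mono G_coercive)
  finally show ?thesis .
qed

lemma bf_bound: assumes a: "adm p" "adm k" "adm l"
  shows "\<exists>C\<ge>0. \<forall>x\<in>H. \<forall>z\<in>H. \<bar>bf p k l x z\<bar> \<le> C * ((E1 x + E0 x) + (E1 z + E0 z))"
proof -
  obtain A where A: "A \<ge> 0" "\<And>f g. sq_int f \<Longrightarrow> sq_int g \<Longrightarrow> \<bar>LINT t|hl. p t (f t) (g t)\<bar> \<le> A * ((LINT t|hl. (norm (f t))\<^sup>2) + (LINT t|hl. (norm (g t))\<^sup>2))"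
    using adm_bound[OF a(1)] by blast
  obtain B where B: "B \<ge> 0" "\<And>f g. sq_int f \<Longrightarrow> sq_int g \<Longrightarrow> \<bar>LINT t|hl. k t (f t) (g t)\<bar> \<le> B * ((LINT t|hl. (norm (f t))\<^sup>2) + (LINT t|hl. (norm (g t))\<^sup>2))"
    using adm_bound[OF a(2)] by blast
  obtain C where C: "C \<ge> 0" "\<And>f g. sq_int f \<Longrightarrow> sq_int g \<Longrightarrow> \<bar>LINT t|hl. l t (f t) (g t)\<bar> \<le> C * ((LINT t|hl. (norm (f t))\<^sup>2) + (LINT t|hl. (norm (g t))\<^sup>2))"
    using adm_bound[OF a(3)] by blast
  show ?thesis
  proof (intro exI[of _ "A + B + C"] conjI ballI)
    fix x z assume H: "x \<in> H" "z \<in> H"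
    have "bf p k l x z = (LINT t|hl. p t (wd x t) (wd z t)) + ((LINT t|hl. k t (x t) (wd z t)) + (LINT t|hl. k t (z t) (wd x t))) + (LINT t|hl. l t (x t) (z t))"
    proof -
      have i: "integrable hl (\<lambda>t. p t (wd x t) (wd z t))" "integrable hl (\<lambda>t. k t (x t) (wd z t))"
        "integrable hl (\<lambda>t. k t (z t) (wd x t))" "integrable hl (\<lambda>t. l t (x t) (z t))"
        by (intro adm_integrable[OF a(1)] adm_integrable[OF a(2)] adm_integrable[OF a(3)] wd H_D H)+
      show ?thesis unfolding bf_def using i by simp
    qed
    moreover have "\<bar>LINT t|hl. p t (wd x t) (wd z t)\<bar> \<le> A * (E1 x + E1 z)" unfolding E1_def using H by (intro A wd)
    moreover have "\<bar>LINT t|hl. k t (x t) (wd z t)\<bar> \<le> B * (E0 x + E1 z)" unfolding E1_def E0_def using H by (intro B wd H_D)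
    moreover have "\<bar>LINT t|hl. k t (z t) (wd x t)\<bar> \<le> B * (E0 z + E1 x)" unfolding E1_def E0_def using H by (intro B wd H_D)
    moreover have "\<bar>LINT t|hl. l t (x t) (z t)\<bar> \<le> C * (E0 x + E0 z)" unfolding E0_def using H by (intro C H_D)
    ultimately have "\<bar>bf p k l x z\<bar> \<le> A * (E1 x + E1 z) + (B * (E0 x + E1 z) + B * (E0 z + E1 x)) + C * (E0 x + E0 z)"
      by linarith
    also have "\<dots> = (A + B) * (E1 x + E1 z) + (B + C) * (E0 x + E0 z)" by (simp add: algebra_simps)
    also have "\<dots> \<le> (A + B + C) * (E1 x + E1 z) + (A + B + C) * (E0 x + E0 z)"
      using A(1) B(1) C(1) by (intro add_mono[of "_ * _" "_ * _"] mult_right_mono) auto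
    finally show "\<bar>bf p k l x z\<bar> \<le> (A + B + C) * ((E1 x + E0 x) + (E1 z + E0 z))" by (simp add: algebra_simps)
  qed (use A B C in auto)
qed

lemma pointwise_bound: assumes "x \<in> H" "0 \<le> s" "s \<le> t" shows "(norm (x t - x s))\<^sup>2 \<le> (t - s) * E1 x"
proof -
  have "(norm (x t - x s))\<^sup>2 \<le> (t - s) * (LINT u|hl. indicator {s..t} u * (norm (wd x u))\<^sup>2)"
    using assms by (intro weak_derivative_increment H_D wd)
  also have "\<dots> \<le> (t - s) * E1 x" unfolding E1_def
    using assms by (intro mult_left_mono integral_mono sq_int_Icc_integrable sq_int_integrable wd)
      (auto simp: indicator_def)
  finally show ?thesis .
qed

sublocale ip_on H ip
proof
  show "subspace H" by (rule H_subspace)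
  fix x y z c assume H: "x \<in> H" 
  have a: "adm (\<lambda>t. G)" using G by (rule adm_const)
  show "x \<noteq> 0 \<Longrightarrow> 0 < ip x x"
  proof (rule ccontr)
    assume "x \<noteq> 0" "\<not> 0 < ip x x"
    then have "c0 * (E1 x + E0 x) \<le> 0" using ip_lower[OF H] by linarith
    then have "E1 x + E0 x \<le> 0" using c0 by (simp add: mult_le_0_iff)
    then have "E1 x = 0" using E_nonneg[of x] by linarith
    \<comment> \<open>Elements are functions, not classes, so vanishing at every point has to be
      shown: the derivative part E1 together with x 0 = 0 gives it by the increment
      estimate.\<close>
    then have "x t = 0" for t
      using pointwise_bound[OF H, of 0 t] H_D(2,3)[OF H] by (cases "t < 0") auto
    then show False using \<open>x \<noteq> 0\<close> by (auto simp: fun_eq_iff)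
  qed
  assume H': "y \<in> H"
  show "ip x y = ip y x" unfolding ip_bf by (rule bf_sym) (auto intro: G_sym)
  show "ip (c *\<^sub>R x) y = c * ip x y" unfolding ip_bf by (intro bf_scale a adm_0 H H')
  assume "z \<in> H"
  then show "ip (x + y) z = ip x z + ip y z" unfolding ip_bf by (intro bf_add a adm_0 H H')
qed

lemma ip_upper: "\<exists>C>0. \<forall>x\<in>H. ip x x \<le> C * (E1 x + E0 x)"
proof -
  obtain C where C: "C \<ge> 0" "\<forall>x\<in>H. \<forall>z\<in>H. \<bar>ip x z\<bar> \<le> C * ((E1 x + E0 x) + (E1 z + E0 z))"
    using bf_bound[OF adm_const[OF G] adm_0 adm_const[OF G]] unfolding ip_bf by blast
  show ?thesis
  proof (intro exI[of _ "2 * C + 1"] conjI ballI)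
    fix x assume "x \<in> H"
    then have "ip x x \<le> C * ((E1 x + E0 x) + (E1 x + E0 x))" using C(2) by force
    also have "\<dots> \<le> (2 * C + 1) * (E1 x + E0 x)" using E_nonneg[of x] by (simp add: algebra_simps)
    finally show "ip x x \<le> (2 * C + 1) * (E1 x + E0 x)" .
  qed (use C in simp)
qed

section \<open>Completeness of the Sobolev space\<close>

lemma H_diff: assumes "f \<in> H" "g \<in> H"
  shows "f - g \<in> H" "AE t in hl. wd (f - g) t = wd f t - wd g t"
proof -
  have eq: "f - g = f + (-1) *\<^sub>R g" by simp
  show "f - g \<in> H" using assms by auto
  show "AE t in hl. wd (f - g) t = wd f t - wd g t"
    unfolding eq using H_add(2)[OF assms(1) H_scale(1)[OF assms(2), of "-1"]] H_scale(2)[OF assms(2), of "-1"]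
    by eventually_elim simp
qed

lemma E1_diff: assumes "f \<in> H" "g \<in> H"
  shows "E1 (f - g) = (LINT t|hl. (norm (wd f t - wd g t))\<^sup>2)"
  unfolding E1_def
proof (rule integral_cong_AE)
  show "AE t in hl. (norm (wd (f - g) t))\<^sup>2 = (norm (wd f t - wd g t))\<^sup>2"
    using H_diff(2)[OF assms] by eventually_elim simp
  show "(\<lambda>t. (norm (wd (f - g) t))\<^sup>2) \<in> borel_measurable hl"
    by (intro borel_measurable_integrable sq_int_integrable wd H_diff assms)
  show "(\<lambda>t. (norm (wd f t - wd g t))\<^sup>2) \<in> borel_measurable hl"
    by (intro borel_measurable_integrable sq_int_integrable sq_int_diff wd assms)
qed

lemma E0_diff: "E0 (f - g) = (LINT t|hl. (norm (f t - g t))\<^sup>2)"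
  by (simp add: E0_def)

lemma (in -) test_integral_bound:
  assumes u: "u \<in> borel_measurable hl" "\<And>t. \<bar>u t\<bar> \<le> K * indicator {a..b} t" and ab: "0 \<le> a" "a \<le> b"
    and f: "sq_int (f :: real \<Rightarrow> 'a::euclidean_space)"
  shows "(norm (LINT t|hl. u t *\<^sub>R f t))\<^sup>2 \<le> K\<^sup>2 * ((b - a) * (LINT t|hl. (norm (f t))\<^sup>2))"
proof -
  have "0 \<le> \<bar>u a\<bar>" by simp
  then have K: "0 \<le> K" using u(2)[of a] ab by (simp add: indicator_def)
  have "norm (LINT t|hl. u t *\<^sub>R f t) \<le> (LINT t|hl. norm (u t *\<^sub>R f t))" by (rule integral_norm_bound)
  also have "\<dots> \<le> (LINT t|hl. K * (indicator {a..b} t * norm (f t)))"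
  proof (rule integral_mono)
    show "integrable hl (\<lambda>t. norm (u t *\<^sub>R f t))"
      by (intro integrable_norm sq_int_bounded_mult_integrable[OF f u])
    show "integrable hl (\<lambda>t. K * (indicator {a..b} t * norm (f t)))"
      by (intro integrable_mult_right sq_int_Icc_integrable f)
    show "norm (u t *\<^sub>R f t) \<le> K * (indicator {a..b} t * norm (f t))" for t
      using mult_right_mono[OF u(2)[of t], of "norm (f t)"] by (simp add: mult.assoc)
  qed
  also have "\<dots> = K * (LINT t|hl. indicator {a..b} t * norm (f t))" by simp
  finally have "(norm (LINT t|hl. u t *\<^sub>R f t))\<^sup>2 \<le> (K * (LINT t|hl. indicator {a..b} t * norm (f t)))\<^sup>2"
    by (rule power_mono) simp
  also have "\<dots> = K\<^sup>2 * (LINT t|hl. indicator {a..b} t * norm (f t))\<^sup>2" by (rule power_mult_distrib)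
  also have "\<dots> \<le> K\<^sup>2 * ((b - a) * (LINT t|hl. indicator {a..b} t * (norm (f t))\<^sup>2))"
    by (intro mult_left_mono integral_Icc_sq_le f ab) simp
  also have "\<dots> \<le> K\<^sup>2 * ((b - a) * (LINT t|hl. (norm (f t))\<^sup>2))"
    using ab f by (intro mult_left_mono integral_mono sq_int_Icc_integrable sq_int_integrable)
      (auto simp: indicator_def)
  finally show ?thesis .
qed

lemma (in -) test_function_bounds:
  assumes "\<phi> \<in> test_functions"
  obtains K a b where "0 \<le> a" "a \<le> b" "\<phi> \<in> borel_measurable hl" "deriv \<phi> \<in> borel_measurable hl"
    "\<And>t. \<bar>\<phi> t\<bar> \<le> K * indicator {a..b} t" "\<And>t. \<bar>deriv \<phi> t\<bar> \<le> K * indicator {a..b} t"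
proof -
  obtain D a b where D: "\<And>x. (\<phi> has_real_derivative D x) (at x)" "continuous_on UNIV D"
    and ab: "0 < a" "\<And>t. t \<notin> {a..b} \<Longrightarrow> \<phi> t = 0"
    using assms(1) by (auto simp: test_functions_def C1_real_iff)
  have dD: "deriv \<phi> = D" using D by (auto intro!: DERIV_imp_deriv)
  have Dz: "D t = 0" if "t \<notin> {a..b}" for t
  proof -
    have "\<forall>\<^sub>F y in nhds t. 0 = \<phi> y"
      using eventually_nhds_in_open[of "- {a..b}" t] that ab(2) by (auto simp: open_Compl elim!: eventually_mono)
    then have "(\<phi> has_real_derivative 0) (at t)"
      using DERIV_cong_ev[OF refl _ refl, where f="\<lambda>_. 0" and g=\<phi> and x=t and u=0] by simp
    then show ?thesis using DERIV_unique[OF D(1)[of t]] by simp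
  qed
  have phic: "continuous_on UNIV \<phi>" using D(1) by (meson DERIV_isCont continuous_at_imp_continuous_on)
  define c where "c = max a b"
  have "compact ((\<lambda>t. (\<phi> t, D t)) ` {a..c})"
    using phic D(2) by (intro compact_continuous_image continuous_on_Pair) (auto intro: continuous_on_subset)
  from compact_imp_bounded[OF this] obtain K where K: "\<And>t. t \<in> {a..c} \<Longrightarrow> norm (\<phi> t, D t) \<le> K"
    unfolding bounded_iff by blast
  have bd: "\<bar>\<phi> t\<bar> \<le> K * indicator {a..c} t" "\<bar>D t\<bar> \<le> K * indicator {a..c} t" for t
  proof -
    have "\<bar>\<phi> t\<bar> \<le> norm (\<phi> t, D t)" "\<bar>D t\<bar> \<le> norm (\<phi> t, D t)"
      using norm_fst_le[of "\<phi> t" "D t"] norm_snd_le[of "D t" "\<phi> t"] by auto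
    moreover have "\<phi> t = 0 \<and> D t = 0" if "t \<notin> {a..c}"
    proof -
      have "t \<notin> {a..b}" using that by (auto simp: c_def)
      then show ?thesis using ab(2) Dz by blast
    qed
    ultimately show "\<bar>\<phi> t\<bar> \<le> K * indicator {a..c} t" "\<bar>D t\<bar> \<le> K * indicator {a..c} t"
      using K[of t] by (cases "t \<in> {a..c}"; simp)+
  qed
  have m: "\<phi> \<in> borel_measurable hl" "D \<in> borel_measurable hl"
    using phic D(2) by (auto intro: measurable_hl borel_measurable_continuous_onI)
  show ?thesis by (rule that[of a c K, unfolded dD, OF _ _ m bd]) (use ab in \<open>auto simp: c_def\<close>)
qed

lemma (in -) tendsto_norm_sq_zero:
  fixes f :: "nat \<Rightarrow> 'b::real_normed_vector"
  assumes "e \<longlonglongrightarrow> 0" "\<And>n. (norm (f n - l))\<^sup>2 \<le> C * e n" shows "f \<longlonglongrightarrow> l"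
proof -
  have "(\<lambda>n. (norm (f n - l))\<^sup>2) \<longlonglongrightarrow> 0"
    by (rule tendsto_zero_squeeze_le[OF assms(1)]) (use assms(2) in auto)
  then have "(\<lambda>n. sqrt ((norm (f n - l))\<^sup>2)) \<longlonglongrightarrow> sqrt 0" by (rule tendsto_real_sqrt)
  then show ?thesis by (simp add: tendsto_norm_zero_iff LIM_zero_iff)
qed

lemma (in -) weak_derivative_limit:
  assumes f: "\<And>n. sq_int (f n)" and f': "\<And>n. sq_int (f' n)" and w: "\<And>n. has_weak_derivative (f n) (f' n)"
    and g: "sq_int g" and g': "sq_int g'"
    and l: "(\<lambda>n. LINT t|hl. (norm (f n t - g t))\<^sup>2) \<longlonglongrightarrow> 0" and l': "(\<lambda>n. LINT t|hl. (norm (f' n t - g' t))\<^sup>2) \<longlonglongrightarrow> 0"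
  shows "has_weak_derivative g g'"
  unfolding has_weak_derivative_def
proof
  fix \<phi> assume \<phi>: "\<phi> \<in> test_functions"
  from \<phi> obtain K a b where K: "0 \<le> a" "a \<le> b" "\<phi> \<in> borel_measurable hl" "deriv \<phi> \<in> borel_measurable hl"
    "\<And>t. \<bar>\<phi> t\<bar> \<le> K * indicator {a..b} t" "\<And>t. \<bar>deriv \<phi> t\<bar> \<le> K * indicator {a..b} t"
    by (rule test_function_bounds) blast
  have "(\<lambda>n. LINT t|hl. deriv \<phi> t *\<^sub>R f n t) \<longlonglongrightarrow> (LINT t|hl. deriv \<phi> t *\<^sub>R g t)"
  proof (rule tendsto_norm_sq_zero[OF l])
    fix n
    have "(LINT t|hl. deriv \<phi> t *\<^sub>R f n t) - (LINT t|hl. deriv \<phi> t *\<^sub>R g t) = (LINT t|hl. deriv \<phi> t *\<^sub>R (f n t - g t))"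
      unfolding scaleR_diff_right
      by (intro Bochner_Integration.integral_diff[symmetric] test_function_mult_integrable \<phi> f g)
    then show "(norm ((LINT t|hl. deriv \<phi> t *\<^sub>R f n t) - (LINT t|hl. deriv \<phi> t *\<^sub>R g t)))\<^sup>2
      \<le> (K\<^sup>2 * (b - a)) * (LINT t|hl. (norm (f n t - g t))\<^sup>2)"
      using test_integral_bound[OF K(4,6,1,2) sq_int_diff[OF f g]] by (simp add: mult.assoc)
  qed
  moreover have "(\<lambda>n. LINT t|hl. \<phi> t *\<^sub>R f' n t) \<longlonglongrightarrow> (LINT t|hl. \<phi> t *\<^sub>R g' t)"
  proof (rule tendsto_norm_sq_zero[OF l'])
    fix n
    have "(LINT t|hl. \<phi> t *\<^sub>R f' n t) - (LINT t|hl. \<phi> t *\<^sub>R g' t) = (LINT t|hl. \<phi> t *\<^sub>R (f' n t - g' t))"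
      unfolding scaleR_diff_right
      by (intro Bochner_Integration.integral_diff[symmetric] test_function_mult_integrable \<phi> f' g')
    then show "(norm ((LINT t|hl. \<phi> t *\<^sub>R f' n t) - (LINT t|hl. \<phi> t *\<^sub>R g' t)))\<^sup>2
      \<le> (K\<^sup>2 * (b - a)) * (LINT t|hl. (norm (f' n t - g' t))\<^sup>2)"
      using test_integral_bound[OF K(3,5,1,2) sq_int_diff[OF f' g']] by (simp add: mult.assoc)
  qed
  then have "(\<lambda>n. - (LINT t|hl. \<phi> t *\<^sub>R f' n t)) \<longlonglongrightarrow> - (LINT t|hl. \<phi> t *\<^sub>R g' t)"
    by (rule tendsto_minus)
  moreover have "(LINT t|hl. deriv \<phi> t *\<^sub>R f n t) = - (LINT t|hl. \<phi> t *\<^sub>R f' n t)" for n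
    using w[of n] \<phi> by (simp add: has_weak_derivative_def)
  ultimately show "(LINT t|hl. deriv \<phi> t *\<^sub>R g t) = - (LINT t|hl. \<phi> t *\<^sub>R g' t)"
    by (intro LIMSEQ_unique) auto
qed

text \<open>The derivatives have an L^2 limit g and the functions an L^2 limit h. The limit in the
  space is the primitive of g that starts at 0: it is continuous, it is the pointwise limit, and it
  coincides with h almost everywhere.\<close>

lemma H_complete:
  assumes X: "\<And>n. X n \<in> H" and C: "cauchy X"
  shows "\<exists>x\<in>H. conv X x"
proof -
  have Ebd: "E1 (x - y) + E0 (x - y) \<le> (nrm (x - y))\<^sup>2 / c0" if "x \<in> H" "y \<in> H" for x y
    using ip_lower[of "x - y"] nrm_sq[of "x - y"] that c0 by (simp add: field_simps)
  have small: "\<exists>N. \<forall>m\<ge>N. \<forall>n\<ge>N. E1 (X m - X n) + E0 (X m - X n) < e" if e: "e > 0" for e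
  proof -
    have "sqrt (e * c0) > 0" using e c0 by simp
    then obtain N where N: "\<And>m n. m \<ge> N \<Longrightarrow> n \<ge> N \<Longrightarrow> nrm (X m - X n) < sqrt (e * c0)"
      using C unfolding cauchy_def by blast
    have "E1 (X m - X n) + E0 (X m - X n) < e" if "m \<ge> N" "n \<ge> N" for m n
    proof -
      have "(nrm (X m - X n))\<^sup>2 < (sqrt (e * c0))\<^sup>2"
        using N[OF that] X by (intro power_strict_mono) auto
      then have "(nrm (X m - X n))\<^sup>2 / c0 < e" using e c0 by (simp add: field_simps)
      then show ?thesis using Ebd[OF X[of m] X[of n]] by linarith
    qed
    then show ?thesis by blast
  qed
  have clV: "closed V" "0 \<in> V" using V by (auto simp: closed_subspace subspace_0)
  have "\<exists>h\<in>L2_halfline V. (\<lambda>n. LINT t|hl. (norm (wd (X n) t - h t))\<^sup>2) \<longlonglongrightarrow> 0"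
  proof (rule L2_complete[OF clV])
    show "wd (X n) \<in> L2_halfline V" for n by (rule wd[OF X])
    show "\<exists>N. \<forall>m\<ge>N. \<forall>n\<ge>N. (LINT t|hl. (norm (wd (X m) t - wd (X n) t))\<^sup>2) < e" if "e > 0" for e
    proof -
      obtain N where "\<forall>m\<ge>N. \<forall>n\<ge>N. E1 (X m - X n) + E0 (X m - X n) < e" using small[OF \<open>e > 0\<close>] by blast
      moreover have "(LINT t|hl. (norm (wd (X m) t - wd (X n) t))\<^sup>2) \<le> E1 (X m - X n) + E0 (X m - X n)" for m n
        unfolding E1_diff[OF X[of m] X[of n]] by simp
      ultimately show ?thesis by (meson order_le_less_trans)
    qed
  qed
  then obtain g where g: "g \<in> L2_halfline V" "(\<lambda>n. LINT t|hl. (norm (wd (X n) t - g t))\<^sup>2) \<longlonglongrightarrow> 0" by blast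
  have "\<exists>h\<in>L2_halfline V. (\<lambda>n. LINT t|hl. (norm (X n t - h t))\<^sup>2) \<longlonglongrightarrow> 0"
  proof (rule L2_complete[OF clV])
    show "X n \<in> L2_halfline V" for n using X[of n] by (simp add: W12_0_def)
    show "\<exists>N. \<forall>m\<ge>N. \<forall>n\<ge>N. (LINT t|hl. (norm (X m t - X n t))\<^sup>2) < e" if "e > 0" for e
    proof -
      obtain N where "\<forall>m\<ge>N. \<forall>n\<ge>N. E1 (X m - X n) + E0 (X m - X n) < e" using small[OF \<open>e > 0\<close>] by blast
      moreover have "(LINT t|hl. (norm (X m t - X n t))\<^sup>2) \<le> E1 (X m - X n) + E0 (X m - X n)" for m n
        unfolding E0_diff by simp
      ultimately show ?thesis by (meson order_le_less_trans)
    qed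
  qed
  then obtain h where h: "h \<in> L2_halfline V" "(\<lambda>n. LINT t|hl. (norm (X n t - h t))\<^sup>2) \<longlonglongrightarrow> 0" by blast
  have sg: "sq_int g" and sh: "sq_int h" using g h by (auto simp: sq_int_L2)
  \<comment> \<open>A primitive rather than h itself, because membership in \<open>W12_0\<close>
    fixes the continuous representative, its value at 0 and the value 0 at negative times.\<close>
  define x where "x t = (if t < 0 then 0 else (LINT u|hl. indicator {0<..t} u *\<^sub>R g u))" for t :: real
  have ptw: "(\<lambda>n. X n t) \<longlonglongrightarrow> x t" if t: "t \<ge> 0" for t
  proof (rule tendsto_norm_sq_zero[OF g(2)])
    fix n
    have "X n t - x t = (X n t - X n 0) - x t" using H_D(2)[OF X[of n]] by simp
    also have "\<dots> = (LINT u|hl. indicator {0<..t} u *\<^sub>R wd (X n) u) - (LINT u|hl. indicator {0<..t} u *\<^sub>R g u)"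
      using t weak_derivative_FTC[OF H_D(1)[OF X] wd(3,2)[OF X], of 0 t n] by (simp add: x_def)
    also have "\<dots> = (LINT u|hl. indicator {0<..t} u *\<^sub>R (wd (X n) u - g u))"
      unfolding scaleR_diff_right
      by (intro Bochner_Integration.integral_diff[symmetric] sq_int_Icc_integrable sg wd X)
    finally have e: "X n t - x t = (LINT u|hl. indicator {0<..t} u *\<^sub>R (wd (X n) u - g u))" .
    have "(norm (X n t - x t))\<^sup>2 \<le> 1\<^sup>2 * ((t - 0) * (LINT u|hl. (norm (wd (X n) u - g u))\<^sup>2))" unfolding e
      using t by (intro test_integral_bound sq_int_diff sg wd X measurable_hl) (auto simp: indicator_def)
    then show "(norm (X n t - x t))\<^sup>2 \<le> t * (LINT u|hl. (norm (wd (X n) u - g u))\<^sup>2)" by simp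
  qed
  have xV: "x t \<in> V" if "t \<ge> 0" for t
    using closed_sequentially[OF clV(1), of "\<lambda>n. X n t" "x t"] ptw[OF that] H_D(4)[OF X that] by blast
  have xc: "continuous_on {0..} x"
  proof -
    define M where "M = (LINT u|hl. (norm (g u))\<^sup>2)"
    have inc: "(norm (x b - x a))\<^sup>2 \<le> (b - a) * M" if "0 \<le> a" "a \<le> b" for a b
    proof -
      have "x b - x a = (LINT u|hl. indicator {0<..b} u *\<^sub>R g u - indicator {0<..a} u *\<^sub>R g u)"
        using that sg by (simp add: x_def sq_int_Icc_integrable)
      also have "\<dots> = (LINT u|hl. indicator {a<..b} u *\<^sub>R g u)"
        using that by (intro Bochner_Integration.integral_cong) (auto simp: indicator_def)
      finally have e: "x b - x a = (LINT u|hl. indicator {a<..b} u *\<^sub>R g u)" .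
      have "(norm (x b - x a))\<^sup>2 \<le> 1\<^sup>2 * ((b - a) * (LINT u|hl. (norm (g u))\<^sup>2))" unfolding e
        using that by (intro test_integral_bound sg measurable_hl) (auto simp: indicator_def)
      then show ?thesis by (simp add: M_def)
    qed
    have M: "M \<ge> 0" by (simp add: M_def)
    show ?thesis unfolding continuous_on_iff
    proof (intro ballI allI impI)
      fix a e :: real assume a: "a \<in> {0..}" and e: "e > 0"
      define d where "d = e\<^sup>2 / (M + 1)"
      have d: "d > 0" using e M by (simp add: d_def)
      have "dist (x b) (x a) < e" if b: "b \<in> {0..}" "dist b a < d" for b
      proof -
        have "(norm (x b - x a))\<^sup>2 \<le> \<bar>b - a\<bar> * M"
          using inc[of a b] inc[of b a] a b by (cases "a \<le> b") (auto simp: norm_minus_commute)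
        also have "\<dots> \<le> d * M" using b M by (intro mult_right_mono) (auto simp: dist_real_def)
        also have "\<dots> < d * (M + 1)" using d by simp
        also have "\<dots> = e\<^sup>2" using M by (simp add: d_def)
        finally have "norm (x b - x a) < e" using e by (intro power2_less_imp_less[of _ e]) auto
        then show ?thesis by (simp add: dist_norm)
      qed
      then show "\<exists>d>0. \<forall>b\<in>{0..}. dist b a < d \<longrightarrow> dist (x b) (x a) < e" using d by blast
    qed
  qed
  have sX: "sq_int (X n)" for n by (rule H_D(5)[OF X])
  \<comment> \<open>L^1 convergence of the squared distances gives almost everywhere convergence of
    a subsequence to h; pointwise convergence to x then identifies the two limits.\<close>
  obtain r where r: "strict_mono r" "AE t in hl. (\<lambda>n. (norm (X (r n) t - h t))\<^sup>2) \<longlonglongrightarrow> 0"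
    using tendsto_L1_AE_subseq[of hl "\<lambda>n t. (norm (X n t - h t))\<^sup>2"] h(2)
      sq_int_integrable[OF sq_int_diff[OF sX sh]] by auto
  have xh: "AE t in hl. x t = h t"
    using r(2) AE_hl_pos
  proof eventually_elim
    case (elim t)
    have "(\<lambda>n. X (r n) t) \<longlonglongrightarrow> h t"
      by (rule tendsto_norm_sq_zero[OF elim(1), where C=1]) simp
    moreover have "(\<lambda>n. X (r n) t) \<longlonglongrightarrow> x t"
      using LIMSEQ_subseq_LIMSEQ[OF ptw r(1), of t] elim(2) by (simp add: o_def)
    ultimately show ?case by (rule LIMSEQ_unique[rotated])
  qed
  have xm: "x \<in> borel_measurable hl"
    using continuous_imp_measurable_on_sets_lebesgue[OF xc] by simp
  have sx: "sq_int x" unfolding sq_int_def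
  proof
    have "integrable hl (\<lambda>t. (norm (x t))\<^sup>2) \<longleftrightarrow> integrable hl (\<lambda>t. (norm (h t))\<^sup>2)"
      using xh xm sq_int_measurable[OF sh] by (intro integrable_cong_AE borel_measurable_power borel_measurable_norm) auto
    then show "integrable hl (\<lambda>t. (norm (x t))\<^sup>2)" using sq_int_integrable[OF sh] by simp
  qed (rule xm)
  have lx: "(\<lambda>n. LINT t|hl. (norm (X n t - x t))\<^sup>2) \<longlonglongrightarrow> 0"
  proof -
    have "(LINT t|hl. (norm (X n t - x t))\<^sup>2) = (LINT t|hl. (norm (X n t - h t))\<^sup>2)" for n
      using xh xm sq_int_measurable[OF sh] sq_int_measurable[OF sX]
      by (intro integral_cong_AE borel_measurable_power borel_measurable_norm borel_measurable_diff) auto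
    then show ?thesis using h(2) by simp
  qed
  have w: "has_weak_derivative x g"
    by (rule weak_derivative_limit[OF sX wd(3)[OF X] wd(2)[OF X] sx sg lx g(2)])
  have xL: "x \<in> L2_halfline V" using xV sx by (simp add: sq_int_L2)
  have xH: "x \<in> H" by (rule H_I[OF xL xc _ _ g(1) w]) (auto simp: x_def)
  obtain C where C: "C > 0" "\<And>x. x \<in> H \<Longrightarrow> ip x x \<le> C * (E1 x + E0 x)" using ip_upper by blast
  have "(\<lambda>n. E1 (X n - x) + E0 (X n - x)) \<longlonglongrightarrow> 0"
  proof -
    have "E1 (X n - x) = (LINT t|hl. (norm (wd (X n) t - g t))\<^sup>2)" for n
      unfolding E1_diff[OF X xH]
      using wd_unique[OF xH sg w] sq_int_measurable[OF sg] sq_int_measurable[OF wd(3)[OF X]] sq_int_measurable[OF wd(3)[OF xH]]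
      by (intro integral_cong_AE borel_measurable_power borel_measurable_norm borel_measurable_diff) auto
    then show ?thesis using tendsto_add[OF g(2) lx] by (simp add: E0_diff)
  qed
  then have "(\<lambda>n. (nrm (X n - x))\<^sup>2) \<longlonglongrightarrow> 0"
  proof (rule tendsto_zero_squeeze_le)
    have d: "X n - x \<in> H" for n using X xH by (rule H_diff(1))
    show "(nrm (X n - x))\<^sup>2 \<le> C * (E1 (X n - x) + E0 (X n - x))" for n
      unfolding nrm_sq[OF d] by (rule C(2)[OF d])
  qed simp
  then have "(\<lambda>n. sqrt ((nrm (X n - x))\<^sup>2)) \<longlonglongrightarrow> sqrt 0" by (rule tendsto_real_sqrt)
  then have "conv X x" using X xH by (simp add: conv_def)
  then show ?thesis using xH by blast
qed

sublocale hilbert_on H ip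
  by unfold_locales (rule H_complete)

section \<open>Integration of symmetric cross terms\<close>

lemma (in -) integral_Ioc_eq_Icc:
  assumes "sq_int g"
  shows "(LINT t|hl. indicator {a<..b} t * (norm (g t))\<^sup>2) = (LINT t|hl. indicator {a..b} t * (norm (g t))\<^sup>2)"
    "integrable hl (\<lambda>t. indicator {a<..b} t * (norm (g t))\<^sup>2)"
proof -
  note [measurable] = sq_int_measurable[OF assms]
  have [measurable]: "(\<lambda>t. indicator {a<..b} t :: real) \<in> borel_measurable hl" "(\<lambda>t. indicator {a..b} t :: real) \<in> borel_measurable hl"
    by (rule measurable_hl, simp)+
  have m: "(\<lambda>t. indicator {a<..b} t * (norm (g t))\<^sup>2) \<in> borel_measurable hl" by measurable
  have m': "(\<lambda>t. indicator {a..b} t * (norm (g t))\<^sup>2) \<in> borel_measurable hl" by measurable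
  have "AE t in lborel. t \<noteq> a" by (rule AE_lborel_singleton)
  then have "AE t in hl. t \<noteq> a" by (intro AE_lebesgue_hl AE_completion)
  then have ae: "AE t in hl. indicator {a<..b} t * (norm (g t))\<^sup>2 = indicator {a..b} t * (norm (g t))\<^sup>2"
    by eventually_elim (simp add: indicator_def)
  show "(LINT t|hl. indicator {a<..b} t * (norm (g t))\<^sup>2) = (LINT t|hl. indicator {a..b} t * (norm (g t))\<^sup>2)"
    by (rule integral_cong_AE[OF m m' ae])
  show "integrable hl (\<lambda>t. indicator {a<..b} t * (norm (g t))\<^sup>2)"
    using integrable_cong_AE[OF m m' ae] sq_int_Icc_integrable(4)[OF assms] by simp
qed

text \<open>The chain rule for \<open>k(x, x)\<close>, obtained by telescoping: over an interval of length \<open>h\<close> the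
  defect is at most \<open>h\<close> times the energy of \<open>x\<close> on it, so it vanishes as the subdivision is refined.\<close>

lemma quadratic_FTC:
  fixes k :: "'a \<Rightarrow> 'a \<Rightarrow> real"
  assumes x: "x \<in> H" and k: "bilinear k" "\<And>u w. k u w = k w u" and ab: "0 \<le> a" "a \<le> b"
  shows "k (x b) (x b) - k (x a) (x a) = 2 * (LINT t|hl. indicator {a<..b} t * k (x t) (wd x t))"
proof -
  define g where "g = wd x"
  note sx = H_D(5)[OF x] and sg = wd(3)[OF x, folded g_def] and xc = H_D(1)[OF x] and wg = wd(2)[OF x, folded g_def]
  define e where "e s t = (LINT u|hl. indicator {s<..t} u * (norm (g u))\<^sup>2)" for s t
  have ik: "integrable hl (\<lambda>u. k (x u) (g u))" by (rule adm_integrable[OF adm_const[OF k(1)] sx sg])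
  have iki: "integrable hl (\<lambda>u. indicator {s<..t} u * k (x u) (g u))" for s t
  proof (rule Bochner_Integration.integrable_bound[OF ik])
    have "(\<lambda>u. indicator {s<..t} u :: real) \<in> borel_measurable hl" by (rule measurable_hl) simp
    then show "(\<lambda>u. indicator {s<..t} u * k (x u) (g u)) \<in> borel_measurable hl" 
      by (intro borel_measurable_times borel_measurable_integrable[OF ik])
  qed (auto simp: indicator_def)
  define D where "D s t = k (x t) (x t) - k (x s) (x s) - 2 * (LINT u|hl. indicator {s<..t} u * k (x u) (g u))" for s t
  obtain B where B: "B > 0" "\<And>u w. \<bar>k u w\<bar> \<le> B * norm u * norm w"
    using bilinear_bounded_pos[OF k(1)] by auto
  have Dadd: "D s u = D s t + D t u" if "s \<le> t" "t \<le> u" for s t u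
  proof -
    have "(LINT r|hl. indicator {s<..u} r * k (x r) (g r))
      = (LINT r|hl. indicator {s<..t} r * k (x r) (g r) + indicator {t<..u} r * k (x r) (g r))"
      using that by (intro Bochner_Integration.integral_cong) (auto simp: indicator_def)
    then show ?thesis using iki by (simp add: D_def)
  qed
  have eadd: "e s u = e s t + e t u" if "s \<le> t" "t \<le> u" for s t u
  proof -
    have "e s u = (LINT r|hl. indicator {s<..t} r * (norm (g r))\<^sup>2 + indicator {t<..u} r * (norm (g r))\<^sup>2)"
      unfolding e_def using that by (intro Bochner_Integration.integral_cong) (auto simp: indicator_def)
    then show ?thesis using integral_Ioc_eq_Icc(2)[OF sg] by (simp add: e_def)
  qed
  have e0: "0 \<le> e s t" for s t by (simp add: e_def)
  have Dle: "\<bar>D s t\<bar> \<le> 2 * B * (t - s) * e s t" if st: "0 \<le> s" "s \<le> t" for s t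
  proof -
    have inc: "(norm (x v - x u))\<^sup>2 \<le> (t - s) * e s t" if "s \<le> u" "u \<le> v" "v \<le> t" for u v
    proof -
      have "(norm (x v - x u))\<^sup>2 \<le> (v - u) * (LINT r|hl. indicator {u..v} r * (norm (g r))\<^sup>2)"
        using that st by (intro weak_derivative_increment xc sg wg) auto
      also have "\<dots> = (v - u) * e u v" by (simp add: e_def integral_Ioc_eq_Icc[OF sg])
      also have "\<dots> \<le> (t - s) * e s t"
        using that eadd[of s u t] eadd[of u v t] e0[of s u] e0[of v t] e0[of u v] by (intro mult_mono) auto
      finally show ?thesis .
    qed
    define q where "q = sqrt ((t - s) * e s t)"
    have q: "q \<ge> 0" "q\<^sup>2 = (t - s) * e s t" using st e0 by (simp_all add: q_def)
    have incq: "norm (x v - x u) \<le> q" if "s \<le> u" "u \<le> v" "v \<le> t" for u v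
      by (rule power2_le_imp_le[OF _ q(1)], unfold q(2), rule inc[OF that])
    \<comment> \<open>For symmetric k the increment of k(x, x) over [s, t] is exactly k w (x t - x
      s). Inside the interval, w - 2 x u is the difference of the two increments x t - x u and x u -
      x s, hence of norm at most 2q.\<close>
    define w where "w = x t + x s"
    have lin: "bounded_linear (k w)" using k(1) by (simp add: bilinear_def linear_conv_bounded_linear)
    have igw: "integrable hl (\<lambda>u. indicator {s<..t} u * k w (g u))"
    proof -
      have "integrable hl (\<lambda>u. k w (indicator {s<..t} u *\<^sub>R g u))"
        by (rule integrable_bounded_linear[OF lin sq_int_Icc_integrable(2)[OF sg]])
      then show ?thesis by (simp add: bilinear_rmul[OF k(1)])
    qed
    have ik2: "integrable hl (\<lambda>u. 2 * (indicator {s<..t} u * k (x u) (g u)))"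
      using iki[of s t] by simp
    have "k (x t) (x t) - k (x s) (x s) = k w (x t - x s)"
      by (simp add: w_def bilinear_ladd[OF k(1)] bilinear_rsub[OF k(1)] k(2)[of "x s" "x t"])
    also have "x t - x s = (LINT u|hl. indicator {s<..t} u *\<^sub>R g u)"
      using st by (intro weak_derivative_FTC xc sg wg)
    also have "k w \<dots> = (LINT u|hl. k w (indicator {s<..t} u *\<^sub>R g u))"
      by (rule integral_bounded_linear[OF lin sq_int_Icc_integrable(2)[OF sg], symmetric])
    also have "\<dots> = (LINT u|hl. indicator {s<..t} u * k w (g u))" by (simp add: bilinear_rmul[OF k(1)])
    finally have "D s t = (LINT u|hl. indicator {s<..t} u * k w (g u)) - (LINT u|hl. 2 * (indicator {s<..t} u * k (x u) (g u)))"
      by (simp add: D_def)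
    also have "\<dots> = (LINT u|hl. indicator {s<..t} u * k w (g u) - 2 * (indicator {s<..t} u * k (x u) (g u)))"
      by (rule Bochner_Integration.integral_diff[OF igw ik2, symmetric])
    finally have Deq: "D s t = (LINT u|hl. indicator {s<..t} u * k w (g u) - 2 * (indicator {s<..t} u * k (x u) (g u)))" .
    have "\<bar>D s t\<bar> \<le> (LINT u|hl. \<bar>indicator {s<..t} u * k w (g u) - 2 * (indicator {s<..t} u * k (x u) (g u))\<bar>)"
      unfolding Deq by (rule integral_abs_bound)
    also have "\<dots> \<le> (LINT u|hl. 2 * B * q * (indicator {s..t} u * norm (g u)))"
    proof (rule integral_mono)
      show "integrable hl (\<lambda>u. \<bar>indicator {s<..t} u * k w (g u) - 2 * (indicator {s<..t} u * k (x u) (g u))\<bar>)"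
        by (rule integrable_abs, rule Bochner_Integration.integrable_diff[OF igw ik2])
      show "integrable hl (\<lambda>u. 2 * B * q * (indicator {s..t} u * norm (g u)))"
        by (intro integrable_mult_right sq_int_Icc_integrable sg)
      fix u
      show "\<bar>indicator {s<..t} u * k w (g u) - 2 * (indicator {s<..t} u * k (x u) (g u))\<bar> \<le> 2 * B * q * (indicator {s..t} u * norm (g u))"
      proof (cases "u \<in> {s<..t}")
        case True
        have "k w (g u) - 2 * k (x u) (g u) = k ((x t - x u) - (x u - x s)) (g u)"
          by (simp add: w_def bilinear_ladd[OF k(1)] bilinear_lsub[OF k(1)])
        also have "\<bar>\<dots>\<bar> \<le> B * norm ((x t - x u) - (x u - x s)) * norm (g u)" by (rule B)
        also have "\<dots> \<le> B * (2 * q) * norm (g u)"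
        proof -
          have "norm ((x t - x u) - (x u - x s)) \<le> q + q"
            using norm_triangle_ineq4[of "x t - x u" "x u - x s"] incq[of u t] incq[of s u] True by simp
          then show ?thesis using B(1) by (intro mult_right_mono mult_left_mono) auto
        qed
        finally show ?thesis using True by simp
      next
        case False
        then show ?thesis using B q by (simp add: indicator_def)
      qed
    qed
    also have "\<dots> = 2 * B * q * (LINT u|hl. indicator {s..t} u * norm (g u))" by simp
    also have "\<dots> \<le> 2 * B * q * q"
    proof -
      have "(LINT u|hl. indicator {s..t} u * norm (g u))\<^sup>2 \<le> q\<^sup>2"
        using integral_Icc_sq_le[OF sg st] by (simp add: q(2) e_def integral_Ioc_eq_Icc[OF sg])
      then have "(LINT u|hl. indicator {s..t} u * norm (g u)) \<le> q" using q(1) by (rule power2_le_imp_le)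
      then show ?thesis using B(1) q(1) by (intro mult_left_mono) auto
    qed
    also have "\<dots> = 2 * B * (t - s) * e s t" using q(2) by (simp add: power2_eq_square mult.assoc)
    finally show ?thesis .
  qed
  \<comment> \<open>Over i steps the defects add up to h times the total energy, with the step
    length h still in front as a factor.\<close>
  have sub: "\<bar>D a (a + real i * h)\<bar> \<le> 2 * B * h * e a (a + real i * h)" if h: "h \<ge> 0" for i h
  proof (induction i)
    case 0
    then show ?case by (simp add: D_def e_def)
  next
    case (Suc i)
    let ?m = "a + real i * h" and ?n = "a + real (Suc i) * h"
    have le: "a \<le> ?m" "?m \<le> ?n" using h by (simp_all add: algebra_simps)
    have "\<bar>D a ?n\<bar> \<le> \<bar>D a ?m\<bar> + \<bar>D ?m ?n\<bar>" using Dadd[OF le] by simp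
    also have "\<dots> \<le> 2 * B * h * e a ?m + 2 * B * (?n - ?m) * e ?m ?n"
      using Suc le ab by (intro add_mono Dle) auto
    also have "?n - ?m = h" by (simp add: algebra_simps)
    also have "2 * B * h * e a ?m + 2 * B * h * e ?m ?n = 2 * B * h * e a ?n"
      using eadd[OF le] by (simp add: distrib_left)
    finally show ?case .
  qed
  have "\<bar>D a b\<bar> \<le> (2 * B * (b - a) * e a b) * inverse (real (Suc n))" for n
  proof -
    have "a + real (Suc n) * ((b - a) / real (Suc n)) = b" by simp
    then show ?thesis using sub[of "(b - a) / real (Suc n)" "Suc n"] ab
      by (simp only:) (simp add: field_simps)
  qed
  then have "(\<lambda>n. \<bar>D a b\<bar>) \<longlonglongrightarrow> 0"
    by (intro tendsto_zero_squeeze_le[OF LIMSEQ_inverse_real_of_nat]) auto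
  then have "D a b = 0" by (simp add: LIMSEQ_const_iff)
  then show ?thesis by (simp add: D_def g_def)
qed

text \<open>As b grows, k(x b, x b) converges to twice the integral. A nonzero limit would keep |x
  b|^2 away from 0 near infinity, against square integrability of x.\<close>

lemma quadratic_FTC_tail:
  fixes k :: "'a \<Rightarrow> 'a \<Rightarrow> real"
  assumes x: "x \<in> H" and k: "bilinear k" "\<And>u w. k u w = k w u" and a: "0 \<le> a" "x a = 0"
  shows "(LINT t|hl. indicator {a<..} t * k (x t) (wd x t)) = 0"
    and "integrable hl (\<lambda>t. indicator {a<..} t * k (x t) (wd x t))"
proof -
  let ?F = "\<lambda>t. k (x t) (wd x t)"
  have iF: "integrable hl ?F" by (rule adm_integrable[OF adm_const[OF k(1)] H_D(5)[OF x] wd(3)[OF x]])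
  have mi: "(\<lambda>u. indicator A u :: real) \<in> borel_measurable hl" if "A \<in> sets borel" for A
    using that by (intro measurable_hl) simp
  have ii: "integrable hl (\<lambda>t. indicator A t * ?F t)" if "A \<in> sets borel" for A
    using borel_measurable_integrable[OF iF] mi[OF that]
    by (intro Bochner_Integration.integrable_bound[OF iF] borel_measurable_times) (auto simp: indicator_def)
  show "integrable hl (\<lambda>t. indicator {a<..} t * ?F t)" by (rule ii) simp
  define I where "I = (LINT t|hl. indicator {a<..} t * ?F t)"
  have "((\<lambda>b. LINT t|hl. indicator {a<..b} t * ?F t) \<longlongrightarrow> I) at_top" unfolding I_def
  proof (rule integral_dominated_convergence_at_top)
    show "integrable hl (\<lambda>t. \<bar>?F t\<bar>)" using iF by simp
    show "\<forall>\<^sub>F b in at_top. AE t in hl. norm (indicator {a<..b} t * ?F t) \<le> \<bar>?F t\<bar>"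
      by (intro always_eventually) (auto simp: indicator_def)
    show "AE t in hl. ((\<lambda>b. indicator {a<..b} t * ?F t) \<longlongrightarrow> indicator {a<..} t * ?F t) at_top"
    proof (rule AE_I2)
      fix t
      have "\<forall>\<^sub>F b in at_top. indicator {a<..b} t * ?F t = indicator {a<..} t * ?F t"
        using eventually_ge_at_top[of t] by eventually_elim (simp add: indicator_def)
      then show "((\<lambda>b. indicator {a<..b} t * ?F t) \<longlongrightarrow> indicator {a<..} t * ?F t) at_top"
        by (rule tendsto_eventually)
    qed
  qed (use ii in \<open>auto intro!: borel_measurable_integrable\<close>)
  then have "((\<lambda>b. 2 * (LINT t|hl. indicator {a<..b} t * ?F t)) \<longlongrightarrow> 2 * I) at_top" by (intro tendsto_intros)
  moreover have "\<forall>\<^sub>F b in at_top. 2 * (LINT t|hl. indicator {a<..b} t * ?F t) = k (x b) (x b)"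
    using eventually_ge_at_top[of a]
  proof eventually_elim
    case (elim b)
    then show ?case using quadratic_FTC[OF x k a(1) elim] bilinear_lzero[OF k(1)] by (simp add: a(2))
  qed
  ultimately have lim: "((\<lambda>b. k (x b) (x b)) \<longlongrightarrow> 2 * I) at_top" by (rule Lim_transform_eventually)
  obtain B where B: "B > 0" "\<And>u w. \<bar>k u w\<bar> \<le> B * norm u * norm w"
    using bilinear_bounded_pos[OF k(1)] by auto
  show "(LINT t|hl. indicator {a<..} t * ?F t) = 0"
  proof (rule ccontr)
    assume "(LINT t|hl. indicator {a<..} t * ?F t) \<noteq> 0"
    then have I: "\<bar>I\<bar> > 0" by (simp add: I_def)
    have "\<forall>\<^sub>F b in at_top. dist (k (x b) (x b)) (2 * I) < \<bar>I\<bar>" using lim I by (rule tendstoD)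
    then obtain N where N: "\<And>b. b \<ge> N \<Longrightarrow> dist (k (x b) (x b)) (2 * I) < \<bar>I\<bar>"
      by (auto simp: eventually_at_top_linorder)
    define M where "M = max 0 N"
    have low: "\<bar>I\<bar> / B \<le> (norm (x t))\<^sup>2" if "t \<ge> M" for t
    proof -
      have "\<bar>I\<bar> \<le> \<bar>k (x t) (x t)\<bar>" using N[of t] that by (auto simp: M_def dist_real_def)
      also have "\<dots> \<le> B * (norm (x t))\<^sup>2" using B(2)[of "x t" "x t"] by (simp add: power2_eq_square mult.assoc)
      finally show ?thesis using B(1) by (simp add: field_simps)
    qed
    have "real n * (\<bar>I\<bar> / B) \<le> E0 x" for n
    proof -
      have "(LINT t|hl. (\<bar>I\<bar> / B) * indicator {M..M + real n} t) \<le> E0 x" unfolding E0_def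
      proof (rule integral_mono)
        show "integrable hl (\<lambda>t. (\<bar>I\<bar> / B) * indicator {M..M + real n} t)"
          by (intro integrable_mult_right integrable_hl_Icc)
        show "integrable hl (\<lambda>t. (norm (x t))\<^sup>2)" by (rule sq_int_integrable[OF H_D(5)[OF x]])
        show "(\<bar>I\<bar> / B) * indicator {M..M + real n} t \<le> (norm (x t))\<^sup>2" for t
          using low[of t] by (simp add: indicator_def)
      qed
      moreover have "(LINT t|hl. indicator {M..M + real n} t) = real n"
        using integral_hl_Icc[of M "M + real n"] by (simp add: M_def)
      ultimately show ?thesis by (simp add: mult.commute)
    qed
    moreover have "\<bar>I\<bar> / B > 0" using I B by simp
    ultimately show False by (meson linorder_not_le reals_Archimedean3)
  qed
qed

section \<open>Coefficients with limits at infinity and the positive case\<close>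

lemma (in -) bilinear_tendsto_uniform:
  fixes k :: "real \<Rightarrow> 'a::euclidean_space \<Rightarrow> 'a \<Rightarrow> real"
  assumes k: "\<And>t. bilinear (k t)" "bilinear kl" and l: "\<And>u w. ((\<lambda>t. k t u w) \<longlongrightarrow> kl u w) at_top" and e: "e > 0"
  shows "\<exists>T. \<forall>t\<ge>T. \<forall>u w. \<bar>k t u w - kl u w\<bar> \<le> e * norm u * norm w"
proof -
  define S where "S t = (\<Sum>i\<in>Basis. \<Sum>j\<in>Basis. \<bar>k t i j - kl i j\<bar>)" for t
  have "(S \<longlongrightarrow> (\<Sum>i\<in>Basis. \<Sum>j\<in>Basis. \<bar>kl i j - kl i j\<bar>)) at_top" unfolding S_def
    by (intro tendsto_intros l)
  then have "(S \<longlongrightarrow> 0) at_top" by simp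
  then have "\<forall>\<^sub>F t in at_top. S t < e" using e by (rule order_tendstoD)
  then obtain T where T: "\<And>t. t \<ge> T \<Longrightarrow> S t < e" by (auto simp: eventually_at_top_linorder)
  have "\<bar>k t u w - kl u w\<bar> \<le> e * norm u * norm w" if "t \<ge> T" for t u w
  proof -
    have rep: "b u w = (\<Sum>i\<in>Basis. \<Sum>j\<in>Basis. (u \<bullet> i) * ((w \<bullet> j) * b i j))" if b: "bilinear b" for b :: "'a \<Rightarrow> 'a \<Rightarrow> real"
    proof -
      have "b u w = b (\<Sum>i\<in>Basis. (u \<bullet> i) *\<^sub>R i) (\<Sum>j\<in>Basis. (w \<bullet> j) *\<^sub>R j)"
        by (simp add: euclidean_representation)
      also have "\<dots> = (\<Sum>(i,j)\<in>Basis \<times> Basis. b ((u \<bullet> i) *\<^sub>R i) ((w \<bullet> j) *\<^sub>R j))"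
        by (rule bilinear_sum[OF b])
      finally show ?thesis
        by (simp add: bilinear_lmul[OF b] bilinear_rmul[OF b] sum.cartesian_product mult.left_commute)
    qed
    have "k t u w - kl u w = (\<Sum>i\<in>Basis. \<Sum>j\<in>Basis. (u \<bullet> i) * ((w \<bullet> j) * (k t i j - kl i j)))"
      unfolding rep[OF k(1)] rep[OF k(2)] by (simp add: sum_subtractf right_diff_distrib)
    also have "\<bar>\<dots>\<bar> \<le> (\<Sum>i\<in>Basis. \<Sum>j\<in>Basis. (norm u * norm w) * \<bar>k t i j - kl i j\<bar>)"
    proof (intro order_trans[OF sum_abs] sum_mono)
      fix i j :: 'a assume ij: "i \<in> Basis" "j \<in> Basis"
      have "\<bar>u \<bullet> i\<bar> * \<bar>w \<bullet> j\<bar> \<le> norm u * norm w" using ij by (intro mult_mono Basis_le_norm) auto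
      then show "\<bar>(u \<bullet> i) * ((w \<bullet> j) * (k t i j - kl i j))\<bar> \<le> (norm u * norm w) * \<bar>k t i j - kl i j\<bar>"
        by (simp add: abs_mult mult_right_mono flip: mult.assoc)
    qed
    also have "\<dots> = S t * (norm u * norm w)" by (simp add: S_def sum_distrib_left mult.commute)
    also have "\<dots> \<le> e * (norm u * norm w)" using T[OF that] by (intro mult_right_mono) auto
    finally show ?thesis by (simp add: mult.assoc)
  qed
  then show ?thesis by blast
qed

definition lim_form :: "(real \<Rightarrow> 'a \<Rightarrow> 'a \<Rightarrow> real) \<Rightarrow> ('a \<Rightarrow> 'a \<Rightarrow> real) \<Rightarrow> bool" where
  "lim_form p q \<longleftrightarrow> adm p \<and> bilinear q \<and> (\<forall>u w. ((\<lambda>t. p t u w) \<longlongrightarrow> q u w) at_top)"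

lemma lim_form_uniform:
  assumes "lim_form p q" "e > 0"
  shows "\<exists>T. \<forall>t\<ge>T. \<forall>u w. \<bar>p t u w - q u w\<bar> \<le> e * norm u * norm w"
  using assms by (intro bilinear_tendsto_uniform) (auto simp: lim_form_def adm_def)

lemma E_le_nrm: assumes "x \<in> H" shows "E1 x \<le> (nrm x)\<^sup>2 / c0" "E0 x \<le> (nrm x)\<^sup>2 / c0"
proof -
  have "c0 * (E1 x + E0 x) \<le> (nrm x)\<^sup>2" using ip_lower[OF assms] nrm_sq[OF assms] by simp
  then have "E1 x + E0 x \<le> (nrm x)\<^sup>2 / c0" using c0 by (simp add: field_simps)
  then show "E1 x \<le> (nrm x)\<^sup>2 / c0" "E0 x \<le> (nrm x)\<^sup>2 / c0" using E_nonneg[of x] by linarith+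
qed

text \<open>\<open>bf_bound\<close> controls the form by the sum of the two energies; evaluated at
  both arguments divided by their norms it becomes the product bound that
  \<open>sym_form_operator\<close> asks for.\<close>

lemma bf_operator:
  assumes a: "adm p" "adm k" "adm l" and sym: "\<And>t u w. p t u w = p t w u" "\<And>t u w. l t u w = l t w u"
  shows "\<exists>A. bounded_operator_on H ip A \<and> selfadjoint_on H ip A \<and> (\<forall>x\<in>H. \<forall>y\<in>H. ip (A x) y = bf p k l x y)"
proof -
  obtain C where C: "C \<ge> 0" "\<And>x z. x \<in> H \<Longrightarrow> z \<in> H \<Longrightarrow> \<bar>bf p k l x z\<bar> \<le> C * ((E1 x + E0 x) + (E1 z + E0 z))"
    using bf_bound[OF a] by blast
  have 0: "bf p k l x z = 0" if "x \<in> H" "z \<in> H" "x = 0" for x z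
    using bf_scale[OF a that(1,2), of 0] that(3) by simp
  have "\<bar>bf p k l x z\<bar> \<le> 4 * C / c0 * nrm x * nrm z" if H: "x \<in> H" "z \<in> H" for x z
  proof (cases "x = 0 \<or> z = 0")
    case True
    then show ?thesis using 0[OF H] 0[OF H(2,1)] bf_sym[OF sym, where k=k and x=x and z=z] H by auto
  next
    case False
    then have pos: "nrm x > 0" "nrm z > 0" using nrm_eq_0 nrm_ge_0 H by (metis order_le_less)+
    let ?x = "(1 / nrm x) *\<^sub>R x" and ?z = "(1 / nrm z) *\<^sub>R z"
    have m: "?x \<in> H" "?z \<in> H" using H by auto
    have n: "nrm ?x = 1" "nrm ?z = 1" using pos H by (simp_all add: nrm_scale)
    have "bf p k l ?x ?z = (1 / nrm x) * bf p k l x ?z" using H m by (intro bf_scale a)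
    also have "bf p k l x ?z = bf p k l ?z x" by (rule bf_sym[OF sym])
    also have "\<dots> = (1 / nrm z) * bf p k l z x" using H m by (intro bf_scale a)
    also have "bf p k l z x = bf p k l x z" by (rule bf_sym[OF sym])
    finally have e: "bf p k l ?x ?z = bf p k l x z / (nrm x * nrm z)" by simp
    have "\<bar>bf p k l ?x ?z\<bar> \<le> C * ((E1 ?x + E0 ?x) + (E1 ?z + E0 ?z))" by (rule C(2)[OF m])
    also have "\<dots> \<le> C * ((1 / c0 + 1 / c0) + (1 / c0 + 1 / c0))"
      using E_le_nrm[OF m(1)] E_le_nrm[OF m(2)] C(1) by (intro mult_left_mono add_mono) (simp_all add: n)
    also have "\<dots> = 4 * C / c0" by simp
    finally have "\<bar>bf p k l x z\<bar> / (nrm x * nrm z) \<le> 4 * C / c0"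
      unfolding e using pos by (simp add: abs_mult)
    then show ?thesis using pos by (simp add: divide_le_eq mult.assoc)
  qed
  then show ?thesis using bf_sym[OF sym, where k=k]
    by (intro sym_form_operator[of "bf p k l" "4 * C / c0"] bf_add[OF a] bf_scale[OF a]) auto
qed

text \<open>Every t in [0, L] lies at most one mesh width to the right of a zero of x, so the
  1/2-Hoelder estimate applies. The constant is the mesh width and becomes as small as
  desired.\<close>

lemma zero_on_grid_bound:
  assumes x: "x \<in> H" and L: "L > 0" and z: "\<And>j. j \<le> Suc n \<Longrightarrow> x (real j * (L / Suc n)) = 0"
    and t: "0 \<le> t" "t \<le> L"
  shows "(norm (x t))\<^sup>2 \<le> (L / Suc n) * E1 x"
proof -
  define h where "h = L / Suc n"
  have h: "h > 0" using L by (simp add: h_def)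
  \<comment> \<open>Index of the last grid point not after t.\<close>
  define j where "j = nat \<lfloor>t / h\<rfloor>"
  have j1: "real j \<le> t / h" "t / h < real j + 1" using t h by (simp_all add: j_def)
  then have j: "real j * h \<le> t" "t - real j * h \<le> h" using h by (simp_all add: field_simps)
  have "t / h \<le> L / h" using t h by (intro divide_right_mono) auto
  also have "L / h = Suc n" using L by (simp add: h_def)
  finally have "real j \<le> Suc n" using j1 by linarith
  then have "x (real j * h) = 0" using z[of j] by (simp add: h_def)
  then have "(norm (x t))\<^sup>2 \<le> (t - real j * h) * E1 x"
    using pointwise_bound[OF x _ j(1)] h by simp
  also have "\<dots> \<le> h * E1 x" using j by (intro mult_right_mono) auto
  finally show ?thesis by (simp add: h_def)
qed

text \<open>Beyond L the coefficients k and l are within c/8 of their limits, and the limit cross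
  term integrates to 0 because x L = 0; before L the bounded lower order terms are absorbed by the
  derivative term through the grid zeros. Positivity of p is asked for t > 0 only, since the lifted
  coefficients are 0 up to time 0.\<close>

theorem fredholm_of_positive:
  assumes p: "adm p" and k: "lim_form k kl" and l: "lim_form l ll"
    and sym: "\<And>t u w. p t u w = p t w u" "\<And>t u w. l t u w = l t w u" "\<And>u w. kl u w = kl w u"
    and c: "c > 0" and cp: "\<And>t v. 0 < t \<Longrightarrow> v \<in> V \<Longrightarrow> c * (norm v)\<^sup>2 \<le> p t v v"
    and cl: "\<And>v. v \<in> V \<Longrightarrow> c * (norm v)\<^sup>2 \<le> ll v v"
  shows "fredholm_form_on H ip (\<lambda>x. bf p k l x x)"
proof -
  have a: "adm p" "adm k" "adm l" using p k l by (auto simp: lim_form_def)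
  obtain A where A: "bounded_operator_on H ip A" "selfadjoint_on H ip A"
    "\<And>x y. x \<in> H \<Longrightarrow> y \<in> H \<Longrightarrow> ip (A x) y = bf p k l x y"
    using bf_operator[OF a sym(1,2)] by blast
  obtain T1 where T1: "\<And>t u w. t \<ge> T1 \<Longrightarrow> \<bar>k t u w - kl u w\<bar> \<le> (c/8) * norm u * norm w"
    using lim_form_uniform[OF k, of "c/8"] c by auto
  obtain T2 where T2: "\<And>t u w. t \<ge> T2 \<Longrightarrow> \<bar>l t u w - ll u w\<bar> \<le> (c/8) * norm u * norm w"
    using lim_form_uniform[OF l, of "c/8"] c by auto
  define L where "L = max 1 (max T1 T2)"
  have L: "L > 0" "T1 \<le> L" "T2 \<le> L" by (auto simp: L_def)
  obtain C1 C2 where C1: "\<And>t u w. \<bar>k t u w\<bar> \<le> C1 * norm u * norm w" and C2: "\<And>t u w. \<bar>l t u w\<bar> \<le> C2 * norm u * norm w"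
    using a unfolding adm_def by metis
  define C where "C = \<bar>C1\<bar> + \<bar>C2\<bar>"
  have CC: "\<bar>k t u w\<bar> \<le> C * (norm u * norm w)" "\<bar>l t u w\<bar> \<le> C * (norm u * norm w)" for t u w
  proof -
    have "\<bar>k t u w\<bar> \<le> C1 * (norm u * norm w)" "\<bar>l t u w\<bar> \<le> C2 * (norm u * norm w)"
      using C1[of t u w] C2[of t u w] by (simp_all add: mult.assoc)
    moreover have "C1 * (norm u * norm w) \<le> C * (norm u * norm w)" "C2 * (norm u * norm w) \<le> C * (norm u * norm w)"
      by (intro mult_right_mono; simp add: C_def)+
    ultimately show "\<bar>k t u w\<bar> \<le> C * (norm u * norm w)" "\<bar>l t u w\<bar> \<le> C * (norm u * norm w)" by linarith+
  qed
  have C0: "C \<ge> 0" by (simp add: C_def)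
  \<comment> \<open>The price of x on [0, L]: 2 C^2 / c from absorbing the cross term into half of
    the derivative term, C from l, and c/2 so that a share of |x|^2 survives there as well.\<close>
  define K where "K = 2 * C\<^sup>2 / c + C + c / 2"
  have K: "K \<ge> 0" using C0 c by (simp add: K_def)
  \<comment> \<open>The mesh is so fine that the total error K e L on [0, L] costs at most (c/4)
    \<open>E1 x\<close>.\<close>
  obtain n where n: "K * L\<^sup>2 * 4 / c \<le> real (Suc n)"
    using real_arch_simple[of "K * L\<^sup>2 * 4 / c"] by (meson le_SucI of_nat_mono order_trans le_refl)
  define pt where "pt j = real j * (L / Suc n)" for j
  have pt: "pt j \<ge> 0" for j using L by (simp add: pt_def)
  define Fs where "Fs = (\<lambda>(j, b) x. x (pt j) \<bullet> b) ` ({..Suc n} \<times> (Basis :: 'a set))"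
  have coer: "(c / 4) * (E1 x + E0 x) \<le> bf p k l x x" if x: "x \<in> H" and F: "\<forall>f\<in>Fs. f x = 0" for x
  proof -
    have z: "x (pt j) = 0" if "j \<le> Suc n" for j
    proof (rule euclidean_eqI)
      fix b :: 'a assume "b \<in> Basis"
      then have "(\<lambda>x. x (pt j) \<bullet> b) \<in> Fs" using that unfolding Fs_def by force
      then show "x (pt j) \<bullet> b = 0 \<bullet> b" using F by force
    qed
    have xL: "x L = 0" using z[of "Suc n"] by (simp add: pt_def)
    define g where "g = wd x"
    note sx = H_D(5)[OF x] and sg = wd(3)[OF x, folded g_def]
    define e where "e = (L / Suc n) * E1 x"
    have kl: "bilinear kl" using k by (simp add: lim_form_def)
    have tail: "(LINT t|hl. indicator {L<..} t * kl (x t) (g t)) = 0"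
      "integrable hl (\<lambda>t. indicator {L<..} t * kl (x t) (g t))"
      using quadratic_FTC_tail[OF x kl sym(3) _ xL] L by (simp_all add: g_def)
    let ?I = "\<lambda>t. p t (g t) (g t) + (k t (x t) (g t) + k t (x t) (g t)) + l t (x t) (x t)"
    \<comment> \<open>Pointwise lower bound of the integrand. The term with kl beyond L is kept
      exactly, since it has integral 0; the last term is the constant loss on [0, L].\<close>
    let ?J = "\<lambda>t. (c/2) * ((norm (g t))\<^sup>2 + (norm (x t))\<^sup>2) + 2 * (indicator {L<..} t * kl (x t) (g t)) - K * e * indicator {0..L} t"
    have iI: "integrable hl ?I" using bf_integrable[OF a x x] by (simp add: g_def)
    have iJ: "integrable hl ?J"
      by (intro Bochner_Integration.integrable_add Bochner_Integration.integrable_diff integrable_mult_right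
          sq_int_integrable sx sg tail(2) integrable_hl_Icc)
    have pw: "?J t \<le> ?I t" if t: "t > 0" for t
    proof -
      define X where "X = norm (x t)"
      define Y where "Y = norm (g t)"
      have xV: "x t \<in> V" "g t \<in> V" using t by (auto simp: g_def intro: H_D(4)[OF x] wd(4)[OF x])
      have P: "c * Y\<^sup>2 \<le> p t (g t) (g t)" unfolding Y_def using t xV by (intro cp)
      show ?thesis
      proof (cases "t \<le> L")
        case True
        have bx: "X\<^sup>2 \<le> e" unfolding X_def e_def
          using zero_on_grid_bound[OF x L(1), of n t] z True t by (simp add: pt_def)
        have k1: "- (C * (X * Y)) \<le> k t (x t) (g t)" using CC(1)[of t "x t" "g t"] by (simp add: X_def Y_def)
        have l1: "- (C * X\<^sup>2) \<le> l t (x t) (x t)" using CC(2)[of t "x t" "x t"] by (simp add: X_def power2_eq_square)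
        \<comment> \<open>The square is completed so that the cross term 2 C X Y costs half of the
          available c Y^2.\<close>
        have "0 \<le> (c / 2) * (Y - (2 * C / c) * X)\<^sup>2" using c by simp
        also have "\<dots> = (c/2) * Y\<^sup>2 - 2 * (C * (X * Y)) + (2 * C\<^sup>2 / c) * X\<^sup>2"
          using c by (simp add: power2_eq_square field_simps)
        finally have am: "2 * (C * (X * Y)) \<le> (c/2) * Y\<^sup>2 + (2 * C\<^sup>2 / c) * X\<^sup>2" by linarith
        have Ke: "K * X\<^sup>2 \<le> K * e" using bx K by (rule mult_left_mono)
        have "?J t = (c/2) * Y\<^sup>2 + (c/2) * X\<^sup>2 - K * e" using True t by (simp add: X_def Y_def distrib_left)
        also have "\<dots> \<le> (c/2) * Y\<^sup>2 + (c/2) * X\<^sup>2 - K * X\<^sup>2" using Ke by simp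
        also have "\<dots> = (c/2) * Y\<^sup>2 - (2 * C\<^sup>2 / c) * X\<^sup>2 - C * X\<^sup>2" by (simp add: K_def algebra_simps)
        also have "\<dots> \<le> c * Y\<^sup>2 - 2 * (C * (X * Y)) - C * X\<^sup>2"
        proof -
          have "(c/2) * Y\<^sup>2 + (c/2) * Y\<^sup>2 = c * Y\<^sup>2" by simp
          then show ?thesis using am by linarith
        qed
        also have "\<dots> \<le> ?I t" using P k1 l1 by linarith
        finally show ?thesis .
      next
        case False
        have k1: "kl (x t) (g t) - (c/8) * (X * Y) \<le> k t (x t) (g t)"
        proof -
          have "\<bar>k t (x t) (g t) - kl (x t) (g t)\<bar> \<le> (c/8) * (X * Y)"
            unfolding X_def Y_def mult.assoc[symmetric] using False L by (intro T1) simp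
          then show ?thesis by linarith
        qed
        have l1: "ll (x t) (x t) - (c/8) * X\<^sup>2 \<le> l t (x t) (x t)"
        proof -
          have "\<bar>l t (x t) (x t) - ll (x t) (x t)\<bar> \<le> (c/8) * X\<^sup>2"
            unfolding X_def power2_eq_square mult.assoc[symmetric] using False L by (intro T2) simp
          then show ?thesis by linarith
        qed
        have l2: "c * X\<^sup>2 \<le> ll (x t) (x t)" unfolding X_def using xV by (intro cl)
        \<comment> \<open>The two cross terms together deviate from their limit by at most (c/4) X
          Y, which is split evenly between X^2 and Y^2.\<close>
        have am: "(c/8) * (2 * (X * Y)) \<le> (c/8) * (X\<^sup>2 + Y\<^sup>2)"
          using c by (intro mult_left_mono mult_le_sum_squares) auto
        have sp: "c * X\<^sup>2 = 8 * ((c/8) * X\<^sup>2)" "c * Y\<^sup>2 = 8 * ((c/8) * Y\<^sup>2)" by simp_all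
        have nn: "0 \<le> (c/8) * X\<^sup>2" "0 \<le> (c/8) * Y\<^sup>2" using c by simp_all
        have "?J t = 4 * ((c/8) * Y\<^sup>2) + 4 * ((c/8) * X\<^sup>2) + 2 * kl (x t) (g t)"
          using False t by (simp add: X_def Y_def distrib_left)
        also have "\<dots> \<le> ?I t"
          using P k1 l1 l2 am nn unfolding sp distrib_left by (simp add: algebra_simps)
        finally show ?thesis .
      qed
    qed
    have "(LINT t|hl. ?J t) \<le> (LINT t|hl. ?I t)"
      by (rule integral_mono_AE[OF iJ iI eventually_mono[OF AE_hl_pos pw]])
    moreover have "(LINT t|hl. ?I t) = bf p k l x x" by (simp add: bf_def g_def)
    moreover have "(LINT t|hl. ?J t) = (c/2) * (E1 x + E0 x) - K * e * L"
    proof -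
      have "(LINT t|hl. ?J t) = (c/2) * (E1 x + E0 x) + 2 * (LINT t|hl. indicator {L<..} t * kl (x t) (g t))
         - K * e * (LINT t|hl. indicator {0..L} t)"
        using sq_int_integrable[OF sx] sq_int_integrable[OF sg] tail(2) integrable_hl_Icc[of 0 L]
        unfolding E1_def E0_def g_def[symmetric]
        by (simp del: Bochner_Integration.integral_indicator integral_indicator)
      then show ?thesis using tail(1) integral_hl_Icc[of 0 L] L by simp
    qed
    moreover have "K * e * L \<le> (c/4) * E1 x"
    proof -
      have "K * L\<^sup>2 * 4 \<le> c * real (Suc n)" using n c by (simp add: field_simps)
      then have "K * L\<^sup>2 / Suc n \<le> c / 4" using c by (simp add: field_simps)
      then have "(K * L\<^sup>2 / Suc n) * E1 x \<le> (c / 4) * E1 x" by (intro mult_right_mono) auto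
      moreover have "K * e * L = (K * L\<^sup>2 / Suc n) * E1 x" by (simp add: e_def power2_eq_square)
      ultimately show ?thesis by simp
    qed
    moreover have "(c/4) * E1 x \<le> (c/4) * (E1 x + E0 x)" using c by (intro mult_left_mono) auto
    moreover have "(c/2) * (E1 x + E0 x) = (c/4) * (E1 x + E0 x) + (c/4) * (E1 x + E0 x)" by simp
    ultimately show ?thesis by linarith
  qed
  obtain Cu where Cu: "Cu > 0" "\<And>x. x \<in> H \<Longrightarrow> ip x x \<le> Cu * (E1 x + E0 x)" using ip_upper by blast
  have "fredholm_operator_on H ip A"
  proof (rule fredholm_of_coercive[OF A(1,2), of Fs "sqrt (L / c0)" "c / (4 * Cu)"])
    show "finite Fs" unfolding Fs_def by auto
    show "0 < c / (4 * Cu)" using c Cu by simp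
    fix f assume f: "f \<in> Fs"
    then obtain j b where jb: "j \<le> Suc n" "b \<in> Basis" "f = (\<lambda>x. x (pt j) \<bullet> b)" by (auto simp: Fs_def)
    show "f (x + y) = f x + f y" for x y by (simp add: jb inner_add_left)
    show "f (r *\<^sub>R x) = r * f x" for r x by (simp add: jb scaleR_fun_def)
    fix x assume x: "x \<in> H"
    have "pt j \<le> L"
    proof -
      have "real j * (L / Suc n) \<le> real (Suc n) * (L / Suc n)" using jb(1) L by (intro mult_right_mono) auto
      then show ?thesis by (simp add: pt_def)
    qed
    have "\<bar>f x\<bar> \<le> norm (x (pt j))" by (simp add: jb Basis_le_norm)
    also have "\<dots> \<le> sqrt (L / c0) * nrm x"
    proof (rule power2_le_imp_le)
      have "(norm (x (pt j)))\<^sup>2 \<le> pt j * E1 x" using pointwise_bound[OF x _ pt, of j] H_D(2)[OF x] by simp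
      also have "\<dots> \<le> L * ((nrm x)\<^sup>2 / c0)" using \<open>pt j \<le> L\<close> L E_le_nrm[OF x] by (intro mult_mono) auto
      also have "\<dots> = (sqrt (L / c0) * nrm x)\<^sup>2" using L c0 by (simp add: power_mult_distrib)
      finally show "(norm (x (pt j)))\<^sup>2 \<le> (sqrt (L / c0) * nrm x)\<^sup>2" .
      show "0 \<le> sqrt (L / c0) * nrm x" using L c0 x by simp
    qed
    finally show "\<bar>f x\<bar> \<le> sqrt (L / c0) * nrm x" .
  next
    fix x assume x: "x \<in> H" "\<forall>f\<in>Fs. f x = 0"
    have "c / (4 * Cu) * ip x x \<le> c / (4 * Cu) * (Cu * (E1 x + E0 x))" using c Cu x by (intro mult_left_mono) auto
    also have "\<dots> = (c / 4) * (E1 x + E0 x)" using Cu(1) by simp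
    also have "\<dots> \<le> bf p k l x x" by (rule coer[OF x])
    finally show "c / (4 * Cu) * ip x x \<le> ip (A x) x" using A(3) x by simp
  qed
  then show ?thesis unfolding fredholm_form_on_def using A by (intro exI[of _ A]) auto
qed

end

section \<open>Singular sequences\<close>

text \<open>The third power makes the profile C^2: the singular vectors are integrated by parts
  twice, so the second derivative of the cut-off must be continuous.\<close>

definition bump :: "real \<Rightarrow> real" where "bump y = (max 0 (y * (1 - y))) ^ 3"
definition bump1 :: "real \<Rightarrow> real" where "bump1 y = 3 * (max 0 (y * (1 - y)))\<^sup>2 * (1 - 2 * y)"
definition bump2 :: "real \<Rightarrow> real" where
  "bump2 y = 6 * max 0 (y * (1 - y)) * (1 - 2 * y)\<^sup>2 - 6 * (max 0 (y * (1 - y)))\<^sup>2"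

lemma DERIV_bump: "(bump has_real_derivative bump1 y) (at y)" "(bump1 has_real_derivative bump2 y) (at y)"
proof -
  have q: "((\<lambda>y::real. y * (1 - y)) has_real_derivative (1 - 2 * y)) (at y)"
    by (auto intro!: derivative_eq_intros)
  have 3: "((\<lambda>x::real. (max 0 x) ^ 3) has_real_derivative 3 * (max 0 x)\<^sup>2) (at x)" for x
    using DERIV_max_power[of 1 x] by (simp add: numeral_3_eq_3 numeral_2_eq_2)
  have 2: "((\<lambda>x::real. (max 0 x)\<^sup>2) has_real_derivative 2 * max 0 x) (at x)" for x
    using DERIV_max_power[of 0 x] by (simp add: numeral_2_eq_2)
  show "(bump has_real_derivative bump1 y) (at y)"
    unfolding bump_def[abs_def] bump1_def using DERIV_chain2[where f="\<lambda>x. (max 0 x) ^ 3", OF 3 q] .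
  have d: "((\<lambda>y::real. (max 0 (y * (1 - y)))\<^sup>2) has_real_derivative (2 * max 0 (y * (1 - y))) * (1 - 2 * y)) (at y)"
    using DERIV_chain2[where f="\<lambda>x. (max 0 x)\<^sup>2", OF 2 q] .
  show "(bump1 has_real_derivative bump2 y) (at y)"
    unfolding bump1_def[abs_def] bump2_def
    by (rule derivative_eq_intros d refl)+ (simp add: power2_eq_square algebra_simps)
qed

lemma bump2_cont: "continuous_on S bump2" unfolding bump2_def[abs_def] by (intro continuous_intros)

lemma bump_zero: assumes "y \<notin> {0..1}" shows "bump y = 0" "bump1 y = 0" "bump2 y = 0"
proof -
  have "y * (1 - y) \<le> 0" using assms by (auto simp: mult_le_0_iff)
  then show "bump y = 0" "bump1 y = 0" "bump2 y = 0" by (simp_all add: bump_def bump1_def bump2_def)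
qed

lemma bump_bounds: "\<bar>bump1 y\<bar> \<le> 3" "\<bar>bump2 y\<bar> \<le> 12"
proof -
  have "\<bar>bump1 y\<bar> \<le> 3 \<and> \<bar>bump2 y\<bar> \<le> 12"
  proof (cases "y \<in> {0..1}")
    case True
    define q where "q = max 0 (y * (1 - y))"
    define r where "r = 1 - 2 * y"
    have "y * (1 - y) \<le> 1 * 1" using True by (intro mult_mono) auto
    then have q: "0 \<le> q" "q \<le> 1" by (auto simp: q_def)
    have r: "\<bar>r\<bar> \<le> 1" using True by (auto simp: r_def)
    have q2: "0 \<le> q\<^sup>2" "q\<^sup>2 \<le> 1" using q by (auto simp: power_le_one)
    have r2: "0 \<le> r\<^sup>2" "r\<^sup>2 \<le> 1" using r by (auto simp: abs_square_le_1)
    have "q\<^sup>2 * \<bar>r\<bar> \<le> 1 * 1" using q2 r by (intro mult_mono) auto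
    then have "\<bar>bump1 y\<bar> \<le> 3" unfolding bump1_def q_def[symmetric] r_def[symmetric] by (simp add: abs_mult)
    moreover have "0 \<le> q * r\<^sup>2" "q * r\<^sup>2 \<le> 1 * 1" using q r2 by (simp, intro mult_mono) auto
    then have "\<bar>bump2 y\<bar> \<le> 12" unfolding bump2_def q_def[symmetric] r_def[symmetric]
      using q2 unfolding mult.assoc by linarith
    ultimately show ?thesis by blast
  qed (simp add: bump_zero)
  then show "\<bar>bump1 y\<bar> \<le> 3" "\<bar>bump2 y\<bar> \<le> 12" by auto
qed

lemma bump_lower: assumes "1/4 \<le> y" "y \<le> 3/4" shows "(3/16) ^ 3 \<le> bump y"
proof -
  have "0 \<le> (y - 1/4) * (3/4 - y)" using assms by (intro mult_nonneg_nonneg) auto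
  then have "3/16 \<le> y * (1 - y)" by (simp add: field_simps)
  then show ?thesis unfolding bump_def by (intro power_mono) auto
qed

lemma sq_int_compact_support:
  fixes u :: "real \<Rightarrow> real"
  assumes u: "continuous_on UNIV u" "\<And>t. t \<notin> {a..b} \<Longrightarrow> u t = 0"
  shows "sq_int (\<lambda>t. u t *\<^sub>R v)"
proof -
  have "compact (u ` {a..b})" using u(1) by (intro compact_continuous_image) (auto intro: continuous_on_subset)
  from compact_imp_bounded[OF this] obtain K where K: "\<And>t. t \<in> {a..b} \<Longrightarrow> norm (u t) \<le> K"
    unfolding bounded_iff by blast
  have [measurable]: "u \<in> borel_measurable hl" using u(1) by (intro measurable_hl borel_measurable_continuous_onI)
  show ?thesis unfolding sq_int_def
  proof
    show "(\<lambda>t. u t *\<^sub>R v) \<in> borel_measurable hl" by measurable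
    show "integrable hl (\<lambda>t. (norm (u t *\<^sub>R v))\<^sup>2)"
    proof (rule Bochner_Integration.integrable_bound)
      show "integrable hl (\<lambda>t. (K * norm v)\<^sup>2 * indicator {a..b} t)"
        by (intro integrable_mult_right integrable_hl_Icc)
      have "(norm (u t *\<^sub>R v))\<^sup>2 \<le> (K * norm v)\<^sup>2 * indicator {a..b} t" for t
      proof (cases "t \<in> {a..b}")
        case True
        have "\<bar>u t\<bar> * norm v \<le> K * norm v" using K[OF True] by (intro mult_right_mono) auto
        then have "(\<bar>u t\<bar> * norm v)\<^sup>2 \<le> (K * norm v)\<^sup>2" by (intro power_mono) auto
        then show ?thesis using True by simp
      qed (simp add: u)
      then show "AE t in hl. norm ((norm (u t *\<^sub>R v))\<^sup>2) \<le> norm ((K * norm v)\<^sup>2 * indicator {a..b} t)"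
        by (intro AE_I2) simp
    qed measurable
  qed
qed

text \<open>A solution of f'' = -\<omega>^2 f is multiplied by a bump stretched to length S. Only
  terms in which a derivative falls on the bump remain in \<phi>2 + \<omega>^2 \<phi>, each of order
  1/S, so the square integral of this remainder stays bounded while that of \<phi> grows like
  S.\<close>

lemma weyl_sequence:
  fixes \<omega> \<delta> L :: real
  assumes \<omega>: "\<omega> \<ge> 0" and \<delta>: "\<delta> > 0" and L: "L > 0"
  shows "\<exists>\<phi> \<phi>1 \<phi>2 M. L < M \<and> (\<forall>t. (\<phi> has_real_derivative \<phi>1 t) (at t)) \<and> (\<forall>t. (\<phi>1 has_real_derivative \<phi>2 t) (at t)) \<and>
    continuous_on UNIV \<phi>2 \<and> (\<forall>t. t \<notin> {L..M} \<longrightarrow> \<phi> t = 0 \<and> \<phi>1 t = 0 \<and> \<phi>2 t = 0) \<and>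
    0 < (LINT t|hl. (\<phi> t)\<^sup>2) \<and> (LINT t|hl. (\<phi>2 t + \<omega>\<^sup>2 * \<phi> t)\<^sup>2) \<le> \<delta> * (LINT t|hl. (\<phi> t)\<^sup>2)"
proof -
  \<comment> \<open>From |bump2| <= 12 and twice |bump1| <= 3 with a factor \<omega>: the remainder
    is at most C/S pointwise. Next, \<open>\<kappa>\<close> is the square of the lower bound
    (3/16)^3 for the bump on its middle half, and S is long enough for 4 C^2 <= \<delta> \<kappa>
    S.\<close>
  define C where "C = 12 + 6 * \<omega>"
  define \<kappa> :: real where "\<kappa> = (3/16) ^ 6"
  define S where "S = max 1 (4 * C\<^sup>2 / (\<delta> * \<kappa>))"
  have \<kappa>: "\<kappa> > 0" by (simp add: \<kappa>_def)
  have S1: "S \<ge> 1" by (simp add: S_def)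
  have "4 * C\<^sup>2 / (\<delta> * \<kappa>) \<le> S" by (simp add: S_def)
  then have SC: "4 * C\<^sup>2 \<le> \<delta> * \<kappa> * S" using \<delta> \<kappa> by (simp add: field_simps)
  define M where "M = L + S"
  define Y where "Y t = (t - L) / S" for t
  define w where "w t = bump (Y t)" for t
  define w1 where "w1 t = bump1 (Y t) / S" for t
  define w2 where "w2 t = bump2 (Y t) / S\<^sup>2" for t
  have dY: "(Y has_real_derivative 1 / S) (at t)" for t
    unfolding Y_def[abs_def] using S1 by (auto intro!: derivative_eq_intros)
  have dw: "(w has_real_derivative w1 t) (at t)" for t
    using DERIV_chain2[where f=bump, OF DERIV_bump(1) dY] by (simp add: w_def[abs_def] w1_def)
  have dw1: "(w1 has_real_derivative w2 t) (at t)" for t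
    using DERIV_cdivide[OF DERIV_chain2[where f=bump1, OF DERIV_bump(2) dY], of S t]
    by (simp add: w1_def[abs_def] w2_def power2_eq_square)
  have cw2: "continuous_on UNIV w2" unfolding w2_def[abs_def] Y_def
    using S1 by (intro continuous_intros continuous_on_compose2[OF bump2_cont[of UNIV]]) auto
  have Yout: "Y t \<notin> {0..1}" if "t \<notin> {L..M}" for t
    using that S1 by (auto simp: Y_def M_def field_simps)
  have z: "w t = 0" "w1 t = 0" "w2 t = 0" if "t \<notin> {L..M}" for t
    using bump_zero[OF Yout[OF that]] by (simp_all add: w_def w1_def w2_def)
  have cw: "continuous_on UNIV w" using dw by (meson DERIV_isCont continuous_at_imp_continuous_on)
  have b1: "\<bar>w1 t\<bar> \<le> 3 / S" for t
    using bump_bounds(1)[of "Y t"] S1 by (simp add: w1_def divide_right_mono)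
  have b2: "\<bar>w2 t\<bar> \<le> 12 / S" for t
  proof -
    have "\<bar>w2 t\<bar> \<le> 12 / S\<^sup>2" using bump_bounds(2)[of "Y t"] S1 by (simp add: w2_def divide_right_mono)
    also have "\<dots> \<le> 12 / S" using S1 by (intro divide_left_mono) (auto simp: power2_eq_square)
    finally show ?thesis .
  qed
  \<comment> \<open>The pair (f, g) stands for (cos, -sin) or (sin, cos) of \<omega> t; which of the
    two carries enough mass is decided at the end.\<close>
  have main: "L < M \<and> (\<forall>t. ((\<lambda>t. w t * f t) has_real_derivative (w1 t * f t + w t * (\<omega> * g t))) (at t)) \<and>
     (\<forall>t. ((\<lambda>t. w1 t * f t + w t * (\<omega> * g t)) has_real_derivative (w2 t * f t + 2 * (w1 t * (\<omega> * g t)) - \<omega>\<^sup>2 * (w t * f t))) (at t)) \<and>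
     continuous_on UNIV (\<lambda>t. w2 t * f t + 2 * (w1 t * (\<omega> * g t)) - \<omega>\<^sup>2 * (w t * f t)) \<and>
     (\<forall>t. t \<notin> {L..M} \<longrightarrow> w t * f t = 0 \<and> w1 t * f t + w t * (\<omega> * g t) = 0 \<and> w2 t * f t + 2 * (w1 t * (\<omega> * g t)) - \<omega>\<^sup>2 * (w t * f t) = 0) \<and>
     0 < (LINT t|hl. (w t * f t)\<^sup>2) \<and>
     (LINT t|hl. ((w2 t * f t + 2 * (w1 t * (\<omega> * g t)) - \<omega>\<^sup>2 * (w t * f t)) + \<omega>\<^sup>2 * (w t * f t))\<^sup>2) \<le> \<delta> * (LINT t|hl. (w t * f t)\<^sup>2)"
    if f: "\<And>t. (f has_real_derivative \<omega> * g t) (at t)" and g: "\<And>t. (g has_real_derivative - (\<omega> * f t)) (at t)"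
      and fb: "\<And>t. \<bar>f t\<bar> \<le> 1" and gb: "\<And>t. \<bar>g t\<bar> \<le> 1"
      and low: "\<kappa> * S / 4 \<le> (LINT t|hl. (w t * f t)\<^sup>2)" for f g :: "real \<Rightarrow> real"
  proof (intro conjI allI impI)
    show "L < M" using S1 by (simp add: M_def)
    show "((\<lambda>t. w t * f t) has_real_derivative (w1 t * f t + w t * (\<omega> * g t))) (at t)" for t
      by (rule derivative_eq_intros dw f refl)+ (simp add: algebra_simps)
    show "((\<lambda>t. w1 t * f t + w t * (\<omega> * g t)) has_real_derivative (w2 t * f t + 2 * (w1 t * (\<omega> * g t)) - \<omega>\<^sup>2 * (w t * f t))) (at t)" for t
      by (rule derivative_eq_intros dw dw1 f g refl)+ (simp add: algebra_simps power2_eq_square)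
    have cf: "continuous_on UNIV f" "continuous_on UNIV g" "continuous_on UNIV w1"
      using f g dw1 by (meson DERIV_isCont continuous_at_imp_continuous_on)+
    show "continuous_on UNIV (\<lambda>t. w2 t * f t + 2 * (w1 t * (\<omega> * g t)) - \<omega>\<^sup>2 * (w t * f t))"
      by (intro continuous_intros cf cw cw2)
    show "0 < (LINT t|hl. (w t * f t)\<^sup>2)" using low \<kappa> S1 by (smt (verit) divide_pos_pos mult_pos_pos)
    have "(LINT t|hl. (w2 t * f t + 2 * (w1 t * (\<omega> * g t)))\<^sup>2) \<le> (LINT t|hl. (C / S)\<^sup>2 * indicator {L..M} t)"
    proof (rule integral_mono)
      have "sq_int (\<lambda>t. (w2 t * f t + 2 * (w1 t * (\<omega> * g t))) *\<^sub>R (1::real))"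
        by (intro sq_int_compact_support[where a=L and b=M] continuous_intros cf cw cw2) (simp add: z)
      then show "integrable hl (\<lambda>t. (w2 t * f t + 2 * (w1 t * (\<omega> * g t)))\<^sup>2)" by (simp add: sq_int_def)
      show "integrable hl (\<lambda>t. (C / S)\<^sup>2 * indicator {L..M} t)" by (intro integrable_mult_right integrable_hl_Icc)
      fix t
      show "(w2 t * f t + 2 * (w1 t * (\<omega> * g t)))\<^sup>2 \<le> (C / S)\<^sup>2 * indicator {L..M} t"
      proof (cases "t \<in> {L..M}")
        case True
        have "\<bar>w2 t * f t\<bar> \<le> 12 / S * 1" unfolding abs_mult using b2 fb S1 by (intro mult_mono) auto
        moreover have "\<bar>w1 t * (\<omega> * g t)\<bar> \<le> 3 / S * (\<omega> * 1)"
          unfolding abs_mult using b1 gb S1 \<omega> by (intro mult_mono) auto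
        ultimately have "\<bar>w2 t * f t + 2 * (w1 t * (\<omega> * g t))\<bar> \<le> 12 / S + 2 * (3 / S * \<omega>)" by linarith
        also have "\<dots> = C / S" by (simp add: C_def add_divide_distrib)
        finally have "\<bar>w2 t * f t + 2 * (w1 t * (\<omega> * g t))\<bar>\<^sup>2 \<le> (C / S)\<^sup>2" by (rule power_mono) simp
        then show ?thesis using True by simp
      qed (simp add: z)
    qed
    also have "\<dots> = (C / S)\<^sup>2 * S" using integral_hl_Icc[of L M] L S1 by (simp add: M_def)
    also have "\<dots> \<le> C\<^sup>2"
    proof -
      have "(C / S)\<^sup>2 * S = C\<^sup>2 / S" using S1 by (simp add: power2_eq_square)
      also have "\<dots> \<le> C\<^sup>2 / 1" using S1 by (intro divide_left_mono) auto
      finally show ?thesis by simp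
    qed
    also have "\<dots> \<le> \<delta> * (\<kappa> * S / 4)" using SC by simp
    also have "\<dots> \<le> \<delta> * (LINT t|hl. (w t * f t)\<^sup>2)" using low \<delta> by (intro mult_left_mono) auto
    finally show "(LINT t|hl. ((w2 t * f t + 2 * (w1 t * (\<omega> * g t)) - \<omega>\<^sup>2 * (w t * f t)) + \<omega>\<^sup>2 * (w t * f t))\<^sup>2) \<le> \<delta> * (LINT t|hl. (w t * f t)\<^sup>2)"
      by simp
  qed (simp_all add: z)
  have iw: "integrable hl (\<lambda>t. (w t * f t)\<^sup>2)" if "continuous_on UNIV f" for f
  proof -
    have "sq_int (\<lambda>t. (w t * f t) *\<^sub>R (1::real))"
      using that by (intro sq_int_compact_support[where a=L and b=M] continuous_intros cw) (simp_all add: z)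
    then show ?thesis by (simp add: sq_int_def)
  qed
  have "(LINT t|hl. \<kappa> * indicator {L + S/4..L + 3*S/4} t) \<le> (LINT t|hl. (w t * 1)\<^sup>2)"
  proof (rule integral_mono)
    show "integrable hl (\<lambda>t. \<kappa> * indicator {L + S/4..L + 3*S/4} t)" by (intro integrable_mult_right integrable_hl_Icc)
    show "integrable hl (\<lambda>t. (w t * 1)\<^sup>2)" by (rule iw) simp
    show "\<kappa> * indicator {L + S/4..L + 3*S/4} t \<le> (w t * 1)\<^sup>2" for t
    proof (cases "t \<in> {L + S/4..L + 3*S/4}")
      case True
      have "1/4 \<le> Y t" "Y t \<le> 3/4" using True S1 by (auto simp: Y_def field_simps)
      then have "(3/16) ^ 3 \<le> w t" unfolding w_def by (rule bump_lower)
      then have "((3/16) ^ 3)\<^sup>2 \<le> (w t)\<^sup>2" by (intro power_mono) auto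
      then show ?thesis using True by (simp add: \<kappa>_def flip: power_mult)
    qed simp
  qed
  moreover have "(LINT t|hl. \<kappa> * indicator {L + S/4..L + 3*S/4} t) = \<kappa> * (S / 2)"
    unfolding integral_mult_right_zero using L S1 by (subst integral_hl_Icc) auto
  ultimately have "\<kappa> * (S / 2) \<le> (LINT t|hl. (w t)\<^sup>2)" by (simp only: mult_1_right)
  \<comment> \<open>As cos^2 + sin^2 = 1, one of the two products carries at least half of the mass
    of the bump. This also covers \<omega> = 0, where the sine vanishes.\<close>
  also have "\<dots> = (LINT t|hl. (w t * cos (\<omega> * t))\<^sup>2 + (w t * sin (\<omega> * t))\<^sup>2)"
    by (simp add: power_mult_distrib flip: distrib_left)
  also have "\<dots> = (LINT t|hl. (w t * cos (\<omega> * t))\<^sup>2) + (LINT t|hl. (w t * sin (\<omega> * t))\<^sup>2)"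
    by (intro Bochner_Integration.integral_add iw continuous_intros)
  finally have "\<kappa> * S / 4 \<le> (LINT t|hl. (w t * cos (\<omega> * t))\<^sup>2) \<or> \<kappa> * S / 4 \<le> (LINT t|hl. (w t * sin (\<omega> * t))\<^sup>2)"
    by (simp add: field_simps) linarith
  then show ?thesis
  proof
    assume low: "\<kappa> * S / 4 \<le> (LINT t|hl. (w t * cos (\<omega> * t))\<^sup>2)"
    have "((\<lambda>t. cos (\<omega> * t)) has_real_derivative \<omega> * - sin (\<omega> * t)) (at t)"
      "((\<lambda>t. - sin (\<omega> * t)) has_real_derivative - (\<omega> * cos (\<omega> * t))) (at t)" for t
      by (auto intro!: derivative_eq_intros)
    note m = main[OF this _ _ low]
    show ?thesis by (intro exI, rule m) auto
  next
    assume low: "\<kappa> * S / 4 \<le> (LINT t|hl. (w t * sin (\<omega> * t))\<^sup>2)"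
    have "((\<lambda>t. sin (\<omega> * t)) has_real_derivative \<omega> * cos (\<omega> * t)) (at t)"
      "((\<lambda>t. cos (\<omega> * t)) has_real_derivative - (\<omega> * sin (\<omega> * t))) (at t)" for t
      by (auto intro!: derivative_eq_intros)
    note m = main[OF this _ _ low]
    show ?thesis by (intro exI, rule m) auto
  qed
qed

section \<open>Singular vectors along an eigendirection\<close>

lemma C2_test_functions:
  assumes "\<And>t. (\<phi> has_real_derivative \<phi>1 t) (at t)" "continuous_on UNIV \<phi>1" "0 < L" "\<And>t. t \<notin> {L..M} \<Longrightarrow> \<phi> t = 0"
  shows "\<phi> \<in> test_functions" "deriv \<phi> = \<phi>1"
proof -
  show "\<phi> \<in> test_functions" unfolding test_functions_def C1_real_iff using assms by blast
  show "deriv \<phi> = \<phi>1" using assms(1) by (auto intro!: DERIV_imp_deriv)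
qed

lemma has_weak_derivative_test:
  fixes v :: "'a::euclidean_space"
  assumes d: "\<And>t. (\<phi> has_real_derivative \<phi>1 t) (at t)" and c: "continuous_on UNIV \<phi>1"
    and z: "\<And>t. t \<notin> {L..M} \<Longrightarrow> \<phi> t = 0" "\<And>t. t \<notin> {L..M} \<Longrightarrow> \<phi>1 t = 0" and LM: "0 < L" "L \<le> M"
  shows "has_weak_derivative (\<lambda>t. \<phi> t *\<^sub>R v) (\<lambda>t. \<phi>1 t *\<^sub>R v)"
  unfolding has_weak_derivative_def
proof
  fix \<psi> assume \<psi>: "\<psi> \<in> test_functions"
  then obtain D where D: "\<And>t. (\<psi> has_real_derivative D t) (at t)" "continuous_on UNIV D"
    by (auto simp: test_functions_def C1_real_iff)
  have dD: "deriv \<psi> = D" using D by (auto intro!: DERIV_imp_deriv)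
  have cp: "continuous_on UNIV \<phi>" "continuous_on UNIV \<psi>"
    using d D by (meson DERIV_isCont continuous_at_imp_continuous_on)+
  have sq: "sq_int (\<lambda>t. \<phi> t *\<^sub>R v)" "sq_int (\<lambda>t. \<phi>1 t *\<^sub>R v)"
    using sq_int_compact_support[OF cp(1) z(1)] sq_int_compact_support[OF c z(2)] by auto
  have "integrable hl (\<lambda>t. D t *\<^sub>R \<phi> t *\<^sub>R v)" "integrable hl (\<lambda>t. \<psi> t *\<^sub>R \<phi>1 t *\<^sub>R v)"
    using test_function_mult_integrable(2)[OF \<psi> sq(1)] test_function_mult_integrable(1)[OF \<psi> sq(2)]
    by (simp_all add: dD)
  then have "(LINT t|hl. D t *\<^sub>R \<phi> t *\<^sub>R v) + (LINT t|hl. \<psi> t *\<^sub>R \<phi>1 t *\<^sub>R v)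
    = (LINT t|hl. (D t * \<phi> t + \<psi> t * \<phi>1 t) *\<^sub>R v)"
    by (simp add: scaleR_add_left)
  also have "\<dots> = (LINT t|lborel. indicator {L..M} t *\<^sub>R ((D t * \<phi> t + \<psi> t * \<phi>1 t) *\<^sub>R v))"
  proof -
    have e: "(\<lambda>t. indicator {0..} t *\<^sub>R ((D t * \<phi> t + \<psi> t * \<phi>1 t) *\<^sub>R v)) = (\<lambda>t. indicator {L..M} t *\<^sub>R ((D t * \<phi> t + \<psi> t * \<phi>1 t) *\<^sub>R v))"
      using z LM by (fastforce simp: fun_eq_iff indicator_def)
    have "continuous_on UNIV (\<lambda>t. (D t * \<phi> t + \<psi> t * \<phi>1 t) *\<^sub>R v)" by (intro continuous_intros cp c D)
    then have [measurable]: "(\<lambda>t. (D t * \<phi> t + \<psi> t * \<phi>1 t) *\<^sub>R v) \<in> borel_measurable borel"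
      by (rule borel_measurable_continuous_onI)
    show ?thesis unfolding integral_hl_eq e by (rule integral_completion) measurable
  qed
  also have "\<dots> = (\<psi> M * \<phi> M) *\<^sub>R v - (\<psi> L * \<phi> L) *\<^sub>R v"
  proof (rule integral_FTC_atLeastAtMost[OF LM(2)])
    have dd: "((\<lambda>t. \<psi> t * \<phi> t) has_vector_derivative (D t * \<phi> t + \<psi> t * \<phi>1 t)) (at t)" for t
      unfolding has_real_derivative_iff_has_vector_derivative[symmetric]
      by (rule derivative_eq_intros D d refl)+ (simp add: algebra_simps)
    show "((\<lambda>t. (\<psi> t * \<phi> t) *\<^sub>R v) has_vector_derivative (D t * \<phi> t + \<psi> t * \<phi>1 t) *\<^sub>R v) (at t within {L..M})" for t
      by (rule has_vector_derivative_at_within[OF bounded_linear.has_vector_derivative[OF bounded_linear_scaleR_left dd]])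
    show "continuous_on {L..M} (\<lambda>t. (D t * \<phi> t + \<psi> t * \<phi>1 t) *\<^sub>R v)"
      by (rule continuous_on_subset[of UNIV]) (intro continuous_intros cp c D, simp)
  qed
  also have "\<dots> = 0"
  proof -
    \<comment> \<open>The hypothesis gives zeros only outside the closed interval; continuity from
      outside extends them to both endpoints, so the boundary terms vanish.\<close>
    have "\<phi> L = 0 \<and> \<phi> M = 0"
    proof
    have "isCont \<phi> L" "isCont \<phi> M" using d by (auto intro: DERIV_isCont)
    then have l: "(\<phi> \<longlongrightarrow> \<phi> L) (at_left L)" and r: "(\<phi> \<longlongrightarrow> \<phi> M) (at_right M)"
      by (auto simp: isCont_def filterlim_at_split)
    have "\<forall>\<^sub>F t in at_left L. \<phi> t = 0" by (auto simp: eventually_at_filter z)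
    from Lim_transform_eventually[OF l this] show "\<phi> L = 0"
      using tendsto_const_iff[of "at_left L" 0 "\<phi> L"] by auto
    have "\<forall>\<^sub>F t in at_right M. \<phi> t = 0" by (auto simp: eventually_at_filter z)
    from Lim_transform_eventually[OF r this] show "\<phi> M = 0"
      using tendsto_const_iff[of "at_right M" 0 "\<phi> M"] by auto
    qed
    then show ?thesis by simp
  qed
  finally have "(LINT t|hl. D t *\<^sub>R \<phi> t *\<^sub>R v) + (LINT t|hl. \<psi> t *\<^sub>R \<phi>1 t *\<^sub>R v) = 0" .
  then show "(LINT t|hl. deriv \<psi> t *\<^sub>R \<phi> t *\<^sub>R v) = - (LINT t|hl. \<psi> t *\<^sub>R \<phi>1 t *\<^sub>R v)"
    unfolding dD by (rule eq_neg_iff_add_eq_0[THEN iffD2])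
qed

lemma sum_products_le: "(x + y) * (z + w) \<le> x\<^sup>2 + y\<^sup>2 + (z\<^sup>2 + (w::real)\<^sup>2)"
proof -
  have "2 * ((x + y) * (z + w)) \<le> (x + y)\<^sup>2 + (z + w)\<^sup>2" by (rule mult_le_sum_squares)
  moreover have "(x + y)\<^sup>2 \<le> 2 * (x\<^sup>2 + y\<^sup>2)" "(z + w)\<^sup>2 \<le> 2 * (z\<^sup>2 + w\<^sup>2)"
    using mult_le_sum_squares[of x y] mult_le_sum_squares[of z w] by (simp_all add: power2_sum mult.assoc)
  ultimately have "2 * ((x + y) * (z + w)) \<le> 2 * (x\<^sup>2 + y\<^sup>2) + 2 * (z\<^sup>2 + w\<^sup>2)"
    by (meson add_mono order_trans)
  then have "2 * ((x + y) * (z + w)) \<le> 2 * (x\<^sup>2 + y\<^sup>2 + (z\<^sup>2 + w\<^sup>2))" by (simp only: distrib_left)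
  then show ?thesis by (rule mult_left_le_imp_le) simp
qed

context sobolev
begin

text \<open>The vector is a Weyl function times v, placed where the coefficients are
  \<epsilon>/2-close to their limits. In the limit form the symmetric cross terms cancel after
  integration by parts, and the rest is - G v (integral of (\<phi>2 + \<omega>^2 \<phi>) \<xi>) with
  \<omega>^2 = -\<mu>.\<close>

lemma singular_vector:
  assumes p: "lim_form p pl" and k: "lim_form k kl" and l: "lim_form l ll"
    and kl_sym: "\<And>u w. kl u w = kl w u"
    and v: "v \<in> V" "v \<noteq> 0" and \<mu>: "\<mu> \<le> 0"
    and pv: "\<And>w. w \<in> V \<Longrightarrow> pl v w = G v w" and lv: "\<And>w. w \<in> V \<Longrightarrow> ll v w = \<mu> * G v w"
    and \<epsilon>: "\<epsilon> > 0" and L0: "L0 > 0"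
  shows "\<exists>x\<in>H. \<exists>M. L0 < M \<and> x \<noteq> 0 \<and> (\<forall>t. t \<notin> {L0..M} \<longrightarrow> x t = 0) \<and> (AE t in hl. t \<notin> {L0..M} \<longrightarrow> wd x t = 0) \<and>
    (\<forall>\<xi>\<in>H. \<bar>bf p k l x \<xi>\<bar> \<le> \<epsilon> * ((E1 x + E0 x) + (E1 \<xi> + E0 \<xi>)))"
proof -
  have a: "adm p" "adm k" "adm l" and bl: "bilinear pl" "bilinear kl" "bilinear ll"
    using p k l by (auto simp: lim_form_def)
  have e2: "\<epsilon> / 2 > 0" using \<epsilon> by simp
  obtain T1 where T1: "\<And>t u w. t \<ge> T1 \<Longrightarrow> \<bar>p t u w - pl u w\<bar> \<le> (\<epsilon>/2) * norm u * norm w"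
    using lim_form_uniform[OF p e2] by auto
  obtain T2 where T2: "\<And>t u w. t \<ge> T2 \<Longrightarrow> \<bar>k t u w - kl u w\<bar> \<le> (\<epsilon>/2) * norm u * norm w"
    using lim_form_uniform[OF k e2] by auto
  obtain T3 where T3: "\<And>t u w. t \<ge> T3 \<Longrightarrow> \<bar>l t u w - ll u w\<bar> \<le> (\<epsilon>/2) * norm u * norm w"
    using lim_form_uniform[OF l e2] by auto
  define L where "L = max L0 (max T1 (max T2 T3))"
  have L: "L > 0" "L0 \<le> L" "T1 \<le> L" "T2 \<le> L" "T3 \<le> L" using L0 by (auto simp: L_def)
  obtain B where B: "B > 0" "\<And>u w. \<bar>G u w\<bar> \<le> B * norm u * norm w"
    using bilinear_bounded_pos[OF G] by auto
  define \<omega> where "\<omega> = sqrt (- \<mu>)"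
  have \<omega>: "\<omega> \<ge> 0" "\<omega>\<^sup>2 = - \<mu>" using \<mu> by (simp_all add: \<omega>_def)
  \<comment> \<open>This accuracy makes the Young term (B |v|)^2 / (2 \<epsilon>) times the squared
    remainder at most (\<epsilon>/2) \<open>E0 x\<close>.\<close>
  have "(\<epsilon> / B)\<^sup>2 > 0" using \<epsilon> B by simp
  from weyl_sequence[OF \<omega>(1) this L(1)]
  obtain \<phi> \<phi>1 \<phi>2 M where LM: "L < M" and d1: "\<And>t. (\<phi> has_real_derivative \<phi>1 t) (at t)"
    and d2: "\<And>t. (\<phi>1 has_real_derivative \<phi>2 t) (at t)" and c2: "continuous_on UNIV \<phi>2"
    and z: "\<And>t. t \<notin> {L..M} \<Longrightarrow> \<phi> t = 0" "\<And>t. t \<notin> {L..M} \<Longrightarrow> \<phi>1 t = 0" "\<And>t. t \<notin> {L..M} \<Longrightarrow> \<phi>2 t = 0"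
    and pos: "0 < (LINT t|hl. (\<phi> t)\<^sup>2)"
    and small: "(LINT t|hl. (\<phi>2 t + \<omega>\<^sup>2 * \<phi> t)\<^sup>2) \<le> (\<epsilon> / B)\<^sup>2 * (LINT t|hl. (\<phi> t)\<^sup>2)" by blast
  have c0': "continuous_on UNIV \<phi>" and c1: "continuous_on UNIV \<phi>1"
    using d1 d2 by (meson DERIV_isCont continuous_at_imp_continuous_on)+
  define \<psi> where "\<psi> t = \<phi>2 t + \<omega>\<^sup>2 * \<phi> t" for t
  have c\<psi>: "continuous_on UNIV \<psi>" unfolding \<psi>_def[abs_def] by (intro continuous_intros c2 c0')
  have z\<psi>: "\<psi> t = 0" if "t \<notin> {L..M}" for t using z that by (simp add: \<psi>_def)
  have test: "\<phi> \<in> test_functions" "deriv \<phi> = \<phi>1" "\<phi>1 \<in> test_functions" "deriv \<phi>1 = \<phi>2"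
    using C2_test_functions[OF d1 c1 L(1) z(1)] C2_test_functions[OF d2 c2 L(1) z(2)] by auto
  define x where "x t = \<phi> t *\<^sub>R v" for t
  have sx: "sq_int x" unfolding x_def[abs_def] by (rule sq_int_compact_support[OF c0' z(1)])
  have sx1: "sq_int (\<lambda>t. \<phi>1 t *\<^sub>R v)" by (rule sq_int_compact_support[OF c1 z(2)])
  have s\<psi>: "sq_int (\<lambda>t. \<psi> t *\<^sub>R (1::real))" by (rule sq_int_compact_support[OF c\<psi> z\<psi>])
  have wx: "has_weak_derivative x (\<lambda>t. \<phi>1 t *\<^sub>R v)" unfolding x_def[abs_def]
    using LM by (intro has_weak_derivative_test[OF d1 c1 z(1,2) L(1)]) auto
  have xH: "x \<in> H"
  proof (rule H_I[OF _ _ _ _ _ wx])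
    show "x \<in> L2_halfline V" using v V sx by (auto simp: sq_int_L2 x_def subspace_scale)
    show "(\<lambda>t. \<phi>1 t *\<^sub>R v) \<in> L2_halfline V" using v V sx1 by (auto simp: sq_int_L2 subspace_scale)
    show "continuous_on {0..} x" unfolding x_def[abs_def]
      by (intro continuous_intros continuous_on_subset[OF c0']) auto
  qed (use z L in \<open>auto simp: x_def\<close>)
  have wdx: "AE t in hl. wd x t = \<phi>1 t *\<^sub>R v" by (rule wd_unique[OF xH sx1 wx])
  have E0x: "E0 x = (LINT t|hl. (\<phi> t)\<^sup>2) * (norm v)\<^sup>2" by (simp add: E0_def x_def power_mult_distrib)
  have E1x: "E1 x = (LINT t|hl. (norm (\<phi>1 t *\<^sub>R v))\<^sup>2)" unfolding E1_def
  proof (rule integral_cong_AE)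
    show "(\<lambda>t. (norm (wd x t))\<^sup>2) \<in> borel_measurable hl" "(\<lambda>t. (norm (\<phi>1 t *\<^sub>R v))\<^sup>2) \<in> borel_measurable hl"
      by (rule borel_measurable_integrable[OF sq_int_integrable[OF wd(3)[OF xH]]]
          borel_measurable_integrable[OF sq_int_integrable[OF sx1]])+
    show "AE t in hl. (norm (wd x t))\<^sup>2 = (norm (\<phi>1 t *\<^sub>R v))\<^sup>2" using wdx by eventually_elim simp
  qed
  have xn0: "x \<noteq> 0"
  proof
    assume "x = 0"
    then have "E0 x = 0" by (simp add: E0_def)
    then show False using E0x pos v by simp
  qed
  have main: "\<bar>bf p k l x \<xi>\<bar> \<le> \<epsilon> * ((E1 x + E0 x) + (E1 \<xi> + E0 \<xi>))" if \<xi>: "\<xi> \<in> H" for \<xi>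
  proof -
    define g where "g = wd \<xi>"
    note s\<xi> = H_D(5)[OF \<xi>] and sg = wd(3)[OF \<xi>, folded g_def] and wg = wd(2)[OF \<xi>, folded g_def]
    let ?I = "\<lambda>t. p t (\<phi>1 t *\<^sub>R v) (g t) + (k t (x t) (g t) + k t (\<xi> t) (\<phi>1 t *\<^sub>R v)) + l t (x t) (\<xi> t)"
    let ?J = "\<lambda>t. pl (\<phi>1 t *\<^sub>R v) (g t) + (kl (x t) (g t) + kl (\<xi> t) (\<phi>1 t *\<^sub>R v)) + ll (x t) (\<xi> t)"
    have iI: "integrable hl ?I"
      by (rule Bochner_Integration.integrable_add[OF Bochner_Integration.integrable_add[OF
            adm_integrable[OF a(1) sx1 sg] Bochner_Integration.integrable_add[OF
              adm_integrable[OF a(2) sx sg] adm_integrable[OF a(2) s\<xi> sx1]]]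
            adm_integrable[OF a(3) sx s\<xi>]])
    have iJ: "integrable hl ?J"
      by (rule Bochner_Integration.integrable_add[OF Bochner_Integration.integrable_add[OF
            adm_integrable[OF adm_const[OF bl(1)] sx1 sg] Bochner_Integration.integrable_add[OF
              adm_integrable[OF adm_const[OF bl(2)] sx sg] adm_integrable[OF adm_const[OF bl(2)] s\<xi> sx1]]]
            adm_integrable[OF adm_const[OF bl(3)] sx s\<xi>]])
    have bfI: "bf p k l x \<xi> = (LINT t|hl. ?I t)" unfolding bf_def g_def[symmetric]
    proof (rule integral_cong_AE)
      show "(\<lambda>t. p t (wd x t) (g t) + (k t (x t) (g t) + k t (\<xi> t) (wd x t)) + l t (x t) (\<xi> t)) \<in> borel_measurable hl"
        using bf_integrable[OF a xH \<xi>] unfolding g_def by (rule borel_measurable_integrable)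
      show "?I \<in> borel_measurable hl" using iI by (rule borel_measurable_integrable)
      show "AE t in hl. p t (wd x t) (g t) + (k t (x t) (g t) + k t (\<xi> t) (wd x t)) + l t (x t) (\<xi> t) = ?I t"
        using wdx by eventually_elim simp
    qed
    have lin: "bounded_linear (G v)" "bounded_linear (kl v)"
      using G bl(2) by (auto simp: bilinear_def linear_conv_bounded_linear)
    have i: "integrable hl (\<lambda>t. \<phi>1 t *\<^sub>R g t)" "integrable hl (\<lambda>t. \<phi> t *\<^sub>R g t)"
      "integrable hl (\<lambda>t. \<phi>1 t *\<^sub>R \<xi> t)" "integrable hl (\<lambda>t. \<phi> t *\<^sub>R \<xi> t)" "integrable hl (\<lambda>t. \<phi>2 t *\<^sub>R \<xi> t)"
      using test_function_mult_integrable(1)[OF test(3) sg] test_function_mult_integrable(1)[OF test(1) sg]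
        test_function_mult_integrable(1)[OF test(3) s\<xi>] test_function_mult_integrable(1)[OF test(1) s\<xi>]
        test_function_mult_integrable(2)[OF test(3) s\<xi>] by (simp_all add: test)
    \<comment> \<open>The functions \<phi> and \<phi>1 are themselves test functions, so the weak
      derivative of \<xi> absorbs both integrations by parts. The first identity makes the two
      kl-terms cancel, the second moves the derivative off \<xi>.\<close>
    have w1: "(LINT t|hl. \<phi>1 t *\<^sub>R \<xi> t) = - (LINT t|hl. \<phi> t *\<^sub>R g t)"
      and w2: "(LINT t|hl. \<phi>2 t *\<^sub>R \<xi> t) = - (LINT t|hl. \<phi>1 t *\<^sub>R g t)"
      using wg test unfolding has_weak_derivative_def by metis+
    have "(LINT t|hl. ?J t) = (LINT t|hl. G v (\<phi>1 t *\<^sub>R g t) + (kl v (\<phi> t *\<^sub>R g t) + kl v (\<phi>1 t *\<^sub>R \<xi> t)) + \<mu> * G v (\<phi> t *\<^sub>R \<xi> t))"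
    proof (rule integral_cong_AE)
      show "?J \<in> borel_measurable hl" using iJ by (rule borel_measurable_integrable)
      show "(\<lambda>t. G v (\<phi>1 t *\<^sub>R g t) + (kl v (\<phi> t *\<^sub>R g t) + kl v (\<phi>1 t *\<^sub>R \<xi> t)) + \<mu> * G v (\<phi> t *\<^sub>R \<xi> t)) \<in> borel_measurable hl"
        by (intro borel_measurable_add borel_measurable_times borel_measurable_const
            borel_measurable_integrable[OF integrable_bounded_linear[OF lin(1) i(1)]]
            borel_measurable_integrable[OF integrable_bounded_linear[OF lin(2) i(2)]]
            borel_measurable_integrable[OF integrable_bounded_linear[OF lin(2) i(3)]]
            borel_measurable_integrable[OF integrable_bounded_linear[OF lin(1) i(4)]])
      show "AE t in hl. ?J t = G v (\<phi>1 t *\<^sub>R g t) + (kl v (\<phi> t *\<^sub>R g t) + kl v (\<phi>1 t *\<^sub>R \<xi> t)) + \<mu> * G v (\<phi> t *\<^sub>R \<xi> t)"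
        using AE_hl_pos
      proof eventually_elim
        case (elim t)
        then have "g t \<in> V" "\<xi> t \<in> V" by (auto simp: g_def intro: H_D(4)[OF \<xi>] wd(4)[OF \<xi>])
        then show ?case
          by (simp add: x_def bilinear_lmul[OF bl(1)] bilinear_lmul[OF bl(2)] bilinear_lmul[OF bl(3)] bilinear_rmul[OF bl(2)]
              bilinear_rmul[OF G] pv lv kl_sym[of "\<xi> t" v])
      qed
    qed
    also have "\<dots> = G v (LINT t|hl. \<phi>1 t *\<^sub>R g t) + (kl v (LINT t|hl. \<phi> t *\<^sub>R g t) + kl v (LINT t|hl. \<phi>1 t *\<^sub>R \<xi> t)) + \<mu> * G v (LINT t|hl. \<phi> t *\<^sub>R \<xi> t)"
      using integrable_bounded_linear[OF lin(1) i(1)] integrable_bounded_linear[OF lin(2) i(2)]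
        integrable_bounded_linear[OF lin(2) i(3)] integrable_bounded_linear[OF lin(1) i(4)]
      by (simp add: integral_bounded_linear[OF lin(1) i(1)] integral_bounded_linear[OF lin(2) i(2)]
          integral_bounded_linear[OF lin(2) i(3)] integral_bounded_linear[OF lin(1) i(4)])
    also have "\<dots> = - G v (LINT t|hl. \<phi>2 t *\<^sub>R \<xi> t) + \<mu> * G v (LINT t|hl. \<phi> t *\<^sub>R \<xi> t)"
      by (simp add: w1 w2 bilinear_rneg[OF bl(2)] bilinear_rneg[OF G])
    also have "\<dots> = - G v (LINT t|hl. \<psi> t *\<^sub>R \<xi> t)"
    proof -
      have "(LINT t|hl. \<psi> t *\<^sub>R \<xi> t) = (LINT t|hl. \<phi>2 t *\<^sub>R \<xi> t) + \<omega>\<^sup>2 *\<^sub>R (LINT t|hl. \<phi> t *\<^sub>R \<xi> t)"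
        using i(4,5) by (simp add: \<psi>_def scaleR_add_left flip: scaleR_scaleR)
      then show ?thesis by (simp add: bilinear_radd[OF G] bilinear_rsub[OF G] bilinear_rmul[OF G] \<omega>(2))
    qed
    finally have Jeq: "(LINT t|hl. ?J t) = - G v (LINT t|hl. \<psi> t *\<^sub>R \<xi> t)" .
    have i\<psi>: "integrable hl (\<lambda>t. (\<psi> t)\<^sup>2)" using sq_int_integrable[OF s\<psi>] by simp
    have i\<xi>: "integrable hl (\<lambda>t. (norm (\<xi> t))\<^sup>2)" by (rule sq_int_integrable[OF s\<xi>])
    have J: "\<bar>LINT t|hl. ?J t\<bar> \<le> (\<epsilon>/2) * (E0 \<xi> + E0 x)"
    proof -
      define b where "b = B * norm v"
      have b: "b \<ge> 0" using B by (simp add: b_def)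
      have "\<bar>LINT t|hl. ?J t\<bar> \<le> b * norm (LINT t|hl. \<psi> t *\<^sub>R \<xi> t)" unfolding Jeq b_def using B(2) by simp
      also have "\<dots> \<le> b * (LINT t|hl. norm (\<psi> t *\<^sub>R \<xi> t))" using b by (intro mult_left_mono integral_norm_bound)
      also have "\<dots> = (LINT t|hl. b * norm (\<psi> t *\<^sub>R \<xi> t))" by simp
      also have "\<dots> \<le> (LINT t|hl. (\<epsilon>/2) * (norm (\<xi> t))\<^sup>2 + (b\<^sup>2 / (2 * \<epsilon>)) * (\<psi> t)\<^sup>2)"
      proof (rule integral_mono)
        have "integrable hl (\<lambda>t. \<psi> t *\<^sub>R \<xi> t)"
          using i(4,5) by (simp add: \<psi>_def scaleR_add_left flip: scaleR_scaleR)
        then show "integrable hl (\<lambda>t. b * norm (\<psi> t *\<^sub>R \<xi> t))" by (intro integrable_mult_right integrable_norm)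
        show "integrable hl (\<lambda>t. (\<epsilon>/2) * (norm (\<xi> t))\<^sup>2 + (b\<^sup>2 / (2 * \<epsilon>)) * (\<psi> t)\<^sup>2)"
          by (rule Bochner_Integration.integrable_add[OF integrable_mult_right[OF i\<xi>] integrable_mult_right[OF i\<psi>]])
        fix t
        have "2 * ((sqrt \<epsilon> * norm (\<xi> t)) * (b * \<bar>\<psi> t\<bar> / sqrt \<epsilon>)) \<le> (sqrt \<epsilon> * norm (\<xi> t))\<^sup>2 + (b * \<bar>\<psi> t\<bar> / sqrt \<epsilon>)\<^sup>2"
          by (rule mult_le_sum_squares)
        moreover have "(sqrt \<epsilon> * norm (\<xi> t)) * (b * \<bar>\<psi> t\<bar> / sqrt \<epsilon>) = b * norm (\<psi> t *\<^sub>R \<xi> t)" using \<epsilon> by simp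
        moreover have "(sqrt \<epsilon> * norm (\<xi> t))\<^sup>2 = 2 * ((\<epsilon>/2) * (norm (\<xi> t))\<^sup>2)" "(b * \<bar>\<psi> t\<bar> / sqrt \<epsilon>)\<^sup>2 = 2 * ((b\<^sup>2 / (2 * \<epsilon>)) * (\<psi> t)\<^sup>2)"
          using \<epsilon> by (simp_all add: power_mult_distrib power_divide)
        ultimately show "b * norm (\<psi> t *\<^sub>R \<xi> t) \<le> (\<epsilon>/2) * (norm (\<xi> t))\<^sup>2 + (b\<^sup>2 / (2 * \<epsilon>)) * (\<psi> t)\<^sup>2" by linarith
      qed
      also have "\<dots> = (\<epsilon>/2) * E0 \<xi> + (b\<^sup>2 / (2 * \<epsilon>)) * (LINT t|hl. (\<psi> t)\<^sup>2)"
        using i\<psi> i\<xi> by (simp add: E0_def)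
      also have "\<dots> \<le> (\<epsilon>/2) * E0 \<xi> + (b\<^sup>2 / (2 * \<epsilon>)) * ((\<epsilon> / B)\<^sup>2 * (LINT t|hl. (\<phi> t)\<^sup>2))"
        using small \<epsilon> unfolding \<psi>_def by (intro add_left_mono mult_left_mono) auto
      also have "(b\<^sup>2 / (2 * \<epsilon>)) * ((\<epsilon> / B)\<^sup>2 * (LINT t|hl. (\<phi> t)\<^sup>2)) = (\<epsilon>/2) * E0 x"
        using \<epsilon> B unfolding b_def E0x by (simp add: power2_eq_square field_simps)
      finally show ?thesis by (simp add: distrib_left)
    qed
    have ix: "integrable hl (\<lambda>t. (norm (\<phi>1 t *\<^sub>R v))\<^sup>2)" "integrable hl (\<lambda>t. (norm (x t))\<^sup>2)"
      "integrable hl (\<lambda>t. (norm (g t))\<^sup>2)"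
      by (rule sq_int_integrable[OF sx1] sq_int_integrable[OF sx] sq_int_integrable[OF sg])+
    \<comment> \<open>Off [L, M] both integrands vanish with \<phi> and \<phi>1; on it all four
      coefficient differences are at most \<epsilon>/2, and their products are grouped as (a + b)(c
      + d).\<close>
    have pw: "\<bar>?I t - ?J t\<bar> \<le> (\<epsilon>/2) * ((norm (\<phi>1 t *\<^sub>R v))\<^sup>2 + (norm (x t))\<^sup>2 + ((norm (g t))\<^sup>2 + (norm (\<xi> t))\<^sup>2))" for t
    proof (cases "t \<in> {L..M}")
      case False
      have b: "bilinear (p t)" "bilinear (k t)" "bilinear (l t)" using a by (auto simp: adm_def)
      have "?I t = 0" "?J t = 0" using z[OF False]
        by (simp_all add: x_def bilinear_lzero[OF b(1)] bilinear_lzero[OF b(2)] bilinear_rzero[OF b(2)] bilinear_lzero[OF b(3)]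
            bilinear_lzero[OF bl(1)] bilinear_lzero[OF bl(2)] bilinear_rzero[OF bl(2)] bilinear_lzero[OF bl(3)])
      then show ?thesis using \<epsilon> by simp
    next
      case True
      let ?a = "norm (\<phi>1 t *\<^sub>R v)" and ?b = "norm (x t)" and ?c = "norm (g t)" and ?d = "norm (\<xi> t)"
      have t: "T1 \<le> t" "T2 \<le> t" "T3 \<le> t" using True L by auto
      have "\<bar>p t (\<phi>1 t *\<^sub>R v) (g t) - pl (\<phi>1 t *\<^sub>R v) (g t)\<bar> \<le> (\<epsilon>/2) * ?a * ?c" by (rule T1[OF t(1)])
      moreover have "\<bar>k t (x t) (g t) - kl (x t) (g t)\<bar> \<le> (\<epsilon>/2) * ?b * ?c" by (rule T2[OF t(2)])
      moreover have "\<bar>k t (\<xi> t) (\<phi>1 t *\<^sub>R v) - kl (\<xi> t) (\<phi>1 t *\<^sub>R v)\<bar> \<le> (\<epsilon>/2) * ?d * ?a" by (rule T2[OF t(2)])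
      moreover have "\<bar>l t (x t) (\<xi> t) - ll (x t) (\<xi> t)\<bar> \<le> (\<epsilon>/2) * ?b * ?d" by (rule T3[OF t(3)])
      ultimately have "\<bar>?I t - ?J t\<bar> \<le> (\<epsilon>/2) * ?a * ?c + (\<epsilon>/2) * ?b * ?c + (\<epsilon>/2) * ?d * ?a + (\<epsilon>/2) * ?b * ?d"
        by linarith
      also have "\<dots> = (\<epsilon>/2) * ((?a + ?b) * (?c + ?d))" by (simp only: distrib_left distrib_right mult_ac add_ac)
      also have "\<dots> \<le> (\<epsilon>/2) * (?a\<^sup>2 + ?b\<^sup>2 + (?c\<^sup>2 + ?d\<^sup>2))" using \<epsilon> by (intro mult_left_mono sum_products_le) auto
      finally show ?thesis .
    qed
    have "(LINT t|hl. ?I t) - (LINT t|hl. ?J t) = (LINT t|hl. ?I t - ?J t)"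
      by (rule Bochner_Integration.integral_diff[OF iI iJ, symmetric])
    moreover have "\<bar>LINT t|hl. ?I t - ?J t\<bar> \<le> (LINT t|hl. \<bar>?I t - ?J t\<bar>)" by (rule integral_abs_bound)
    moreover have "(LINT t|hl. \<bar>?I t - ?J t\<bar>) \<le> (LINT t|hl. (\<epsilon>/2) * ((norm (\<phi>1 t *\<^sub>R v))\<^sup>2 + (norm (x t))\<^sup>2 + ((norm (g t))\<^sup>2 + (norm (\<xi> t))\<^sup>2)))"
    proof (rule integral_mono[OF _ _ pw])
      show "integrable hl (\<lambda>t. \<bar>?I t - ?J t\<bar>)" by (rule integrable_abs[OF Bochner_Integration.integrable_diff[OF iI iJ]])
      show "integrable hl (\<lambda>t. (\<epsilon>/2) * ((norm (\<phi>1 t *\<^sub>R v))\<^sup>2 + (norm (x t))\<^sup>2 + ((norm (g t))\<^sup>2 + (norm (\<xi> t))\<^sup>2)))"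
        by (rule integrable_mult_right[OF Bochner_Integration.integrable_add[OF Bochner_Integration.integrable_add[OF ix(1,2)]
            Bochner_Integration.integrable_add[OF ix(3) i\<xi>]]])
    qed
    moreover have "(LINT t|hl. (\<epsilon>/2) * ((norm (\<phi>1 t *\<^sub>R v))\<^sup>2 + (norm (x t))\<^sup>2 + ((norm (g t))\<^sup>2 + (norm (\<xi> t))\<^sup>2))) = (\<epsilon>/2) * (E1 x + E0 x + (E1 \<xi> + E0 \<xi>))"
      using ix i\<xi> unfolding E1x E0_def E1_def[of \<xi>] g_def[symmetric] by simp
    ultimately have "\<bar>bf p k l x \<xi>\<bar> \<le> (\<epsilon>/2) * (E0 \<xi> + E0 x) + (\<epsilon>/2) * (E1 x + E0 x + (E1 \<xi> + E0 \<xi>))"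
      unfolding bfI using J by linarith
    also have "\<dots> \<le> (\<epsilon>/2) * (E1 x + E0 x + (E1 \<xi> + E0 \<xi>)) + (\<epsilon>/2) * (E1 x + E0 x + (E1 \<xi> + E0 \<xi>))"
      using \<epsilon> E_nonneg[of x] E_nonneg[of \<xi>] by (intro add_right_mono mult_left_mono) auto
    also have "\<dots> = \<epsilon> * ((E1 x + E0 x) + (E1 \<xi> + E0 \<xi>))" by simp
    finally show ?thesis .
  qed
  have "AE t in hl. t \<notin> {L0..M} \<longrightarrow> wd x t = 0"
    using wdx by eventually_elim (use z(2) L(2) in auto)
  moreover have "x t = 0" if "t \<notin> {L0..M}" for t using that z(1)[of t] L(2) by (auto simp: x_def)
  moreover have "L0 < M" using LM L(2) by simp
  ultimately show ?thesis using xH xn0 main by blast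
qed

text \<open>Singular vectors are chosen successively, each supported beyond the previous one and
  with a smaller \<epsilon>. Normalised, they form the orthonormal sequence that
  \<open>not_fredholm_of_orthonormal\<close> excludes.\<close>

theorem not_fredholm_of_nonpositive:
  assumes p: "lim_form p pl" and k: "lim_form k kl" and l: "lim_form l ll"
    and sym: "\<And>t u w. p t u w = p t w u" "\<And>t u w. l t u w = l t w u" "\<And>u w. kl u w = kl w u"
    and v: "v \<in> V" "v \<noteq> 0" and \<mu>: "\<mu> \<le> 0"
    and pv: "\<And>w. w \<in> V \<Longrightarrow> pl v w = G v w" and lv: "\<And>w. w \<in> V \<Longrightarrow> ll v w = \<mu> * G v w"
  shows "\<not> fredholm_form_on H ip (\<lambda>x. bf p k l x x)"
proof
  assume "fredholm_form_on H ip (\<lambda>x. bf p k l x x)"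
  then obtain A where A: "bounded_operator_on H ip A" "selfadjoint_on H ip A"
    "\<And>x. x \<in> H \<Longrightarrow> bf p k l x x = ip (A x) x" "fredholm_operator_on H ip A"
    unfolding fredholm_form_on_def by blast
  have a: "adm p" "adm k" "adm l" using p k l by (auto simp: lim_form_def)
  have AH: "A x \<in> H" and Aadd: "y \<in> H \<Longrightarrow> A (x + y) = A x + A y" and Asc: "A (c *\<^sub>R x) = c *\<^sub>R A x"
    if "x \<in> H" for x y c using A(1) that by (auto simp: bounded_operator_on_def)
  \<comment> \<open>\<open>fredholm_form_on\<close> fixes the operator only through the diagonal of
    the form; polarisation with selfadjointness recovers all values.\<close>
  have pol: "ip (A x) y = bf p k l x y" if H: "x \<in> H" "y \<in> H" for x y
  proof -
    have xy: "x + y \<in> H" using H by auto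
    have "bf p k l (x + y) (x + y) = bf p k l x (x + y) + bf p k l y (x + y)" by (intro bf_add[OF a] H xy)
    also have "\<dots> = bf p k l (x + y) x + bf p k l (x + y) y"
      using bf_sym[OF sym(1,2), where k=k and x=x and z="x+y"] bf_sym[OF sym(1,2), where k=k and x=y and z="x+y"] by simp
    also have "\<dots> = bf p k l x x + 2 * bf p k l x y + bf p k l y y"
      using bf_add[OF a H H(1)] bf_add[OF a H H(2)] bf_sym[OF sym(1,2), where k=k and x=y and z=x] by simp
    finally have 1: "bf p k l (x + y) (x + y) = bf p k l x x + 2 * bf p k l x y + bf p k l y y" .
    have "ip (A (x + y)) (x + y) = ip (A x) x + ip (A x) y + (ip (A y) x + ip (A y) y)"
      using H AH by (simp add: Aadd ip_simps)
    moreover have "ip (A y) x = ip (A x) y"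
      using A(2) H ip_sym[of x "A y"] AH by (simp add: selfadjoint_on_def)
    ultimately show ?thesis using 1 A(3)[OF xy] A(3)[OF H(1)] A(3)[OF H(2)] by simp
  qed
  define P where "P n = (\<lambda>(x, L, M). x \<in> H \<and> 0 < L \<and> L < M \<and> nrm x = 1 \<and> nrm (A x) \<le> (1/4) ^ n \<and>
     (\<forall>t. t \<notin> {L..M} \<longrightarrow> x t = 0) \<and> (AE t in hl. t \<notin> {L..M} \<longrightarrow> wd x t = 0))" for n :: nat
  have step: "\<exists>x M. P n (x, L, M)" if L: "L > 0" for n L
  proof -
    \<comment> \<open>The energies of x and of a test vector of the same norm r add up to at most 2
      r^2 / c0, so this \<epsilon> leaves exactly 4^-n r^2.\<close>
    define \<epsilon> where "\<epsilon> = (c0 / 2) * (1/4) ^ n"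
    have \<epsilon>: "\<epsilon> > 0" using c0 by (simp add: \<epsilon>_def)
    obtain x M where x: "x \<in> H" "L < M" "x \<noteq> 0" "\<forall>t. t \<notin> {L..M} \<longrightarrow> x t = 0" "AE t in hl. t \<notin> {L..M} \<longrightarrow> wd x t = 0"
      "\<And>\<xi>. \<xi> \<in> H \<Longrightarrow> \<bar>bf p k l x \<xi>\<bar> \<le> \<epsilon> * ((E1 x + E0 x) + (E1 \<xi> + E0 \<xi>))"
      using singular_vector[OF p k l sym(3) v \<mu> pv lv \<epsilon> L] by blast
    define r where "r = nrm x"
    have r: "r > 0" using x nrm_eq_0[OF x(1)] nrm_ge_0[OF x(1)] unfolding r_def by linarith
    define b where "b = nrm (A x)"
    have b0: "b \<ge> 0" using AH[OF x(1)] by (simp add: b_def)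
    have Ele: "E1 y + E0 y \<le> (nrm y)\<^sup>2 / c0" if "y \<in> H" for y
      using ip_lower[OF that] nrm_sq[OF that] c0 by (simp add: field_simps)
    have "b \<le> (1/4) ^ n * r"
    proof (cases "b = 0")
      case False
      then have b: "b > 0" using b0 by simp
      \<comment> \<open>The optimal test direction A x, rescaled to the norm of x: the bound for the
        form is additive in the energies and therefore sharpest for equal norms.\<close>
      let ?\<xi> = "(r / b) *\<^sub>R A x"
      have \<xi>: "?\<xi> \<in> H" using AH[OF x(1)] by auto
      have n\<xi>: "nrm ?\<xi> = r" using b r AH[OF x(1)] by (simp add: nrm_scale b_def[symmetric])
      have "bf p k l x ?\<xi> = (r / b) * ip (A x) (A x)"
        using pol[OF x(1) \<xi>] AH[OF x(1)] by (simp add: ip_scale_r)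
      also have "ip (A x) (A x) = b * b" using nrm_sq[OF AH[OF x(1)]] by (simp add: b_def power2_eq_square)
      also have "(r / b) * (b * b) = r * b" using b by simp
      finally have "r * b \<le> \<epsilon> * ((E1 x + E0 x) + (E1 ?\<xi> + E0 ?\<xi>))" using x(6)[OF \<xi>] by simp
      also have "\<dots> \<le> \<epsilon> * (r\<^sup>2 / c0 + r\<^sup>2 / c0)"
        using Ele[OF x(1)] Ele[OF \<xi>] \<epsilon> unfolding n\<xi> r_def[symmetric] by (intro mult_left_mono add_mono) auto
      also have "\<dots> = r * ((1/4) ^ n * r)" using c0 by (simp add: \<epsilon>_def power2_eq_square)
      finally show ?thesis using r by simp
    qed (use r in simp)
    then have nA: "nrm (A ((1 / r) *\<^sub>R x)) \<le> (1/4) ^ n"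
      using r AH[OF x(1)] by (simp add: Asc[OF x(1)] nrm_scale b_def[symmetric] divide_le_eq)
    have "AE t in hl. t \<notin> {L..M} \<longrightarrow> wd ((1 / r) *\<^sub>R x) t = 0"
      using x(5) H_scale(2)[OF x(1), of "1 / r"] by eventually_elim simp
    moreover have "(1 / r) *\<^sub>R x \<in> H" "nrm ((1 / r) *\<^sub>R x) = 1"
      using x(1) r by (auto simp: nrm_scale r_def[symmetric])
    moreover have "((1 / r) *\<^sub>R x) t = 0" if "t \<notin> {L..M}" for t
      using x(4) that by (simp add: scaleR_fun_def)
    ultimately have "P n ((1 / r) *\<^sub>R x, L, M)"
      using x(2) L nA unfolding P_def prod.case by blast
    then show ?thesis by blast
  qed
  \<comment> \<open>The next window starts at M + 1, strictly after the previous one ends, so the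
    supports are disjoint and all mixed inner products vanish.\<close>
  have "\<exists>f. \<forall>n. P n (f n) \<and> snd (snd (f n)) < fst (snd (f (Suc n)))"
  proof (rule dependent_nat_choice)
    show "\<exists>y. P 0 y" using step[of 1 0] by auto
    fix y n assume y: "P n y"
    obtain x L M where yy: "y = (x, L, M)" by (cases y)
    then have "M + 1 > 0" using y by (auto simp: P_def)
    from step[OF this, of "Suc n"] show "\<exists>z. P (Suc n) z \<and> snd (snd y) < fst (snd z)" using yy by force
  qed
  then obtain f where f: "\<And>n. P n (f n)" "\<And>n. snd (snd (f n)) < fst (snd (f (Suc n)))" by blast
  define x where "x n = fst (f n)" for n
  define L where "L n = fst (snd (f n))" for n
  define M where "M n = snd (snd (f n))" for n
  have fe: "f n = (x n, L n, M n)" for n by (simp add: x_def L_def M_def)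
  have x: "x n \<in> H" "nrm (x n) = 1" "nrm (A (x n)) \<le> (1/4) ^ n" "L n < M n"
    "t \<notin> {L n..M n} \<Longrightarrow> x n t = 0" "AE t in hl. t \<notin> {L n..M n} \<longrightarrow> wd (x n) t = 0" for n t
    using f(1)[of n] unfolding fe P_def by auto
  have gap: "M n < L (Suc n)" for n using f(2)[of n] by (simp add: L_def M_def)
  have mono: "M m < L n" if "m < n" for m n
    using that
  proof (induction n)
    case (Suc n)
    show ?case
    proof (cases "m = n")
      case False
      then have "M m < L n" using Suc by simp
      then show ?thesis using x(4)[of n] gap[of n] by linarith
    qed (simp add: gap)
  qed simp
  have orth: "ip (x m) (x n) = 0" if "m < n" for m n
  proof -
    have "ip (x m) (x n) = (LINT t|hl. 0)" unfolding ip_def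
    proof (rule integral_cong_AE)
      show "(\<lambda>t. G (wd (x m) t) (wd (x n) t) + G (x m t) (x n t)) \<in> borel_measurable hl"
        by (intro borel_measurable_integrable Bochner_Integration.integrable_add adm_integrable[OF adm_const[OF G]] wd H_D x)
      show "AE t in hl. G (wd (x m) t) (wd (x n) t) + G (x m t) (x n t) = 0"
        using x(6)[of m] x(6)[of n]
      proof eventually_elim
        case (elim t)
        show ?case
        proof (cases "t \<in> {L m..M m}")
          case True
          then have "t \<notin> {L n..M n}" using mono[OF that] by auto
          then show ?thesis using elim x(5)[of t n] by (simp add: bilinear_rzero[OF G])
        next
          case False
          then show ?thesis using elim x(5)[of t m] by (simp add: bilinear_lzero[OF G])
        qed
      qed
    qed simp
    then show ?thesis by simp
  qed
  have "\<not> fredholm_operator_on H ip A"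
  proof (rule not_fredholm_of_orthonormal[OF A(2), of x])
    show "ip (x n) (x n) = 1" for n using nrm_sq[OF x(1)[of n]] x(2)[of n] by simp
    show "ip (x m) (x n) = 0" if "m \<noteq> n" for m n
      using orth[of m n] orth[of n m] ip_sym[OF x(1)[of m] x(1)[of n]] that by (cases "m < n") auto
  qed (use x in auto)
  then show False using A(4) by simp
qed

end

section \<open>Second differentials of homogeneous functions\<close>

text \<open>The second derivative is given as the derivative of z -> f' z w, matching the nested
  derivatives of \<open>second_differential\<close>. Symmetry and continuity of f'' are carried
  along by every construction, since the limit form must be symmetric and its coefficients must
  converge.\<close>

definition twice_diff :: "'a::euclidean_space set \<Rightarrow> ('a \<Rightarrow> real) \<Rightarrow> ('a \<Rightarrow> 'a \<Rightarrow> real) \<Rightarrow> ('a \<Rightarrow> 'a \<Rightarrow> 'a \<Rightarrow> real) \<Rightarrow> bool" where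
  "twice_diff S f f' f'' \<longleftrightarrow> open S \<and> (\<forall>x\<in>S. (f has_derivative f' x) (at x)) \<and>
     (\<forall>x\<in>S. \<forall>w. ((\<lambda>z. f' z w) has_derivative (\<lambda>v. f'' x v w)) (at x)) \<and>
     (\<forall>x\<in>S. \<forall>v w. f'' x v w = f'' x w v) \<and> (\<forall>v w. continuous_on S (\<lambda>x. f'' x v w))"

lemma twice_diff_D:
  assumes "twice_diff S f f' f''" "x \<in> S"
  shows "open S" "(f has_derivative f' x) (at x)" "((\<lambda>z. f' z w) has_derivative (\<lambda>v. f'' x v w)) (at x)"
    "f'' x v w = f'' x w v" "continuous_on S (\<lambda>x. f'' x v w)"
  using assms unfolding twice_diff_def by blast+

lemma twice_diff_bilinear:
  assumes "twice_diff S f f' f''" "x \<in> S"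
  shows "bilinear (f'' x)"
proof -
  have l: "linear (\<lambda>v. f'' x v w)" for w
    using has_derivative_linear[OF twice_diff_D(3)[OF assms]] .
  have "linear (f'' x v)" for v
  proof -
    have "f'' x v = (\<lambda>w. f'' x w v)" using twice_diff_D(4)[OF assms] by blast
    then show ?thesis using l[of v] by simp
  qed
  then show ?thesis using l unfolding bilinear_def by blast
qed

lemma second_differential_eq:
  assumes f: "twice_diff S f f' f''" and x: "x \<in> S"
  shows "second_differential f x v w = f'' x v w"
proof -
  have fr: "frechet_derivative f (at z) = f' z" if "z \<in> S" for z
    using frechet_derivative_at[OF twice_diff_D(2)[OF f that]] by simp
  have "((\<lambda>z. frechet_derivative f (at z) w) has_derivative (\<lambda>v. f'' x v w)) (at x)"
    by (rule has_derivative_transform_within_open[OF twice_diff_D(3)[OF f x, of w] twice_diff_D(1)[OF f x] x]) (simp add: fr)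
  from frechet_derivative_at[OF this] show ?thesis unfolding second_differential_def by metis
qed

lemma twice_diff_cong:
  assumes "twice_diff S f f' f''" "\<And>x. x \<in> S \<Longrightarrow> f x = g x"
  shows "twice_diff S g f' f''"
proof -
  have "(g has_derivative f' x) (at x)" if "x \<in> S" for x
    by (rule has_derivative_transform_within_open[OF twice_diff_D(2,1)[OF assms(1) that] that assms(2)])
  then show ?thesis using assms(1) unfolding twice_diff_def by blast
qed

lemma twice_diff_const: "open S \<Longrightarrow> twice_diff S (\<lambda>x. c) (\<lambda>x w. 0) (\<lambda>x v w. 0)"
  unfolding twice_diff_def by auto

lemma twice_diff_add:
  assumes f: "twice_diff S f f' f''" and g: "twice_diff S g g' g''"
  shows "twice_diff S (\<lambda>x. f x + g x) (\<lambda>x w. f' x w + g' x w) (\<lambda>x v w. f'' x v w + g'' x v w)"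
  using assms unfolding twice_diff_def
  by (auto intro!: has_derivative_add continuous_on_add)

lemma twice_diff_mult:
  assumes f: "twice_diff S f f' f''" and g: "twice_diff S g g' g''"
  shows "twice_diff S (\<lambda>x. f x * g x) (\<lambda>x w. f x * g' x w + f' x w * g x)
    (\<lambda>x v w. f x * g'' x v w + f' x v * g' x w + (f' x w * g' x v + f'' x v w * g x))"
  unfolding twice_diff_def
proof (intro conjI ballI allI)
  show "open S" using f by (simp add: twice_diff_def)
  fix x assume x: "x \<in> S"
  note F = twice_diff_D[OF f x] and G = twice_diff_D[OF g x]
  show "((\<lambda>x. f x * g x) has_derivative (\<lambda>w. f x * g' x w + f' x w * g x)) (at x)"
    by (rule has_derivative_mult[OF F(2) G(2)])
  fix w
  show "((\<lambda>z. f z * g' z w + f' z w * g z) has_derivative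
    (\<lambda>v. f x * g'' x v w + f' x v * g' x w + (f' x w * g' x v + f'' x v w * g x))) (at x)"
    by (rule has_derivative_add[OF has_derivative_mult[OF F(2) G(3)] has_derivative_mult[OF F(3) G(2)]])
  fix v
  show "f x * g'' x v w + f' x v * g' x w + (f' x w * g' x v + f'' x v w * g x) =
    f x * g'' x w v + f' x w * g' x v + (f' x v * g' x w + f'' x w v * g x)"
    using F(4)[of v w] G(4)[of v w] by simp
next
  fix v w
  have c: "continuous_on S f" "continuous_on S g" "continuous_on S (\<lambda>x. f' x u)" "continuous_on S (\<lambda>x. g' x u)" for u
    using f g unfolding twice_diff_def
    by (meson has_derivative_continuous continuous_at_imp_continuous_on)+
  have c2: "continuous_on S (\<lambda>x. f'' x v w)" "continuous_on S (\<lambda>x. g'' x v w)"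
    using f g unfolding twice_diff_def by blast+
  show "continuous_on S (\<lambda>x. f x * g'' x v w + f' x v * g' x w + (f' x w * g' x v + f'' x v w * g x))"
    by (intro continuous_intros c c2)
qed

definition C2_fun :: "'a::euclidean_space set \<Rightarrow> ('a \<Rightarrow> real) \<Rightarrow> bool" where
  "C2_fun S f \<longleftrightarrow> (\<exists>f' f''. twice_diff S f f' f'')"

lemma C2_fun_const: "open S \<Longrightarrow> C2_fun S (\<lambda>x. c)"
  unfolding C2_fun_def using twice_diff_const by blast

lemma C2_fun_add: "C2_fun S f \<Longrightarrow> C2_fun S g \<Longrightarrow> C2_fun S (\<lambda>x. f x + g x)"
  unfolding C2_fun_def using twice_diff_add by blast

lemma C2_fun_mult: "C2_fun S f \<Longrightarrow> C2_fun S g \<Longrightarrow> C2_fun S (\<lambda>x. f x * g x)"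
  unfolding C2_fun_def using twice_diff_mult by blast

lemma C2_fun_sum: "open S \<Longrightarrow> (\<And>i. i \<in> I \<Longrightarrow> C2_fun S (f i)) \<Longrightarrow> C2_fun S (\<lambda>x. \<Sum>i\<in>I. f i x)"
  by (induction I rule: infinite_finite_induct) (auto intro: C2_fun_const C2_fun_add)

lemma C2_fun_cong: "C2_fun S f \<Longrightarrow> (\<And>x. x \<in> S \<Longrightarrow> f x = g x) \<Longrightarrow> C2_fun S g"
  unfolding C2_fun_def using twice_diff_cong by blast

text \<open>Serves both the pair distances, with b x y the inner product of the differences, and the
  powers of the mass norm. The form may be degenerate elsewhere, as long as it is positive on
  S.\<close>

lemma C2_fun_quadratic_powr:
  fixes b :: "'a::euclidean_space \<Rightarrow> 'a \<Rightarrow> real"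
  assumes b: "bounded_bilinear b" "\<And>x y. b x y = b y x" and S: "open S" "\<And>x. x \<in> S \<Longrightarrow> 0 < b x x"
  shows "C2_fun S (\<lambda>x. b x x powr p)"
proof -
  interpret bounded_bilinear b by (rule b)
  define f' where "f' x w = 2 * p * (b x x powr (p - 1) * b x w)" for x w
  define f'' where "f'' x v w = 2 * p * (b x x powr (p - 1) * b v w + (2 * (p - 1)) * (b x x powr (p - 2) * b x v) * b x w)" for x v w
  have q: "((\<lambda>x. b x x) has_derivative (\<lambda>w. 2 * b x w)) (at x)" for x
    using FDERIV[OF has_derivative_ident has_derivative_ident, of x UNIV] by (simp add: b(2)[of _ x])
  have pw: "((\<lambda>x. b x x powr r) has_derivative (\<lambda>w. 2 * r * (b x x powr (r - 1) * b x w))) (at x)" if x: "x \<in> S" for x r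
  proof -
    have "((\<lambda>y. y powr r) has_derivative (\<lambda>h. h * (r * b x x powr (r - 1)))) (at (b x x))"
      using has_real_derivative_powr[OF S(2)[OF x], of r] by (simp add: has_field_derivative_def mult_commute_abs)
    from has_derivative_compose[OF q this] show ?thesis by (simp add: mult_ac)
  qed
  have lin: "((\<lambda>z. b z w) has_derivative (\<lambda>v. b v w)) (at x)" for x w
    by (rule bounded_linear_imp_has_derivative[OF bounded_linear_left])
  have cb: "continuous_on S (\<lambda>x. b x w)" "continuous_on S (\<lambda>x. b x x)" for w
    by (intro continuous_on continuous_intros)+
  have "twice_diff S (\<lambda>x. b x x powr p) f' f''"
    unfolding twice_diff_def
  proof (intro conjI ballI allI)
    show "open S" by fact
    show "((\<lambda>x. b x x powr p) has_derivative f' x) (at x)" if "x \<in> S" for x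
      using pw[OF that, of p] by (simp add: f'_def[abs_def])
    show "((\<lambda>z. f' z w) has_derivative (\<lambda>v. f'' x v w)) (at x)" if x: "x \<in> S" for x w
    proof -
      have "((\<lambda>z. 2 * p * (b z z powr (p - 1) * b z w)) has_derivative
        (\<lambda>v. 2 * p * (b x x powr (p - 1) * b v w + 2 * (p - 1) * (b x x powr (p - 1 - 1) * b x v) * b x w))) (at x)"
        by (rule has_derivative_mult_right[OF has_derivative_mult[OF pw[OF x, of "p - 1"] lin]])
      then show ?thesis unfolding f'_def f''_def by simp
    qed
    show "f'' x v w = f'' x w v" for x v w
      by (simp add: f''_def b(2)[of v w] mult_ac)
    show "continuous_on S (\<lambda>x. f'' x v w)" for v w
      unfolding f''_def using S(2) by (intro continuous_intros cb) fastforce+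
  qed
  then show ?thesis unfolding C2_fun_def by blast
qed

text \<open>The identity f(c x) = K f(x) is differentiated once and twice. For K = c^2 the second
  derivative is invariant under scaling.\<close>

lemma twice_diff_homogeneous:
  assumes f: "twice_diff S f f' f''" and c: "c \<noteq> 0" and S: "\<And>x. x \<in> S \<Longrightarrow> c *\<^sub>R x \<in> S"
    and hom: "\<And>x. x \<in> S \<Longrightarrow> f (c *\<^sub>R x) = K * f x" and x: "x \<in> S"
  shows "c * f' (c *\<^sub>R x) w = K * f' x w" "c * (c * f'' (c *\<^sub>R x) v w) = K * f'' x v w"
proof -
  have sc: "((\<lambda>z. c *\<^sub>R z) has_derivative (\<lambda>v. c *\<^sub>R v)) (at x)" for x :: 'a
    by (intro derivative_intros)
  have 1: "c * f' (c *\<^sub>R x) w = K * f' x w" if x: "x \<in> S" for x w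
  proof -
    have "((\<lambda>z. f (c *\<^sub>R z)) has_derivative (\<lambda>v. f' (c *\<^sub>R x) (c *\<^sub>R v))) (at x)"
      by (rule has_derivative_compose[OF sc twice_diff_D(2)[OF f S[OF x]]])
    moreover have "((\<lambda>z. f (c *\<^sub>R z)) has_derivative (\<lambda>v. K * f' x v)) (at x)"
      by (rule has_derivative_transform_within_open[OF has_derivative_mult_right[OF twice_diff_D(2)[OF f x]] twice_diff_D(1)[OF f x] x])
        (simp add: hom)
    ultimately have "(\<lambda>v. f' (c *\<^sub>R x) (c *\<^sub>R v)) = (\<lambda>v. K * f' x v)" by (rule has_derivative_unique)
    then have "f' (c *\<^sub>R x) (c *\<^sub>R w) = K * f' x w" by metis
    then show ?thesis
      using linear_cmul[OF has_derivative_linear[OF twice_diff_D(2)[OF f S[OF x]]], of c w] by simp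
  qed
  show "c * f' (c *\<^sub>R x) w = K * f' x w" by (rule 1[OF x])
  have "((\<lambda>z. c * f' (c *\<^sub>R z) w) has_derivative (\<lambda>v. c * f'' (c *\<^sub>R x) (c *\<^sub>R v) w)) (at x)"
    by (rule has_derivative_mult_right[OF has_derivative_compose[OF sc twice_diff_D(3)[OF f S[OF x], of w]]])
  moreover have "((\<lambda>z. c * f' (c *\<^sub>R z) w) has_derivative (\<lambda>v. K * f'' x v w)) (at x)"
    by (rule has_derivative_transform_within_open[OF has_derivative_mult_right[OF twice_diff_D(3)[OF f x, of w]] twice_diff_D(1)[OF f x] x])
      (simp add: 1)
  ultimately have "(\<lambda>v. c * f'' (c *\<^sub>R x) (c *\<^sub>R v) w) = (\<lambda>v. K * f'' x v w)" by (rule has_derivative_unique)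
  then have "c * f'' (c *\<^sub>R x) (c *\<^sub>R v) w = K * f'' x v w" by metis
  then show "c * (c * f'' (c *\<^sub>R x) v w) = K * f'' x v w"
    using bilinear_lmul[OF twice_diff_bilinear[OF f S[OF x]], of c v w] by simp
qed

text \<open>For degree 0 the first derivative satisfies f'(c x) w = f'(x) w / c; differentiation at
  c = 1 gives the formula. At a critical point the radial direction therefore lies in the kernel of
  the second derivative.\<close>

lemma twice_diff_radial:
  assumes f: "twice_diff S f f' f''" and S: "\<And>c x. c > 0 \<Longrightarrow> x \<in> S \<Longrightarrow> c *\<^sub>R x \<in> S"
    and hom: "\<And>c x. c > 0 \<Longrightarrow> x \<in> S \<Longrightarrow> f (c *\<^sub>R x) = f x" and x: "x \<in> S"
  shows "f'' x x w = - f' x w"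
proof -
  have "((\<lambda>c. c *\<^sub>R x) has_derivative (\<lambda>h. h *\<^sub>R x)) (at 1)" by (auto intro!: derivative_eq_intros)
  from has_derivative_compose[OF this, of "\<lambda>z. f' z w" "\<lambda>v. f'' x v w"] twice_diff_D(3)[OF f x, of w]
  have "((\<lambda>c. f' (c *\<^sub>R x) w) has_derivative (\<lambda>h. f'' x (h *\<^sub>R x) w)) (at 1)" by simp
  then have 1: "((\<lambda>c. f' (c *\<^sub>R x) w) has_real_derivative f'' x x w) (at 1)"
    unfolding has_field_derivative_def using bilinear_lmul[OF twice_diff_bilinear[OF f x], of _ x w]
    by (simp add: mult_commute_abs)
  have "((\<lambda>c. inverse c * f' x w) has_real_derivative - f' x w) (at 1)"
    by (auto intro!: derivative_eq_intros)
  moreover have "\<forall>\<^sub>F c in nhds (1::real). inverse c * f' x w = f' (c *\<^sub>R x) w"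
  proof (rule eventually_mono[OF eventually_nhds_in_open[of "{0<..}" "1::real"]])
    fix c :: real assume "c \<in> {0<..}"
    then show "inverse c * f' x w = f' (c *\<^sub>R x) w"
      using twice_diff_homogeneous(1)[OF f _ S, of c 1 x w] hom x by (simp add: field_simps)
  qed auto
  ultimately have "((\<lambda>c. f' (c *\<^sub>R x) w) has_real_derivative - f' x w) (at 1)"
    using DERIV_cong_ev[OF refl _ refl, where f="\<lambda>c. inverse c * f' x w" and g="\<lambda>c. f' (c *\<^sub>R x) w"] by blast
  with 1 show ?thesis by (rule DERIV_unique)
qed

section \<open>The potential\<close>

text \<open>Collision-free configurations with arbitrary centre of mass: an open subset of the whole
  configuration type, where Frechet derivatives are taken.\<close>

definition config :: "(real^'d^'n::finite) set" where
  "config = {q. \<forall>i j. i \<noteq> j \<longrightarrow> q $ i \<noteq> q $ j}"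

lemma inner_M_sum: "inner_M m u v = (\<Sum>i\<in>UNIV. m i * (u $ i \<bullet> v $ i))"
  by (simp add: inner_M_def mass_op_def inner_vec_def sum_distrib_left mult.assoc)

lemma bilinear_inner_M: "bilinear (inner_M m)"
  unfolding bilinear_def linear_iff
  by (simp add: inner_M_sum inner_add_left inner_add_right distrib_left sum.distrib sum_distrib_left mult.left_commute)

lemma inner_M_sym: "inner_M m u v = inner_M m v u"
  by (simp add: inner_M_sum inner_commute)

lemma inner_M_coercive:
  fixes m :: "'n::finite \<Rightarrow> real"
  assumes "\<forall>i. m i > 0"
  shows "Min (range m) * (norm u)\<^sup>2 \<le> inner_M m u u" "Min (range m) > 0"
proof -
  have "Min (range m) * (u $ i \<bullet> u $ i) \<le> m i * (u $ i \<bullet> u $ i)" for i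
    by (intro mult_right_mono Min_le) auto
  then show "Min (range m) * (norm u)\<^sup>2 \<le> inner_M m u u"
    by (simp add: inner_M_sum power2_norm_eq_inner inner_vec_def[of u] sum_distrib_left sum_mono)
  show "Min (range m) > 0" using assms by (subst Min_gr_iff) auto
qed

lemma inner_M_pos: assumes "\<forall>i. m i > 0" "u \<noteq> 0" shows "0 < inner_M m u u"
proof -
  have "0 < Min (range m) * (norm u)\<^sup>2" using inner_M_coercive(2)[OF assms(1)] assms(2) by simp
  then show ?thesis using inner_M_coercive(1)[OF assms(1), of u] by linarith
qed

lemma inner_M_nonneg: assumes "\<forall>i. m i > 0" shows "0 \<le> inner_M m u u"
  using inner_M_pos[OF assms, of u] bilinear_lzero[OF bilinear_inner_M, of m u] by (cases "u = 0") (simp_all add: less_imp_le)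

lemma bounded_bilinear_inner_M: "bounded_bilinear (inner_M m)"
  using bilinear_inner_M bilinear_conv_bounded_bilinear by blast

lemma subspace_cm_space: "subspace (cm_space m)"
proof (rule subspaceI)
  show "c *\<^sub>R x \<in> cm_space m" if "x \<in> cm_space m" for c x
  proof -
    have "(\<Sum>i\<in>UNIV. m i *\<^sub>R c *\<^sub>R x $ i) = c *\<^sub>R (\<Sum>i\<in>UNIV. m i *\<^sub>R x $ i)"
      unfolding scaleR_sum_right by (intro sum.cong refl scaleR_left_commute)
    then show ?thesis using that by (simp add: cm_space_def)
  qed
qed (simp_all add: cm_space_def scaleR_add_right sum.distrib)

text \<open>Gives meaning to the \<open>THE\<close> in \<open>hessian_M\<close> and
  \<open>adjoint_M\<close>.\<close>

lemma cm_space_riesz: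
  fixes m :: "'n::finite \<Rightarrow> real" and g :: "real^'d^'n \<Rightarrow> real"
  assumes m: "\<forall>i. m i > 0" and g: "linear g"
  shows "\<exists>!u. u \<in> cm_space m \<and> (\<forall>w\<in>cm_space m. inner_M m u w = g w)"
proof (rule ex_ex1I)
  define a where "a = (\<Sum>b\<in>Basis. g b *\<^sub>R b)"
  have ga: "g w = a \<bullet> w" for w
  proof -
    have "g w = g (\<Sum>b\<in>Basis. (w \<bullet> b) *\<^sub>R b)" by (simp add: euclidean_representation)
    also have "\<dots> = (\<Sum>b\<in>Basis. (w \<bullet> b) * g b)" using g by (simp add: linear_sum linear_cmul)
    finally show ?thesis by (simp add: a_def inner_sum_left mult.commute inner_commute[of w])
  qed
  \<comment> \<open>The Euclidean gradient divided by the masses represents g on the whole space.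
    Subtracting the mass-weighted mean c moves it into \<open>cm_space m\<close>, and equal
    displacements of all bodies are mass-orthogonal to that space.\<close>
  define u0 :: "real^'d^'n" where "u0 = (\<chi> i. (1 / m i) *\<^sub>R a $ i)"
  define tm where "tm = (\<Sum>i\<in>UNIV. m i)"
  have tm: "tm > 0" unfolding tm_def using m by (intro sum_pos) auto
  define c where "c = (1 / tm) *\<^sub>R (\<Sum>i\<in>UNIV. m i *\<^sub>R u0 $ i)"
  define u :: "real^'d^'n" where "u = (\<chi> i. u0 $ i - c)"
  have "(\<Sum>i\<in>UNIV. m i *\<^sub>R u $ i) = (\<Sum>i\<in>UNIV. m i *\<^sub>R u0 $ i) - tm *\<^sub>R c"
    by (simp add: u_def scaleR_diff_right sum_subtractf tm_def scaleR_sum_left)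
  also have "\<dots> = 0" using tm by (simp add: c_def)
  finally have uV: "u \<in> cm_space m" by (simp add: cm_space_def)
  have "inner_M m u w = g w" if w: "w \<in> cm_space m" for w
  proof -
    have "inner_M m u w = (\<Sum>i\<in>UNIV. m i * (u0 $ i \<bullet> w $ i)) - (\<Sum>i\<in>UNIV. m i * (c \<bullet> w $ i))"
      by (simp add: inner_M_sum u_def inner_diff_left right_diff_distrib sum_subtractf)
    also have "(\<Sum>i\<in>UNIV. m i * (c \<bullet> w $ i)) = c \<bullet> (\<Sum>i\<in>UNIV. m i *\<^sub>R w $ i)"
      by (simp add: inner_sum_right)
    also have "\<dots> = 0" using w by (simp add: cm_space_def)
    also have "(\<Sum>i\<in>UNIV. m i * (u0 $ i \<bullet> w $ i)) = (\<Sum>i\<in>UNIV. a $ i \<bullet> w $ i)"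
      using m by (intro sum.cong) (auto simp: u0_def less_imp_neq[symmetric])
    finally show ?thesis by (simp add: ga inner_vec_def)
  qed
  then show "\<exists>u. u \<in> cm_space m \<and> (\<forall>w\<in>cm_space m. inner_M m u w = g w)" using uV by blast
next
  fix u v assume u: "u \<in> cm_space m \<and> (\<forall>w\<in>cm_space m. inner_M m u w = g w)"
    and v: "v \<in> cm_space m \<and> (\<forall>w\<in>cm_space m. inner_M m v w = g w)"
  have "u - v \<in> cm_space m" using u v subspace_cm_space subspace_diff by blast
  then have "inner_M m (u - v) (u - v) = 0" using u v by (simp add: bilinear_lsub[OF bilinear_inner_M])
  then show "u = v" using inner_M_pos[OF m, of "u - v"] by force
qed

lemma hessian_M_inner:
  assumes m: "\<forall>i. m i > 0" and f: "twice_diff S f f' f''" and x: "x \<in> S" and w: "w \<in> cm_space m"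
  shows "inner_M m (hessian_M m f x v) w = f'' x v w"
proof -
  have "linear (f'' x v)" using twice_diff_bilinear[OF f x] by (simp add: bilinear_def)
  from theI'[OF cm_space_riesz[OF m this]] show ?thesis
    using w unfolding hessian_M_def second_differential_eq[OF f x] by blast
qed

lemma adjoint_M_inner:
  assumes m: "\<forall>i. m i > 0" and A: "linear A" and w: "w \<in> cm_space m"
  shows "inner_M m (adjoint_M m A v) w = inner_M m v (A w)"
proof -
  have "linear (\<lambda>w. inner_M m v (A w))"
    using linear_compose[OF A, of "inner_M m v"] bilinear_inner_M[of m] unfolding bilinear_def o_def by blast
  from theI'[OF cm_space_riesz[OF m this]] show ?thesis
    using w unfolding adjoint_M_def by blast
qed

lemma open_config: "open (config :: (real^'d^'n::finite) set)"
proof -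
  have "config = (\<Inter>i::'n. \<Inter>j\<in>UNIV - {i}. {q :: real^'d^'n. q $ i \<noteq> q $ j})"
    by (auto simp: config_def)
  moreover have "open (\<Inter>i::'n. \<Inter>j\<in>UNIV - {i}. {q :: real^'d^'n. q $ i \<noteq> q $ j})"
    by (intro open_INT ballI open_Collect_neq continuous_intros) simp_all
  ultimately show ?thesis by simp
qed

lemma config_scale: "c \<noteq> 0 \<Longrightarrow> q \<in> config \<Longrightarrow> c *\<^sub>R q \<in> config"
  by (simp add: config_def)

lemma collision_free_iff: "q \<in> collision_free m \<longleftrightarrow> q \<in> cm_space m \<and> q \<in> config"
  by (simp add: collision_free_def config_def)

lemma config_nonzero: assumes "CARD('n) \<ge> 2" "(q :: real^'d^'n::finite) \<in> config" shows "q \<noteq> 0"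
proof -
  obtain i j :: 'n where "i \<noteq> j" using assms(1) by (metis UNIV_I card_2_iff' ex_card)
  then show ?thesis using assms(2) by (auto simp: config_def)
qed

lemma norm_powr_inner: "norm x powr p = (x \<bullet> x) powr (p / 2)"
  unfolding norm_eq_sqrt_inner powr_half_sqrt[OF inner_ge_zero, symmetric] powr_powr by simp

lemma norm_M_powr: assumes "\<forall>i. m i > 0" shows "norm_M m x powr p = inner_M m x x powr (p / 2)"
  unfolding norm_M_def powr_half_sqrt[OF inner_M_nonneg[OF assms], symmetric] powr_powr by simp

lemma C2_potential: "C2_fun (config :: (real^'d^'n::finite) set) (potential m \<alpha>)"
proof -
  have pair: "C2_fun config (\<lambda>q :: real^'d^'n. norm (q $ i - q $ j) powr (- \<alpha>))" if "i \<noteq> j" for i j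
    unfolding norm_powr_inner
  proof (rule C2_fun_quadratic_powr[where b="\<lambda>x y. (x $ i - x $ j) \<bullet> (y $ i - y $ j)"])
    have "bilinear (\<lambda>x y :: real^'d^'n. (x $ i - x $ j) \<bullet> (y $ i - y $ j))"
      unfolding bilinear_def linear_iff by (simp add: inner_simps algebra_simps)
    then show "bounded_bilinear (\<lambda>x y :: real^'d^'n. (x $ i - x $ j) \<bullet> (y $ i - y $ j))"
      using bilinear_conv_bounded_bilinear by blast
    show "0 < (x $ i - x $ j) \<bullet> (x $ i - x $ j)" if "x \<in> config" for x :: "real^'d^'n"
      using that \<open>i \<noteq> j\<close> by (auto simp: config_def)
  qed (auto simp: open_config inner_commute)
  have "C2_fun config (\<lambda>q :: real^'d^'n. (1/2) * (\<Sum>i\<in>UNIV. \<Sum>j\<in>UNIV - {i}. (m i * m j) * norm (q $ i - q $ j) powr (- \<alpha>)))"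
    by (intro C2_fun_mult C2_fun_const C2_fun_sum open_config pair) auto
  then show ?thesis by (rule C2_fun_cong) (simp add: potential_def)
qed

lemma potential_scale: assumes "c > 0" shows "potential m \<alpha> (c *\<^sub>R q) = c powr (- \<alpha>) * potential m \<alpha> q"
proof -
  have "norm (c *\<^sub>R q $ i - c *\<^sub>R q $ j) powr (- \<alpha>) = c powr (- \<alpha>) * norm (q $ i - q $ j) powr (- \<alpha>)" for i j
    using assms by (simp add: powr_mult flip: scaleR_diff_right)
  then show ?thesis by (simp add: potential_def sum_distrib_left mult.left_commute)
qed

lemma potential_pos:
  assumes "CARD('n) \<ge> 2" "\<forall>i. m i > 0" "(q :: real^'d^'n::finite) \<in> config" shows "potential m \<alpha> q > 0"
proof -
  obtain i j :: 'n where ij: "i \<noteq> j" using assms(1) by (metis UNIV_I card_2_iff' ex_card)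
  have p: "0 < m k * m l * norm (q $ k - q $ l) powr (- \<alpha>)" if "k \<noteq> l" for k l
    using assms(2)[rule_format, of k] assms(2)[rule_format, of l] assms(3) that by (simp add: config_def)
  have nn: "0 \<le> (\<Sum>l\<in>UNIV - {k}. m k * m l * norm (q $ k - q $ l) powr (- \<alpha>))" for k
    using p by (intro sum_nonneg) (metis DiffD2 insertI1 less_imp_le)
  have "0 < (\<Sum>l\<in>UNIV - {i}. m i * m l * norm (q $ i - q $ l) powr (- \<alpha>))"
    using p ij by (intro sum_pos2[where i=j]) (auto simp: less_imp_le)
  then have "0 < (\<Sum>k\<in>UNIV. \<Sum>l\<in>UNIV - {k}. m k * m l * norm (q $ k - q $ l) powr (- \<alpha>))"
    by (rule sum_pos2[OF finite UNIV_I]) (rule nn)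
  then show ?thesis by (simp add: potential_def)
qed

lemma norm_M_scale: "norm_M m (c *\<^sub>R x) = \<bar>c\<bar> * norm_M m x"
  by (simp add: norm_M_def bilinear_lmul[OF bilinear_inner_M] bilinear_rmul[OF bilinear_inner_M] real_sqrt_mult
      flip: mult.assoc power2_eq_square)

lemma norm_M_pos: "\<forall>i. m i > 0 \<Longrightarrow> x \<noteq> 0 \<Longrightarrow> 0 < norm_M m x"
  using inner_M_pos[of m x] by (simp add: norm_M_def)

locale nbody =
  fixes m :: "'n::finite \<Rightarrow> real" and \<alpha> :: real and s0 :: "real^'d^'n"
  assumes n2: "CARD('n) \<ge> 2" and m: "\<forall>i. m i > 0" and \<alpha>: "0 < \<alpha>" "\<alpha> < 2" and cc: "central_configuration m \<alpha> s0"
begin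

abbreviation "X \<equiv> cm_space m"
abbreviation "U \<equiv> potential m \<alpha>"
abbreviation "ipM \<equiv> inner_M m"

lemma s0: "s0 \<in> X" "s0 \<in> config" "ipM s0 s0 = 1" "norm_M m s0 = 1"
  using cc inner_M_nonneg[of m s0] m by (auto simp: central_configuration_def ellipsoid_def collision_free_iff norm_M_def)

lemma C2_norm_powr: "C2_fun config (\<lambda>x :: real^'d^'n. norm_M m x powr p)"
  unfolding norm_M_powr[OF m]
  by (rule C2_fun_quadratic_powr[OF bounded_bilinear_inner_M inner_M_sym open_config inner_M_pos[OF m config_nonzero[OF n2]]])

lemma U_tilde_scale: "c > 0 \<Longrightarrow> U_tilde m \<alpha> (c *\<^sub>R x) = U_tilde m \<alpha> x"
  by (simp add: U_tilde_def norm_M_scale potential_scale powr_mult powr_minus)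

text \<open>Writes W as the squared norm times a function of degree 0 that vanishes at s0; both the
  homogeneity of W and its Hessian at s0 follow from this factorisation.\<close>

lemma W_fun_eq: assumes "x \<in> config"
  shows "W_fun m \<alpha> s0 x = norm_M m x powr 2 * (U_tilde m \<alpha> x + (- U s0))"
proof -
  have "norm_M m x > 0" using norm_M_pos[OF m config_nonzero[OF n2 assms]] .
  then show ?thesis by (simp add: W_fun_def U_tilde_def powr_add algebra_simps)
qed

lemma W_fun_scale: assumes "c > 0" "x \<in> config" shows "W_fun m \<alpha> s0 (c *\<^sub>R x) = c\<^sup>2 * W_fun m \<alpha> s0 x"
  using assms config_scale[of c x]
  by (simp add: W_fun_eq U_tilde_scale norm_M_scale powr_mult)

text \<open>\<open>U_tilde\<close> has degree 0 and agrees with U on the ellipsoid, so along the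
  line s0 + t w it equals U along the projected curve in the ellipsoid, whose derivative at 0
  vanishes for a central configuration.\<close>

lemma U_tilde_critical:
  assumes f: "twice_diff config (U_tilde m \<alpha>) f' f''" and w: "w \<in> X"
  shows "f' s0 w = 0"
proof -
  define p where "p t = s0 + t *\<^sub>R w" for t :: real
  define c where "c t = p t /\<^sub>R norm_M m (p t)" for t
  have p0: "p 0 = s0" by (simp add: p_def)
  have pd: "(p has_vector_derivative w) (at t)" for t
    unfolding p_def[abs_def] by (auto intro!: derivative_eq_intros)
  have ev: "\<forall>\<^sub>F t in nhds 0. p t \<in> config"
  proof -
    have "open (p -` config)" unfolding p_def
      by (rule open_vimage[OF open_config]) (intro continuous_intros)
    moreover have "0 \<in> p -` config" using s0(2) by (simp add: p0)
    ultimately have "\<forall>\<^sub>F t in nhds 0. t \<in> p -` config" by (rule eventually_nhds_in_open)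
    then show ?thesis by simp
  qed
  have pX: "p t \<in> X" for t
    unfolding p_def by (intro subspace_add[OF subspace_cm_space] subspace_scale[OF subspace_cm_space] s0(1) w)
  have pos: "norm_M m (p t) > 0" if "p t \<in> config" for t
    using norm_M_pos[OF m config_nonzero[OF n2 that]] .
  have cE: "c t \<in> ellipsoid m" if "p t \<in> config" for t
    using pX[of t] pos[OF that] that config_scale[of "inverse (norm_M m (p t))" "p t"]
      subspace_scale[OF subspace_cm_space pX[of t], of "inverse (norm_M m (p t))"]
    by (auto simp: c_def ellipsoid_def collision_free_iff norm_M_scale)
  have Uc: "U (c t) = U_tilde m \<alpha> (p t)" if "p t \<in> config" for t
  proof -
    have "U (c t) = inverse (norm_M m (p t)) powr (- \<alpha>) * U (p t)"
      unfolding c_def using pos[OF that] by (intro potential_scale) simp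
    also have "inverse (norm_M m (p t)) powr (- \<alpha>) = norm_M m (p t) powr \<alpha>"
      using pos[OF that] by (simp add: powr_minus inverse_powr)
    finally show ?thesis by (simp add: U_tilde_def)
  qed
  have "((\<lambda>t. ipM (p t) (p t)) has_real_derivative 2 * ipM s0 w) (at 0)"
  proof -
    have "((\<lambda>t. ipM (p t) (p t)) has_vector_derivative ipM (p 0) w + ipM w (p 0)) (at 0)"
      by (rule bounded_bilinear.has_vector_derivative[OF bounded_bilinear_inner_M pd pd])
    then show ?thesis by (simp add: has_real_derivative_iff_has_vector_derivative p0 inner_M_sym[of m w])
  qed
  then have "((\<lambda>t. sqrt (ipM (p t) (p t))) has_real_derivative (inverse (sqrt (ipM (p 0) (p 0))) / 2) * (2 * ipM s0 w)) (at 0)"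
    by (intro DERIV_chain2[where f=sqrt, OF DERIV_real_sqrt]) (simp add: p0 s0)
  then have nd: "((\<lambda>t. norm_M m (p t)) has_real_derivative ipM s0 w) (at 0)"
    by (simp add: norm_M_def p0 s0)
  have "((\<lambda>t. inverse (norm_M m (p t))) has_real_derivative - (inverse (norm_M m (p 0)) * ipM s0 w * inverse (norm_M m (p 0)))) (at 0)"
    by (rule DERIV_inverse'[OF nd]) (simp add: p0 s0)
  then have "(c has_vector_derivative inverse (norm_M m (p 0)) *\<^sub>R w + (- (inverse (norm_M m (p 0)) * ipM s0 w * inverse (norm_M m (p 0)))) *\<^sub>R p 0) (at 0)"
    unfolding c_def[abs_def] by (rule has_vector_derivative_scaleR[OF _ pd])
  then have "c differentiable (at 0)" by (rule differentiableI_vector)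
  moreover have "c 0 = s0" by (simp add: c_def p0 s0)
  moreover have "\<forall>\<^sub>F t in nhds 0. c t \<in> ellipsoid m" using ev by eventually_elim (rule cE)
  ultimately have "((\<lambda>t. U (c t)) has_real_derivative 0) (at 0)" using cc by (auto simp: central_configuration_def)
  moreover have "\<forall>\<^sub>F t in nhds 0. U (c t) = U_tilde m \<alpha> (p t)" using ev by eventually_elim (rule Uc)
  ultimately have 0: "((\<lambda>t. U_tilde m \<alpha> (p t)) has_real_derivative 0) (at 0)"
    using DERIV_cong_ev[OF refl _ refl, where f="\<lambda>t. U (c t)" and g="\<lambda>t. U_tilde m \<alpha> (p t)" and x=0 and u=0] by blast
  have "(p has_derivative (\<lambda>h. h *\<^sub>R w)) (at 0)" using pd[of 0] by (simp add: has_vector_derivative_def)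
  moreover have "(U_tilde m \<alpha> has_derivative f' s0) (at (p 0))" unfolding p0 by (rule twice_diff_D(2)[OF f s0(2)])
  ultimately have "((\<lambda>t. U_tilde m \<alpha> (p t)) has_derivative (\<lambda>h. f' s0 (h *\<^sub>R w))) (at 0)"
    by (rule has_derivative_compose)
  moreover have "(\<lambda>h. f' s0 (h *\<^sub>R w)) = (*) (f' s0 w)"
    using linear_cmul[OF has_derivative_linear[OF twice_diff_D(2)[OF f s0(2)]], of _ w] by (simp add: fun_eq_iff mult.commute)
  ultimately have "((\<lambda>t. U_tilde m \<alpha> (p t)) has_real_derivative f' s0 w) (at 0)"
    by (simp add: has_field_derivative_def)
  with 0 show ?thesis by (rule DERIV_unique[symmetric])
qed

text \<open>In the product rule for W at s0 the second factor and its first derivative on X vanish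
  and the first factor is 1, so only the Hessian of \<open>U_tilde\<close> remains. The radial
  kernel comes from degree 0, and the scaling invariance of W'' from degree 2.\<close>

lemma hessians:
  obtains f' f'' W' W'' where "twice_diff config (U_tilde m \<alpha>) f' f''" "twice_diff config (W_fun m \<alpha> s0) W' W''"
    "\<And>v w. v \<in> X \<Longrightarrow> w \<in> X \<Longrightarrow> W'' s0 v w = f'' s0 v w"
    "\<And>w. w \<in> X \<Longrightarrow> W'' s0 s0 w = 0"
    "\<And>c x v w. c > 0 \<Longrightarrow> x \<in> config \<Longrightarrow> W'' (c *\<^sub>R x) v w = W'' x v w"
proof -
  have "C2_fun config (U_tilde m \<alpha> :: real^'d^'n \<Rightarrow> real)" unfolding U_tilde_def[abs_def]
    by (intro C2_fun_mult C2_norm_powr C2_potential)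
  then obtain f' f'' where f: "twice_diff config (U_tilde m \<alpha> :: real^'d^'n \<Rightarrow> real) f' f''" by (auto simp: C2_fun_def)
  obtain N' N'' where N: "twice_diff config (\<lambda>x :: real^'d^'n. norm_M m x powr 2) N' N''" using C2_norm_powr[of 2] by (auto simp: C2_fun_def)
  have "twice_diff config (\<lambda>x. U_tilde m \<alpha> x + (- U s0)) (\<lambda>x w. f' x w + 0) (\<lambda>x v w. f'' x v w + 0)"
    by (rule twice_diff_add[OF f twice_diff_const[OF open_config]])
  then have f2: "twice_diff config (\<lambda>x. U_tilde m \<alpha> x + (- U s0)) f' f''" by simp
  define W' where "W' x w = norm_M m x powr 2 * f' x w + N' x w * (U_tilde m \<alpha> x + (- U s0))" for x w
  define W'' where "W'' x v w = norm_M m x powr 2 * f'' x v w + N' x v * f' x w + (N' x w * f' x v + N'' x v w * (U_tilde m \<alpha> x + (- U s0)))" for x v w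
  have W: "twice_diff config (W_fun m \<alpha> s0) W' W''"
    using twice_diff_cong[OF twice_diff_mult[OF N f2] W_fun_eq[symmetric]] by (simp add: W'_def[abs_def] W''_def[abs_def])
  have 1: "W'' s0 v w = f'' s0 v w" if "v \<in> X" "w \<in> X" for v w
    using U_tilde_critical[OF f that(1)] U_tilde_critical[OF f that(2)]
    by (simp add: W''_def s0 U_tilde_def)
  have 2: "W'' s0 s0 w = 0" if "w \<in> X" for w
  proof -
    have "f'' s0 s0 w = - f' s0 w"
      by (rule twice_diff_radial[OF f _ _ s0(2)]) (auto simp: config_scale U_tilde_scale)
    then show ?thesis using 1[OF s0(1) that] U_tilde_critical[OF f that] by simp
  qed
  have 3: "W'' (c *\<^sub>R x) v w = W'' x v w" if "c > 0" "x \<in> config" for c x v w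
  proof -
    have "c * (c * W'' (c *\<^sub>R x) v w) = c\<^sup>2 * W'' x v w"
      by (rule twice_diff_homogeneous(2)[OF W _ config_scale W_fun_scale that(2)]) (use that in auto)
    then show ?thesis using that by (simp add: power2_eq_square)
  qed
  show ?thesis
  proof (rule that[of f' f'' W' W''])
    show "twice_diff config (U_tilde m \<alpha>) f' f''" by (fact f)
    show "twice_diff config (W_fun m \<alpha> s0) W' W''" by (fact W)
    show "W'' s0 v w = f'' s0 v w" if "v \<in> X" "w \<in> X" for v w using that by (fact 1)
    show "W'' s0 s0 w = 0" if "w \<in> X" for w using that by (fact 2)
    show "W'' (c *\<^sub>R x) v w = W'' x v w" if "c > 0" "x \<in> config" for c x v w using that by (fact 3)
  qed
qed

end

section \<open>Asymptotic motions\<close>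

locale asymptotic_motion = nbody m \<alpha> s0
  for m :: "'n::finite \<Rightarrow> real" and \<alpha> :: real and s0 :: "real^'d^'n" +
  fixes T :: ereal and \<gamma> :: "real \<Rightarrow> real^'d^'n"
  assumes sol: "s0_asymptotic_solution m \<alpha> s0 T \<gamma>"
begin

definition "I = einterval 0 T"
definition "D = {t. 0 \<le> t \<and> ereal t < T}"
definition "F = end_filter T"
definition "g1 = velocity \<gamma>"
definition "g2 = velocity g1"
definition "r t = norm_M m (\<gamma> t)"
definition "\<sigma> t = \<gamma> t /\<^sub>R r t"
definition "J1 t = 2 * ipM (\<gamma> t) (g1 t)"
text \<open>As J1 is the derivative of r^2, the quotient J1/(2r) is the radial velocity. Up to the
  factor (2-\<alpha>)/4, v is \<rho>'/\<rho>, and S1 is s', both with respect to the regularised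
  time but expressed in the original one.\<close>

definition "v t = r t powr (\<alpha> / 2) * (J1 t / (2 * r t))"
definition "S1 t = r t powr (\<alpha> / 2) *\<^sub>R (g1 t - (J1 t / (2 * r t)) *\<^sub>R \<sigma> t)"
definition "h = energy m \<alpha> T \<gamma>"

lemma motion: "asymptotic_solution m \<alpha> T \<gamma>" and \<sigma>_lim: "(\<sigma> \<longlongrightarrow> s0) F"
  using sol by (simp_all add: s0_asymptotic_solution_def F_def \<sigma>_def[abs_def] r_def)

lemma infinite_T: assumes "\<not> T < \<infinity>" shows "T = \<infinity>" "I = {0<..}" "D = {0..}" "F = at_top"
  using assms unfolding I_def D_def F_def by (auto simp: end_filter_def einterval_iff zero_ereal_def)

lemma T_cases: obtains T' where "T = ereal T'" "T' > 0" "I = {0<..<T'}" "D = {0..<T'}" "F = at_left T'"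
  | "I = {0<..}" "D = {0..}" "F = at_top"
proof (cases "T < \<infinity>")
  case True
  have "0 < T" using motion by (simp add: asymptotic_solution_def)
  then obtain T' where T': "T = ereal T'" "T' > 0" using True by (cases T) auto
  show thesis
  proof (rule that(1)[OF T'])
    show "I = {0<..<T'}" "D = {0..<T'}" "F = at_left T'"
      unfolding I_def D_def F_def end_filter_def unfolding T' by (auto simp: einterval_iff zero_ereal_def)
  qed
next
  case False
  then show thesis using that(2) infinite_T(2-4) by blast
qed

lemma I_subset_D: "I \<subseteq> D" and open_I: "open I" and convex_I: "convex I" and I_iff: "t \<in> I \<longleftrightarrow> t \<in> D \<and> 0 < t" and zero_D: "0 \<in> D"
  by (cases rule: T_cases; auto)+

lemma D_down: "t \<in> D \<Longrightarrow> 0 \<le> s \<Longrightarrow> s \<le> t \<Longrightarrow> s \<in> D"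
  by (cases rule: T_cases) auto

lemma D_larger: "t \<in> D \<Longrightarrow> \<exists>u\<in>I. t < u"
proof (cases rule: T_cases)
  case (1 T')
  show "t \<in> D \<Longrightarrow> \<exists>u\<in>I. t < u" unfolding 1(3,4) using dense[of t T'] by fastforce
next
  case 2
  show "t \<in> D \<Longrightarrow> \<exists>u\<in>I. t < u" unfolding 2 by (intro bexI[of _ "t + 1"]) auto
qed

text \<open>One description for both kinds of end, so that most limit arguments treat collisions and
  parabolic motions together.\<close>

lemma eventually_F: "eventually P F \<longleftrightarrow> (\<exists>t0\<in>D. \<forall>t\<in>I. t0 < t \<longrightarrow> P t)"
proof (cases rule: T_cases)
  case (1 T')
  show ?thesis
  proof
    assume "eventually P F"
    then obtain b where b: "b < T'" "\<And>y. b < y \<Longrightarrow> y < T' \<Longrightarrow> P y"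
      unfolding 1(5) eventually_at_left_field by blast
    then show "\<exists>t0\<in>D. \<forall>t\<in>I. t0 < t \<longrightarrow> P t" using 1(2) unfolding 1(3,4) by (intro bexI[of _ "max 0 b"]) auto
  next
    assume "\<exists>t0\<in>D. \<forall>t\<in>I. t0 < t \<longrightarrow> P t"
    then obtain t0 where t0: "t0 \<in> D" "\<forall>t\<in>I. t0 < t \<longrightarrow> P t" by blast
    then show "eventually P F" unfolding 1(5) eventually_at_left_field 1(3,4) by (intro exI[of _ t0]) auto
  qed
next
  case 2
  show ?thesis
  proof
    assume "eventually P F"
    then obtain N where "\<And>n. n \<ge> N \<Longrightarrow> P n" unfolding 2(3) eventually_at_top_linorder by blast
    then show "\<exists>t0\<in>D. \<forall>t\<in>I. t0 < t \<longrightarrow> P t" unfolding 2(1,2) by (intro bexI[of _ "max 0 N"]) auto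
  next
    assume "\<exists>t0\<in>D. \<forall>t\<in>I. t0 < t \<longrightarrow> P t"
    then obtain t0 where t0: "t0 \<in> D" "\<forall>t\<in>I. t0 < t \<longrightarrow> P t" by blast
    then show "eventually P F" unfolding 2(3) eventually_at_top_dense 2(1,2) by (intro exI[of _ t0]) auto
  qed
qed

lemma F_nontrivial: "F \<noteq> bot"
  by (cases rule: T_cases) auto

lemma ev_I: "eventually (\<lambda>t. t \<in> I) F"
  using zero_D by (auto simp: eventually_F)

lemma bounded_on_D:
  fixes f :: "real \<Rightarrow> real"
  assumes f: "continuous_on D f" and l: "(f \<longlongrightarrow> l) F"
  shows "\<exists>B. \<forall>t\<in>D. \<bar>f t\<bar> \<le> B"
proof -
  have "eventually (\<lambda>t. dist (f t) l < 1) F" using l by (rule tendstoD) simp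
  then obtain t0 where t0: "t0 \<in> D" "\<And>t. t \<in> I \<Longrightarrow> t0 < t \<Longrightarrow> dist (f t) l < 1" by (auto simp: eventually_F)
  have "{0..t0} \<subseteq> D" using D_down[OF t0(1)] by auto
  then have "compact (f ` {0..t0})" using f by (intro compact_continuous_image) (auto intro: continuous_on_subset)
  from compact_imp_bounded[OF this] obtain B where B: "\<And>t. t \<in> {0..t0} \<Longrightarrow> norm (f t) \<le> B"
    unfolding bounded_iff by blast
  have "\<bar>f t\<bar> \<le> max B (\<bar>l\<bar> + 1)" if t: "t \<in> D" for t
  proof (cases "t \<le> t0")
    case True
    have "0 \<le> t" using t by (simp add: D_def)
    then show ?thesis using B[of t] True by auto
  next
    case False
    have "0 \<le> t0" using t0 by (simp add: D_def)
    then have "dist (f t) l < 1" using t0(2)[of t] t False by (auto simp: I_iff)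
    then show ?thesis by (auto simp: dist_real_def)
  qed
  then show ?thesis by blast
qed

section \<open>Newton's equation, conservation of energy and the Lagrange-Jacobi identity\<close>

lemma \<gamma>_D: assumes "t \<in> D" shows "\<gamma> t \<in> X" "\<gamma> t \<in> config" "\<gamma> t \<noteq> 0" "r t > 0"
proof -
  show c: "\<gamma> t \<in> X" "\<gamma> t \<in> config"
    using motion assms by (auto simp: asymptotic_solution_def D_def collision_free_iff)
  then show n: "\<gamma> t \<noteq> 0" using config_nonzero[OF n2] by blast
  show "r t > 0" unfolding r_def by (rule norm_M_pos[OF m n])
qed

lemma \<gamma>_cont: "continuous_on D \<gamma>"
  using motion by (simp add: asymptotic_solution_def D_def)

lemma deriv_\<gamma>: assumes "t \<in> I"
  shows "(\<gamma> has_vector_derivative g1 t) (at t)" "(g1 has_vector_derivative g2 t) (at t)"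
proof -
  have C2: "C2_on I \<gamma>" using motion by (simp add: asymptotic_solution_def I_def)
  then show "(\<gamma> has_vector_derivative g1 t) (at t)"
    using assms by (simp add: C2_on_def g1_def vector_derivative_works)
  obtain Df where "\<forall>x\<in>I. (g1 has_vector_derivative Df x) (at x)"
    using C2 unfolding C2_on_def C1_differentiable_on_def g1_def by blast
  then show "(g1 has_vector_derivative g2 t) (at t)"
    using assms by (metis g2_def vector_derivative_at)
qed

lemma g1_cont: "continuous_on I g1"
proof (rule continuous_at_imp_continuous_on, rule ballI)
  fix t assume "t \<in> I"
  from has_vector_derivative_continuous[OF deriv_\<gamma>(2)[OF this]] show "isCont g1 t" .
qed

lemma grad: assumes "t \<in> I" shows "(U has_derivative (\<lambda>k. ipM (g2 t) k)) (at (\<gamma> t))"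
proof -
  have "GDERIV U (\<gamma> t) :> mass_op m (g2 t)"
    using motion assms by (simp add: asymptotic_solution_def I_def g2_def g1_def)
  then show ?thesis by (simp add: gderiv_def inner_M_def inner_commute)
qed

lemma ip_deriv:
  assumes "(a has_vector_derivative a') (at t)" "(b has_vector_derivative b') (at t)"
  shows "((\<lambda>t. ipM (a t) (b t)) has_real_derivative (ipM (a t) b' + ipM a' (b t))) (at t)"
  unfolding has_real_derivative_iff_has_vector_derivative
  by (rule bounded_bilinear.has_vector_derivative[OF bounded_bilinear_inner_M assms])

lemma U_\<gamma>_deriv: assumes "t \<in> I" shows "((\<lambda>t. U (\<gamma> t)) has_real_derivative ipM (g2 t) (g1 t)) (at t)"
proof -
  have "((\<lambda>t. U (\<gamma> t)) has_derivative (\<lambda>k. ipM (g2 t) (k *\<^sub>R g1 t))) (at t)"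
    using deriv_\<gamma>(1)[OF assms] unfolding has_vector_derivative_def
    by (rule has_derivative_compose) (rule grad[OF assms])
  then show ?thesis
    by (simp add: has_field_derivative_def bilinear_rmul[OF bilinear_inner_M] mult_commute_abs)
qed

lemma norm_M_sq: "(norm_M m x)\<^sup>2 = ipM x x"
  using inner_M_nonneg[OF m] by (simp add: norm_M_def)

text \<open>Conservation along the convex set I supplies the unique constant denoted by the
  \<open>THE\<close> in \<open>energy\<close>.\<close>

lemma energy_eq: assumes "t \<in> I" shows "ipM (g1 t) (g1 t) = 2 * (U (\<gamma> t) + h)"
proof -
  have "\<exists>c. \<forall>t\<in>I. ipM (g1 t) (g1 t) / 2 - U (\<gamma> t) = c"
  proof (rule has_field_derivative_zero_constant[OF convex_I])
    fix t assume t: "t \<in> I"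
    have "((\<lambda>t. ipM (g1 t) (g1 t) / 2 - U (\<gamma> t)) has_real_derivative (ipM (g1 t) (g2 t) + ipM (g2 t) (g1 t)) / 2 - ipM (g2 t) (g1 t)) (at t)"
      by (rule DERIV_diff[OF DERIV_cdivide[OF ip_deriv[OF deriv_\<gamma>(2)[OF t] deriv_\<gamma>(2)[OF t]]] U_\<gamma>_deriv[OF t]])
    then show "((\<lambda>t. ipM (g1 t) (g1 t) / 2 - U (\<gamma> t)) has_real_derivative 0) (at t within I)"
      by (simp add: inner_M_sym[of m "g1 t"] has_field_derivative_at_within)
  qed
  then obtain c where c: "\<And>t. t \<in> I \<Longrightarrow> ipM (g1 t) (g1 t) / 2 - U (\<gamma> t) = c" by blast
  have "h = c" unfolding h_def energy_def
  proof (rule the_equality)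
    show "\<forall>t\<in>einterval 0 T. c = (norm_M m (velocity \<gamma> t))\<^sup>2 / 2 - U (\<gamma> t)"
      using c by (simp add: norm_M_sq g1_def I_def)
    fix k assume "\<forall>t\<in>einterval 0 T. k = (norm_M m (velocity \<gamma> t))\<^sup>2 / 2 - U (\<gamma> t)"
    then show "k = c" using c assms by (force simp: norm_M_sq g1_def I_def)
  qed
  then show ?thesis using c[OF assms] by simp
qed

text \<open>Euler's identity for a function of degree -\<alpha>: U(c \<gamma>) is differentiated at
  c = 1 by the chain rule with Newton's equation and by the scaling law.\<close>

lemma euler: assumes t: "t \<in> I" shows "ipM (\<gamma> t) (g2 t) = - \<alpha> * U (\<gamma> t)"
proof -
  have "((\<lambda>c. c *\<^sub>R \<gamma> t) has_derivative (\<lambda>k. k *\<^sub>R \<gamma> t)) (at 1)" by (auto intro!: derivative_eq_intros)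
  then have "((\<lambda>c. U (c *\<^sub>R \<gamma> t)) has_derivative (\<lambda>k. ipM (g2 t) (k *\<^sub>R \<gamma> t))) (at 1)"
    by (rule has_derivative_compose) (simp add: grad[OF t])
  then have 1: "((\<lambda>c. U (c *\<^sub>R \<gamma> t)) has_real_derivative ipM (g2 t) (\<gamma> t)) (at 1)"
    by (simp add: has_field_derivative_def bilinear_rmul[OF bilinear_inner_M] mult_commute_abs)
  have "((\<lambda>c. c powr (- \<alpha>) * U (\<gamma> t)) has_real_derivative (- \<alpha> * 1 powr (- \<alpha> - 1)) * U (\<gamma> t)) (at 1)"
    by (rule DERIV_cmult_right[OF has_real_derivative_powr]) simp
  moreover have "\<forall>\<^sub>F c in nhds (1::real). c powr (- \<alpha>) * U (\<gamma> t) = U (c *\<^sub>R \<gamma> t)"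
    by (rule eventually_mono[OF eventually_nhds_in_open[of "{0<..}"]]) (auto simp: potential_scale)
  ultimately have "((\<lambda>c. U (c *\<^sub>R \<gamma> t)) has_real_derivative - \<alpha> * U (\<gamma> t)) (at 1)"
    using DERIV_cong_ev[OF refl _ refl, where f="\<lambda>c. c powr (- \<alpha>) * U (\<gamma> t)" and g="\<lambda>c. U (c *\<^sub>R \<gamma> t)" and x=1] by simp
  from DERIV_unique[OF 1 this] show ?thesis by (simp add: inner_M_sym[of m "\<gamma> t"])
qed

lemma r_sq: "(r t)\<^sup>2 = ipM (\<gamma> t) (\<gamma> t)" by (simp add: r_def norm_M_sq)

text \<open>The second part is the Lagrange-Jacobi identity: \<open>euler\<close> eliminates the
  acceleration and \<open>energy_eq\<close> the kinetic energy.\<close>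

lemma J_deriv: assumes t: "t \<in> I"
  shows "((\<lambda>t. ipM (\<gamma> t) (\<gamma> t)) has_real_derivative J1 t) (at t)"
    and "(J1 has_real_derivative (4 * h + (4 - 2 * \<alpha>) * U (\<gamma> t))) (at t)"
proof -
  show "((\<lambda>t. ipM (\<gamma> t) (\<gamma> t)) has_real_derivative J1 t) (at t)"
    using ip_deriv[OF deriv_\<gamma>(1)[OF t] deriv_\<gamma>(1)[OF t]] by (simp add: J1_def inner_M_sym[of m "g1 t"])
  have "(J1 has_real_derivative 2 * (ipM (\<gamma> t) (g2 t) + ipM (g1 t) (g1 t))) (at t)"
    unfolding J1_def[abs_def] by (rule DERIV_cmult[OF ip_deriv[OF deriv_\<gamma>[OF t]]])
  then show "(J1 has_real_derivative (4 * h + (4 - 2 * \<alpha>) * U (\<gamma> t))) (at t)"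
    by (simp add: euler[OF t] energy_eq[OF t] algebra_simps)
qed

lemma r_deriv: assumes t: "t \<in> I" shows "(r has_real_derivative J1 t / (2 * r t)) (at t)"
proof -
  have "ipM (\<gamma> t) (\<gamma> t) > 0" using \<gamma>_D(3)[of t] t I_subset_D inner_M_pos[OF m] by blast
  then have "((\<lambda>t. sqrt (ipM (\<gamma> t) (\<gamma> t))) has_real_derivative (inverse (sqrt (ipM (\<gamma> t) (\<gamma> t))) / 2) * J1 t) (at t)"
    by (intro DERIV_chain2[where f=sqrt, OF DERIV_real_sqrt] J_deriv t)
  moreover have "(\<lambda>t. sqrt (ipM (\<gamma> t) (\<gamma> t))) = r" by (simp add: fun_eq_iff r_def norm_M_def)
  moreover have "sqrt (ipM (\<gamma> t) (\<gamma> t)) = r t" by (simp add: r_def norm_M_def)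
  ultimately have "(r has_real_derivative (inverse (r t) / 2) * J1 t) (at t)" by simp
  moreover have "(inverse (r t) / 2) * J1 t = J1 t / (2 * r t)" by (simp add: field_simps)
  ultimately show ?thesis by (simp only:)
qed

lemma r_cont: "continuous_on D r"
  unfolding r_def[abs_def] norm_M_def
  by (rule continuous_on_real_sqrt[OF bounded_bilinear.continuous_on[OF bounded_bilinear_inner_M \<gamma>_cont \<gamma>_cont]])

lemma \<sigma>_cont: "continuous_on D \<sigma>"
proof -
  have "continuous_on D (\<lambda>t. inverse (r t))"
    by (rule continuous_on_inverse[OF r_cont]) (use \<gamma>_D(4) in force)
  from continuous_on_scaleR[OF this \<gamma>_cont] show ?thesis unfolding \<sigma>_def[abs_def] .
qed

lemma \<sigma>_D: assumes "t \<in> D" shows "\<sigma> t \<in> X" "\<sigma> t \<in> config" "ipM (\<sigma> t) (\<sigma> t) = 1" "\<gamma> t = r t *\<^sub>R \<sigma> t"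
proof -
  note g = \<gamma>_D[OF assms]
  show "\<sigma> t \<in> X" unfolding \<sigma>_def by (rule subspace_scale[OF subspace_cm_space g(1)])
  show "\<sigma> t \<in> config" unfolding \<sigma>_def using g by (intro config_scale) auto
  show "\<gamma> t = r t *\<^sub>R \<sigma> t" using g by (simp add: \<sigma>_def)
  show "ipM (\<sigma> t) (\<sigma> t) = 1" using g
    by (simp add: \<sigma>_def bilinear_lmul[OF bilinear_inner_M] bilinear_rmul[OF bilinear_inner_M] r_sq[symmetric] power2_eq_square field_simps)
qed

lemma U_\<gamma>: assumes "t \<in> D" shows "U (\<gamma> t) = r t powr (- \<alpha>) * U (\<sigma> t)"
  unfolding \<sigma>_D(4)[OF assms] by (rule potential_scale[OF \<gamma>_D(4)[OF assms]])

section \<open>Limits of the radius and of the rescaled velocity at the end of the motion\<close>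

lemma isCont_U: assumes "x \<in> config" shows "isCont U (x :: real^'d^'n)"
proof -
  obtain f' f'' where "twice_diff (config :: (real^'d^'n) set) U f' f''" using C2_potential[of m \<alpha>] unfolding C2_fun_def by auto
  from has_derivative_continuous[OF twice_diff_D(2)[OF this assms]] show ?thesis .
qed

lemma U_\<sigma>_lim: "((\<lambda>t. U (\<sigma> t)) \<longlongrightarrow> U s0) F"
  using isCont_tendsto_compose[OF isCont_U[OF s0(2)] \<sigma>_lim] .

lemma U_\<sigma>_cont: "continuous_on D (\<lambda>t. U (\<sigma> t))"
proof (rule continuous_on_compose2[OF _ \<sigma>_cont])
  show "continuous_on (config :: (real^'d^'n) set) U" by (rule continuous_at_imp_continuous_on) (use isCont_U in blast)
qed (use \<sigma>_D in auto)

lemma U_s0_pos: "U s0 > 0" by (rule potential_pos[OF n2 m s0(2)])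

text \<open>Cauchy-Schwarz for <\<gamma>, \<gamma>'>, with the speed expressed by the
  energy.\<close>

lemma J1_bound: assumes "t \<in> I" shows "(J1 t)\<^sup>2 \<le> 8 * (r t)\<^sup>2 * (U (\<gamma> t) + h)"
proof -
  interpret ip_on UNIV ipM
    by standard (simp_all add: bilinear_ladd[OF bilinear_inner_M] bilinear_lmul[OF bilinear_inner_M] inner_M_pos[OF m], rule inner_M_sym)
  have "\<bar>ipM (\<gamma> t) (g1 t)\<bar> \<le> nrm (\<gamma> t) * nrm (g1 t)" by (rule CS) auto
  then have "\<bar>ipM (\<gamma> t) (g1 t)\<bar>\<^sup>2 \<le> (nrm (\<gamma> t) * nrm (g1 t))\<^sup>2" by (intro power_mono) auto
  also have "\<dots> = (r t)\<^sup>2 * (2 * (U (\<gamma> t) + h))"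
    using energy_eq[OF assms] by (simp add: power_mult_distrib nrm_sq r_sq)
  finally show ?thesis by (simp add: J1_def power_mult_distrib algebra_simps)
qed

text \<open>Vanishing kinetic energy gives U(\<gamma>) -> -h, so h <= 0. For h < 0 the radius would
  converge, hence J1 -> 0 by \<open>J1_bound\<close>, while the derivative of J1 tends to 2 \<alpha>
  h < 0, a contradiction. With h = 0 the power r^-\<alpha> tends to 0.\<close>

lemma parabolic: assumes "T = \<infinity>" shows "h = 0" "filterlim r at_top F"
proof -
  have F: "F = at_top" "I = {0<..}" using infinite_T assms by simp_all
  have "((\<lambda>t. (norm_M m (velocity \<gamma> t))\<^sup>2 / 2) \<longlongrightarrow> 0) F"
    using motion assms unfolding asymptotic_solution_def F by simp
  then have K0: "((\<lambda>t. ipM (g1 t) (g1 t) / 2) \<longlongrightarrow> 0) F" by (simp add: norm_M_sq g1_def)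
  have "\<forall>\<^sub>F t in F. ipM (g1 t) (g1 t) / 2 = U (\<gamma> t) + h"
    using ev_I by eventually_elim (simp add: energy_eq)
  from Lim_transform_eventually[OF K0 this] have Uh0: "((\<lambda>t. U (\<gamma> t) + h) \<longlongrightarrow> 0) F" .
  then have "((\<lambda>t. (U (\<gamma> t) + h) - h) \<longlongrightarrow> 0 - h) F" by (intro tendsto_intros)
  then have Uh: "((\<lambda>t. U (\<gamma> t)) \<longlongrightarrow> - h) F" by simp
  have Upos: "U (\<gamma> t) > 0" if "t \<in> D" for t using potential_pos[OF n2 m \<gamma>_D(2)[OF that]] .
  have "\<forall>\<^sub>F t in F. 0 \<le> U (\<gamma> t)" using ev_I by eventually_elim (use Upos I_subset_D in \<open>force intro: less_imp_le\<close>)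
  from tendsto_lowerbound[OF Uh this F_nontrivial] have h0: "h \<le> 0" by simp
  have rpow: "((\<lambda>t. r t powr (- \<alpha>)) \<longlongrightarrow> - h / U s0) F"
  proof (rule Lim_transform_eventually[OF tendsto_divide[OF Uh U_\<sigma>_lim]])
    show "U s0 \<noteq> 0" using U_s0_pos by simp
    show "\<forall>\<^sub>F t in F. U (\<gamma> t) / U (\<sigma> t) = r t powr - \<alpha>" using ev_I
    proof eventually_elim
      case (elim t)
      then have t: "t \<in> D" using I_subset_D by blast
      have "U (\<sigma> t) > 0" by (rule potential_pos[OF n2 m \<sigma>_D(2)[OF t]])
      then show ?case using U_\<gamma>[OF t] by simp
    qed
  qed
  show h: "h = 0"
  proof (rule ccontr)
    assume "h \<noteq> 0"
    then have hneg: "h < 0" using h0 by simp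
    have lpos: "0 < - h / U s0" using hneg U_s0_pos by (intro divide_pos_pos) auto
    have rl: "(r \<longlongrightarrow> (- h / U s0) powr (- 1 / \<alpha>)) F"
    proof (rule Lim_transform_eventually)
      show "((\<lambda>t. (r t powr (- \<alpha>)) powr (- 1 / \<alpha>)) \<longlongrightarrow> (- h / U s0) powr (- 1 / \<alpha>)) F"
        using lpos by (intro tendsto_powr rpow tendsto_const) auto
      show "\<forall>\<^sub>F t in F. (r t powr (- \<alpha>)) powr (- 1 / \<alpha>) = r t" using ev_I
      proof eventually_elim
        case (elim t)
        then have "r t > 0" using \<gamma>_D(4) I_subset_D by blast
        then show ?case using \<alpha> by (simp add: powr_powr)
      qed
    qed
    have "((\<lambda>t. 8 * (r t)\<^sup>2 * (U (\<gamma> t) + h)) \<longlongrightarrow> 8 * ((- h / U s0) powr (- 1 / \<alpha>))\<^sup>2 * 0) F"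
      by (intro tendsto_intros rl Uh0)
    then have up: "((\<lambda>t. 8 * (r t)\<^sup>2 * (U (\<gamma> t) + h)) \<longlongrightarrow> 0) F" by simp
    have "((\<lambda>t. (J1 t)\<^sup>2) \<longlongrightarrow> 0) F"
    proof (rule tendsto_sandwich[OF _ _ tendsto_const up])
      show "\<forall>\<^sub>F t in F. (J1 t)\<^sup>2 \<le> 8 * (r t)\<^sup>2 * (U (\<gamma> t) + h)" using ev_I by eventually_elim (rule J1_bound)
    qed simp
    then have "((\<lambda>t. sqrt ((J1 t)\<^sup>2)) \<longlongrightarrow> sqrt 0) F" by (rule tendsto_real_sqrt)
    then have J0: "(J1 \<longlongrightarrow> 0) F" by (simp add: tendsto_rabs_zero_iff)
    define c where "c = - (2 * \<alpha> * h)"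
    have c: "c > 0" using hneg \<alpha> by (simp add: c_def mult_pos_neg)
    have "((\<lambda>t. 4 * h + (4 - 2 * \<alpha>) * U (\<gamma> t)) \<longlongrightarrow> 4 * h + (4 - 2 * \<alpha>) * (- h)) F" by (intro tendsto_intros Uh)
    moreover have "4 * h + (4 - 2 * \<alpha>) * (- h) = - c" by (simp add: c_def algebra_simps)
    ultimately have "\<forall>\<^sub>F t in F. 4 * h + (4 - 2 * \<alpha>) * U (\<gamma> t) < - c / 2"
      using c by (intro order_tendstoD(2)[of _ "- c"]) auto
    moreover have "\<forall>\<^sub>F t in F. \<bar>J1 t\<bar> < c / 8"
      using tendstoD[OF J0, of "c / 8"] c by (simp add: dist_real_def)
    ultimately have "\<forall>\<^sub>F t in F. 4 * h + (4 - 2 * \<alpha>) * U (\<gamma> t) < - c / 2 \<and> \<bar>J1 t\<bar> < c / 8" by (rule eventually_conj)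
    then obtain t0 where t0: "t0 \<in> D" "\<And>t. t \<in> I \<Longrightarrow> t0 < t \<Longrightarrow> 4 * h + (4 - 2 * \<alpha>) * U (\<gamma> t) < - c / 2 \<and> \<bar>J1 t\<bar> < c / 8"
      unfolding eventually_F by blast
    have t00: "t0 \<ge> 0" using t0 by (simp add: D_def)
    \<comment> \<open>Over one unit of time J1 would fall by more than c/2, yet its values at both
      ends are below c/8 in modulus.\<close>
    have "\<exists>z. t0 + 1 < z \<and> z < t0 + 2 \<and> J1 (t0 + 2) - J1 (t0 + 1) = (t0 + 2 - (t0 + 1)) * (4 * h + (4 - 2 * \<alpha>) * U (\<gamma> z))"
      using t00 by (intro MVT2 J_deriv(2)) (auto simp: F)
    then obtain z where z: "t0 + 1 < z" "J1 (t0 + 2) - J1 (t0 + 1) = 4 * h + (4 - 2 * \<alpha>) * U (\<gamma> z)" by auto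
    have "J1 (t0 + 2) - J1 (t0 + 1) < - c / 2" using t0(2)[of z] z t00 by (simp add: F)
    moreover have "\<bar>J1 (t0 + 2)\<bar> < c / 8" "\<bar>J1 (t0 + 1)\<bar> < c / 8" using t0(2)[of "t0 + 2"] t0(2)[of "t0 + 1"] t00 by (simp_all add: F)
    ultimately show False using c by linarith
  qed
  have "filterlim (\<lambda>t. inverse (r t powr (- \<alpha>))) at_top F"
  proof (rule filterlim_inverse_at_top)
    show "((\<lambda>t. r t powr (- \<alpha>)) \<longlongrightarrow> 0) F" using rpow h by simp
    show "\<forall>\<^sub>F t in F. 0 < r t powr (- \<alpha>)" using ev_I by eventually_elim (use \<gamma>_D(4) I_subset_D in force)
  qed
  then have ra: "filterlim (\<lambda>t. r t powr \<alpha>) at_top F" by (simp add: powr_minus)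
  show "filterlim r at_top F"
    unfolding filterlim_at_top_gt[where c=0]
  proof (intro allI impI)
    fix Z :: real assume Z: "Z > 0"
    have "\<forall>\<^sub>F t in F. Z powr \<alpha> \<le> r t powr \<alpha>" using ra by (simp add: filterlim_at_top)
    then show "\<forall>\<^sub>F t in F. Z \<le> r t" using ev_I
    proof eventually_elim
      case (elim t)
      have "r t > 0" using \<gamma>_D(4) I_subset_D elim by blast
      then show ?case using elim(1) Z \<alpha> powr_less_mono2[of \<alpha> "r t" Z] by (meson less_imp_le not_le)
    qed
  qed
qed

lemma collision: assumes "T < \<infinity>" shows "(r \<longlongrightarrow> 0) F"
proof -
  have 0: "(\<gamma> \<longlongrightarrow> 0) F" using motion assms by (simp add: asymptotic_solution_def F_def end_filter_def)
  have "((\<lambda>t. ipM (\<gamma> t) (\<gamma> t)) \<longlongrightarrow> ipM 0 (0 :: real^'d^'n)) F"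
    by (rule bounded_bilinear.tendsto[OF bounded_bilinear_inner_M 0 0])
  then have "((\<lambda>t. sqrt (ipM (\<gamma> t) (\<gamma> t))) \<longlongrightarrow> sqrt (ipM 0 (0 :: real^'d^'n))) F" by (rule tendsto_real_sqrt)
  then show ?thesis by (simp add: r_def[abs_def] norm_M_def bilinear_lzero[OF bilinear_inner_M])
qed

text \<open>At a collision r tends to 0; a parabolic motion has h = 0.\<close>

lemma hr_lim: "((\<lambda>t. h * r t powr \<alpha>) \<longlongrightarrow> 0) F"
proof (cases "T < \<infinity>")
  case True
  have "((\<lambda>t. r t powr \<alpha>) \<longlongrightarrow> 0) F"
  proof (rule tendsto_zero_powrI[OF collision[OF True] tendsto_const])
    show "\<forall>\<^sub>F t in F. 0 \<le> r t" using ev_I by eventually_elim (use \<gamma>_D(4) I_subset_D in \<open>force intro: less_imp_le\<close>)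
  qed (rule \<alpha>)
  from tendsto_mult_right_zero[OF this] show ?thesis .
next
  case False
  then show ?thesis using parabolic by simp
qed

text \<open>The sign of the radial velocity near the end, and hence of
  \<open>delta_bar\<close>.\<close>

definition "sg = (if T < \<infinity> then - 1 else (1::real))"

text \<open>Near the end of the motion \<open>|\<gamma>|\<^sup>2\<close> is convex by the Lagrange--Jacobi identity, so its monotonicity is
  decided by its limit.\<close>

lemma J1_sign: "\<forall>\<^sub>F t in F. sg * J1 t > 0"
proof (cases "T < \<infinity>")
  case True
  have "filterlim (\<lambda>t. inverse (r t powr \<alpha>)) at_top F"
  proof (rule filterlim_inverse_at_top)
    have nn: "\<forall>\<^sub>F t in F. 0 < r t" using ev_I by eventually_elim (use \<gamma>_D(4) I_subset_D in force)
    show "((\<lambda>t. r t powr \<alpha>) \<longlongrightarrow> 0) F"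
      by (rule tendsto_zero_powrI[OF collision[OF True] tendsto_const]) (use nn \<alpha> in \<open>auto elim: eventually_mono\<close>)
    show "\<forall>\<^sub>F t in F. 0 < r t powr \<alpha>" using nn by eventually_elim simp
  qed
  then have "filterlim (\<lambda>t. U (\<sigma> t) * inverse (r t powr \<alpha>)) at_top F"
    by (rule filterlim_tendsto_pos_mult_at_top[OF U_\<sigma>_lim U_s0_pos])
  then have "\<forall>\<^sub>F t in F. (\<bar>4 * h\<bar> + 1) / (4 - 2 * \<alpha>) \<le> U (\<sigma> t) * inverse (r t powr \<alpha>)"
    by (simp add: filterlim_at_top)
  then have "\<forall>\<^sub>F t in F. 0 < 4 * h + (4 - 2 * \<alpha>) * U (\<gamma> t)" using ev_I
  proof eventually_elim
    case (elim t)
    then have "U (\<gamma> t) = U (\<sigma> t) * inverse (r t powr \<alpha>)" using U_\<gamma>[of t] I_subset_D by (auto simp: powr_minus)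
    then have "(\<bar>4 * h\<bar> + 1) \<le> (4 - 2 * \<alpha>) * U (\<gamma> t)" using elim \<alpha> by (simp add: field_simps)
    then show ?case by linarith
  qed
  then obtain t0 where t0: "t0 \<in> D" "\<And>t. t \<in> I \<Longrightarrow> t0 < t \<Longrightarrow> 0 < 4 * h + (4 - 2 * \<alpha>) * U (\<gamma> t)" unfolding eventually_F by blast
  have t00: "0 \<le> t0" using t0 by (simp add: D_def)
  have "J1 t < 0" if t: "t \<in> I" "t0 < t" for t
  proof (rule ccontr)
    assume "\<not> J1 t < 0"
    have Imem: "x \<in> I" if "t \<le> x" "x \<in> D" for x using that t t00 by (auto simp: I_iff)
    have pos: "J1 x > 0" if x: "t < x" "x \<in> D" for x
    proof -
      have "J1 t < J1 x"
      proof (rule DERIV_pos_imp_increasing[OF x(1)])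
        fix y assume "t \<le> y" "y \<le> x"
        then have "y \<in> I" "t0 < y" using Imem[of y] D_down[OF x(2), of y] t t00 by auto
        then show "\<exists>d. (J1 has_real_derivative d) (at y) \<and> 0 < d" using J_deriv(2) t0(2) by blast
      qed
      then show ?thesis using \<open>\<not> J1 t < 0\<close> by simp
    qed
    have inc: "ipM (\<gamma> t) (\<gamma> t) \<le> ipM (\<gamma> x) (\<gamma> x)" if x: "t < x" "x \<in> D" for x
    proof (rule DERIV_nonneg_imp_nondecreasing[OF less_imp_le[OF x(1)]])
      fix y assume y: "t \<le> y" "y \<le> x"
      then have yI: "y \<in> I" using Imem[of y] D_down[OF x(2), of y] t t00 by auto
      then have "J1 y \<ge> 0" using pos[of y] y \<open>\<not> J1 t < 0\<close> I_subset_D by (cases "y = t") (auto intro: less_imp_le)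
      then show "\<exists>d. ((\<lambda>t. ipM (\<gamma> t) (\<gamma> t)) has_real_derivative d) (at y) \<and> 0 \<le> d" using J_deriv(1)[OF yI] by blast
    qed
    have "\<forall>\<^sub>F x in F. (r t)\<^sup>2 \<le> (r x)\<^sup>2"
      unfolding eventually_F r_sq using inc t I_subset_D by blast
    moreover have "((\<lambda>x. (r x)\<^sup>2) \<longlongrightarrow> 0\<^sup>2) F" by (intro tendsto_power collision[OF True])
    ultimately have "(r t)\<^sup>2 \<le> 0\<^sup>2" using tendsto_lowerbound F_nontrivial by blast
    then show False using \<gamma>_D(4)[of t] t I_subset_D by auto
  qed
  then show ?thesis using True t0(1) unfolding eventually_F sg_def by auto
next
  case False
  then have Ti: "T = \<infinity>" by simp
  have F: "F = at_top" "I = {0<..}" using infinite_T[OF False] by simp_all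
  note p = parabolic[OF Ti]
  have J2: "0 < 4 * h + (4 - 2 * \<alpha>) * U (\<gamma> t)" if "t \<in> I" for t
    using potential_pos[OF n2 m \<gamma>_D(2)[of t]] that I_subset_D \<alpha> p(1) by auto
  \<comment> \<open>Otherwise r would stay bounded. From one positive value on, J1 stays positive
    because it increases.\<close>
  have "\<exists>t\<in>I. J1 t > 0"
  proof (rule ccontr)
    assume "\<not> ?thesis"
    then have neg: "J1 t \<le> 0" if "t \<in> I" for t using that by force
    have dec: "ipM (\<gamma> x) (\<gamma> x) \<le> ipM (\<gamma> 1) (\<gamma> 1)" if "1 < x" for x
    proof (rule DERIV_nonpos_imp_nonincreasing[of 1 x "\<lambda>t. ipM (\<gamma> t) (\<gamma> t)"])
      fix y assume "1 \<le> y" "y \<le> x"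
      then have "y \<in> I" by (simp add: F)
      then show "\<exists>d. ((\<lambda>t. ipM (\<gamma> t) (\<gamma> t)) has_real_derivative d) (at y) \<and> d \<le> 0" using J_deriv(1) neg by blast
    qed (use that in simp)
    have "\<forall>\<^sub>F x in F. r 1 + 1 \<le> r x" using p(2) by (simp add: filterlim_at_top)
    then have "\<forall>\<^sub>F x in F. False" using eventually_gt_at_top[of "1::real", folded F(1)]
    proof eventually_elim
      case (elim x)
      have "0 \<le> r 1" by (simp add: r_def norm_M_def inner_M_nonneg[OF m])
      moreover have "(r x)\<^sup>2 \<le> (r 1)\<^sup>2" using dec[OF elim(2)] by (simp add: r_sq)
      ultimately show ?case using elim(1) power2_le_imp_le[of "r x" "r 1"] by linarith
    qed
    then show False using F_nontrivial by simp
  qed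
  then obtain t where t: "t \<in> I" "J1 t > 0" by blast
  have "J1 x > 0" if x: "t < x" for x
  proof -
    have "J1 t < J1 x"
    proof (rule DERIV_pos_imp_increasing[OF x])
      fix y assume "t \<le> y" "y \<le> x"
      then have "y \<in> I" using t by (simp add: F)
      then show "\<exists>d. (J1 has_real_derivative d) (at y) \<and> 0 < d" using J_deriv(2) J2 by blast
    qed
    then show ?thesis using t by simp
  qed
  then show ?thesis using t(1) I_subset_D False unfolding eventually_F sg_def by auto
qed

lemma J1_cont: "continuous_on I J1"
proof (rule continuous_at_imp_continuous_on, rule ballI)
  fix t assume "t \<in> I"
  from DERIV_isCont[OF J_deriv(2)[OF this]] show "isCont J1 t" .
qed

lemma r_pos: "t \<in> D \<Longrightarrow> r t > 0" by (rule \<gamma>_D(4))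

lemma r_pos_I: "t \<in> I \<Longrightarrow> r t > 0" using r_pos I_subset_D by blast

lemma r_powr_deriv: assumes t: "t \<in> I"
  shows "((\<lambda>t. r t powr a) has_real_derivative a * r t powr (a - 1) * (J1 t / (2 * r t))) (at t)"
  by (rule DERIV_chain2[where f="\<lambda>x. x powr a", OF has_real_derivative_powr[OF r_pos_I[OF t]] r_deriv[OF t]])

lemma r_powr_cont: "continuous_on D (\<lambda>t. r t powr a)"
  by (rule continuous_on_powr[OF r_cont continuous_on_const]) (use r_pos in force)

lemma v_sq: assumes t: "t \<in> I" shows "(v t)\<^sup>2 = (J1 t)\<^sup>2 / 4 / r t powr (2 - \<alpha>)"
proof -
  have "(r t powr (\<alpha> / 2))\<^sup>2 = r t powr \<alpha>" using r_pos_I[OF t] by (simp add: power2_eq_square powr_add[symmetric])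
  moreover have "r t powr (2 - \<alpha>) = (r t)\<^sup>2 / r t powr \<alpha>" using r_pos_I[OF t] by (simp add: powr_diff)
  ultimately show ?thesis using r_pos_I[OF t] by (simp add: v_def power_mult_distrib power_divide field_simps)
qed

text \<open>L'Hospital's rule for \<open>\<langle>\<gamma>, \<gamma>'\<rangle>\<^sup>2 / r\<^sup>2\<^sup>-\<^sup>\<alpha>\<close>: the common factor \<open>\<langle>\<gamma>, \<gamma>'\<rangle>\<close> of the derivatives cancels.\<close>

lemma v_sq_lim: "((\<lambda>t. (v t)\<^sup>2) \<longlongrightarrow> 2 * U s0) F"
proof -
  define f' where "f' t = J1 t * (4 * h + (4 - 2 * \<alpha>) * U (\<gamma> t)) / 2" for t
  define g' where "g' t = (2 - \<alpha>) * r t powr (2 - \<alpha> - 1) * (J1 t / (2 * r t))" for t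
  have evJ: "\<forall>\<^sub>F t in F. t \<in> I \<and> J1 t \<noteq> 0"
    using ev_I J1_sign by eventually_elim auto
  have f: "\<forall>\<^sub>F t in F. ((\<lambda>t. (J1 t)\<^sup>2 / 4) has_real_derivative f' t) (at t)"
    using ev_I
  proof eventually_elim
    case (elim t)
    have "((\<lambda>t. (J1 t)\<^sup>2 / 4) has_real_derivative (of_nat 2 * ((4 * h + (4 - 2 * \<alpha>) * U (\<gamma> t)) * J1 t ^ (2 - Suc 0))) / 4) (at t)"
      by (rule DERIV_cdivide[OF DERIV_power[OF J_deriv(2)[OF elim]]])
    then show ?case by (rule DERIV_cong) (simp add: f'_def)
  qed
  have g: "\<forall>\<^sub>F t in F. ((\<lambda>t. r t powr (2 - \<alpha>)) has_real_derivative g' t) (at t)"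
    using ev_I
  proof eventually_elim
    case (elim t)
    show ?case unfolding g'_def by (rule r_powr_deriv[OF elim])
  qed
  have gn: "\<forall>\<^sub>F t in F. r t powr (2 - \<alpha>) \<noteq> 0" using ev_I by eventually_elim (use r_pos_I in force)
  have g'n: "\<forall>\<^sub>F t in F. g' t \<noteq> 0" using evJ by eventually_elim (use r_pos_I \<alpha> in \<open>force simp: g'_def\<close>)
  have "((\<lambda>t. 4 / (2 - \<alpha>) * (h * r t powr \<alpha>) + 2 * U (\<sigma> t)) \<longlongrightarrow> 4 / (2 - \<alpha>) * 0 + 2 * U s0) F"
    by (intro tendsto_add tendsto_mult tendsto_const hr_lim U_\<sigma>_lim)
  then have "((\<lambda>t. 4 / (2 - \<alpha>) * (h * r t powr \<alpha>) + 2 * U (\<sigma> t)) \<longlongrightarrow> 2 * U s0) F" by simp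
  moreover have "\<forall>\<^sub>F t in F. 4 / (2 - \<alpha>) * (h * r t powr \<alpha>) + 2 * U (\<sigma> t) = f' t / g' t"
    using evJ
  proof eventually_elim
    case (elim t)
    then have t: "t \<in> I" and J: "J1 t \<noteq> 0" by auto
    note r = r_pos_I[OF t]
    have a: "2 - \<alpha> > 0" using \<alpha> by simp
    have p: "r t powr (2 - \<alpha> - 1) = r t / r t powr \<alpha>"
    proof -
      have "r t powr (2 - \<alpha> - 1) = r t powr (1 - \<alpha>)" by (simp add: algebra_simps)
      then show ?thesis using r by (simp add: powr_diff)
    qed
    have rp: "r t powr \<alpha> > 0" using r by simp
    have U: "U (\<gamma> t) * r t powr \<alpha> = U (\<sigma> t)"
      using U_\<gamma>[of t] t I_subset_D rp by (auto simp: powr_minus)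
    have "g' t = (2 - \<alpha>) * J1 t / (2 * r t powr \<alpha>)"
      unfolding g'_def p using r rp by (simp add: field_simps)
    moreover have "f' t = J1 t * (2 * h + (2 - \<alpha>) * U (\<gamma> t))" by (simp add: f'_def field_simps)
    ultimately have "f' t / g' t = (2 * h + (2 - \<alpha>) * U (\<gamma> t)) * 2 * r t powr \<alpha> / (2 - \<alpha>)"
      using J rp a by simp
    also have "\<dots> = (4 * (h * r t powr \<alpha>) + 2 * (2 - \<alpha>) * (U (\<gamma> t) * r t powr \<alpha>)) / (2 - \<alpha>)" by (simp add: algebra_simps)
    also have "\<dots> = 4 / (2 - \<alpha>) * (h * r t powr \<alpha>) + 2 * U (\<sigma> t)" unfolding U using a by (simp add: field_simps)
    finally show ?case by simp
  qed
  ultimately have q: "((\<lambda>t. f' t / g' t) \<longlongrightarrow> 2 * U s0) F" by (rule Lim_transform_eventually)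
  have "((\<lambda>t. (J1 t)\<^sup>2 / 4 / r t powr (2 - \<alpha>)) \<longlongrightarrow> 2 * U s0) F"
  proof (cases "T < \<infinity>")
    \<comment> \<open>A collision is the case 0/0, where \<open>J1_bound\<close> makes the numerator
      tend to 0; for a parabolic motion the denominator tends to infinity, and no limit of the
      numerator enters.\<close>
    case True
    then obtain T' where F: "F = at_left T'" unfolding F_def end_filter_def by auto
    note r0 = collision[OF True]
    have nn: "\<forall>\<^sub>F t in F. 0 \<le> r t" using ev_I by eventually_elim (use r_pos_I in \<open>force intro: less_imp_le\<close>)
    have g0: "((\<lambda>t. r t powr (2 - \<alpha>)) \<longlongrightarrow> 0) F"
      by (rule tendsto_zero_powrI[OF r0 tendsto_const nn]) (use \<alpha> in simp)
    have "((\<lambda>t. 2 * (r t powr (2 - \<alpha>) * U (\<sigma> t) + h * (r t)\<^sup>2)) \<longlongrightarrow> 2 * (0 * U s0 + h * 0\<^sup>2)) F"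
      by (intro tendsto_intros g0 U_\<sigma>_lim r0)
    then have up: "((\<lambda>t. 2 * (r t powr (2 - \<alpha>) * U (\<sigma> t) + h * (r t)\<^sup>2)) \<longlongrightarrow> 0) F" by simp
    have f0: "((\<lambda>t. (J1 t)\<^sup>2 / 4) \<longlongrightarrow> 0) F"
    proof (rule tendsto_sandwich[OF _ _ tendsto_const up])
      show "\<forall>\<^sub>F t in F. (J1 t)\<^sup>2 / 4 \<le> 2 * (r t powr (2 - \<alpha>) * U (\<sigma> t) + h * (r t)\<^sup>2)" using ev_I
      proof eventually_elim
        case (elim t)
        have "(r t)\<^sup>2 * U (\<gamma> t) = r t powr (2 - \<alpha>) * U (\<sigma> t)"
          using U_\<gamma>[of t] elim I_subset_D r_pos_I[OF elim] by (auto simp: powr_diff powr_minus divide_inverse)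
        then show ?case using J1_bound[OF elim] by (simp add: algebra_simps)
      qed
    qed simp
    show ?thesis
      using lhopital_left[OF f0[unfolded F] g0[unfolded F] gn[unfolded F] g'n[unfolded F] f[unfolded F] g[unfolded F] q[unfolded F]]
      unfolding F .
  next
    case False
    note F = infinite_T(4)[OF False]
    have "filterlim (\<lambda>t. exp ((2 - \<alpha>) * ln (r t))) at_top F"
      using \<alpha> by (intro filterlim_compose[OF exp_at_top] filterlim_tendsto_pos_mult_at_top[OF tendsto_const]
        filterlim_compose[OF ln_at_top] parabolic(2)[OF infinite_T(1)[OF False]]) simp
    moreover have "\<forall>\<^sub>F t in F. exp ((2 - \<alpha>) * ln (r t)) = r t powr (2 - \<alpha>)"
      using ev_I by eventually_elim (use r_pos_I in \<open>force simp: powr_def\<close>)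
    ultimately have g_top: "filterlim (\<lambda>t. r t powr (2 - \<alpha>)) at_top F" by (rule filterlim_mono_eventually[OF _ order_refl order_refl])
    show ?thesis
      using lhospital_at_top_at_top[OF g_top[unfolded F] g'n[unfolded F] f[unfolded F] g[unfolded F] q[unfolded F]]
      unfolding F .
  qed
  then show ?thesis
    by (rule Lim_transform_eventually) (use ev_I v_sq in \<open>auto elim: eventually_mono\<close>)
qed

lemma v_lim: "(v \<longlongrightarrow> sg * sqrt (2 * U s0)) F"
proof (rule Lim_transform_eventually)
  show "((\<lambda>t. sg * sqrt ((v t)\<^sup>2)) \<longlongrightarrow> sg * sqrt (2 * U s0)) F"
    by (intro tendsto_mult tendsto_const tendsto_real_sqrt v_sq_lim)
  show "\<forall>\<^sub>F t in F. sg * sqrt ((v t)\<^sup>2) = v t"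
    using ev_I J1_sign
  proof eventually_elim
    case (elim t)
    have p: "r t powr (\<alpha> / 2) / (2 * r t) > 0" using r_pos_I[OF elim(1)] by simp
    have "v t = r t powr (\<alpha> / 2) / (2 * r t) * J1 t" by (simp add: v_def)
    then have "sg * v t = r t powr (\<alpha> / 2) / (2 * r t) * (sg * J1 t)" by simp
    then have "sg * v t > 0" using mult_pos_pos[OF p elim(2)] by simp
    then show ?case by (auto simp: sg_def split: if_splits)
  qed
qed

lemma v_cont: "continuous_on I v"
  unfolding v_def[abs_def]
proof (intro continuous_on_mult continuous_on_divide J1_cont continuous_on_const)
  show "continuous_on I (\<lambda>t. r t powr (\<alpha> / 2))" "continuous_on I r"
    using r_powr_cont r_cont I_subset_D by (blast intro: continuous_on_subset)+
qed (use r_pos_I in force)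

text \<open>Energy conservation multiplied by r^\<alpha>, with the velocity split orthogonally into
  its radial and tangential parts. The limit of v^2 then forces S1 to 0.\<close>

lemma S1_sq: assumes t: "t \<in> I" shows "ipM (S1 t) (S1 t) = 2 * U (\<sigma> t) + 2 * (h * r t powr \<alpha>) - (v t)\<^sup>2"
proof -
  have tD: "t \<in> D" using t I_subset_D by blast
  note r = r_pos[OF tD]
  define k where "k = J1 t / (2 * r t)"
  note bl = bilinear_lmul[OF bilinear_inner_M] bilinear_rmul[OF bilinear_inner_M] bilinear_lsub[OF bilinear_inner_M] bilinear_rsub[OF bilinear_inner_M]
  have 1: "ipM (\<sigma> t) (g1 t) = k" using r by (simp add: \<sigma>_def bl k_def J1_def field_simps)
  then have 2: "ipM (g1 t) (\<sigma> t) = k" by (simp add: inner_M_sym[of m "g1 t"])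
  have 3: "(r t powr (\<alpha> / 2))\<^sup>2 = r t powr \<alpha>" using r by (simp add: power2_eq_square powr_add[symmetric])
  have "ipM (S1 t) (S1 t) = (r t powr (\<alpha> / 2))\<^sup>2 * (ipM (g1 t) (g1 t) - k\<^sup>2)"
    unfolding S1_def k_def[symmetric] by (simp add: bl 1 2 \<sigma>_D(3)[OF tD] power2_eq_square algebra_simps)
  also have "\<dots> = r t powr \<alpha> * (2 * (U (\<gamma> t) + h)) - (v t)\<^sup>2"
    unfolding v_def k_def[symmetric] energy_eq[OF t] power_mult_distrib 3 by (simp add: algebra_simps)
  also have "r t powr \<alpha> * (2 * (U (\<gamma> t) + h)) = 2 * U (\<sigma> t) + 2 * (h * r t powr \<alpha>)"
    unfolding U_\<gamma>[OF tD] using r by (simp add: powr_minus algebra_simps)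
  finally show ?thesis .
qed

lemma S1_cont: "continuous_on I S1"
  unfolding S1_def[abs_def]
proof (intro continuous_on_scaleR continuous_on_diff continuous_on_divide J1_cont g1_cont continuous_on_mult continuous_on_const)
  show "continuous_on I (\<lambda>t. r t powr (\<alpha> / 2))" "continuous_on I r" "continuous_on I \<sigma>"
    using r_powr_cont r_cont \<sigma>_cont I_subset_D by (blast intro: continuous_on_subset)+
qed (use r_pos_I in force)

lemma mass_min: "Min (range m) > 0" by (rule inner_M_coercive(2)[OF m])

lemma S1_lim: "(S1 \<longlongrightarrow> 0) F"
proof -
  have "((\<lambda>t. 2 * U (\<sigma> t) + 2 * (h * r t powr \<alpha>) - (v t)\<^sup>2) \<longlongrightarrow> 2 * U s0 + 2 * 0 - 2 * U s0) F"
    by (intro tendsto_intros U_\<sigma>_lim hr_lim v_sq_lim)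
  then have "((\<lambda>t. 2 * U (\<sigma> t) + 2 * (h * r t powr \<alpha>) - (v t)\<^sup>2) \<longlongrightarrow> 0) F" by simp
  from tendsto_divide[OF this tendsto_const, of "Min (range m)"] mass_min
  have "((\<lambda>t. (2 * U (\<sigma> t) + 2 * (h * r t powr \<alpha>) - (v t)\<^sup>2) / Min (range m)) \<longlongrightarrow> 0) F" by simp
  then have up: "((\<lambda>t. sqrt ((2 * U (\<sigma> t) + 2 * (h * r t powr \<alpha>) - (v t)\<^sup>2) / Min (range m))) \<longlongrightarrow> 0) F"
    using tendsto_real_sqrt by fastforce
  have "((\<lambda>t. norm (S1 t)) \<longlongrightarrow> 0) F"
  proof (rule tendsto_sandwich[OF _ _ tendsto_const up])
    show "\<forall>\<^sub>F t in F. norm (S1 t) \<le> sqrt ((2 * U (\<sigma> t) + 2 * (h * r t powr \<alpha>) - (v t)\<^sup>2) / Min (range m))"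
      using ev_I
    proof eventually_elim
      case (elim t)
      have "(norm (S1 t))\<^sup>2 * Min (range m) \<le> 2 * U (\<sigma> t) + 2 * (h * r t powr \<alpha>) - (v t)\<^sup>2"
        using inner_M_coercive(1)[OF m, of "S1 t"] by (simp add: S1_sq[OF elim] mult.commute)
      then have "(norm (S1 t))\<^sup>2 \<le> (2 * U (\<sigma> t) + 2 * (h * r t powr \<alpha>) - (v t)\<^sup>2) / Min (range m)"
        using mass_min by (simp add: pos_le_divide_eq)
      then show ?case by (rule real_le_rsqrt)
    qed
  qed simp
  then show ?thesis by (rule tendsto_norm_zero_cancel)
qed

text \<open>In \<open>S1_sq\<close> both v^2 and the squared mass norm of S1 are at most 2
  U(\<sigma>) + 2 h r^\<alpha>, which is continuous on D with a finite limit. The least mass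
  converts mass norms into Euclidean ones.\<close>

lemma bounds: obtains B where "B > 0" "\<And>t. t \<in> I \<Longrightarrow> \<bar>v t\<bar> \<le> B" "\<And>t. t \<in> I \<Longrightarrow> norm (S1 t) \<le> B"
    "\<And>t. t \<in> D \<Longrightarrow> norm (\<sigma> t) \<le> B" "\<And>t. t \<in> D \<Longrightarrow> \<bar>h * r t powr \<alpha>\<bar> \<le> B"
proof -
  obtain B1 where B1: "\<And>t. t \<in> D \<Longrightarrow> \<bar>U (\<sigma> t)\<bar> \<le> B1" using bounded_on_D[OF U_\<sigma>_cont U_\<sigma>_lim] by blast
  obtain B2 where B2: "\<And>t. t \<in> D \<Longrightarrow> \<bar>h * r t powr \<alpha>\<bar> \<le> B2"
    using bounded_on_D[OF continuous_on_mult[OF continuous_on_const r_powr_cont] hr_lim] by blast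
  define K where "K = 2 * B1 + 2 * B2"
  define c where "c = Min (range m)"
  have c: "c > 0" unfolding c_def by (rule mass_min)
  have K: "2 * U (\<sigma> t) + 2 * (h * r t powr \<alpha>) \<le> K" if "t \<in> D" for t using B1[OF that] B2[OF that] unfolding K_def by linarith
  have K0: "K \<ge> 0" using B1[OF zero_D] B2[OF zero_D] unfolding K_def by linarith
  define B where "B = 1 + sqrt K + sqrt (K / c) + sqrt (1 / c) + \<bar>B2\<bar>"
  have le: "sqrt K \<le> B" "sqrt (K / c) \<le> B" "sqrt (1 / c) \<le> B" "B2 \<le> B" "B > 0"
    using K0 c unfolding B_def by (auto intro!: add_nonneg_nonneg add_pos_nonneg simp: add_increasing add_increasing2)
  have nS: "(norm x)\<^sup>2 \<le> y / c" if "ipM x x \<le> y" for x :: "real^'d^'n" and y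
    using inner_M_coercive(1)[OF m, of x] that c by (simp add: pos_le_divide_eq c_def[symmetric] mult.commute)
  show thesis
  proof (rule that[of B])
    show "B > 0" by (rule le)
    show "\<bar>v t\<bar> \<le> B" if t: "t \<in> I" for t
    proof -
      have "(v t)\<^sup>2 \<le> K" using S1_sq[OF t] inner_M_nonneg[OF m, of "S1 t"] K[OF subsetD[OF I_subset_D t]] by linarith
      then have "sqrt ((v t)\<^sup>2) \<le> sqrt K" by (rule real_sqrt_le_mono)
      then show ?thesis using le(1) by simp
    qed
    show "norm (S1 t) \<le> B" if t: "t \<in> I" for t
    proof -
      have "ipM (S1 t) (S1 t) \<le> K" using S1_sq[OF t] K[OF subsetD[OF I_subset_D t]] zero_le_power2[of "v t"] by linarith
      from real_le_rsqrt[OF nS[OF this]] show ?thesis using le(2) by simp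
    qed
    show "norm (\<sigma> t) \<le> B" if t: "t \<in> D" for t
      using real_le_rsqrt[OF nS[OF eq_refl[OF \<sigma>_D(3)[OF t]]]] le(3) by simp
    show "\<bar>h * r t powr \<alpha>\<bar> \<le> B" if t: "t \<in> D" for t using B2[OF t] le(4) by simp
  qed
qed

section \<open>Regularised time\<close>

definition "rate t = r t powr (- (2 + \<alpha>) / 2)"
definition "tau = new_time m \<alpha> \<gamma>"
definition "\<theta> = old_time m \<alpha> T \<gamma>"

lemma rate_pos: "t \<in> D \<Longrightarrow> rate t > 0" using r_pos by (force simp: rate_def)

lemma rate_cont: "continuous_on D rate"
  unfolding rate_def[abs_def] by (rule r_powr_cont)

lemma tau_eq: "tau t = integral {0..t} rate"
  by (simp add: tau_def new_time_def rate_def[abs_def] r_def)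

lemma tau_0: "tau 0 = 0" by (simp add: tau_eq)

lemma sub_D: "t \<in> D \<Longrightarrow> {0..t} \<subseteq> D" using D_down by auto

lemma tau_deriv_within: assumes "u \<in> D" "0 \<le> t" "t \<le> u" shows "(tau has_real_derivative rate t) (at t within {0..u})"
  unfolding tau_eq[abs_def]
  by (rule integral_has_real_derivative) (use assms continuous_on_subset[OF rate_cont sub_D[OF assms(1)]] in auto)

lemma tau_deriv: assumes "t \<in> I" shows "(tau has_real_derivative rate t) (at t)"
proof -
  obtain u where u: "u \<in> I" "t < u" using D_larger assms I_subset_D by blast
  have "(tau has_real_derivative rate t) (at t within {0..u})"
    by (rule tau_deriv_within) (use u assms I_subset_D in \<open>auto simp: I_iff\<close>)
  moreover have "at t within {0..u} = at t"
    by (rule at_within_interior) (use u assms in \<open>auto simp: I_iff\<close>)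
  ultimately show ?thesis by simp
qed

lemma tau_cont: assumes "u \<in> D" shows "continuous_on {0..u} tau"
  by (rule DERIV_continuous_on) (use tau_deriv_within[OF assms] in auto)

lemma tau_mono: assumes "a < b" "a \<in> D" "b \<in> D" shows "tau a < tau b"
proof (rule DERIV_pos_imp_increasing_open[OF assms(1)])
  have a: "0 \<le> a" using assms by (simp add: D_def)
  show "\<exists>y. (tau has_real_derivative y) (at x) \<and> 0 < y" if "a < x" "x < b" for x
  proof -
    have "x \<in> D" using D_down[OF assms(3)] a that by auto
    then show ?thesis using tau_deriv[of x] rate_pos[of x] a that by (auto simp: I_iff)
  qed
  show "continuous_on {a..b} tau" by (rule continuous_on_subset[OF tau_cont[OF assms(3)]]) (use a in auto)
qed

lemma tau_inj: "inj_on tau D"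
proof (rule linorder_inj_onI)
  show "tau x \<noteq> tau y" if "x < y" "x \<in> D" "y \<in> D" for x y using tau_mono[OF that] by simp
qed auto

lemma tau_less: "a \<in> D \<Longrightarrow> b \<in> D \<Longrightarrow> tau a < tau b \<Longrightarrow> a < b"
  using tau_mono[of b a] by (cases a b rule: linorder_cases) auto

lemma sg_ln_r_top: "filterlim (\<lambda>t. sg * ln (r t)) at_top F"
proof (cases "T < \<infinity>")
  case True
  have "\<forall>\<^sub>F t in F. r t \<in> {0<..}" using ev_I by eventually_elim (simp add: r_pos_I)
  with collision[OF True] have "filterlim r (at_right 0) F"
    by (auto simp: filterlim_at elim: eventually_mono)
  from filterlim_compose[OF ln_at_0 this] have "filterlim (\<lambda>t. ln (r t)) at_bot F" .
  then show ?thesis using True by (simp add: sg_def filterlim_uminus_at_bot)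
next
  case False
  have "sg = 1" unfolding sg_def using False by simp
  with filterlim_compose[OF ln_at_top parabolic(2)[OF infinite_T(1)[OF False]]] show ?thesis by simp
qed

text \<open>\<open>|(ln r)'| \<le> B tau'\<close> and \<open>ln r\<close> is unbounded.\<close>

lemma tau_top: "filterlim tau at_top F"
proof -
  obtain B where B: "B > 0" "\<And>t. t \<in> I \<Longrightarrow> \<bar>v t\<bar> \<le> B" using bounds by metis
  obtain t1 where t1: "t1 \<in> I" using D_larger[OF zero_D] by blast
  have le: "sg * ln (r t) - B * tau t \<le> sg * ln (r t1) - B * tau t1" if t: "t \<in> I" "t1 < t" for t
  proof (rule DERIV_nonpos_imp_nonincreasing[OF less_imp_le[OF t(2)]])
    fix x assume x: "t1 \<le> x" "x \<le> t"
    have "0 \<le> x" using t1 x by (simp add: I_iff)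
    then have "x \<in> D" using D_down[of t x] t x I_subset_D by blast
    then have xI: "x \<in> I" using x t1 by (auto simp: I_iff)
    note rp = r_pos_I[OF xI]
    have "((\<lambda>t. sg * ln (r t) - B * tau t) has_real_derivative sg * (1 / r x * (J1 x / (2 * r x))) - B * rate x) (at x)"
      by (rule DERIV_diff[OF DERIV_cmult[OF DERIV_chain2[OF DERIV_ln_divide[OF rp] r_deriv[OF xI]]] DERIV_cmult[OF tau_deriv[OF xI]]])
    moreover have "sg * (1 / r x * (J1 x / (2 * r x))) - B * rate x \<le> 0"
    proof -
      \<comment> \<open>Both sides are the logarithmic derivative of r in the original time.\<close>
      have e: "rate x * v x = 1 / r x * (J1 x / (2 * r x))"
      proof -
        have "rate x * r x powr (\<alpha> / 2) = r x powr (- (2 + \<alpha>) / 2 + \<alpha> / 2)" unfolding rate_def by (rule powr_add[symmetric])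
        also have "- (2 + \<alpha>) / 2 + \<alpha> / 2 = - 1" by (simp add: field_simps)
        also have "r x powr (- 1) = 1 / r x" using rp by (simp add: powr_minus divide_inverse)
        finally have "rate x * r x powr (\<alpha> / 2) = 1 / r x" .
        then show ?thesis unfolding v_def by (metis mult.assoc)
      qed
      have "sg * v x \<le> B" using B(2)[OF xI] by (auto simp: sg_def)
      then have "rate x * (sg * v x) \<le> rate x * B" using rate_pos[of x] \<open>x \<in> D\<close> by (intro mult_left_mono) auto
      then show ?thesis unfolding e[symmetric] by (simp add: mult_ac)
    qed
    ultimately show "\<exists>y. ((\<lambda>t. sg * ln (r t) - B * tau t) has_real_derivative y) (at x) \<and> y \<le> 0" by blast
  qed
  define C where "C = sg * ln (r t1) - B * tau t1"
  show ?thesis unfolding filterlim_at_top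
  proof
    fix Z
    have "\<forall>\<^sub>F t in F. B * Z + C \<le> sg * ln (r t)" using sg_ln_r_top by (simp add: filterlim_at_top)
    moreover have "\<forall>\<^sub>F t in F. t \<in> I \<and> t1 < t" using t1 I_subset_D by (auto simp: eventually_F)
    ultimately show "\<forall>\<^sub>F t in F. Z \<le> tau t"
    proof eventually_elim
      case (elim t)
      then have "B * Z \<le> B * tau t" using le[of t] unfolding C_def by linarith
      then show ?case using B(1) by simp
    qed
  qed
qed

lemma tau_surj: assumes "0 \<le> s" shows "s \<in> tau ` D"
proof -
  have "\<forall>\<^sub>F t in F. s \<le> tau t" using tau_top by (simp add: filterlim_at_top)
  then have "\<forall>\<^sub>F t in F. t \<in> I \<and> s \<le> tau t" using ev_I by eventually_elim simp
  then obtain t where t: "t \<in> I" "s \<le> tau t" using eventually_happens[of _ F] F_nontrivial by blast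
  then have tD: "t \<in> D" "0 \<le> t" by (auto simp: I_iff)
  have "\<exists>x\<ge>0. x \<le> t \<and> tau x = s"
    by (rule IVT'[OF _ t(2) tD(2) tau_cont[OF tD(1)]]) (simp add: tau_0 assms)
  then show ?thesis using D_down[OF tD(1)] by blast
qed

lemma \<theta>_D: assumes "0 \<le> s" shows "\<theta> s \<in> D" "tau (\<theta> s) = s"
proof -
  have e: "\<theta> s = inv_into D tau s" by (simp add: \<theta>_def old_time_def D_def tau_def)
  show "\<theta> s \<in> D" unfolding e by (rule inv_into_into[OF tau_surj[OF assms]])
  show "tau (\<theta> s) = s" unfolding e by (rule f_inv_into_f[OF tau_surj[OF assms]])
qed

lemma tau_nonneg: "t \<in> D \<Longrightarrow> 0 \<le> tau t"
  using tau_mono[of 0 t] zero_D tau_0 by (cases "t = 0") (auto simp: D_def)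

lemma \<theta>_tau: "t \<in> D \<Longrightarrow> \<theta> (tau t) = t"
  using \<theta>_D[OF tau_nonneg[of t]] tau_inj by (auto dest: inj_onD)

lemma \<theta>_I: assumes "0 < s" shows "\<theta> s \<in> I"
proof -
  have "\<theta> s \<noteq> 0" using \<theta>_D(2)[of s] tau_0 assms by force
  then show ?thesis using \<theta>_D(1)[of s] assms by (auto simp: I_iff D_def)
qed

lemma \<theta>_isCont: assumes "0 < s" shows "isCont \<theta> s"
proof -
  note t = \<theta>_I[OF assms]
  obtain u where u: "u \<in> I" "\<theta> s < u" using D_larger t I_subset_D by blast
  define a where "a = \<theta> s / 2"
  have a: "0 < a" "a < \<theta> s" using t by (auto simp: a_def I_iff)
  have sub: "z \<in> I" if "a \<le> z" "z \<le> u" for z using D_down[of u z] u a that by (auto simp: I_iff)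
  have "isCont \<theta> (tau (\<theta> s))"
  proof (rule isCont_inverse_function2[OF a(2) u(2)])
    show "\<theta> (tau z) = z" if "a \<le> z" "z \<le> u" for z using sub[OF that] I_subset_D by (intro \<theta>_tau) blast
    show "isCont tau z" if "a \<le> z" "z \<le> u" for z using DERIV_isCont[OF tau_deriv[OF sub[OF that]]] .
  qed
  then show ?thesis using \<theta>_D(2)[of s] assms by simp
qed

lemma \<theta>_deriv: assumes "0 < s" shows "(\<theta> has_real_derivative r (\<theta> s) powr ((2 + \<alpha>) / 2)) (at s)"
proof -
  have wp: "rate (\<theta> s) > 0" by (rule rate_pos) (use \<theta>_D assms in simp)
  have "(\<theta> has_real_derivative inverse (rate (\<theta> s))) (at s)"
  proof (rule DERIV_inverse_function[OF tau_deriv[OF \<theta>_I[OF assms]] _ _ _ _ \<theta>_isCont[OF assms], of 0 "s + 1"])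
    show "tau (\<theta> y) = y" if "0 < y" for y using \<theta>_D(2)[of y] that by simp
  qed (use assms wp in auto)
  moreover have "- (2 + \<alpha>) / 2 = - ((2 + \<alpha>) / 2)" by (rule minus_divide_left[symmetric])
  ultimately show ?thesis unfolding rate_def by (simp only: powr_minus inverse_inverse_eq)
qed

lemma \<theta>_lim: "filterlim \<theta> F at_top"
  unfolding filterlim_iff
proof (intro allI impI)
  fix P assume "eventually P F"
  then obtain t0 where t0: "t0 \<in> D" "\<And>t. t \<in> I \<Longrightarrow> t0 < t \<Longrightarrow> P t" by (auto simp: eventually_F)
  have "P (\<theta> s)" if s: "tau t0 < s" for s
  proof (rule t0(2))
    have s0: "0 < s" using tau_nonneg[OF t0(1)] s by simp
    show "\<theta> s \<in> I" by (rule \<theta>_I[OF s0])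
    show "t0 < \<theta> s" using tau_less[OF t0(1), of "\<theta> s"] \<theta>_D[of s] s0 s by simp
  qed
  then show "\<forall>\<^sub>F s in at_top. P (\<theta> s)" by (auto simp: eventually_at_top_dense)
qed

lemma \<theta>_cont: "continuous_on {0<..} \<theta>"
  by (rule continuous_at_imp_continuous_on) (use \<theta>_isCont in auto)

lemma at_pos: "0 < s \<Longrightarrow> at s within {0..} = at (s::real)"
  by (rule at_within_interior) auto

section \<open>Regularised variables expressed in the original time\<close>

lemma reg_s_eq: "reg_s m \<alpha> T \<gamma> s = \<sigma> (\<theta> s)"
  by (simp add: reg_s_def \<sigma>_def \<theta>_def r_def)

lemma reg_rho_eq: "reg_rho m \<alpha> T \<gamma> s = r (\<theta> s) powr ((2 - \<alpha>) / 4)"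
  by (simp add: reg_rho_def \<theta>_def r_def)

lemma \<sigma>_deriv: assumes t: "t \<in> I"
  shows "(\<sigma> has_vector_derivative r t powr (- (2 + \<alpha>) / 2) *\<^sub>R S1 t) (at t)"
proof -
  note r = r_pos_I[OF t]
  define k where "k = J1 t / (2 * r t)"
  have "((\<lambda>t. inverse (r t)) has_real_derivative - (inverse (r t) * k * inverse (r t))) (at t)"
    unfolding k_def by (rule DERIV_inverse'[OF r_deriv[OF t]]) (use r in simp)
  from has_vector_derivative_scaleR[OF this deriv_\<gamma>(1)[OF t]]
  have "(\<sigma> has_vector_derivative inverse (r t) *\<^sub>R g1 t + (- (inverse (r t) * k * inverse (r t))) *\<^sub>R \<gamma> t) (at t)"
    unfolding \<sigma>_def[abs_def] .
  moreover have "inverse (r t) *\<^sub>R g1 t + (- (inverse (r t) * k * inverse (r t))) *\<^sub>R \<gamma> t = inverse (r t) *\<^sub>R (g1 t - k *\<^sub>R \<sigma> t)"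
    by (simp add: \<sigma>_def algebra_simps)
  moreover have "r t powr (- (2 + \<alpha>) / 2) * r t powr (\<alpha> / 2) = inverse (r t)"
  proof -
    have "r t powr (- (2 + \<alpha>) / 2) * r t powr (\<alpha> / 2) = r t powr (- (2 + \<alpha>) / 2 + \<alpha> / 2)" by (rule powr_add[symmetric])
    also have "- (2 + \<alpha>) / 2 + \<alpha> / 2 = - 1" by (simp add: field_simps)
    finally show ?thesis using r by (simp add: powr_minus)
  qed
  ultimately show ?thesis unfolding S1_def k_def[symmetric] by (simp add: scaleR_scaleR)
qed

lemma reg_s_deriv: assumes s: "0 < s" shows "tau_deriv (reg_s m \<alpha> T \<gamma>) s = S1 (\<theta> s)"
proof -
  note t = \<theta>_I[OF s]
  have e: "r (\<theta> s) powr ((2 + \<alpha>) / 2) * r (\<theta> s) powr (- (2 + \<alpha>) / 2) = 1"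
  proof -
    have "r (\<theta> s) powr ((2 + \<alpha>) / 2) * r (\<theta> s) powr (- (2 + \<alpha>) / 2) = r (\<theta> s) powr ((2 + \<alpha>) / 2 + - (2 + \<alpha>) / 2)" by (rule powr_add[symmetric])
    also have "(2 + \<alpha>) / 2 + - (2 + \<alpha>) / 2 = 0" by (simp only: minus_divide_left[symmetric] right_minus)
    finally show ?thesis using r_pos_I[OF t] by simp
  qed
  have "((\<sigma> \<circ> \<theta>) has_vector_derivative r (\<theta> s) powr ((2 + \<alpha>) / 2) *\<^sub>R (r (\<theta> s) powr (- (2 + \<alpha>) / 2) *\<^sub>R S1 (\<theta> s))) (at s)"
    using \<theta>_deriv[OF s] unfolding has_real_derivative_iff_has_vector_derivative
    by (rule vector_diff_chain_at) (rule \<sigma>_deriv[OF t])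
  then have "(reg_s m \<alpha> T \<gamma> has_vector_derivative S1 (\<theta> s)) (at s)"
    unfolding scaleR_scaleR e by (simp add: o_def reg_s_eq[abs_def])
  then show ?thesis unfolding at_pos[OF s] by (rule vector_derivative_at)
qed

lemma reg_rho_pos: "0 < s \<Longrightarrow> reg_rho m \<alpha> T \<gamma> s > 0"
  using r_pos_I[OF \<theta>_I] by (force simp: reg_rho_eq)

lemma reg_rho_deriv: assumes s: "0 < s"
  shows "tau_deriv (reg_rho m \<alpha> T \<gamma>) s / reg_rho m \<alpha> T \<gamma> s = (2 - \<alpha>) / 4 * v (\<theta> s)"
proof -
  note t = \<theta>_I[OF s]
  note r = r_pos_I[OF t]
  define R where "R = r (\<theta> s)"
  define k where "k = J1 (\<theta> s) / (2 * R)"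
  have "((\<lambda>s. r (\<theta> s) powr ((2 - \<alpha>) / 4)) has_real_derivative
      (2 - \<alpha>) / 4 * R powr ((2 - \<alpha>) / 4 - 1) * k * R powr ((2 + \<alpha>) / 2)) (at s)"
    unfolding R_def k_def by (rule DERIV_chain2[OF r_powr_deriv[OF t] \<theta>_deriv[OF s]])
  then have "(reg_rho m \<alpha> T \<gamma> has_vector_derivative
      (2 - \<alpha>) / 4 * R powr ((2 - \<alpha>) / 4 - 1) * k * R powr ((2 + \<alpha>) / 2)) (at s)"
    by (simp add: reg_rho_eq[abs_def] has_real_derivative_iff_has_vector_derivative)
  then have d: "tau_deriv (reg_rho m \<alpha> T \<gamma>) s = (2 - \<alpha>) / 4 * R powr ((2 - \<alpha>) / 4 - 1) * k * R powr ((2 + \<alpha>) / 2)"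
    unfolding at_pos[OF s] by (rule vector_derivative_at)
  have p: "R powr ((2 - \<alpha>) / 4 - 1) * R powr ((2 + \<alpha>) / 2) = R powr ((2 - \<alpha>) / 4) * R powr (\<alpha> / 2)"
    unfolding powr_add[symmetric] by (rule arg_cong[where f="\<lambda>x. R powr x"]) (simp add: field_simps)
  have "tau_deriv (reg_rho m \<alpha> T \<gamma>) s = (2 - \<alpha>) / 4 * k * (R powr ((2 - \<alpha>) / 4 - 1) * R powr ((2 + \<alpha>) / 2))"
    unfolding d by (simp add: mult_ac)
  also have "\<dots> = R powr ((2 - \<alpha>) / 4) * ((2 - \<alpha>) / 4 * (R powr (\<alpha> / 2) * k))"
    unfolding p by (simp add: mult_ac)
  finally have e: "tau_deriv (reg_rho m \<alpha> T \<gamma>) s = R powr ((2 - \<alpha>) / 4) * ((2 - \<alpha>) / 4 * (R powr (\<alpha> / 2) * k))" .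
  have "R > 0" using r by (simp add: R_def)
  then show ?thesis unfolding e reg_rho_eq R_def[symmetric] by (simp add: v_def k_def R_def)
qed

lemma reg_rho_powr: assumes s: "0 < s"
  shows "reg_rho m \<alpha> T \<gamma> s powr (beta \<alpha> - 2) = r (\<theta> s) powr \<alpha>"
proof -
  have "(2 - \<alpha>) / 4 * (beta \<alpha> - 2) = \<alpha>" using \<alpha> by (simp add: beta_def field_simps)
  then show ?thesis unfolding reg_rho_eq powr_powr by simp
qed

lemma delta_bar_eq: "delta_bar m \<alpha> s0 T = (2 - \<alpha>) / 4 * (sg * sqrt (2 * U s0))"
  by (simp add: delta_bar_def sg_def)

lemma limit_\<theta>: "(f \<longlongrightarrow> l) F \<Longrightarrow> ((\<lambda>s. f (\<theta> s)) \<longlongrightarrow> l) at_top"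
  by (rule filterlim_compose[OF _ \<theta>_lim])

lemma cont_\<theta>: assumes "continuous_on I f" shows "continuous_on {0<..} (\<lambda>s. f (\<theta> s))"
  by (rule continuous_on_compose2[OF assms \<theta>_cont]) (use \<theta>_I in auto)

end

section \<open>The asymptotic quadratic form\<close>

lemma bilinear_add: "bilinear f \<Longrightarrow> bilinear g \<Longrightarrow> bilinear (\<lambda>u w. f u w + g u w)"
  unfolding bilinear_def by (auto intro: linear_compose_add)

lemma bilinear_diff: "bilinear f \<Longrightarrow> bilinear g \<Longrightarrow> bilinear (\<lambda>u w. f u w - g u w)"
  unfolding bilinear_def by (auto intro: linear_compose_sub)

lemma bilinear_cmult: "bilinear (f :: 'a::real_vector \<Rightarrow> 'a \<Rightarrow> real) \<Longrightarrow> bilinear (\<lambda>u w. c * f u w)"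
  unfolding bilinear_def linear_iff by (simp add: algebra_simps)

lemma bilinear_tensor:
  fixes f g :: "'a::real_vector \<Rightarrow> real"
  shows "linear f \<Longrightarrow> linear g \<Longrightarrow> bilinear (\<lambda>u w. f u * g w)"
  unfolding bilinear_def linear_iff by (simp add: algebra_simps)

lemma bilinear_uniform_bound:
  fixes b :: "'i \<Rightarrow> 'a::euclidean_space \<Rightarrow> 'a \<Rightarrow> real"
  assumes b: "\<And>t. t \<in> S \<Longrightarrow> bilinear (b t)" and C: "\<And>u w. \<exists>C. \<forall>t\<in>S. \<bar>b t u w\<bar> \<le> C"
  shows "\<exists>C. \<forall>t\<in>S. \<forall>u w. \<bar>b t u w\<bar> \<le> C * norm u * norm w"
proof -
  obtain K where K: "\<And>i j t. t \<in> S \<Longrightarrow> \<bar>b t i j\<bar> \<le> K i j" using C by metis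
  have "\<bar>b t u w\<bar> \<le> (\<Sum>i\<in>Basis. \<Sum>j\<in>Basis. \<bar>K i j\<bar>) * norm u * norm w" if t: "t \<in> S" for t u w
  proof -
    have "b t u w = b t (\<Sum>i\<in>Basis. (u \<bullet> i) *\<^sub>R i) (\<Sum>j\<in>Basis. (w \<bullet> j) *\<^sub>R j)" by (simp add: euclidean_representation)
    also have "\<dots> = (\<Sum>(i, j)\<in>Basis \<times> Basis. b t ((u \<bullet> i) *\<^sub>R i) ((w \<bullet> j) *\<^sub>R j))"
      by (rule bilinear_sum[OF b[OF t]])
    also have "\<dots> = (\<Sum>i\<in>Basis. \<Sum>j\<in>Basis. (u \<bullet> i) * ((w \<bullet> j) * b t i j))"
      by (simp add: sum.cartesian_product bilinear_lmul[OF b[OF t]] bilinear_rmul[OF b[OF t]] mult.left_commute)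
    finally have e: "b t u w = (\<Sum>i\<in>Basis. \<Sum>j\<in>Basis. (u \<bullet> i) * ((w \<bullet> j) * b t i j))" .
    have "\<bar>b t u w\<bar> \<le> (\<Sum>i\<in>Basis. \<Sum>j\<in>Basis. \<bar>K i j\<bar> * (norm u * norm w))"
      unfolding e
    proof (rule order_trans[OF sum_abs], rule sum_mono, rule order_trans[OF sum_abs], rule sum_mono)
      fix i j :: 'a assume ij: "i \<in> Basis" "j \<in> Basis"
      have "\<bar>u \<bullet> i\<bar> * (\<bar>w \<bullet> j\<bar> * \<bar>b t i j\<bar>) \<le> norm u * (norm w * \<bar>K i j\<bar>)"
        using K[OF t, of i j] by (intro mult_mono Basis_le_norm ij mult_nonneg_nonneg) auto
      then show "\<bar>(u \<bullet> i) * ((w \<bullet> j) * b t i j)\<bar> \<le> \<bar>K i j\<bar> * (norm u * norm w)" by (simp add: abs_mult mult_ac)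
    qed
    then show ?thesis by (simp add: sum_distrib_right mult.assoc)
  qed
  then show ?thesis by blast
qed

lemma fredholm_form_on_cong:
  assumes "\<And>x. x \<in> H \<Longrightarrow> q x = q' x"
  shows "fredholm_form_on H ip q \<longleftrightarrow> fredholm_form_on H ip q'"
  using assms unfolding fredholm_form_on_def by simp

context sobolev
begin

text \<open>The Rayleigh quotient attains its minimum on the compact G-unit sphere of V, and the
  first variation there is the eigenvalue equation. A minimum \<mu> <= 0 yields the singular
  direction, \<mu> > 0 a uniform lower bound for the limit form.\<close>

lemma minimal_eigenvector:
  assumes B: "bilinear B" "\<And>u w. B u w = B w u" and v1: "v1 \<in> V" "v1 \<noteq> 0"
  obtains v \<mu> where "v \<in> V" "v \<noteq> 0" "\<And>w. w \<in> V \<Longrightarrow> B v w = \<mu> * G v w" "\<And>w. w \<in> V \<Longrightarrow> \<mu> * G w w \<le> B w w"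
proof -
  define S where "S = {v \<in> V. G v v = 1}"
  have bG: "bounded_bilinear G" and bB: "bounded_bilinear B"
    using G B(1) by (simp_all add: bilinear_conv_bounded_bilinear)
  have Gpos: "G w w > 0" if "w \<noteq> 0" for w
  proof -
    have "0 < c0 * (norm w)\<^sup>2" using c0 that by simp
    then show ?thesis using G_coercive[of w] by linarith
  qed
  have scS: "(1 / sqrt (G w w)) *\<^sub>R w \<in> S" if "w \<in> V" "w \<noteq> 0" for w
    using that Gpos[OF that(2)] unfolding S_def
    by (simp add: subspace_scale[OF V] bilinear_lmul[OF G] bilinear_rmul[OF G] divide_simps)
  have "closed S"
  proof -
    have "continuous_on UNIV (\<lambda>v. G v v)" by (intro bounded_bilinear.continuous_on[OF bG] continuous_intros)
    then have "closed {v. G v v = 1}" by (intro closed_Collect_eq continuous_on_const)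
    moreover have "S = V \<inter> {v. G v v = 1}" by (auto simp: S_def)
    ultimately show ?thesis using closed_subspace[OF V] by (simp add: closed_Int)
  qed
  moreover have "bounded S"
  proof -
    have "norm v \<le> sqrt (1 / c0)" if "v \<in> S" for v
    proof (rule real_le_rsqrt)
      show "(norm v)\<^sup>2 \<le> 1 / c0" using G_coercive[of v] that c0 by (simp add: S_def pos_le_divide_eq mult.commute)
    qed
    then show ?thesis unfolding bounded_iff by blast
  qed
  ultimately have "compact S" by (simp add: compact_eq_bounded_closed)
  moreover have "S \<noteq> {}" using scS[OF v1] by blast
  moreover have "continuous_on S (\<lambda>v. B v v)" by (intro bounded_bilinear.continuous_on[OF bB] continuous_intros)
  ultimately have "\<exists>v\<in>S. \<forall>w\<in>S. B v v \<le> B w w" by (rule continuous_attains_inf)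
  then obtain v where v: "v \<in> S" "\<And>w. w \<in> S \<Longrightarrow> B v v \<le> B w w" by auto
  define \<mu> where "\<mu> = B v v"
  have le: "\<mu> * G w w \<le> B w w" if "w \<in> V" for w
  proof (cases "w = 0")
    case True
    then show ?thesis by (simp add: bilinear_lzero[OF G] bilinear_lzero[OF B(1)])
  next
    case False
    note g = Gpos[OF False]
    have "\<mu> \<le> B ((1 / sqrt (G w w)) *\<^sub>R w) ((1 / sqrt (G w w)) *\<^sub>R w)" unfolding \<mu>_def by (rule v(2)[OF scS[OF that False]])
    also have "\<dots> = B w w / G w w" using g by (simp add: bilinear_lmul[OF B(1)] bilinear_rmul[OF B(1)])
    finally show ?thesis using g by (simp add: pos_le_divide_eq)
  qed
  have vV: "v \<in> V" "G v v = 1" using v by (auto simp: S_def)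
  have eig: "B v w = \<mu> * G v w" if w: "w \<in> V" for w
  proof -
    have "B v w - \<mu> * G v w = 0"
    proof (rule linear_part_zero)
      show "0 \<le> B w w - \<mu> * G w w" using le[OF w] by simp
      show "0 \<le> 2 * t * (B v w - \<mu> * G v w) + t\<^sup>2 * (B w w - \<mu> * G w w)" for t
      proof -
        have "v + t *\<^sub>R w \<in> V" using subspace_add[OF V vV(1) subspace_scale[OF V w]] .
        from le[OF this] have "0 \<le> B (v + t *\<^sub>R w) (v + t *\<^sub>R w) - \<mu> * G (v + t *\<^sub>R w) (v + t *\<^sub>R w)" by simp
        also have "\<dots> = 2 * t * (B v w - \<mu> * G v w) + t\<^sup>2 * (B w w - \<mu> * G w w)"
          using vV(2) by (simp add: bilinear_ladd[OF B(1)] bilinear_radd[OF B(1)] bilinear_lmul[OF B(1)] bilinear_rmul[OF B(1)]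
            bilinear_ladd[OF G] bilinear_radd[OF G] bilinear_lmul[OF G] bilinear_rmul[OF G] B(2)[of w v] G_sym[of w v]
            \<mu>_def power2_eq_square algebra_simps)
        finally show ?thesis .
      qed
    qed
    then show ?thesis by simp
  qed
  have "v \<noteq> 0" using vV(2) bilinear_lzero[OF G] by force
  with vV(1) show thesis
  proof (rule that[of v \<mu>])
    show "B v w = \<mu> * G v w" if "w \<in> V" for w using that by (rule eig)
    show "\<mu> * G w w \<le> B w w" if "w \<in> V" for w using that by (rule le)
  qed
qed

end

context asymptotic_motion
begin

section \<open>Coefficients of the asymptotic form and their limits\<close>

sublocale sob: sobolev X ipM "Min (range m)"
proof
  show "subspace X" by (rule subspace_cm_space)
  show "bilinear ipM" by (rule bilinear_inner_M)
  show "0 < Min (range m)" by (rule mass_min)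
  show "ipM u v = ipM v u" for u v by (rule inner_M_sym)
  show "Min (range m) * (norm u)\<^sup>2 \<le> ipM u u" for u by (rule inner_M_coercive(1)[OF m])
qed

text \<open>Continuous, bounded and convergent: the properties of a matrix entry that make the
  lifted coefficient admissible with a limit. They are stable under sums and products, so the
  coefficients can be treated term by term.\<close>

definition nice :: "(real \<Rightarrow> real) \<Rightarrow> real \<Rightarrow> bool" where
  "nice f l \<longleftrightarrow> continuous_on I f \<and> (\<exists>C. \<forall>t\<in>I. \<bar>f t\<bar> \<le> C) \<and> (f \<longlongrightarrow> l) F"

lemma nice_const: "nice (\<lambda>t. c) c"
  by (auto simp: nice_def)

lemma nice_add: assumes "nice f l" "nice g k" shows "nice (\<lambda>t. f t + g t) (l + k)"
proof -
  obtain A B where "\<forall>t\<in>I. \<bar>f t\<bar> \<le> A" "\<forall>t\<in>I. \<bar>g t\<bar> \<le> B" using assms unfolding nice_def by blast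
  then have "\<forall>t\<in>I. \<bar>f t + g t\<bar> \<le> A + B" by (meson abs_triangle_ineq add_mono order_trans)
  then show ?thesis using assms unfolding nice_def by (auto intro: continuous_on_add tendsto_add)
qed

lemma nice_mult: assumes "nice f l" "nice g k" shows "nice (\<lambda>t. f t * g t) (l * k)"
proof -
  obtain A B where AB: "\<forall>t\<in>I. \<bar>f t\<bar> \<le> A" "\<forall>t\<in>I. \<bar>g t\<bar> \<le> B" using assms unfolding nice_def by blast
  have "\<bar>f t * g t\<bar> \<le> A * B" if "t \<in> I" for t
    using AB that mult_mono[of "\<bar>f t\<bar>" A "\<bar>g t\<bar>" B] by (force simp: abs_mult)
  then show ?thesis using assms unfolding nice_def by (auto intro: continuous_on_mult tendsto_mult)
qed

lemma nice_diff: assumes "nice f l" "nice g k" shows "nice (\<lambda>t. f t - g t) (l - k)"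
  using nice_add[OF assms(1) nice_mult[OF nice_const[of "- 1"] assms(2)]] by simp

lemma nice_D: assumes "continuous_on D f" "(f \<longlongrightarrow> l) F" shows "nice f l"
proof -
  obtain C where "\<forall>t\<in>D. \<bar>f t\<bar> \<le> C" using bounded_on_D[OF assms] ..
  then have "\<forall>t\<in>I. \<bar>f t\<bar> \<le> C" using I_subset_D by blast
  then show ?thesis using continuous_on_subset[OF assms(1) I_subset_D] assms(2) unfolding nice_def by blast
qed

lemma nice_v: "nice v (sg * sqrt (2 * U s0))"
proof -
  obtain B where "\<And>t. t \<in> I \<Longrightarrow> \<bar>v t\<bar> \<le> B" using bounds by metis
  then show ?thesis using v_cont v_lim unfolding nice_def by blast
qed

lemma nice_hr: "nice (\<lambda>t. h * r t powr \<alpha>) 0"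
  by (rule nice_D[OF continuous_on_mult[OF continuous_on_const r_powr_cont] hr_lim])

lemma nice_\<sigma>: "nice (\<lambda>t. ipM (\<sigma> t) u) (ipM s0 u)"
  by (rule nice_D[OF bounded_bilinear.continuous_on[OF bounded_bilinear_inner_M \<sigma>_cont continuous_on_const]
      bounded_bilinear.tendsto[OF bounded_bilinear_inner_M \<sigma>_lim tendsto_const]])

lemma nice_S1: "nice (\<lambda>t. ipM (S1 t) u) 0"
proof -
  obtain B where B: "\<And>t. t \<in> I \<Longrightarrow> norm (S1 t) \<le> B" using bounds by metis
  obtain K where K: "\<And>a b :: real^'d^'n. norm (ipM a b) \<le> norm a * norm b * K" "K > 0"
    using bounded_bilinear.pos_bounded[OF bounded_bilinear_inner_M] by blast
  have "\<bar>ipM (S1 t) u\<bar> \<le> B * norm u * K" if "t \<in> I" for t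
  proof -
    have "\<bar>ipM (S1 t) u\<bar> \<le> norm (S1 t) * norm u * K" using K(1)[of "S1 t" u] by simp
    also have "\<dots> \<le> B * norm u * K" using B[OF that] K(2) by (intro mult_right_mono) auto
    finally show ?thesis .
  qed
  moreover have "continuous_on I (\<lambda>t. ipM (S1 t) u)"
    by (rule bounded_bilinear.continuous_on[OF bounded_bilinear_inner_M S1_cont continuous_on_const])
  moreover have "((\<lambda>t. ipM (S1 t) u) \<longlongrightarrow> ipM 0 u) F"
    by (rule bounded_bilinear.tendsto[OF bounded_bilinear_inner_M S1_lim tendsto_const])
  ultimately show ?thesis unfolding nice_def by (auto simp: bilinear_lzero[OF bilinear_inner_M])
qed

text \<open>Times \<open>s \<le> 0\<close> are cut off because \<^term>\<open>\<gamma>\<close> need not be differentiable at 0.\<close>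

definition lift :: "(real \<Rightarrow> real^'d^'n \<Rightarrow> real^'d^'n \<Rightarrow> real) \<Rightarrow> real \<Rightarrow> real^'d^'n \<Rightarrow> real^'d^'n \<Rightarrow> real" where
  "lift b s u w = (if 0 < s then b (\<theta> s) u w else 0)"

lemma lim_form_lift:
  assumes b: "\<And>t. t \<in> I \<Longrightarrow> bilinear (b t)" and n: "\<And>u w. nice (\<lambda>t. b t u w) (q u w)" and q: "bilinear q"
  shows "sob.lim_form (lift b) q"
  unfolding sob.lim_form_def sob.adm_def
proof (intro conjI allI)
  show "bilinear (lift b s)" for s
  proof (cases "0 < s")
    case True
    then show ?thesis using b[OF \<theta>_I[OF True]] by (simp add: lift_def[abs_def])
  next
    case False
    then show ?thesis by (simp add: lift_def[abs_def] bilinear_def linear_iff)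
  qed
  show "(\<lambda>s. lift b s u w) \<in> borel_measurable hl" for u w
  proof (rule measurable_hl)
    have "continuous_on {0<..} (\<lambda>s. b (\<theta> s) u w)" using cont_\<theta> n[of u w] unfolding nice_def by blast
    then have "(\<lambda>s. if s \<in> {0<..} then b (\<theta> s) u w else 0) \<in> borel_measurable borel"
      by (intro borel_measurable_continuous_on_if) auto
    then show "(\<lambda>s. lift b s u w) \<in> borel_measurable borel" by (simp add: lift_def)
  qed
  have "\<exists>C. \<forall>t\<in>I. \<forall>u w. \<bar>b t u w\<bar> \<le> C * norm u * norm w"
    by (rule bilinear_uniform_bound[OF b]) (use n in \<open>auto simp: nice_def\<close>)
  then obtain C where C: "\<And>t u w. t \<in> I \<Longrightarrow> \<bar>b t u w\<bar> \<le> C * norm u * norm w" by blast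
  have "\<bar>lift b s u w\<bar> \<le> \<bar>C\<bar> * norm u * norm w" for s u w
  proof (cases "0 < s")
    case True
    have "C * norm u * norm w \<le> \<bar>C\<bar> * norm u * norm w" by (intro mult_right_mono) auto
    then show ?thesis using C[OF \<theta>_I[OF True], of u w] True by (simp add: lift_def)
  qed (simp add: lift_def)
  then show "\<exists>C. \<forall>s u w. \<bar>lift b s u w\<bar> \<le> C * norm u * norm w" by blast
  show "bilinear q" by (rule q)
  show "((\<lambda>s. lift b s u w) \<longlongrightarrow> q u w) at_top" for u w
  proof (rule Lim_transform_eventually)
    show "((\<lambda>s. b (\<theta> s) u w) \<longlongrightarrow> q u w) at_top" using n[of u w] limit_\<theta> unfolding nice_def by blast
    show "\<forall>\<^sub>F s in at_top. b (\<theta> s) u w = lift b s u w"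
      using eventually_gt_at_top[of "0::real"] by eventually_elim (simp add: lift_def)
  qed
qed

abbreviation "cc0 \<equiv> c_const \<alpha>"
definition "\<delta> = delta_bar m \<alpha> s0 T"
definition "a t = (2 - \<alpha>) / 4 * v t"
definition "b t = h * r t powr \<alpha>"

text \<open>P, Q and R-tilde as bilinear forms in the original time, with a = \<rho>'/\<rho> and b =
  h \<rho>^(\<beta>-2). In pk the second argument is the slot of the derivative; the parameter W of
  pl stands for the second derivative of \<open>W_fun\<close>.\<close>

definition "pp t x y = cc0 * (ipM (\<sigma> t) x * ipM (\<sigma> t) y) + ipM x y"
definition "pk t x y = (cc0 * a t) * (ipM x y - ipM (\<sigma> t) x * ipM (\<sigma> t) y) + cc0 * (ipM (S1 t) x * ipM (\<sigma> t) y)"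
definition "pl W t x y = (cc0 * (a t * a t) + beta \<alpha> * (beta \<alpha> - 2) * b t) * (ipM (\<sigma> t) x * ipM (\<sigma> t) y)
    + (2 * U s0 - cc0 * (a t * a t) + beta \<alpha> * b t) * ipM x y
    + cc0 * (ipM (S1 t) x * ipM (S1 t) y)
    - (cc0 * a t) * (ipM (S1 t) x * ipM (\<sigma> t) y + ipM (\<sigma> t) x * ipM (S1 t) y) + W (\<sigma> t) x y"

text \<open>The limits of pp, pk and pl, with \<sigma> replaced by s0, a by \<delta>, and S1 and b
  by 0. The only asymmetric term of pk contains S1, so qk is symmetric.\<close>

definition "qp x y = cc0 * (ipM s0 x * ipM s0 y) + ipM x y"
definition "qk x y = (cc0 * \<delta>) * (ipM x y - ipM s0 x * ipM s0 y)"
definition "ql W x y = (cc0 * (\<delta> * \<delta>)) * (ipM s0 x * ipM s0 y) + (2 * U s0 - cc0 * (\<delta> * \<delta>)) * ipM x y + W s0 x y"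

lemma linear_ipM: "linear (ipM (x :: real^'d^'n))"
  using bilinear_inner_M unfolding bilinear_def by blast

lemmas bil = bilinear_add bilinear_diff bilinear_cmult bilinear_tensor linear_ipM bilinear_inner_M

lemma nice_a: "nice a \<delta>"
  unfolding a_def[abs_def] \<delta>_def delta_bar_eq by (rule nice_mult[OF nice_const nice_v])

lemma nice_b: "nice b 0"
  unfolding b_def[abs_def] by (rule nice_hr)

lemmas nice = nice_add nice_diff nice_mult nice_const nice_a nice_b nice_\<sigma> nice_S1

lemma pp_lim: "sob.lim_form (lift pp) qp"
proof (rule lim_form_lift)
  show "bilinear (pp t)" for t unfolding pp_def[abs_def] by (intro bil)
  show "bilinear qp" unfolding qp_def[abs_def] by (intro bil)
  show "nice (\<lambda>t. pp t u w) (qp u w)" for u w unfolding pp_def qp_def by (intro nice)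
qed

lemma pk_lim: "sob.lim_form (lift pk) qk"
proof (rule lim_form_lift)
  show "bilinear (pk t)" for t unfolding pk_def[abs_def] by (intro bil)
  show "bilinear qk" unfolding qk_def[abs_def] by (intro bil)
  show "nice (\<lambda>t. pk t u w) (qk u w)" for u w
  proof -
    have "nice (\<lambda>t. pk t u w) ((cc0 * \<delta>) * (ipM u w - ipM s0 u * ipM s0 w) + cc0 * (0 * ipM s0 w))"
      unfolding pk_def by (intro nice)
    then show ?thesis by (simp add: qk_def)
  qed
qed

lemma pl_lim:
  assumes f: "twice_diff config f f' W"
  shows "sob.lim_form (lift (pl W)) (ql W)"
proof (rule lim_form_lift)
  have W: "bilinear (W x)" if "x \<in> config" for x using twice_diff_bilinear[OF f that] .
  show "bilinear (pl W t)" if "t \<in> I" for t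
  proof -
    have "\<sigma> t \<in> config" using \<sigma>_D(2) I_subset_D that by blast
    then show ?thesis unfolding pl_def[abs_def] by (intro bil W)
  qed
  show "bilinear (ql W)" unfolding ql_def[abs_def] by (intro bil W s0)
  show "nice (\<lambda>t. pl W t u w) (ql W u w)" for u w
  proof -
    have Wc: "continuous_on config (\<lambda>x. W x u w)" by (rule twice_diff_D(5)[OF f s0(2)])
    have "nice (\<lambda>t. W (\<sigma> t) u w) (W s0 u w)"
    proof (rule nice_D)
      show "continuous_on D (\<lambda>t. W (\<sigma> t) u w)" by (rule continuous_on_compose2[OF Wc \<sigma>_cont]) (use \<sigma>_D(2) in blast)
      have "isCont (\<lambda>x. W x u w) s0" using Wc s0(2) unfolding continuous_on_eq_continuous_at[OF open_config] by blast
      from isCont_tendsto_compose[OF this \<sigma>_lim] show "((\<lambda>t. W (\<sigma> t) u w) \<longlongrightarrow> W s0 u w) F" .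
    qed
    then have "nice (\<lambda>t. pl W t u w) ((cc0 * (\<delta> * \<delta>) + beta \<alpha> * (beta \<alpha> - 2) * 0) * (ipM s0 u * ipM s0 w)
        + (2 * U s0 - cc0 * (\<delta> * \<delta>) + beta \<alpha> * 0) * ipM u w + cc0 * (0 * 0)
        - (cc0 * \<delta>) * (0 * ipM s0 w + ipM s0 u * 0) + W s0 u w)"
      unfolding pl_def by (intro nice)
    then show ?thesis by (simp add: ql_def)
  qed
qed

lemmas ipM_simps = bilinear_ladd[OF bilinear_inner_M] bilinear_radd[OF bilinear_inner_M] bilinear_lsub[OF bilinear_inner_M]
  bilinear_rsub[OF bilinear_inner_M] bilinear_lmul[OF bilinear_inner_M] bilinear_rmul[OF bilinear_inner_M]

lemma coeff_P_inner:
  assumes "0 < s" shows "ipM (coeff_P m \<alpha> T \<gamma> s x) y = lift pp s x y"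
  using assms unfolding coeff_P_def Let_def tensor_M_def reg_s_eq pp_def lift_def by (simp add: ipM_simps)

lemma coeff_Q_inner:
  assumes "0 < s" shows "ipM (coeff_Q m \<alpha> T \<gamma> s x) y = lift pk s x y"
  using assms unfolding coeff_Q_def Let_def tensor_M_def reg_s_eq reg_s_deriv[OF assms] reg_rho_deriv[OF assms] a_def[symmetric]
    pk_def lift_def
  by (simp add: ipM_simps)

lemma linear_coeff_Q: "linear (coeff_Q m \<alpha> T \<gamma> s)"
  unfolding coeff_Q_def Let_def tensor_M_def linear_iff
  by (simp add: ipM_simps algebra_simps)

text \<open>The scaling invariance \<open>hom\<close> moves the Hessian of W from y = \<rho> s to s,
  which stays near s0 although \<rho> degenerates.\<close>

lemma coeff_R_tilde_inner:
  assumes f: "twice_diff config (W_fun m \<alpha> s0) f' W" and hom: "\<And>c x v w. c > 0 \<Longrightarrow> x \<in> config \<Longrightarrow> W (c *\<^sub>R x) v w = W x v w"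
    and s: "0 < s" and y: "y \<in> X"
  shows "ipM (coeff_R_tilde m \<alpha> s0 T \<gamma> s x) y = lift (pl W) s x y"
proof -
  have \<sigma>c: "\<sigma> (\<theta> s) \<in> config" using \<sigma>_D(2) \<theta>_D(1)[of s] s by simp
  note \<rho> = reg_rho_pos[OF s]
  have "reg_y m \<alpha> T \<gamma> s \<in> config" unfolding reg_y_def reg_s_eq using \<rho> by (intro config_scale \<sigma>c) simp
  from hessian_M_inner[OF m f this y]
  have "ipM (hessian_M m (W_fun m \<alpha> s0) (reg_y m \<alpha> T \<gamma> s) x) y = W (reg_y m \<alpha> T \<gamma> s) x y" .
  also have "\<dots> = W (\<sigma> (\<theta> s)) x y" unfolding reg_y_def reg_s_eq by (rule hom[OF \<rho> \<sigma>c])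
  finally have W: "ipM (hessian_M m (W_fun m \<alpha> s0) (reg_y m \<alpha> T \<gamma> s) x) y = W (\<sigma> (\<theta> s)) x y" .
  have "ipM (coeff_R m \<alpha> s0 T \<gamma> s x) y + W (\<sigma> (\<theta> s)) x y = pl W (\<theta> s) x y"
    unfolding coeff_R_def Let_def tensor_M_def h_def[symmetric] reg_s_eq reg_s_deriv[OF s] reg_rho_deriv[OF s] reg_rho_powr[OF s]
      a_def[symmetric] pl_def b_def
    by (simp add: ipM_simps power2_eq_square algebra_simps)
  then show ?thesis using s by (simp add: coeff_R_tilde_def ipM_simps W lift_def)
qed

lemma asymptotic_form_eq:
  assumes f: "twice_diff config (W_fun m \<alpha> s0) f' W" and hom: "\<And>c x v w. c > 0 \<Longrightarrow> x \<in> config \<Longrightarrow> W (c *\<^sub>R x) v w = W x v w"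
    and H: "\<eta> \<in> W12_0 X"
  shows "asymptotic_form m \<alpha> s0 T \<gamma> \<eta> = sob.bf (lift pp) (lift pk) (lift (pl W)) \<eta> \<eta>"
  unfolding asymptotic_form_def Let_def sob.bf_def
\<comment> \<open>The identity of the integrands is proved for s > 0; the point 0, where the lifted
  coefficients are set to 0, is a null set.\<close>
proof (rule integral_discrete_difference[where X="{0}"])
  fix s assume "s \<in> space hl" "s \<notin> {0}"
  then have s: "0 < s" by (simp add: space_restrict_space)
  have X: "\<eta> s \<in> X" "weak_deriv X \<eta> s \<in> X" using sob.H_D(4)[OF H, of s] sob.wd(4)[OF H, of s] s by simp_all
  have "ipM (adjoint_M m (coeff_Q m \<alpha> T \<gamma> s) (weak_deriv X \<eta> s)) (\<eta> s) = lift pk s (\<eta> s) (weak_deriv X \<eta> s)"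
    unfolding adjoint_M_inner[OF m linear_coeff_Q X(1)] by (subst inner_M_sym) (rule coeff_Q_inner[OF s])
  then show "ipM (coeff_P m \<alpha> T \<gamma> s (weak_deriv X \<eta> s)) (weak_deriv X \<eta> s)
      + ipM (coeff_Q m \<alpha> T \<gamma> s (\<eta> s)) (weak_deriv X \<eta> s)
      + ipM (adjoint_M m (coeff_Q m \<alpha> T \<gamma> s) (weak_deriv X \<eta> s)) (\<eta> s)
      + ipM (coeff_R_tilde m \<alpha> s0 T \<gamma> s (\<eta> s)) (\<eta> s)
    = lift pp s (weak_deriv X \<eta> s) (weak_deriv X \<eta> s)
      + (lift pk s (\<eta> s) (weak_deriv X \<eta> s) + lift pk s (\<eta> s) (weak_deriv X \<eta> s))
      + lift (pl W) s (\<eta> s) (\<eta> s)"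
    by (simp only: coeff_P_inner[OF s] coeff_Q_inner[OF s] coeff_R_tilde_inner[OF f hom s X(1)] add.assoc)
qed (auto simp: emeasure_restrict_space sets_restrict_space_iff)

lemma W12_inner_eq: "W12_inner m = sob.ip"
  by (simp add: fun_eq_iff W12_inner_def sob.ip_def)

lemma c_const_pos: "cc0 > 0"
proof -
  have "1 < 4 / (2 - \<alpha>)" using \<alpha> by simp
  then have "1 < (4 / (2 - \<alpha>))\<^sup>2" by (simp add: one_less_power)
  then show ?thesis by (simp add: c_const_def)
qed

text \<open>By the choice of the constant, (c_const + 1) ((2-\<alpha>)/4)^2 = 1, so c_const
  \<delta>^2 = 2 U(s0) - \<delta>^2. The limit coefficient of the identity is therefore \<delta>^2,
  the one in \<open>R_tilde_0\<close>.\<close>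

lemma \<delta>_sq: "2 * U s0 - cc0 * (\<delta> * \<delta>) = (2 - \<alpha>)\<^sup>2 / 8 * U s0"
proof -
  have sg: "sg * sg = 1" by (simp add: sg_def)
  have "\<delta> * \<delta> = ((2 - \<alpha>) / 4)\<^sup>2 * (sg * sg) * (sqrt (2 * U s0))\<^sup>2"
    by (simp add: \<delta>_def delta_bar_eq power2_eq_square mult_ac)
  also have "\<dots> = ((2 - \<alpha>) / 4)\<^sup>2 * (2 * U s0)" using U_s0_pos by (simp add: sg)
  finally have d: "\<delta> * \<delta> = ((2 - \<alpha>) / 4)\<^sup>2 * (2 * U s0)" .
  have "4 / (2 - \<alpha>) * ((2 - \<alpha>) / 4) = 1" using \<alpha> by (simp add: field_simps)
  then have "(4 / (2 - \<alpha>))\<^sup>2 * ((2 - \<alpha>) / 4)\<^sup>2 = 1" unfolding power_mult_distrib[symmetric] by (simp only: power_one)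
  then have "cc0 * (\<delta> * \<delta>) = 2 * U s0 - ((2 - \<alpha>) / 4)\<^sup>2 * (2 * U s0)"
    unfolding d c_const_def by (simp add: left_diff_distrib mult.assoc[symmetric])
  then show ?thesis by (simp add: power_divide)
qed

theorem fredholm_iff_BS:
  "fredholm_form_on (W12_0 X) (W12_inner m) (asymptotic_form m \<alpha> s0 T \<gamma>) \<longleftrightarrow> BS_condition m \<alpha> s0 T"
proof (rule hessians)
  fix f' f'' W' W
  assume f: "twice_diff config (U_tilde m \<alpha>) f' f''" and W: "twice_diff config (W_fun m \<alpha> s0) W' W"
    and Wf: "\<And>v w. v \<in> X \<Longrightarrow> w \<in> X \<Longrightarrow> W s0 v w = f'' s0 v w"
    and Wrad: "\<And>w. w \<in> X \<Longrightarrow> W s0 s0 w = 0"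
    and Whom: "\<And>c x v w. c > 0 \<Longrightarrow> x \<in> config \<Longrightarrow> W (c *\<^sub>R x) v w = W x v w"
  have Wsym: "W x v w = W x w v" if "x \<in> config" for x v w by (rule twice_diff_D(4)[OF W that])
  have pp_sym: "lift pp s u w = lift pp s w u" for s u w
    by (simp add: lift_def pp_def inner_M_sym[of m u w] mult.commute)
  have pl_sym: "lift (pl W) s u w = lift (pl W) s w u" for s u w
  proof (cases "0 < s")
    case True
    have "\<sigma> (\<theta> s) \<in> config" using \<sigma>_D(2) \<theta>_D(1)[of s] True by simp
    from Wsym[OF this, of u w] show ?thesis
      by (simp add: lift_def pl_def inner_M_sym[of m u w] mult_ac add.commute)
  qed (simp add: lift_def)
  have qk_sym: "qk u w = qk w u" for u w by (simp add: qk_def inner_M_sym[of m u w] mult.commute)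
  have ql_bil: "bilinear (ql W)" using pl_lim[OF W] by (simp add: sob.lim_form_def)
  have ql_sym: "ql W u w = ql W w u" for u w
    using Wsym[OF s0(2), of u w] by (simp add: ql_def inner_M_sym[of m u w] mult.commute)
  have form: "fredholm_form_on (W12_0 X) (W12_inner m) (asymptotic_form m \<alpha> s0 T \<gamma>) \<longleftrightarrow>
      fredholm_form_on (W12_0 X) sob.ip (\<lambda>x. sob.bf (lift pp) (lift pk) (lift (pl W)) x x)"
    unfolding W12_inner_eq by (rule fredholm_form_on_cong) (rule asymptotic_form_eq[OF W Whom])
  have BS: "BS_condition m \<alpha> s0 T \<longleftrightarrow> (\<forall>x\<in>X. x \<noteq> 0 \<longrightarrow> ql W x x > 0)"
  proof -
    have "ipM (R_tilde_0 m \<alpha> s0 T x) x = ql W x x" if x: "x \<in> X" for x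
      using hessian_M_inner[OF m f s0(2) x, of x] Wf[OF x x]
      unfolding R_tilde_0_def tensor_M_def ql_def \<delta>_sq
      by (simp add: ipM_simps \<delta>_def power2_eq_square)
    then show ?thesis by (simp add: BS_condition_def)
  qed
  show ?thesis unfolding form BS
  proof
    assume fred: "fredholm_form_on (W12_0 X) sob.ip (\<lambda>x. sob.bf (lift pp) (lift pk) (lift (pl W)) x x)"
    show "\<forall>x\<in>X. x \<noteq> 0 \<longrightarrow> ql W x x > 0"
    proof (rule ccontr)
      assume "\<not> (\<forall>x\<in>X. x \<noteq> 0 \<longrightarrow> ql W x x > 0)"
      then obtain v1 where v1: "v1 \<in> X" "v1 \<noteq> 0" "ql W v1 v1 \<le> 0" by force
      obtain z \<mu> where z: "z \<in> X" "z \<noteq> 0" and eig: "\<And>w. w \<in> X \<Longrightarrow> ql W z w = \<mu> * ipM z w"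
        and le: "\<And>w. w \<in> X \<Longrightarrow> \<mu> * ipM w w \<le> ql W w w"
        using sob.minimal_eigenvector[OF ql_bil ql_sym v1(1,2)] by metis
      have \<mu>: "\<mu> \<le> 0"
      proof -
        have "\<mu> * ipM v1 v1 \<le> 0" using le[OF v1(1)] v1(3) by linarith
        then show ?thesis using inner_M_pos[OF m v1(2)] by (simp add: mult_le_0_iff)
      qed
      \<comment> \<open>The terms with cc0 \<delta>^2 cancel in direction s0, and the Hessian
        vanishes there, which leaves the eigenvalue 2 U(s0). Symmetry then makes z orthogonal to s0,
        because \<mu> <= 0 < 2 U(s0).\<close>
      have "ql W s0 z = 2 * U s0 * ipM s0 z" by (simp add: ql_def s0(3) Wrad[OF z(1)] algebra_simps)
      moreover have "ql W s0 z = \<mu> * ipM s0 z" using eig[OF s0(1)] by (simp add: ql_sym[of s0] inner_M_sym[of m z])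
      ultimately have "(2 * U s0 - \<mu>) * ipM s0 z = 0" by (simp only: left_diff_distrib diff_self)
      then have orth: "ipM s0 z = 0" using U_s0_pos \<mu> by simp
      have "qp z w = ipM z w" for w by (simp add: qp_def orth)
      from sob.not_fredholm_of_nonpositive[OF pp_lim pk_lim pl_lim[OF W] pp_sym pl_sym qk_sym z \<mu> this eig]
      show False using fred by blast
    qed
  next
    assume pos: "\<forall>x\<in>X. x \<noteq> 0 \<longrightarrow> ql W x x > 0"
    define c0 where "c0 = Min (range m)"
    have c0: "c0 > 0" "\<And>u :: real^'d^'n. c0 * (norm u)\<^sup>2 \<le> ipM u u"
      using mass_min inner_M_coercive(1)[OF m] by (simp_all add: c0_def)
    obtain z \<mu> where z: "z \<in> X" "z \<noteq> 0" and eig: "\<And>w. w \<in> X \<Longrightarrow> ql W z w = \<mu> * ipM z w"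
      and le: "\<And>w. w \<in> X \<Longrightarrow> \<mu> * ipM w w \<le> ql W w w"
      using sob.minimal_eigenvector[OF ql_bil ql_sym s0(1) config_nonzero[OF n2 s0(2)]] by metis
    have \<mu>: "\<mu> > 0"
    proof -
      have "0 < \<mu> * ipM z z" unfolding eig[OF z(1), symmetric] using pos z by blast
      then show ?thesis using inner_M_pos[OF m z(2)] by (simp add: zero_less_mult_iff)
    qed
    \<comment> \<open>The eigenvalue bounds are relative to the mass inner product; c0 turns them
      into Euclidean bounds, with c0 \<mu> for the limit of R-tilde and c0 for P, which dominates
      the identity.\<close>
    define c where "c = min (c0 * \<mu>) c0"
    show "fredholm_form_on (W12_0 X) sob.ip (\<lambda>x. sob.bf (lift pp) (lift pk) (lift (pl W)) x x)"
    proof (rule sob.fredholm_of_positive[OF _ pk_lim pl_lim[OF W] pp_sym pl_sym qk_sym])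
      show "sob.adm (lift pp)" using pp_lim by (simp add: sob.lim_form_def)
      show "c > 0" using c0 \<mu> by (simp add: c_def)
      show "c * (norm x)\<^sup>2 \<le> lift pp t x x" if "0 < t" "x \<in> X" for t x
      proof -
        have "c * (norm x)\<^sup>2 \<le> c0 * (norm x)\<^sup>2" by (intro mult_right_mono) (auto simp: c_def)
        also have "\<dots> \<le> ipM x x" by (rule c0)
        also have "\<dots> \<le> pp (\<theta> t) x x" using c_const_pos by (simp add: pp_def)
        finally show ?thesis using that by (simp add: lift_def)
      qed
      show "c * (norm x)\<^sup>2 \<le> ql W x x" if "x \<in> X" for x
      proof -
        have "c * (norm x)\<^sup>2 \<le> \<mu> * (c0 * (norm x)\<^sup>2)" unfolding mult.assoc[symmetric] mult.commute[of \<mu>]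
          by (intro mult_right_mono) (auto simp: c_def)
        also have "\<dots> \<le> \<mu> * ipM x x" using c0(2)[of x] \<mu> by (intro mult_left_mono) auto
        also have "\<dots> \<le> ql W x x" by (rule le[OF that])
        finally show ?thesis .
      qed
    qed
  qed
qed

end

theorem theorem3p14:
  fixes m :: "'n::finite \<Rightarrow> real"
    and \<alpha> :: real
    and s0 :: "real^'d^'n"
    and T :: ereal
    and \<gamma> :: "real \<Rightarrow> real^'d^'n"
  assumes "CARD('n) \<ge> 2" and "CARD('d) \<ge> 2"
    and "\<And>i. m i > 0"
    and "0 < \<alpha>" and "\<alpha> < 2"
    and "central_configuration m \<alpha> s0"
    and "s0_asymptotic_solution m \<alpha> s0 T \<gamma>"
  shows "fredholm_form_on (W12_0 (cm_space m)) (W12_inner m) (asymptotic_form m \<alpha> s0 T \<gamma>)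
         \<longleftrightarrow> BS_condition m \<alpha> s0 T"
proof -
  interpret asymptotic_motion m \<alpha> s0 T \<gamma>
  proof
    show "\<forall>i. m i > 0" using assms(3) by blast
  qed (fact assms)+
  show ?thesis by (rule fredholm_iff_BS)
qed

end
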